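(* Let $\varepsilon>0$ and $\delta>0$ be fixed. Assume that $\xi\in\mathcal D$, that $|\sinh\xi|,|\cosh\xi|\ge\varepsilon$, and that $\alpha,\beta\in\mathbb C$ are bounded. Then the Jacobi functions admit the following inverse factorial expansions: $$2^{2\nu+\alpha+\beta+1}B(\nu+1,\nu+\alpha+\beta+1)P_\nu^{(\alpha,\beta)}(\cosh(2\xi))\sim \left(\frac{e^{\xi}}{\sinh\xi}\right)^{\alpha+1/2}\left(\frac{e^{\xi}}{\cosh\xi}\right)^{\beta+1/2}e^{2\nu\xi}\sum_{n=0}^\infty g_n(-\xi,\alpha,\beta)\frac{\Gamma(2\nu+\alpha+\beta-n+1)}{\Gamma(2\nu+\alpha+\beta+2)}$$ $$-\,C(\xi,\alpha)\left(\frac{e^{-\xi}}{\sinh\xi}\right)^{\alpha+1/2}\left(\frac{e^{-\xi}}{\cosh\xi}\right)^{\beta+1/2}e^{-2\nu\xi}\sum_{m=0}^\infty g_m(\xi,\alpha,\beta)\frac{\Gamma(2\nu+\alpha+\beta-m+1)}{\Gamma(2\nu+\alpha+\beta+2)}$$ as $\nu\to\infty$ in the sector $|\arg\nu|\le\frac{\pi}{2}-\delta$ ($<\frac\pi2$), and $$\frac{2^{2\nu+\alpha+\beta+1}}{\pi}B(\nu+1,\nu+\alpha+\beta+1)Q_\nu^{(\alpha,\beta)}(\cosh(2\xi))\sim\left(\frac{e^{-\xi}}{\sinh\xi}\right)^{\alpha+1/2}\left(\frac{e^{-\xi}}{\cosh\xi}\right)^{\beta+1/2}e^{-2\nu\xi}\sum_{n=0}^\infty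 g_n(\xi,\alpha,\beta)\frac{\Gamma(2\nu+\alpha+\beta-n+1)}{\Gamma(2\nu+\alpha+\beta+2)}$$ as $\nu\to\infty$ in the sector $|\arg\nu|\le\pi-\delta$ ($<\pi$).
   Context: $\mathbf F\left({a,b\atop c};x\right)$ is the regularised hypergeometric function, $\sum_{n\ge0}\frac{(a)_n(b)_n}{\Gamma(c+n)\,n!}x^n$ for $|x|<1$, continued analytically to $x\in\mathbb C\setminus[1,\infty)$; $(w)_n=w(w+1)\cdots(w+n-1)$, $(w)_0=1$; $B$ is the beta function; $\mathbb Z^-=\{-1,-2,\dots\}$. The Jacobi functions are $$P_\nu^{(\alpha,\beta)}(z)=\frac{\Gamma(\nu+\alpha+1)}{\Gamma(\nu+1)}\mathbf F\left({-\nu,\nu+\alpha+\beta+1\atop \alpha+1};\frac{1-z}{2}\right),\quad z\in\mathbb C\setminus(-\infty,-1],\ \nu+\alpha\notin\mathbb Z^-,$$ $$Q_\nu^{(\alpha,\beta)}(z)=\frac{2^{\nu+\alpha+\beta}\Gamma(\nu+\alpha+1)\Gamma(\nu+\beta+1)}{(z-1)^{\nu+\alpha+1}(z+1)^\beta}\mathbf F\left({\nu+1,\nu+\alpha+1\atop 2\nu+\alpha+\beta+2};\frac{2}{1-z}\right),\quad z\in\mathbb C\setminus(-\infty,1],\ \nu+\alpha,\nu+\beta\notin\mathbb Z^-,$$ with principal powers. $\mathcal D=\{\xi:\Re\xi>0,\ |\Im\xi|<\frac\pi2\}$; $\xi\mapsto\cosh(2\xi)$ maps $\mathcal D$ biholomorphically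 onto $\mathbb C\setminus(-\infty,1]$. For $\xi\in\mathcal D$: $C(\xi,\alpha)=\sin(\pi\alpha)$ if $\xi>0$, and $C(\xi,\alpha)=\mp i e^{\pm\pi i\alpha}$ if $0<\pm\Im\xi<\frac\pi2$. Also $$a_n(\mu)=\frac{(\frac12+\mu)_n(\frac12-\mu)_n}{(-2)^n n!},\qquad g_n(\pm\xi,\alpha,\beta)=\sum_{\ell=0}^n(\pm1)^\ell a_\ell(\alpha)a_{n-\ell}(\beta)\left(\frac{e^{\pm\xi}}{\sinh\xi}\right)^\ell\left(\frac{e^{\pm\xi}}{\cosh\xi}\right)^{n-\ell}.$$ Fractional powers such as $(e^{\pm\xi}/\sinh\xi)^{\alpha+1/2}$ are defined with the real logarithm of the base for $\xi>0$ and by continuity elsewhere in $\mathcal D$. Meaning of $\sim$: for all non-negative integers $N$ (and $M$), the left-hand side equals the right-hand side with each infinite series $\sum_{n\ge 0}$ (resp. $\sum_{m\ge0}$) replaced by its partial sum of the first $N$ (resp. $M$) terms plus an error term that is $O(|\nu|^{-N-1})$ (resp. $O(|\nu|^{-M-1})$) as $\nu\to\infty$ in the stated sector, uniformly for $\xi$, $\alpha$, $\beta$ in the stated ranges (the error term standing inside the bracket multiplied by the corresponding prefactor). *)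

theory Defs
  imports "HOL-Complex_Analysis.Complex_Analysis"
begin

text \<open>
  The regularised hypergeometric function is the analytic continuation of its power series to
  the plane cut along \<open>[1, \<infinity>)\<close>. The cut plane is connected, so the identity theorem determines
  the continuation uniquely there; values on the cut are arbitrary. Since \<^const>\<open>rGamma\<close> is the
  entire function \<open>1/\<Gamma>\<close>, no value of \<open>c\<close> has to be excluded.
\<close>

definition hyp_cut_plane :: "complex set" where
  "hyp_cut_plane = - (of_real ` {1::real..})"

definition hyp2F1_reg :: "complex \<Rightarrow> complex \<Rightarrow> complex \<Rightarrow> complex \<Rightarrow> complex" where
  "hyp2F1_reg a b c = (SOME f. f holomorphic_on hyp_cut_plane \<and>
     (\<forall>x\<in>ball 0 1.
        (\<lambda>n. pochhammer a n * pochhammer b n * rGamma (c + of_nat n) / fact n * x ^ n) sums f x))"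

text \<open>
  The Jacobi functions are meant for \<open>z\<close> outside \<open>(-\<infinity>, -1]\<close> and \<open>\<nu> + \<alpha>\<close> not a negative integer
  (first kind), respectively \<open>z\<close> outside \<open>(-\<infinity>, 1]\<close> and neither \<open>\<nu> + \<alpha>\<close> nor \<open>\<nu> + \<beta>\<close> a negative
  integer (second kind).
\<close>

definition jacobi_P :: "complex \<Rightarrow> complex \<Rightarrow> complex \<Rightarrow> complex \<Rightarrow> complex" where
  "jacobi_P \<nu> \<alpha> \<beta> z =
     Gamma (\<nu> + \<alpha> + 1) / Gamma (\<nu> + 1) *
     hyp2F1_reg (- \<nu>) (\<nu> + \<alpha> + \<beta> + 1) (\<alpha> + 1) ((1 - z) / 2)"

definition jacobi_Q :: "complex \<Rightarrow> complex \<Rightarrow> complex \<Rightarrow> complex \<Rightarrow> complex" where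
  "jacobi_Q \<nu> \<alpha> \<beta> z =
     2 powr (\<nu> + \<alpha> + \<beta>) * Gamma (\<nu> + \<alpha> + 1) * Gamma (\<nu> + \<beta> + 1) /
       ((z - 1) powr (\<nu> + \<alpha> + 1) * (z + 1) powr \<beta>) *
     hyp2F1_reg (\<nu> + 1) (\<nu> + \<alpha> + 1) (2 * \<nu> + \<alpha> + \<beta> + 2) (2 / (1 - z))"

definition half_strip :: "complex set" where
  "half_strip = {\<xi>. Re \<xi> > 0 \<and> \<bar>Im \<xi>\<bar> < pi / 2}"

text \<open>Only used for \<open>\<xi> \<in> half_strip\<close>, where \<open>Im \<xi> = 0\<close> means \<open>\<xi> > 0\<close>.\<close>

definition stokes_C :: "complex \<Rightarrow> complex \<Rightarrow> complex" where
  "stokes_C \<xi> \<alpha> =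
     (if Im \<xi> = 0 then sin (of_real pi * \<alpha>)
      else if Im \<xi> > 0 then - \<i> * exp (of_real pi * \<i> * \<alpha>)
      else \<i> * exp (- (of_real pi * \<i> * \<alpha>)))"

definition a_coeff :: "nat \<Rightarrow> complex \<Rightarrow> complex" where
  "a_coeff n \<mu> = pochhammer (1/2 + \<mu>) n * pochhammer (1/2 - \<mu>) n / ((- 2) ^ n * fact n)"

text \<open>
  A single function of \<open>\<zeta> = \<plusminus>\<xi>\<close>: as \<open>sinh\<close> is odd and \<open>cosh\<close> is even, the factor \<open>(\<plusminus>1)\<^sup>l\<close> of the
  usual formula in terms of \<open>\<xi>\<close> arises by itself (lemma \<open>g_coeff_minus\<close>).
\<close>

definition g_coeff :: "nat \<Rightarrow> complex \<Rightarrow> complex \<Rightarrow> complex \<Rightarrow> complex" where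
  "g_coeff n \<zeta> \<alpha> \<beta> =
     (\<Sum>l\<le>n. a_coeff l \<alpha> * a_coeff (n - l) \<beta> *
        (exp \<zeta> / sinh \<zeta>) ^ l * (exp \<zeta> / cosh \<zeta>) ^ (n - l))"

lemma g_coeff_minus:
  "g_coeff n (- \<xi>) \<alpha> \<beta> =
     (\<Sum>l\<le>n. (- 1) ^ l * a_coeff l \<alpha> * a_coeff (n - l) \<beta> *
        (exp (- \<xi>) / sinh \<xi>) ^ l * (exp (- \<xi>) / cosh \<xi>) ^ (n - l))"
  unfolding g_coeff_def
proof (intro sum.cong refl)
  fix l
  have "(exp (- \<xi>) / sinh (- \<xi>)) ^ l = (- 1) ^ l * (exp (- \<xi>) / sinh \<xi>) ^ l"
    by (simp flip: power_mult_distrib)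
  then show "a_coeff l \<alpha> * a_coeff (n - l) \<beta> *
        (exp (- \<xi>) / sinh (- \<xi>)) ^ l * (exp (- \<xi>) / cosh (- \<xi>)) ^ (n - l) =
      (- 1) ^ l * a_coeff l \<alpha> * a_coeff (n - l) \<beta> *
        (exp (- \<xi>) / sinh \<xi>) ^ l * (exp (- \<xi>) / cosh \<xi>) ^ (n - l)"
    by (simp only: cosh_minus mult_ac)
qed

text \<open>
  The powers of \<open>e\<^sup>\<plusminus>\<^sup>\<xi> / sinh \<xi>\<close> and \<open>e\<^sup>\<plusminus>\<^sup>\<xi> / cosh \<xi>\<close> are the continuous extensions to
  \<^term>\<open>half_strip\<close> of the real powers on \<open>\<xi> > 0\<close>. They coincide with the principal powers
  \<^const>\<open>powr\<close>, because these four quotients are positive for \<open>\<xi> > 0\<close> and never meet the cut: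
\<close>

lemma half_strip_base_not_nonpos:
  assumes "\<xi> \<in> half_strip"
  shows "exp \<xi> / sinh \<xi> \<notin> \<real>\<^sub>\<le>\<^sub>0" "exp \<xi> / cosh \<xi> \<notin> \<real>\<^sub>\<le>\<^sub>0"
        "exp (- \<xi>) / sinh \<xi> \<notin> \<real>\<^sub>\<le>\<^sub>0" "exp (- \<xi>) / cosh \<xi> \<notin> \<real>\<^sub>\<le>\<^sub>0"
proof -
  define w where "w = exp (2 * \<xi>)"
  have xi: "Re \<xi> > 0" "\<bar>Im \<xi>\<bar> < pi / 2"
    using assms by (auto simp: half_strip_def)
  have "norm w > 1"
    using xi by (simp add: w_def)
  then have w0: "w \<noteq> 0"
    by auto
  have real_w: "Re w > 1" if "Im w = 0"
  proof -
    have "sin (2 * Im \<xi>) = 0"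
      using that by (simp add: w_def Im_exp)
    moreover have "\<bar>2 * Im \<xi>\<bar> < pi"
      using xi by simp
    ultimately have "2 * Im \<xi> = 0"
      by (smt (verit) sin_gt_zero sin_minus)
    then show ?thesis
      using xi by (simp add: w_def Re_exp)
  qed
  have cut: "1 / (w + of_real c) \<notin> \<real>\<^sub>\<le>\<^sub>0" if "\<bar>c\<bar> = 1" for c
  proof
    assume "1 / (w + of_real c) \<in> \<real>\<^sub>\<le>\<^sub>0"
    then have "w + of_real c \<in> \<real>\<^sub>\<le>\<^sub>0"
      by (metis inverse_eq_divide nonpos_Reals_inverse_iff)
    then have "Im w = 0" "Re w \<le> - c"
      by (auto simp: complex_nonpos_Reals_iff)
    then show False
      using real_w that by linarith
  qed
  have pos: "1 / (1 + of_real c / w) \<notin> \<real>\<^sub>\<le>\<^sub>0" if "\<bar>c\<bar> = 1" for c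
  proof
    assume "1 / (1 + of_real c / w) \<in> \<real>\<^sub>\<le>\<^sub>0"
    then have "1 + of_real c / w \<in> \<real>\<^sub>\<le>\<^sub>0"
      by (metis inverse_eq_divide nonpos_Reals_inverse_iff)
    then have "Re (of_real c / w) \<le> - 1"
      by (auto simp: complex_nonpos_Reals_iff)
    moreover have "norm (of_real c / w) < 1"
      using \<open>norm w > 1\<close> that by (auto simp: norm_divide divide_less_eq_1)
    ultimately show False
      using abs_Re_le_cmod[of "of_real c / w"] by linarith
  qed
  have scale: "2 * x \<notin> \<real>\<^sub>\<le>\<^sub>0" if "x \<notin> \<real>\<^sub>\<le>\<^sub>0" for x :: complex
    using that by (auto simp: complex_nonpos_Reals_iff)
  have e: "exp \<xi> * exp \<xi> = w" "exp (- \<xi>) = 1 / exp \<xi>"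
    by (simp_all add: w_def exp_minus field_simps flip: exp_add)
  have s: "sinh \<xi> = (w - 1) / (2 * exp \<xi>)" and c: "cosh \<xi> = (w + 1) / (2 * exp \<xi>)"
    by (simp_all add: sinh_field_def cosh_field_def e(2) flip: e(1)) (simp_all add: field_simps)
  have "exp \<xi> / sinh \<xi> = 2 * (1 / (1 + of_real (- 1) / w))"
       "exp \<xi> / cosh \<xi> = 2 * (1 / (1 + of_real 1 / w))"
    using w0 by (simp_all add: s c e field_simps)
  moreover have "exp (- \<xi>) / sinh \<xi> = 2 * (1 / (w + of_real (- 1)))"
       "exp (- \<xi>) / cosh \<xi> = 2 * (1 / (w + of_real 1))"
    by (simp_all add: s c e)
  ultimately show "exp \<xi> / sinh \<xi> \<notin> \<real>\<^sub>\<le>\<^sub>0" "exp \<xi> / cosh \<xi> \<notin> \<real>\<^sub>\<le>\<^sub>0"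
        "exp (- \<xi>) / sinh \<xi> \<notin> \<real>\<^sub>\<le>\<^sub>0" "exp (- \<xi>) / cosh \<xi> \<notin> \<real>\<^sub>\<le>\<^sub>0"
    by (metis scale pos cut abs_minus_cancel abs_one)+
qed

end

(*
Multiplied by sinh^(alpha+1/2) cosh^(beta+1/2), both Jacobi functions of cosh(2 z) solve a Schroedinger
equation u'' = (w^2 + V) u with w = 2 nu + alpha + beta + 1, and the formal inverse factorial series in
1/w solves it up to an explicit residual.  The second kind is the solution u that is recessive for
Re z -> infinity.  Along straight lines on which Re (w z) increases, the remainder of u obeys a Volterra
equation with an integrable kernel, which gives uniform bounds; a slanted line (slope m) covers the sectors of
nu beyond the right half-plane.  Continuing u through the segment Re z = 0, 0 < |Im z| < pi/2, to
Re z < 0 gives the expansion of u (-z); the constant in front is found by shifting nu to nu + n with a ladder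
operator and letting n -> infinity.  The function of the first kind is u (-z) - C u (z): both sides have
the same Wronskian with it, and the normalisation comes from Gauss's summation theorem.
*)
theory Submission
  imports Defs
begin


section \<open>Linear differential equations of second order\<close>

text \<open>The series is anchored at Re z -> -infinity: there \<open>g_coeff n\<close> tends to 0
  for n \<ge> 1, so a remainder with at least one term kept tends to 0 exactly when e^(w z) u has
  the limit 1 / w. The scaling \<open>jacobi_norm\<close> that achieves this is the one that turns
  the recessive solution into Q. At Re z -> +infinity the remainder tends instead to a constant that
  is the same for all lines. One complete line, midway between two singularities, bounds this
  constant; afterwards a ray from +infinity down to a given point suffices, and rays may be slanted
  as the argument of \<nu> requires. For the reflected argument a complete line through the point is
  needed, and it has to pass between the singularities 0 and \<plusminus> i pi/2 of the potential at
  a fixed distance from both. This restricts the slope, and hence the sector for P. The segments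
  above and below 0 give two continuations, told apart by a sign \<sigma>; their difference produces
  the jump of C(\<xi>, \<alpha>).\<close>

lemma starlike_primitive_vanishing:
  fixes f :: "complex \<Rightarrow> complex"
  assumes "open S" "a \<in> S" "\<And>z. z \<in> S \<Longrightarrow> closed_segment a z \<subseteq> S" "f holomorphic_on S"
  shows "\<exists>g. g a = 0 \<and> (\<forall>z\<in>S. (g has_field_derivative f z) (at z))"
proof -
  have "starlike S"
    using assms by (auto simp: starlike_def)
  then obtain g where g: "\<And>z. z \<in> S \<Longrightarrow> (g has_field_derivative f z) (at z)"
    using holomorphic_starlike_primitive[of S f "{}"] assms holomorphic_on_imp_continuous_on[OF assms(4)]
      holomorphic_on_imp_differentiable_at[OF assms(4,1)] by auto blast
  then have "\<forall>z\<in>S. ((\<lambda>z. g z - g a) has_field_derivative f z) (at z)"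
    by (auto intro!: derivative_eq_intros)
  then show ?thesis
    by (intro exI[of _ "\<lambda>z. g z - g a"]) auto
qed

text \<open>The inductive estimate of Picard iteration: each integration along the segment raises
  the power by one and divides by the new exponent. Iterated, this builds up the factorials that
  make the series in \<open>linear_ode_exists\<close> converge.\<close>

lemma segment_power_bound:
  fixes f :: "complex \<Rightarrow> complex"
  assumes "\<And>y. y \<in> closed_segment a z \<Longrightarrow> (f has_field_derivative f' y) (at y)" "f a = 0"
    and "\<And>y. y \<in> closed_segment a z \<Longrightarrow> norm (f' y) \<le> C * norm (y - a) ^ n"
  shows "norm (f z) \<le> C * norm (z - a) ^ (n + 1) / (n + 1)"
proof -
  define p where "p = (\<lambda>s::real. a + of_real s * (z - a))"
  have p: "p s \<in> closed_segment a z" if "0 \<le> s" "s \<le> 1" for s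
    unfolding closed_segment_def p_def using that
    by (intro CollectI exI[of _ s]) (auto simp: scaleR_conv_of_real algebra_simps)
  have pv: "(p has_vector_derivative (z - a)) (at s within T)" for s T
    unfolding p_def by (auto intro!: derivative_eq_intros)
  have fv: "((f \<circ> p) has_vector_derivative (z - a) * f' (p s)) (at s within T)"
    if "0 \<le> s" "s \<le> 1" for s T
    using field_vector_diff_chain_within[OF pv, of f "f' (p s)" s T] assms(1)[OF p[OF that]]
    by (auto simp: has_field_derivative_at_within)
  define r where "r = norm (z - a)"
  have "norm ((f \<circ> p) 1 - (f \<circ> p) 0) \<le>
     (\<lambda>s. C * r ^ (n + 1) / (n + 1) * s ^ (n + 1)) 1 - (\<lambda>s. C * r ^ (n + 1) / (n + 1) * s ^ (n + 1)) 0"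
  proof (rule differentiable_bound_general)
    show "continuous_on {0..1} (f \<circ> p)"
      by (rule continuous_on_vector_derivative) (use fv in auto)
    show "continuous_on {0..1} (\<lambda>s. C * r ^ (n + 1) / (n + 1) * s ^ (n + 1))"
      by (intro continuous_intros)
    show "((f \<circ> p) has_vector_derivative (z - a) * f' (p s)) (at s)" if "0 < s" "s < 1" for s
      using fv[of s] that by auto
    show "((\<lambda>s. C * r ^ (n + 1) / (n + 1) * s ^ (n + 1)) has_vector_derivative
             C * r ^ (n + 1) * s ^ n) (at s)" for s
    proof -
      have "((\<lambda>s. C * r ^ (n + 1) / real (n + 1) * s ^ (n + 1)) has_real_derivative
             C * r ^ (n + 1) / real (n + 1) * (real (n + 1) * s ^ n)) (at s)"
        by (rule DERIV_cmult) (use DERIV_pow[of "n + 1" s] in simp)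
      then show ?thesis
        unfolding has_real_derivative_iff_has_vector_derivative[symmetric] by (simp add: mult.assoc del: power_Suc of_nat_Suc of_nat_add)
    qed
    show "norm ((z - a) * f' (p s)) \<le> C * r ^ (n + 1) * s ^ n" if "0 < s" "s < 1" for s
    proof -
      have "norm (f' (p s)) \<le> C * norm (p s - a) ^ n"
        using that by (intro assms p) auto
      also have "norm (p s - a) = s * r"
        using that by (simp add: p_def r_def norm_mult)
      finally have "r * norm (f' (p s)) \<le> r * (C * (s * r) ^ n)"
        by (intro mult_left_mono) (auto simp: r_def)
      then show ?thesis
        by (simp add: norm_mult r_def power_mult_distrib mult_ac)
    qed
  qed simp
  then show ?thesis
    using assms(2) by (simp add: p_def r_def)
qed

lemma linear_ode_exists:
  fixes p q :: "complex \<Rightarrow> complex"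
  assumes S: "open S" "a \<in> S" "\<And>z. z \<in> S \<Longrightarrow> closed_segment a z \<subseteq> S"
    and pq: "p holomorphic_on S" "q holomorphic_on S"
  shows "\<exists>u v. u a = u0 \<and> v a = v0 \<and>
    (\<forall>z\<in>S. (u has_field_derivative v z) (at z) \<and>
       (v has_field_derivative (p z * v z + q z * u z)) (at z))"
proof -
  \<comment> \<open>\<open>I\<close> is integration from \<open>a\<close>. The system u' = v, v' = p
    v + q u is solved by Picard iteration organised as a series: u and v are the sums of the
    successive corrections \<open>U n\<close> and \<open>V n\<close>.\<close>
  define I where "I = (\<lambda>f. SOME g. g a = 0 \<and> (\<forall>z\<in>S. (g has_field_derivative f z) (at z)))"
  have I: "I f a = 0 \<and> (\<forall>z\<in>S. (I f has_field_derivative f z) (at z))" if "f holomorphic_on S" for f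
    unfolding I_def by (rule someI_ex[OF starlike_primitive_vanishing[OF S that]])
  have I_holo: "I f holomorphic_on S" if "f holomorphic_on S" for f
    using I[OF that] by (meson holomorphic_onI has_field_derivative_at_within field_differentiable_def)
  define step where
    "step = (\<lambda>P :: (complex \<Rightarrow> complex) \<times> (complex \<Rightarrow> complex). (I (snd P), I (\<lambda>z. p z * snd P z + q z * fst P z)))"
  define it where "it = (\<lambda>n. (step ^^ n) (\<lambda>_. u0, \<lambda>_. v0))"
  define U where "U = (\<lambda>n. fst (it n))"
  define V where "V = (\<lambda>n. snd (it n))"
  have US: "U (Suc n) = I (V n)" "V (Suc n) = I (\<lambda>z. p z * V n z + q z * U n z)" for n
    by (simp_all add: U_def V_def it_def step_def)
  have U0: "U 0 = (\<lambda>_. u0)" "V 0 = (\<lambda>_. v0)"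
    by (simp_all add: U_def V_def it_def)
  have holo: "U n holomorphic_on S \<and> V n holomorphic_on S" for n
    by (induction n) (auto simp: U0 US intro!: I_holo holomorphic_intros pq)
  have Ua: "U n a = (if n = 0 then u0 else 0)" "V n a = (if n = 0 then v0 else 0)" for n
  proof -
    have "(\<lambda>z. p z * V m z + q z * U m z) holomorphic_on S" "V m holomorphic_on S" for m
      using holo[of m] pq by (auto intro!: holomorphic_on_add holomorphic_on_mult)
    then have "I (\<lambda>z. p z * V m z + q z * U m z) a = 0" "I (V m) a = 0" for m
      using I by blast+
    then show "U n a = (if n = 0 then u0 else 0)" "V n a = (if n = 0 then v0 else 0)"
      by (cases n; simp add: U0 US)+
  qed
  define U' where "U' = (\<lambda>n z. if n = 0 then 0 else V (n - 1) z)"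
  define V' where "V' = (\<lambda>n z. if n = 0 then 0 else p z * V (n - 1) z + q z * U (n - 1) z)"
  have dU: "(U n has_field_derivative U' n z) (at z)" if "z \<in> S" for n z
  proof (cases n)
    case (Suc m)
    have "V m holomorphic_on S" using holo by blast
    then show ?thesis using I[of "V m"] that by (simp add: U'_def US Suc)
  qed (simp add: U'_def U0)
  have dV: "(V n has_field_derivative V' n z) (at z)" if "z \<in> S" for n z
  proof (cases n)
    case (Suc m)
    have "(\<lambda>z. p z * V m z + q z * U m z) holomorphic_on S"
      using holo[of m] pq by (intro holomorphic_on_add holomorphic_on_mult) auto
    then show ?thesis using I[of "\<lambda>z. p z * V m z + q z * U m z"] that by (simp add: V'_def US Suc)
  qed (simp add: V'_def U0)
  have bound: "\<exists>C M. 0 \<le> C \<and> 0 \<le> M \<and> (\<forall>n. \<forall>z\<in>K.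
      norm (U n z) \<le> C * (M * norm (z - a)) ^ n / fact n \<and> norm (V n z) \<le> C * (M * norm (z - a)) ^ n / fact n)"
    if K: "compact K" "K \<subseteq> S" "\<And>z. z \<in> K \<Longrightarrow> closed_segment a z \<subseteq> K" for K
  proof -
    have "continuous_on K p" "continuous_on K q"
      using pq K by (meson holomorphic_on_imp_continuous_on continuous_on_subset)+
    then have "bounded (p ` K)" "bounded (q ` K)"
      using K by (auto intro!: compact_imp_bounded compact_continuous_image)
    then obtain Mp Mq where Mp: "\<And>z. z \<in> K \<Longrightarrow> norm (p z) \<le> Mp" and Mq: "\<And>z. z \<in> K \<Longrightarrow> norm (q z) \<le> Mq"
      unfolding bounded_iff by blast
    define M where "M = 1 + \<bar>Mp\<bar> + \<bar>Mq\<bar>"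
    define C where "C = norm u0 + norm v0"
    have M: "norm (p z) + norm (q z) \<le> M" if "z \<in> K" for z
      using Mp[OF that] Mq[OF that] by (simp add: M_def)
    have M1: "M \<ge> 1" "C \<ge> 0" by (auto simp: M_def C_def)
    have "\<forall>z\<in>K. norm (U n z) \<le> C * (M * norm (z - a)) ^ n / fact n \<and>
             norm (V n z) \<le> C * (M * norm (z - a)) ^ n / fact n" for n
    proof (induction n)
      case 0
      then show ?case by (auto simp: U0 C_def)
    next
      case (Suc n)
      define D where "D = C * M ^ (n + 1) / fact n"
      have eq: "D * norm (z - a) ^ (n + 1) / (n + 1) = C * (M * norm (z - a)) ^ Suc n / fact (Suc n)" for z
        by (simp add: D_def power_mult_distrib field_simps)
      have Dn: "M * (C * (M * norm (y - a)) ^ n / fact n) = D * norm (y - a) ^ n" for y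
        by (simp add: D_def power_mult_distrib)
      have 1: "norm (U' (Suc n) y) \<le> D * norm (y - a) ^ n" if "y \<in> K" for y
      proof -
        have "norm (U' (Suc n) y) \<le> 1 * (C * (M * norm (y - a)) ^ n / fact n)"
          using Suc that by (auto simp: U'_def)
        also have "\<dots> \<le> M * (C * (M * norm (y - a)) ^ n / fact n)"
          using M1 by (intro mult_right_mono) auto
        finally show ?thesis by (simp only: Dn)
      qed
      have 2: "norm (V' (Suc n) y) \<le> D * norm (y - a) ^ n" if "y \<in> K" for y
      proof -
        let ?b = "C * (M * norm (y - a)) ^ n / fact n"
        have "norm (V' (Suc n) y) \<le> norm (p y) * norm (V n y) + norm (q y) * norm (U n y)"
          by (auto simp: V'_def norm_mult[symmetric] intro: norm_triangle_ineq)
        also have "\<dots> \<le> norm (p y) * ?b + norm (q y) * ?b"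
          using Suc that by (intro add_mono mult_left_mono) auto
        also have "\<dots> = (norm (p y) + norm (q y)) * ?b" by (simp only: distrib_right)
        also have "\<dots> \<le> M * ?b"
          using M1 M that by (intro mult_right_mono) auto
        finally show ?thesis by (simp only: Dn)
      qed
      show ?case
      proof (intro ballI conjI)
        fix z assume z: "z \<in> K"
        have sub: "y \<in> K" "y \<in> S" if "y \<in> closed_segment a z" for y
          using K(3)[OF z] K(2) that by auto
        show "norm (U (Suc n) z) \<le> C * (M * norm (z - a)) ^ Suc n / fact (Suc n)"
          unfolding eq[symmetric]
          by (rule segment_power_bound[OF dU]) (auto simp: sub 1 Ua)
        show "norm (V (Suc n) z) \<le> C * (M * norm (z - a)) ^ Suc n / fact (Suc n)"
          unfolding eq[symmetric]
          by (rule segment_power_bound[OF dV]) (auto simp: sub 2 Ua)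
      qed
    qed
    then show ?thesis using M1 by (intro exI[of _ C] exI[of _ M]) auto
  qed
  have unif: "\<exists>d>0. cball z d \<subseteq> S \<and>
      uniform_limit (cball z d) (\<lambda>n x. \<Sum>k<n. U k x) (\<lambda>x. \<Sum>k. U k x) sequentially \<and>
      uniform_limit (cball z d) (\<lambda>n x. \<Sum>k<n. V k x) (\<lambda>x. \<Sum>k. V k x) sequentially" if z: "z \<in> S" for z
  proof -
    obtain d where d: "d > 0" "cball z d \<subseteq> S"
      using S(1) z open_contains_cball by blast
    \<comment> \<open>The union of the segments from \<open>a\<close> to the points of the disc:
      compact and again starlike about \<open>a\<close>, so that one bound for the coefficients
      serves all iterated integrals ending in the disc.\<close>
    define K where "K = (\<lambda>(s, y). a + of_real s * (y - a)) ` ({0..1::real} \<times> cball z d)"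
    have K1: "compact K"
      unfolding K_def case_prod_beta
      by (intro compact_continuous_image compact_Times continuous_intros compact_Icc compact_cball)
    have in_seg: "a + of_real s * (y - a) \<in> closed_segment a y" if "0 \<le> s" "s \<le> 1" for s y
      unfolding closed_segment_def using that
      by (intro CollectI exI[of _ s]) (auto simp: scaleR_conv_of_real algebra_simps)
    have K2: "K \<subseteq> S"
    proof
      fix x assume "x \<in> K"
      then obtain s y where "x = a + of_real s * (y - a)" "0 \<le> s" "s \<le> 1" "y \<in> cball z d"
        by (auto simp: K_def)
      then show "x \<in> S" using in_seg[of s y] S(3)[of y] d by blast
    qed
    have K3: "closed_segment a x \<subseteq> K" if "x \<in> K" for x
    proof
      fix y assume "y \<in> closed_segment a x"
      then obtain s where s: "0 \<le> s" "s \<le> 1" "y = (1 - s) *\<^sub>R a + s *\<^sub>R x"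
        by (auto simp: closed_segment_def)
      from that obtain t w where t: "x = a + of_real t * (w - a)" "0 \<le> t" "t \<le> 1" "w \<in> cball z d"
        by (auto simp: K_def)
      have "y = a + of_real (s * t) * (w - a)"
        by (simp add: s(3) t(1) scaleR_conv_of_real algebra_simps)
      moreover have "0 \<le> s * t" "s * t \<le> 1"
        using s t by (auto intro: mult_le_one)
      ultimately show "y \<in> K"
        unfolding K_def using t by force
    qed
    have K4: "cball z d \<subseteq> K"
    proof
      fix y assume "y \<in> cball z d"
      then show "y \<in> K"
        unfolding K_def by (intro image_eqI[of _ _ "(1, y)"]) auto
    qed
    obtain C M where CM: "0 \<le> C" "0 \<le> M"
      "\<And>n y. y \<in> K \<Longrightarrow> norm (U n y) \<le> C * (M * norm (y - a)) ^ n / fact n"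
      "\<And>n y. y \<in> K \<Longrightarrow> norm (V n y) \<le> C * (M * norm (y - a)) ^ n / fact n"
      using bound[OF K1 K2 K3] by blast
    define r where "r = M * (norm (z - a) + d)"
    have r: "C * (M * norm (y - a)) ^ n / fact n \<le> C * (r ^ n /\<^sub>R fact n)" if "y \<in> cball z d" for y n
    proof -
      have "norm (y - a) \<le> norm (z - a) + d"
        using that norm_triangle_ineq[of "z - a" "y - z"] by (simp add: dist_norm norm_minus_commute)
      then have "(M * norm (y - a)) ^ n \<le> r ^ n"
        unfolding r_def using CM by (intro power_mono mult_left_mono) auto
      then show ?thesis using CM by (auto intro!: mult_left_mono divide_right_mono simp: divide_inverse_commute)
    qed
    have sm: "summable (\<lambda>n. C * (r ^ n /\<^sub>R fact n))"
      by (intro summable_mult summable_exp_generic)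
    show ?thesis
    proof (intro exI[of _ d] conjI d)
      show "uniform_limit (cball z d) (\<lambda>n x. \<Sum>k<n. U k x) (\<lambda>x. \<Sum>k. U k x) sequentially"
        by (rule Weierstrass_m_test[OF _ sm]) (meson CM(3,4) K4 r order_trans subsetD)
      show "uniform_limit (cball z d) (\<lambda>n x. \<Sum>k<n. V k x) (\<lambda>x. \<Sum>k. V k x) sequentially"
        by (rule Weierstrass_m_test[OF _ sm]) (meson CM(3,4) K4 r order_trans subsetD)
    qed
  qed
  define u where "u = (\<lambda>z. \<Sum>k. U k z)"
  define v where "v = (\<lambda>z. \<Sum>k. V k z)"
  \<comment> \<open>The derivative of correction n is made of corrections n - 1, so differentiated
    partial sums are shifted by one; this is why limits are compared at \<open>Suc n\<close>
    below.\<close>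
  have sum_Suc0: "(\<Sum>k<Suc n. if k = 0 then 0 else f (k - 1)) = (\<Sum>k<n. f k)" for n and f :: "nat \<Rightarrow> complex"
    by (subst sum.lessThan_Suc_shift) simp
  have limU: "(\<lambda>n. \<Sum>k<n. U k z) \<longlonglongrightarrow> u z" and limV: "(\<lambda>n. \<Sum>k<n. V k z) \<longlonglongrightarrow> v z" if "z \<in> S" for z
    using unif[OF that] unfolding u_def v_def by (auto intro: tendsto_uniform_limitI)
  have "\<exists>g'. \<forall>x\<in>S. (u has_field_derivative g' x) (at x) \<and> (\<lambda>n. \<Sum>k<n. U' k x) \<longlonglongrightarrow> g' x"
    by (rule has_complex_derivative_uniform_sequence[OF S(1)])
      (use unif in \<open>auto simp: u_def intro!: DERIV_sum dU\<close>)
  then obtain u' where u': "\<And>x. x \<in> S \<Longrightarrow> (u has_field_derivative u' x) (at x)"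
      "\<And>x. x \<in> S \<Longrightarrow> (\<lambda>n. \<Sum>k<n. U' k x) \<longlonglongrightarrow> u' x" by blast
  have "\<exists>g'. \<forall>x\<in>S. (v has_field_derivative g' x) (at x) \<and> (\<lambda>n. \<Sum>k<n. V' k x) \<longlonglongrightarrow> g' x"
    by (rule has_complex_derivative_uniform_sequence[OF S(1)])
      (use unif in \<open>auto simp: v_def intro!: DERIV_sum dV\<close>)
  then obtain v' where v': "\<And>x. x \<in> S \<Longrightarrow> (v has_field_derivative v' x) (at x)"
      "\<And>x. x \<in> S \<Longrightarrow> (\<lambda>n. \<Sum>k<n. V' k x) \<longlonglongrightarrow> v' x" by blast
  have "u' x = v x" if "x \<in> S" for x
  proof (rule LIMSEQ_unique)
    show "(\<lambda>n. \<Sum>k<Suc n. U' k x) \<longlonglongrightarrow> u' x" using u'(2)[OF that] by (rule LIMSEQ_Suc)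
    show "(\<lambda>n. \<Sum>k<Suc n. U' k x) \<longlonglongrightarrow> v x"
      using limV[OF that] sum_Suc0[of "\<lambda>k. V k x"] by (simp only: U'_def)
  qed
  moreover have "v' x = p x * v x + q x * u x" if "x \<in> S" for x
  proof (rule LIMSEQ_unique)
    show "(\<lambda>n. \<Sum>k<Suc n. V' k x) \<longlonglongrightarrow> v' x" using v'(2)[OF that] by (rule LIMSEQ_Suc)
    have "(\<Sum>k<Suc n. V' k x) = p x * (\<Sum>k<n. V k x) + q x * (\<Sum>k<n. U k x)" for n
      using sum_Suc0[of "\<lambda>k. p x * V k x + q x * U k x"]
      by (simp only: V'_def sum.distrib sum_distrib_left)
    then show "(\<lambda>n. \<Sum>k<Suc n. V' k x) \<longlonglongrightarrow> p x * v x + q x * u x"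
      by (auto intro!: tendsto_intros limU limV that)
  qed
  ultimately have der: "\<forall>z\<in>S. (u has_field_derivative v z) (at z) \<and>
       (v has_field_derivative (p z * v z + q z * u z)) (at z)"
    using u' v' by auto
  have "(\<lambda>k. U k a) sums u0" "(\<lambda>k. V k a) sums v0"
    unfolding Ua using sums_If_finite_set[of "{0::nat}" "\<lambda>_. u0"] sums_If_finite_set[of "{0::nat}" "\<lambda>_. v0"]
    by auto
  then have "u a = u0" "v a = v0"
    by (auto simp: u_def v_def sums_iff)
  with der show ?thesis by blast
qed

lemma linear_ode_solution:
  fixes p q :: "complex \<Rightarrow> complex"
  assumes S: "open S" "a \<in> S" "\<And>z. z \<in> S \<Longrightarrow> closed_segment a z \<subseteq> S"
    and pq: "p holomorphic_on S" "q holomorphic_on S"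
  shows "\<exists>y. y a = u0 \<and> deriv y a = v0 \<and> y holomorphic_on S \<and>
    (\<forall>z\<in>S. deriv (deriv y) z = p z * deriv y z + q z * y z)"
proof -
  have "\<exists>u v. u a = u0 \<and> v a = v0 \<and>
        (\<forall>z\<in>S. (u has_field_derivative v z) (at z) \<and> (v has_field_derivative p z * v z + q z * u z) (at z))"
    by (rule linear_ode_exists[OF S pq, of u0 v0])
  then obtain y y' where y0: "y a = u0 \<and> y' a = v0 \<and>
        (\<forall>z\<in>S. (y has_field_derivative y' z) (at z) \<and> (y' has_field_derivative p z * y' z + q z * y z) (at z))"
    by (elim exE)
  note y = y0[THEN conjunct1] y0[THEN conjunct2, THEN conjunct1]
      y0[THEN conjunct2, THEN conjunct2, rule_format, THEN conjunct1]
      y0[THEN conjunct2, THEN conjunct2, rule_format, THEN conjunct2]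
  have dy: "deriv y z = y' z" if "z \<in> S" for z
    using y(3)[OF that] by (rule DERIV_imp_deriv)
  have "deriv (deriv y) z = deriv y' z" if "z \<in> S" for z
    by (intro deriv_cong_ev) (use S(1) that dy in \<open>auto simp: eventually_nhds\<close>)
  moreover have "deriv y' z = p z * y' z + q z * y z" if "z \<in> S" for z
    using DERIV_imp_deriv[OF y(4)[OF that]] .
  moreover have "y holomorphic_on S"
    using y(3) by (meson holomorphic_onI has_field_derivative_at_within field_differentiable_def)
  ultimately show ?thesis using y(1,2) dy S(2) by (intro exI[of _ y]) auto
qed

text \<open>Differentiating the equation by Leibniz's rule expresses each derivative of order at
  least 2 at \<open>a\<close> through lower ones, so every Taylor coefficient at \<open>a\<close>
  vanishes; connectedness does the rest.\<close>

lemma linear_ode_unique: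
  fixes p q :: "complex \<Rightarrow> complex"
  assumes S: "open S" "connected S" "a \<in> S"
    and pq: "p holomorphic_on S" "q holomorphic_on S" "u holomorphic_on S"
    and ode: "\<And>z. z \<in> S \<Longrightarrow> deriv (deriv u) z = p z * deriv u z + q z * u z"
    and init: "u a = 0" "deriv u a = 0" and z: "z \<in> S"
  shows "u z = 0"
proof -
  have du: "deriv u holomorphic_on S"
    using pq S by (intro holomorphic_intros)
  have "\<forall>m<n. (deriv ^^ m) u a = 0" for n
  proof (induction n)
    case (Suc n)
    have "(deriv ^^ n) u a = 0"
    proof (cases "n < 2")
      case True
      then show ?thesis using init by (auto simp: numeral_2_eq_2 less_Suc_eq)
    next
      case False
      then have k: "n = Suc (Suc (n - 2))"
        by simp
      define k where "k = n - 2"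
      note k = k[folded k_def]
      have ev: "eventually (\<lambda>z. z \<in> S) (nhds a)"
        using S by (simp add: eventually_nhds_in_open)
      have "(deriv ^^ n) u a = (deriv ^^ k) (deriv (deriv u)) a"
        by (subst k) (simp add: funpow_Suc_right del: funpow.simps)
      also have "\<dots> = (deriv ^^ k) (\<lambda>z. p z * deriv u z + q z * u z) a"
        by (intro higher_deriv_cong_ev) (use ev ode in \<open>auto elim!: eventually_mono\<close>)
      also have "\<dots> = (deriv ^^ k) (\<lambda>z. p z * deriv u z) a + (deriv ^^ k) (\<lambda>z. q z * u z) a"
        by (intro higher_deriv_add[of _ S]) (use pq du S in \<open>auto intro!: holomorphic_intros\<close>)
      also have "(deriv ^^ k) (\<lambda>z. q z * u z) a = (\<Sum>i = 0..k. of_nat (k choose i) * (deriv ^^ i) q a * (deriv ^^ (k - i)) u a)"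
        by (rule higher_deriv_mult[OF pq(2,3)]) (use S in auto)
      also have "\<dots> = 0"
        using Suc k by (intro sum.neutral) auto
      also have "(deriv ^^ k) (\<lambda>z. p z * deriv u z) a = (\<Sum>i = 0..k. of_nat (k choose i) * (deriv ^^ i) p a * (deriv ^^ (k - i)) (deriv u) a)"
        by (rule higher_deriv_mult[OF pq(1) du]) (use S in auto)
      also have "\<dots> = 0"
      proof (intro sum.neutral ballI)
        fix i
        have "(deriv ^^ (k - i)) (deriv u) a = (deriv ^^ Suc (k - i)) u a"
          by (simp add: funpow_Suc_right del: funpow.simps)
        also have "\<dots> = 0" using Suc.IH[rule_format, of "Suc (k - i)"] k by simp
        finally show "of_nat (k choose i) * (deriv ^^ i) p a * (deriv ^^ (k - i)) (deriv u) a = 0" by simp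
      qed
      finally show ?thesis by simp
    qed
    then show ?case using Suc by (auto simp: less_Suc_eq)
  qed simp
  then show ?thesis
    by (intro holomorphic_fun_eq_0_on_connected[OF pq(3) S(1,2) _ S(3) z]) blast
qed

lemma wronskian_constant:
  fixes u v Q :: "complex \<Rightarrow> complex"
  assumes "open S" "connected S" "u holomorphic_on S" "v holomorphic_on S"
    and "\<And>z. z \<in> S \<Longrightarrow> deriv (deriv u) z = Q z * u z" "\<And>z. z \<in> S \<Longrightarrow> deriv (deriv v) z = Q z * v z"
  shows "\<exists>c. \<forall>z\<in>S. u z * deriv v z - deriv u z * v z = c"
proof -
  have d: "(u has_field_derivative deriv u z) (at z)" "(v has_field_derivative deriv v z) (at z)"
     "(deriv u has_field_derivative Q z * u z) (at z)" "(deriv v has_field_derivative Q z * v z) (at z)"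
    if "z \<in> S" for z
    using holomorphic_derivI[OF assms(3,1) that] holomorphic_derivI[OF assms(4,1) that]
      holomorphic_derivI[OF holomorphic_deriv[OF assms(3,1)] assms(1) that]
      holomorphic_derivI[OF holomorphic_deriv[OF assms(4,1)] assms(1) that]
    by (simp_all only: assms(5,6)[OF that])
  have d0: "((\<lambda>z. u z * deriv v z - deriv u z * v z) has_field_derivative 0) (at z)" if "z \<in> S" for z
    using DERIV_diff[OF DERIV_mult[OF d(1,4)[OF that]] DERIV_mult[OF d(3,2)[OF that]]]
    by (simp add: algebra_simps)
  then have "continuous_on S (\<lambda>z. u z * deriv v z - deriv u z * v z)"
    by (rule DERIV_continuous_on[OF has_field_derivative_at_within])
  then have "(\<lambda>z. u z * deriv v z - deriv u z * v z) constant_on S"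
    using assms(1,2) d0 by (intro DERIV_zero_connected_constant_on[of S "{}"]) auto
  then show ?thesis
    unfolding constant_on_def by blast
qed

text \<open>A fundamental system on the starlike set has Wronskian 1, and the Wronskians of the given
  solution with it are constant; Pluecker's relation then writes the solution as a combination of
  the system.\<close>

lemma linear_ode_extend:
  fixes Q :: "complex \<Rightarrow> complex"
  assumes S: "open S" "a \<in> S" "\<And>z. z \<in> S \<Longrightarrow> closed_segment a z \<subseteq> S" "Q holomorphic_on S"
    and T: "open T" "connected T" "T \<subseteq> S" "u holomorphic_on T"
    and ode: "\<And>z. z \<in> T \<Longrightarrow> deriv (deriv u) z = Q z * u z"
  shows "\<exists>v. v holomorphic_on S \<and> (\<forall>z\<in>S. deriv (deriv v) z = Q z * v z) \<and> (\<forall>z\<in>T. v z = u z)"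
proof -
  have *: "\<exists>y. y a = u0 \<and> deriv y a = v0 \<and> y holomorphic_on S \<and> (\<forall>z\<in>S. deriv (deriv y) z = Q z * y z)"
    for u0 v0
  proof -
    have "\<exists>y. y a = u0 \<and> deriv y a = v0 \<and> y holomorphic_on S \<and> (\<forall>z\<in>S. deriv (deriv y) z = 0 * deriv y z + Q z * y z)"
      by (rule linear_ode_solution[OF S(1,2,3) holomorphic_on_const[of 0] S(4), of u0 v0])
    then show ?thesis by simp
  qed
  obtain y1 where y1: "y1 a = 1" "deriv y1 a = 0" "y1 holomorphic_on S" "\<And>z. z \<in> S \<Longrightarrow> deriv (deriv y1) z = Q z * y1 z"
    using * by metis
  obtain y2 where y2: "y2 a = 0" "deriv y2 a = 1" "y2 holomorphic_on S" "\<And>z. z \<in> S \<Longrightarrow> deriv (deriv y2) z = Q z * y2 z"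
    using * by metis
  have "connected S"
    using S(2,3) by (intro starlike_imp_connected) (auto simp: starlike_def)
  then have "\<exists>c. \<forall>z\<in>S. y1 z * deriv y2 z - deriv y1 z * y2 z = c"
    using S(1) y1(3,4) y2(3,4) by (intro wronskian_constant[where Q = Q]) auto
  then have W: "y1 z * deriv y2 z - deriv y1 z * y2 z = 1" if "z \<in> S" for z
    using S(2) that y1(1,2) y2(1,2) by force
  have Ty: "y1 holomorphic_on T" "y2 holomorphic_on T"
    using y1(3) y2(3) T(3) by (auto intro: holomorphic_on_subset)
  have "\<exists>c. \<forall>z\<in>T. u z * deriv y2 z - deriv u z * y2 z = c"
    using T Ty ode y2(4) by (intro wronskian_constant[where Q = Q]) auto
  then obtain c2 where c2: "\<And>z. z \<in> T \<Longrightarrow> u z * deriv y2 z - deriv u z * y2 z = c2" by blast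
  have "\<exists>c. \<forall>z\<in>T. u z * deriv y1 z - deriv u z * y1 z = c"
    using T Ty ode y1(4) by (intro wronskian_constant[where Q = Q]) auto
  then obtain c1 where c1: "\<And>z. z \<in> T \<Longrightarrow> u z * deriv y1 z - deriv u z * y1 z = c1" by blast
  define v where "v = (\<lambda>z. c2 * y1 z - c1 * y2 z)"
  have dv: "deriv v z = c2 * deriv y1 z - c1 * deriv y2 z" if "z \<in> S" for z
    unfolding v_def by (intro DERIV_imp_deriv)
      (auto intro!: derivative_eq_intros holomorphic_derivI[OF y1(3) S(1) that] holomorphic_derivI[OF y2(3) S(1) that])
  have "deriv (deriv v) z = Q z * v z" if "z \<in> S" for z
  proof -
    have "deriv (deriv v) z = deriv (\<lambda>z. c2 * deriv y1 z - c1 * deriv y2 z) z"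
      by (intro deriv_cong_ev) (use S(1) that dv in \<open>auto simp: eventually_nhds\<close>)
    also have "\<dots> = c2 * deriv (deriv y1) z - c1 * deriv (deriv y2) z"
      by (intro DERIV_imp_deriv) (auto intro!: derivative_eq_intros
        holomorphic_derivI[OF holomorphic_deriv[OF y1(3) S(1)] S(1) that]
        holomorphic_derivI[OF holomorphic_deriv[OF y2(3) S(1)] S(1) that])
    finally show ?thesis using that by (simp add: y1 y2 v_def algebra_simps)
  qed
  moreover have "v z = u z" if "z \<in> T" for z
  proof -
    have "v z = u z * (y1 z * deriv y2 z - deriv y1 z * y2 z)"
      by (simp add: v_def c1[OF that, symmetric] c2[OF that, symmetric] algebra_simps)
    then show ?thesis using W T(3) that by auto
  qed
  moreover have "v holomorphic_on S"
    unfolding v_def using y1 y2 by (intro holomorphic_intros)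
  ultimately show ?thesis by blast
qed



section \<open>The regularised hypergeometric function\<close>

definition hyp_coeff :: "complex \<Rightarrow> complex \<Rightarrow> complex \<Rightarrow> nat \<Rightarrow> complex" where
  "hyp_coeff a b c n = pochhammer a n * pochhammer b n * rGamma (c + of_nat n) / fact n"

text \<open>Free of quotients because c + n may vanish. In that case both sides are 0, the
  right-hand one through \<open>rGamma\<close>.\<close>

lemma hyp_coeff_Suc:
  "(c + of_nat n) * of_nat (Suc n) * hyp_coeff a b c (Suc n) =
     (a + of_nat n) * (b + of_nat n) * hyp_coeff a b c n"
proof -
  have "rGamma (c + of_nat n) = (c + of_nat n) * rGamma (c + of_nat (Suc n))"
    using rGamma_plus1[of "c + of_nat n"] by (simp add: add_ac)
  then show ?thesis
    by (simp add: hyp_coeff_def pochhammer_Suc fact_Suc divide_simps del: of_nat_Suc)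
qed

lemma tendsto_shift_ratio:
  fixes a c :: complex
  shows "(\<lambda>n. (a + of_nat n) / (c + of_nat n)) \<longlonglongrightarrow> 1"
proof -
  have inf: "filterlim (\<lambda>n. c + of_nat n) at_infinity sequentially"
    by (rule tendsto_add_filterlim_at_infinity[OF tendsto_const tendsto_of_nat])
  have "(\<lambda>n. 1 + (a - c) * inverse (c + of_nat n)) \<longlonglongrightarrow> 1 + (a - c) * 0"
    by (intro tendsto_intros filterlim_compose[OF tendsto_inverse_0 inf])
  moreover have "\<forall>\<^sub>F n in sequentially. c + of_nat n \<noteq> 0"
    using inf by (rule filterlim_at_infinity_imp_eventually_ne)
  then have "\<forall>\<^sub>F n in sequentially. 1 + (a - c) * inverse (c + of_nat n) = (a + of_nat n) / (c + of_nat n)"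
    by eventually_elim (simp add: field_simps)
  ultimately show ?thesis
    using tendsto_cong by force
qed

lemma summable_hyp:
  assumes "norm x < 1"
  shows "summable (\<lambda>n. norm (hyp_coeff a b c n * x ^ n))"
proof -
  let ?q = "\<lambda>n. (a + of_nat n) / (c + of_nat n) * ((b + of_nat n) / (1 + of_nat n)) * x"
  have "?q \<longlonglongrightarrow> 1 * 1 * x"
    by (intro tendsto_intros tendsto_shift_ratio)
  then have "(\<lambda>n. norm (?q n)) \<longlonglongrightarrow> norm x"
    using tendsto_norm by fastforce
  then have "\<forall>\<^sub>F n in sequentially. norm (?q n) < (norm x + 1) / 2"
    using assms by (intro order_tendstoD) auto
  moreover have "\<forall>\<^sub>F n in sequentially. c + of_nat n \<noteq> 0"
    by (rule filterlim_at_infinity_imp_eventually_ne[OF tendsto_add_filterlim_at_infinity[OF tendsto_const tendsto_of_nat]])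
  ultimately have "\<forall>\<^sub>F n in sequentially. norm (?q n) < (norm x + 1) / 2 \<and> c + of_nat n \<noteq> 0"
    by (rule eventually_conj)
  then obtain N where N: "\<And>n. n \<ge> N \<Longrightarrow> norm (?q n) < (norm x + 1) / 2 \<and> c + of_nat n \<noteq> 0"
    unfolding eventually_sequentially by blast
  show ?thesis
  proof (rule summable_ratio_test[of "(norm x + 1) / 2" N])
    fix n assume n: "n \<ge> N"
    have "hyp_coeff a b c (Suc n) = (a + of_nat n) / (c + of_nat n) * ((b + of_nat n) / of_nat (Suc n)) * hyp_coeff a b c n"
      using hyp_coeff_Suc[of c n a b] N[OF n] of_nat_neq_0[of n, where 'a = complex]
      by (simp add: divide_simps mult_ac del: of_nat_Suc)
    then have "hyp_coeff a b c (Suc n) * x ^ Suc n = ?q n * (hyp_coeff a b c n * x ^ n)"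
      by simp
    then have "norm (hyp_coeff a b c (Suc n) * x ^ Suc n) = norm (?q n) * norm (hyp_coeff a b c n * x ^ n)"
      by (simp only: norm_mult)
    also have "\<dots> \<le> (norm x + 1) / 2 * norm (hyp_coeff a b c n * x ^ n)"
      using N[OF n] by (intro mult_right_mono) auto
    finally show "norm (norm (hyp_coeff a b c (Suc n) * x ^ Suc n)) \<le> (norm x + 1) / 2 * norm (norm (hyp_coeff a b c n * x ^ n))"
      by simp
  qed (use assms in auto)
qed

text \<open>The operator z d/dz multiplies the n-th coefficient by n without shifting indices, which
  keeps the comparison of coefficients in \<open>hyp_series_ode\<close> simple.\<close>

lemma power_series_theta:
  fixes c :: "nat \<Rightarrow> complex"
  assumes "\<And>z. norm z < 1 \<Longrightarrow> (\<lambda>n. c n * z ^ n) sums f z"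
  shows "f holomorphic_on ball 0 1"
    and "norm z < 1 \<Longrightarrow> (\<lambda>n. of_nat n * c n * z ^ n) sums (z * deriv f z)"
proof -
  show holo: "f holomorphic_on ball 0 1"
    using assms by (intro power_series_holomorphic[of 0 1 c]) auto
  assume z: "norm z < 1"
  have "(f has_field_derivative deriv f z) (at z)"
    using holo z by (intro holomorphic_derivI[of _ "ball 0 1"]) auto
  then have "(\<lambda>n. diffs c n * z ^ n) sums deriv f z"
    by (intro termdiffs_sums_strong[OF assms _ z]) auto
  then have "(\<lambda>n. z * (diffs c n * z ^ n)) sums (z * deriv f z)"
    by (rule sums_mult)
  then have "(\<lambda>n. of_nat (Suc n) * c (Suc n) * z ^ (Suc n)) sums (z * deriv f z)"
    by (simp add: diffs_def mult_ac)
  then show "(\<lambda>n. of_nat n * c n * z ^ n) sums (z * deriv f z)"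
    by (subst (asm) sums_Suc_iff) simp
qed

definition hyp_series :: "complex \<Rightarrow> complex \<Rightarrow> complex \<Rightarrow> complex \<Rightarrow> complex" where
  "hyp_series a b c x = (\<Sum>n. hyp_coeff a b c n * x ^ n)"

lemma hyp_series_sums: "norm x < 1 \<Longrightarrow> (\<lambda>n. hyp_coeff a b c n * x ^ n) sums hyp_series a b c x"
  unfolding hyp_series_def by (intro summable_sums summable_norm_cancel[OF summable_hyp])

lemma hyp_series_holomorphic: "hyp_series a b c holomorphic_on ball 0 1"
  using hyp_series_sums by (rule power_series_theta(1))

text \<open>With \<theta> = x d/dx the equation reads \<theta> (\<theta> + c - 1) f = x (\<theta> +
  a) (\<theta> + b) f, which is the recurrence \<open>hyp_coeff_Suc\<close> term by term. This is x
  times the usual form, hence the division by x at the end.\<close>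

lemma hyp_series_ode:
  fixes a b c :: complex
  assumes x: "norm x < 1" "x \<noteq> 0"
  defines "f \<equiv> hyp_series a b c"
  shows "x * (1 - x) * deriv (deriv f) x + (c - (a + b + 1) * x) * deriv f x - a * b * f x = 0"
proof -
  define t where "t = hyp_coeff a b c"
  have s0: "(\<lambda>n. t n * z ^ n) sums f z" if "norm z < 1" for z
    unfolding t_def f_def using that by (rule hyp_series_sums)
  have s1: "(\<lambda>n. of_nat n * t n * z ^ n) sums (z * deriv f z)" if "norm z < 1" for z
    using power_series_theta(2)[OF s0 that] .
  have s2: "(\<lambda>n. of_nat n * (of_nat n * t n) * x ^ n) sums (x * deriv (\<lambda>z. z * deriv f z) x)"
    using power_series_theta(2)[OF s1 x(1)] .
  have "f holomorphic_on ball 0 1"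
    unfolding f_def by (rule hyp_series_holomorphic)
  then have "deriv f holomorphic_on ball 0 1"
    by (intro holomorphic_deriv) auto
  then have "(deriv f has_field_derivative deriv (deriv f) x) (at x)"
    using x by (intro holomorphic_derivI[of _ "ball 0 1"]) auto
  then have "deriv (\<lambda>z. z * deriv f z) x = deriv f x + x * deriv (deriv f) x"
    by (intro DERIV_imp_deriv) (auto intro!: derivative_eq_intros)
  note s2 = s2[unfolded this]
  have L: "(\<lambda>n. of_nat n * (of_nat n * t n) * x ^ n + (c - 1) * (of_nat n * t n * x ^ n)) sums
      (x * (deriv f x + x * deriv (deriv f) x) + (c - 1) * (x * deriv f x))"
    by (intro sums_add sums_mult s2 s1 x)
  have "(\<lambda>n. x * (of_nat n * (of_nat n * t n) * x ^ n + (a + b) * (of_nat n * t n * x ^ n) + a * b * (t n * x ^ n))) sums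
      (x * (x * (deriv f x + x * deriv (deriv f) x) + (a + b) * (x * deriv f x) + a * b * f x))"
    by (intro sums_add sums_mult s2 s1 s0 x)
  moreover have "x * (of_nat n * (of_nat n * t n) * x ^ n + (a + b) * (of_nat n * t n * x ^ n) + a * b * (t n * x ^ n)) =
      of_nat (Suc n) * (of_nat (Suc n) * t (Suc n)) * x ^ Suc n + (c - 1) * (of_nat (Suc n) * t (Suc n) * x ^ Suc n)" for n
  proof -
    have "x * (of_nat n * (of_nat n * t n) * x ^ n + (a + b) * (of_nat n * t n * x ^ n) + a * b * (t n * x ^ n)) =
       ((a + of_nat n) * (b + of_nat n) * t n) * x ^ Suc n"
      by (simp add: algebra_simps)
    also have "\<dots> = ((c + of_nat n) * of_nat (Suc n) * t (Suc n)) * x ^ Suc n"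
      by (simp only: hyp_coeff_Suc t_def)
    finally show ?thesis by (simp add: algebra_simps)
  qed
  ultimately have "(\<lambda>n. of_nat (Suc n) * (of_nat (Suc n) * t (Suc n)) * x ^ Suc n + (c - 1) * (of_nat (Suc n) * t (Suc n) * x ^ Suc n)) sums
      (x * (x * (deriv f x + x * deriv (deriv f) x) + (a + b) * (x * deriv f x) + a * b * f x))"
    by simp
  then have "(\<lambda>n. of_nat n * (of_nat n * t n) * x ^ n + (c - 1) * (of_nat n * t n * x ^ n)) sums
      (x * (x * (deriv f x + x * deriv (deriv f) x) + (a + b) * (x * deriv f x) + a * b * f x))"
    by (subst (asm) sums_Suc_iff) simp
  from sums_unique2[OF L this] have "x * (x * (1 - x) * deriv (deriv f) x + (c - (a + b + 1) * x) * deriv f x - a * b * f x) = 0"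
    by (simp add: algebra_simps)
  then show ?thesis using x by simp
qed

text \<open>The continuation is glued from two pieces: the series on the disc, and a solution of the
  differential equation on the plane cut along [0, infinity), which avoids both singular points 0
  and 1.\<close>

lemma hyp_cut_plane_eq: "hyp_cut_plane = ball 0 1 \<union> - (of_real ` {0::real..})"
proof -
  have "z \<in> ball 0 1 \<longleftrightarrow> x < 1" if "z = of_real x" "0 \<le> x" for z :: complex and x :: real
    using that by simp
  moreover have "x < 1 \<Longrightarrow> x \<notin> {1..}" for x :: real by simp
  ultimately show ?thesis
    unfolding hyp_cut_plane_def by (auto simp: image_iff)
qed

lemma open_neg_cut: "open (- (of_real ` {r::real..}) :: complex set)"
proof -
  have "(of_real ` {r..} :: complex set) = \<real> \<inter> {z. Re z \<ge> r}"
    by (auto simp: Reals_def)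
  then show ?thesis
    by (simp add: closed_Int closed_complex_Reals closed_halfspace_Re_ge open_closed)
qed

lemma open_hyp_cut_plane: "open hyp_cut_plane"
  unfolding hyp_cut_plane_def by (rule open_neg_cut)

lemma starlike_neg_cut:
  fixes z :: complex
  assumes "s < r" "z \<in> - (of_real ` {r::real..})"
  shows "closed_segment (of_real s) z \<subseteq> - (of_real ` {r..})"
proof
  fix y assume "y \<in> closed_segment (of_real s) z"
  then obtain u where u: "0 \<le> u" "u \<le> 1" "y = (1 - u) *\<^sub>R of_real s + u *\<^sub>R z"
    by (auto simp: closed_segment_def)
  show "y \<in> - (of_real ` {r..})"
  proof
    assume "y \<in> of_real ` {r..}"
    then obtain x where x: "y = of_real x" "x \<ge> r" by auto
    have im: "u * Im z = 0" and re: "(1 - u) * s + u * Re z = x"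
      using u(3) x(1) by (auto simp: complex_eq_iff)
    show False
    proof (cases "u = 0")
      case True
      then show False using re x(2) assms(1) by simp
    next
      case False
      then have "z = of_real (Re z)" using im by (simp add: complex_eq_iff)
      then have "Re z < r" using assms(2)
        by (metis ComplD atLeast_iff image_eqI not_le)
      then have "u * Re z < u * r" "(1 - u) * s \<le> (1 - u) * r"
        using False u assms(1) by (auto intro: mult_left_mono)
      then have "(1 - u) * s + u * Re z < r" by (simp add: algebra_simps)
      then show False using re x(2) by simp
    qed
  qed
qed

lemma connected_hyp_cut_plane: "connected hyp_cut_plane"
proof (rule starlike_imp_connected)
  have "of_real 0 \<in> hyp_cut_plane"
    by (simp add: hyp_cut_plane_def image_iff)
  then show "starlike hyp_cut_plane"
    unfolding starlike_def using starlike_neg_cut[of 0 1]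
    by (intro bexI[of _ "of_real 0"]) (auto simp: hyp_cut_plane_def)
qed

lemma hyp_continuation_exists:
  "\<exists>f. f holomorphic_on hyp_cut_plane \<and> (\<forall>x\<in>ball 0 1. f x = hyp_series a b c x)"
proof -
  define S where "S = - (of_real ` {0::real..} :: complex set)"
  \<comment> \<open>A point common to both pieces; the solution takes its initial values from the
    series there. The overlap is starlike about \<open>z0\<close>, hence connected, and uniqueness
    identifies the two pieces on it.\<close>
  define z0 where "z0 = (of_real (- 1 / 2) :: complex)"
  have S: "open S" "z0 \<in> S" "\<And>z. z \<in> S \<Longrightarrow> closed_segment z0 z \<subseteq> S"
  proof -
    show "open S" by (simp only: S_def open_neg_cut)
    show "z0 \<in> S" by (simp only: S_def z0_def Compl_iff image_iff of_real_eq_iff) auto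
    show "closed_segment z0 z \<subseteq> S" if "z \<in> S" for z
      using that unfolding S_def z0_def by (intro starlike_neg_cut) auto
  qed
  have z0: "z0 \<in> ball 0 1" by (simp add: z0_def)
  have nz: "z \<noteq> 0" "1 - z \<noteq> 0" if "z \<in> S" for z
    using that unfolding S_def by (auto simp: image_iff dest: spec[of _ 0] spec[of _ 1])
  define p where "p = (\<lambda>x. - (c - (a + b + 1) * x) / (x * (1 - x)))"
  define q where "q = (\<lambda>x. a * b / (x * (1 - x)))"
  have pq: "p holomorphic_on S" "q holomorphic_on S"
    unfolding p_def q_def using nz by (auto intro!: holomorphic_intros)
  define f where "f = hyp_series a b c"
  obtain y where y: "y z0 = f z0" "deriv y z0 = deriv f z0" "y holomorphic_on S"
      "\<forall>z\<in>S. deriv (deriv y) z = p z * deriv y z + q z * y z"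
    using linear_ode_solution[OF S pq, of "f z0" "deriv f z0"] by metis
  define T where "T = ball 0 1 \<inter> S"
  have T: "open T" "z0 \<in> T"
    using S z0 by (auto simp: T_def)
  have seg: "closed_segment z0 z \<subseteq> T" if "z \<in> T" for z
    using that S(3) closed_segment_subset[of z0 "ball 0 1" z] T(2) by (auto simp: T_def)
  have "connected T"
    using T(2) seg by (intro starlike_imp_connected) (auto simp: starlike_def)
  have fT: "f holomorphic_on T" and yT: "y holomorphic_on T" and pqT: "p holomorphic_on T" "q holomorphic_on T"
    using hyp_series_holomorphic y(3) pq unfolding f_def T_def by (auto intro: holomorphic_on_subset)
  have d1: "deriv (\<lambda>z. f z - y z) z = deriv f z - deriv y z" if "z \<in> T" for z
    by (intro deriv_diff) (use fT yT T(1) that in \<open>auto simp: holomorphic_on_imp_differentiable_at\<close>)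
  have eq: "f z - y z = 0" if "z \<in> T" for z
  proof (rule linear_ode_unique[OF T(1) \<open>connected T\<close> T(2) pqT _ _ _ _ that])
    show "(\<lambda>z. f z - y z) holomorphic_on T"
      using fT yT by (rule holomorphic_on_diff)
    show "f z0 - y z0 = 0" "deriv (\<lambda>z. f z - y z) z0 = 0"
      using y d1 T(2) by auto
    fix z assume z: "z \<in> T"
    have "deriv (deriv (\<lambda>z. f z - y z)) z = deriv (\<lambda>z. deriv f z - deriv y z) z"
      by (intro deriv_cong_ev) (use d1 T(1) z in \<open>auto simp: eventually_nhds\<close>)
    also have "\<dots> = deriv (deriv f) z - deriv (deriv y) z"
      by (intro deriv_diff) (use holomorphic_on_imp_differentiable_at[OF holomorphic_deriv[OF fT T(1)] T(1) z]
           holomorphic_on_imp_differentiable_at[OF holomorphic_deriv[OF yT T(1)] T(1) z] in auto)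
    also have "deriv (deriv y) z = p z * deriv y z + q z * y z"
      using y z by (auto simp: T_def)
    also have "deriv (deriv f) z = p z * deriv f z + q z * f z"
    proof -
      have e: "z * (1 - z) * deriv (deriv f) z = a * b * f z - (c - (a + b + 1) * z) * deriv f z"
        using hyp_series_ode[of z a b c] nz[of z] z unfolding f_def T_def by (auto simp: algebra_simps)
      have "z * (1 - z) \<noteq> 0"
        using nz[of z] z by (simp add: T_def)
      then have "deriv (deriv f) z = z * (1 - z) * deriv (deriv f) z / (z * (1 - z))"
        by (simp only: nonzero_mult_div_cancel_left not_False_eq_True)
      also have "\<dots> = (a * b * f z - (c - (a + b + 1) * z) * deriv f z) / (z * (1 - z))"
        by (simp only: e)
      also have "\<dots> = p z * deriv f z + q z * f z"
      proof -
        have alg: "(P * F - A * B) / D = - A / D * B + P / D * F" for P F A B D :: complex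
          by (simp add: diff_divide_distrib)
        show ?thesis unfolding p_def q_def by (rule alg)
      qed
      finally show ?thesis .
    qed
    finally show "deriv (deriv (\<lambda>z. f z - y z)) z = p z * deriv (\<lambda>z. f z - y z) z + q z * (f z - y z)"
      unfolding d1[OF z] by (simp add: algebra_simps)
  qed
  define F where "F = (\<lambda>z. if z \<in> ball 0 1 then f z else y z)"
  have "F holomorphic_on ball 0 1"
    using hyp_series_holomorphic[of a b c] unfolding f_def[symmetric]
    by (rule holomorphic_transform) (simp add: F_def)
  moreover have "F holomorphic_on S"
    using y(3) by (rule holomorphic_transform) (use eq in \<open>auto simp: F_def T_def\<close>)
  ultimately have "F holomorphic_on hyp_cut_plane"
    unfolding hyp_cut_plane_eq S_def[symmetric] using S(1) by (intro holomorphic_on_Un) auto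
  moreover have "\<forall>x\<in>ball 0 1. F x = hyp_series a b c x"
    by (simp add: F_def f_def)
  ultimately show ?thesis by blast
qed

lemma hyp2F1_reg_spec:
  "hyp2F1_reg a b c holomorphic_on hyp_cut_plane \<and>
   (\<forall>x\<in>ball 0 1. (\<lambda>n. hyp_coeff a b c n * x ^ n) sums hyp2F1_reg a b c x)"
proof -
  have ex: "\<exists>f. f holomorphic_on hyp_cut_plane \<and> (\<forall>x\<in>ball 0 1.
        (\<lambda>n. pochhammer a n * pochhammer b n * rGamma (c + of_nat n) / fact n * x ^ n) sums f x)"
    using hyp_continuation_exists[of a b c] hyp_series_sums[of _ a b c]
    by (auto simp: hyp_coeff_def)
  show ?thesis
    unfolding hyp2F1_reg_def hyp_coeff_def by (rule someI_ex[OF ex])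
qed

lemma hyp2F1_reg_holomorphic: "hyp2F1_reg a b c holomorphic_on hyp_cut_plane"
  using hyp2F1_reg_spec by blast

lemma hyp2F1_reg_series: "norm x < 1 \<Longrightarrow> hyp2F1_reg a b c x = hyp_series a b c x"
  using hyp2F1_reg_spec[of a b c] hyp_series_sums[of x a b c] sums_unique2 by (metis mem_ball_0)

lemma hyp2F1_reg_0: "hyp2F1_reg a b c 0 = rGamma c"
  using sums_unique2[OF hyp_series_sums[of 0 a b c] powser_sums_zero]
  by (simp add: hyp2F1_reg_series hyp_coeff_def)

text \<open>The equation is known on the punctured disc from the series; the puncture is a limit
  point, so the identity theorem extends it to 0 and to the whole cut plane.\<close>

lemma hyp2F1_reg_ode:
  fixes a b c :: complex
  assumes "x \<in> hyp_cut_plane"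
  defines "f \<equiv> hyp2F1_reg a b c"
  shows "x * (1 - x) * deriv (deriv f) x + (c - (a + b + 1) * x) * deriv f x - a * b * f x = 0"
proof (rule analytic_continuation[of _ hyp_cut_plane "ball 0 1 - {0}" 0 x])
  have f: "f holomorphic_on hyp_cut_plane"
    unfolding f_def by (rule hyp2F1_reg_holomorphic)
  show "(\<lambda>x. x * (1 - x) * deriv (deriv f) x + (c - (a + b + 1) * x) * deriv f x - a * b * f x) holomorphic_on hyp_cut_plane"
    using f open_hyp_cut_plane by (intro holomorphic_intros) auto
  show "ball 0 1 - {0} \<subseteq> hyp_cut_plane" "0 \<in> hyp_cut_plane"
    by (auto simp: hyp_cut_plane_eq)
  show "0 islimpt ball (0::complex) 1 - {0}"
    using islimpt_insert[of "0::complex" 0 "ball 0 1 - {0}"]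
    by (simp add: insert_absorb islimpt_ball)
  fix z :: complex assume z: "z \<in> ball 0 1 - {0}"
  have fz: "f z = hyp_series a b c z" and d1: "deriv f z = deriv (hyp_series a b c) z" if "z \<in> ball 0 1" for z
  proof -
    show "f z = hyp_series a b c z"
      using that by (simp add: f_def hyp2F1_reg_series)
    show "deriv f z = deriv (hyp_series a b c) z"
      by (intro deriv_cong_ev)
        (use that in \<open>auto simp: eventually_nhds f_def hyp2F1_reg_series intro!: exI[of _ "ball 0 1"]\<close>)
  qed
  have "deriv (deriv f) z = deriv (deriv (hyp_series a b c)) z"
    by (intro deriv_cong_ev) (use z d1 in \<open>auto simp: eventually_nhds intro!: exI[of _ "ball 0 1"]\<close>)
  then show "z * (1 - z) * deriv (deriv f) z + (c - (a + b + 1) * z) * deriv f z - a * b * f z = 0"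
    using hyp_series_ode[of z a b c] z fz[of z] d1[of z] by simp
qed (use assms open_hyp_cut_plane connected_hyp_cut_plane in auto)



section \<open>The Schroedinger form of the equation\<close>

text \<open>The generalised Poeschl-Teller potential.\<close>

definition pot :: "complex \<Rightarrow> complex \<Rightarrow> complex \<Rightarrow> complex" where
  "pot \<alpha> \<beta> z = (\<alpha>\<^sup>2 - 1/4) / sinh z ^ 2 - (\<beta>\<^sup>2 - 1/4) / cosh z ^ 2"

definition schroedinger_on :: "complex \<Rightarrow> complex \<Rightarrow> complex \<Rightarrow> complex set \<Rightarrow> (complex \<Rightarrow> complex) \<Rightarrow> bool" where
  "schroedinger_on w \<alpha> \<beta> S u \<longleftrightarrow>
     u holomorphic_on S \<and> (\<forall>z\<in>S. deriv (deriv u) z = (w\<^sup>2 + pot \<alpha> \<beta> z) * u z)"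

lemma schroedinger_onD:
  assumes "schroedinger_on w \<alpha> \<beta> S u" "open S" "z \<in> S"
  shows "(u has_field_derivative deriv u z) (at z)"
    and "(deriv u has_field_derivative (w\<^sup>2 + pot \<alpha> \<beta> z) * u z) (at z)"
  using assms holomorphic_derivI[of u S z] holomorphic_derivI[OF holomorphic_deriv[of u S], of z]
  unfolding schroedinger_on_def by metis+

lemma schroedinger_onI:
  assumes "open S" "\<And>z. z \<in> S \<Longrightarrow> (u has_field_derivative v z) (at z)"
    and "\<And>z. z \<in> S \<Longrightarrow> (v has_field_derivative (w\<^sup>2 + pot \<alpha> \<beta> z) * u z) (at z)"
  shows "schroedinger_on w \<alpha> \<beta> S u" and "\<And>z. z \<in> S \<Longrightarrow> deriv u z = v z"
proof -
  show d: "deriv u z = v z" if "z \<in> S" for z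
    using assms(2)[OF that] by (rule DERIV_imp_deriv)
  have "deriv (deriv u) z = deriv v z" if "z \<in> S" for z
    by (intro deriv_cong_ev) (use assms(1) that d in \<open>auto simp: eventually_nhds\<close>)
  moreover have "deriv v z = (w\<^sup>2 + pot \<alpha> \<beta> z) * u z" if "z \<in> S" for z
    using assms(3)[OF that] by (rule DERIV_imp_deriv)
  moreover have "u holomorphic_on S"
    using assms(2) by (meson holomorphic_onI has_field_derivative_at_within field_differentiable_def)
  ultimately show "schroedinger_on w \<alpha> \<beta> S u"
    by (simp add: schroedinger_on_def)
qed

lemma schroedinger_on_subset:
  "schroedinger_on w \<alpha> \<beta> S u \<Longrightarrow> T \<subseteq> S \<Longrightarrow> schroedinger_on w \<alpha> \<beta> T u"
  unfolding schroedinger_on_def by (auto intro: holomorphic_on_subset)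

lemma schroedinger_on_cong:
  assumes "schroedinger_on w \<alpha> \<beta> S u" "open S" "\<And>z. z \<in> S \<Longrightarrow> u z = v z"
  shows "schroedinger_on w \<alpha> \<beta> S v"
proof (rule schroedinger_onI(1)[OF assms(2)])
  fix z assume z: "z \<in> S"
  show "(v has_field_derivative deriv u z) (at z)"
    using has_field_derivative_transform_within_open[OF schroedinger_onD(1)[OF assms(1,2) z] assms(2) z assms(3)] .
  show "(deriv u has_field_derivative (w\<^sup>2 + pot \<alpha> \<beta> z) * v z) (at z)"
    using schroedinger_onD(2)[OF assms(1,2) z] assms(3)[OF z] by simp
qed

lemma schroedinger_on_wronskian:
  assumes "schroedinger_on w \<alpha> \<beta> S u" "schroedinger_on w \<alpha> \<beta> S v" "open S" "connected S"
  shows "\<exists>c. \<forall>z\<in>S. u z * deriv v z - deriv u z * v z = c"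
  using assms unfolding schroedinger_on_def
  by (intro wronskian_constant[where Q = "\<lambda>z. w\<^sup>2 + pot \<alpha> \<beta> z"]) auto

lemma Re_Im_sinh_cosh:
  "Re (sinh z) = sinh (Re z) * cos (Im z)" "Im (sinh z) = cosh (Re z) * sin (Im z)"
  "Re (cosh z) = cosh (Re z) * cos (Im z)" "Im (cosh z) = sinh (Re z) * sin (Im z)"
  by (simp_all add: sinh_field_def cosh_field_def Re_exp Im_exp field_simps)

lemma cosh_sq_complex: "cosh z ^ 2 = 1 + sinh z ^ 2" for z :: complex
  using cosh_square_eq[of z] by simp

lemma DERIV_coth: "sinh z \<noteq> 0 \<Longrightarrow> ((\<lambda>z. cosh z / sinh z) has_field_derivative - (1 / sinh z ^ 2)) (at z)"
  for z :: complex
  by (auto intro!: derivative_eq_intros simp: power2_eq_square[symmetric] cosh_sq_complex field_simps)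

lemma DERIV_sinh_over_cosh: "cosh z \<noteq> 0 \<Longrightarrow> ((\<lambda>z. sinh z / cosh z) has_field_derivative (1 / cosh z ^ 2)) (at z)"
  for z :: complex
  by (auto intro!: derivative_eq_intros simp: power2_eq_square[symmetric] cosh_sq_complex field_simps)

text \<open>A product G f(X) with f hypergeometric solves the normal form for three reasons: the
  first condition lets the hypergeometric equation replace f'', the second cancels the terms in f',
  and the third turns the terms in f into the potential. It is applied with X = -1/sinh^2 for the
  second kind and X = -sinh^2 for the first kind.\<close>

lemma liouville_transform:
  fixes A B a b c w \<alpha> \<beta> :: complex
  defines "L \<equiv> \<lambda>z. A * (cosh z / sinh z) + B * (sinh z / cosh z)"
  assumes S: "open S" "\<And>z. z \<in> S \<Longrightarrow> sinh z \<noteq> 0" "\<And>z. z \<in> S \<Longrightarrow> cosh z \<noteq> 0"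
    and X: "\<And>z. z \<in> S \<Longrightarrow> X z \<in> hyp_cut_plane"
    and dX: "\<And>z. z \<in> S \<Longrightarrow> (X has_field_derivative Xd z) (at z)"
      "\<And>z. z \<in> S \<Longrightarrow> (Xd has_field_derivative Xdd z) (at z)"
    and dG: "\<And>z. z \<in> S \<Longrightarrow> (G has_field_derivative L z * G z) (at z)"
    and eq: "\<And>z. z \<in> S \<Longrightarrow> Xd z ^ 2 = - 4 * k z * (X z * (1 - X z))"
      "\<And>z. z \<in> S \<Longrightarrow> 2 * L z * Xd z + Xdd z + 4 * k z * (c - (a + b + 1) * X z) = 0"
      "\<And>z. z \<in> S \<Longrightarrow> (A + B)\<^sup>2 + (A\<^sup>2 - A) / sinh z ^ 2 - (B\<^sup>2 - B) / cosh z ^ 2 - 4 * a * b * k z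
          = w\<^sup>2 + pot \<alpha> \<beta> z"
  shows "schroedinger_on w \<alpha> \<beta> S (\<lambda>z. G z * hyp2F1_reg a b c (X z))"
proof (rule schroedinger_onI(1)[OF S(1)])
  define f where "f = hyp2F1_reg a b c"
  fix z assume z: "z \<in> S"
  have f1: "(f has_field_derivative deriv f (X z)) (at (X z))"
    unfolding f_def by (rule holomorphic_derivI[OF hyp2F1_reg_holomorphic open_hyp_cut_plane X[OF z]])
  have f2: "(deriv f has_field_derivative deriv (deriv f) (X z)) (at (X z))"
    unfolding f_def
    by (rule holomorphic_derivI[OF holomorphic_deriv[OF hyp2F1_reg_holomorphic open_hyp_cut_plane] open_hyp_cut_plane X[OF z]])
  note c1 = DERIV_chain2[OF f1 dX(1)[OF z]] and c2 = DERIV_chain2[OF f2 dX(1)[OF z]]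
  have "((\<lambda>z. G z * f (X z)) has_field_derivative G z * (L z * f (X z) + Xd z * deriv f (X z))) (at z)"
    using DERIV_mult[OF dG[OF z] c1] by (simp add: algebra_simps)
  then show "((\<lambda>z. G z * hyp2F1_reg a b c (X z)) has_field_derivative
      G z * (L z * f (X z) + Xd z * deriv f (X z))) (at z)" by (simp add: f_def)
  define L1 where "L1 = A * (- (1 / sinh z ^ 2)) + B * (1 / cosh z ^ 2)"
  have dL: "(L has_field_derivative L1) (at z)"
    unfolding L_def L1_def by (intro DERIV_add DERIV_cmult DERIV_coth DERIV_sinh_over_cosh S z)
  have D: "((\<lambda>z. G z * (L z * f (X z) + Xd z * deriv f (X z))) has_field_derivative
      G z * ((L z ^ 2 + L1) * f (X z) + (2 * L z * Xd z + Xdd z) * deriv f (X z) + Xd z ^ 2 * deriv (deriv f) (X z))) (at z)"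
    using DERIV_mult[OF dG[OF z] DERIV_add[OF DERIV_mult[OF dL c1] DERIV_mult[OF dX(2)[OF z] c2]]]
    by (simp add: algebra_simps power2_eq_square)
  have e1: "Xd z ^ 2 * deriv (deriv f) (X z) =
      - 4 * k z * (a * b * f (X z) - (c - (a + b + 1) * X z) * deriv f (X z))"
  proof -
    have "X z * (1 - X z) * deriv (deriv f) (X z) = a * b * f (X z) - (c - (a + b + 1) * X z) * deriv f (X z)"
      using hyp2F1_reg_ode[OF X[OF z], of a b c] unfolding f_def by (simp add: algebra_simps)
    then show ?thesis
      unfolding eq(1)[OF z] by (simp only: mult.assoc)
  qed
  have e2: "L z ^ 2 + L1 = (A + B)\<^sup>2 + (A\<^sup>2 - A) / sinh z ^ 2 - (B\<^sup>2 - B) / cosh z ^ 2"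
  proof -
    define T where "T = cosh z / sinh z"
    define U where "U = sinh z / cosh z"
    have "T ^ 2 = 1 + 1 / sinh z ^ 2" "T * U = 1"
      using S(2,3)[OF z] cosh_sq_complex[of z] by (auto simp: T_def U_def field_simps)
    moreover have "U ^ 2 = (cosh z ^ 2 - 1) / cosh z ^ 2"
      by (simp add: U_def power_divide cosh_sq_complex)
    then have "U ^ 2 = 1 - 1 / cosh z ^ 2"
      using S(3)[OF z] by (simp add: diff_divide_distrib)
    moreover have "L z ^ 2 + L1 = A\<^sup>2 * T ^ 2 + B\<^sup>2 * U ^ 2 + 2 * A * B * (T * U) - A * (1 / sinh z ^ 2) + B * (1 / cosh z ^ 2)"
    proof -
      have "L z = A * T + B * U" by (simp add: L_def T_def U_def)
      then show ?thesis by (simp add: L1_def power2_eq_square algebra_simps)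
    qed
    ultimately have "L z ^ 2 + L1 = A\<^sup>2 * (1 + 1 / sinh z ^ 2) + B\<^sup>2 * (1 - 1 / cosh z ^ 2) + 2 * A * B * 1
        - A * (1 / sinh z ^ 2) + B * (1 / cosh z ^ 2)"
      by (simp only:)
    also have "\<dots> = (A + B)\<^sup>2 + (A\<^sup>2 - A) / sinh z ^ 2 - (B\<^sup>2 - B) / cosh z ^ 2"
      by (simp add: power2_sum divide_inverse algebra_simps)
    finally show ?thesis .
  qed
  have "((\<lambda>z. G z * (L z * f (X z) + Xd z * deriv f (X z))) has_field_derivative
      G z * (((A + B)\<^sup>2 + (A\<^sup>2 - A) / sinh z ^ 2 - (B\<^sup>2 - B) / cosh z ^ 2 - 4 * a * b * k z) * f (X z) +
      (2 * L z * Xd z + Xdd z + 4 * k z * (c - (a + b + 1) * X z)) * deriv f (X z))) (at z)"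
    by (rule DERIV_cong[OF D]) (simp only: e1 e2, simp add: algebra_simps)
  then show "((\<lambda>z. G z * (L z * f (X z) + Xd z * deriv f (X z))) has_field_derivative
      (w\<^sup>2 + pot \<alpha> \<beta> z) * (G z * hyp2F1_reg a b c (X z))) (at z)"
    unfolding eq(2,3)[OF z] by (simp add: f_def mult_ac)
qed

text \<open>On the cut y^2 would be real and non-positive, which forces y to be purely imaginary.
  The lemma serves y = cosh z / sinh z and y = cosh z.\<close>

lemma one_minus_square_in_cut_plane:
  assumes "Re y > 0"
  shows "1 - y\<^sup>2 \<in> hyp_cut_plane"
proof -
  have False if "1 - y\<^sup>2 = of_real x" "x \<ge> 1" for x
  proof -
    have "y\<^sup>2 = of_real (1 - x)" using that(1) by (simp add: algebra_simps)
    then have "Im y = 0" "Re y ^ 2 - Im y ^ 2 = 1 - x"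
      using assms by (auto simp: complex_eq_iff power2_eq_square)
    moreover have "Re y ^ 2 > 0" using assms by simp
    ultimately show False using that(2) by simp
  qed
  then show ?thesis unfolding hyp_cut_plane_def by auto
qed

section \<open>The solution recessive at +infinity\<close>

definition right_half :: "complex set" where "right_half = {z. Re z > 0}"

lemma right_half: "open right_half" "connected right_half" "z \<in> right_half \<longleftrightarrow> Re z > 0"
  unfolding right_half_def by (auto simp: open_halfspace_Re_gt convex_connected convex_halfspace_Re_gt)

lemma sinh_cosh_nz:
  assumes "Re z \<noteq> 0"
  shows "sinh z \<noteq> (0::complex)" "cosh z \<noteq> (0::complex)"
proof -
  have "norm (exp z) \<noteq> norm (exp (- z))" using assms by simp
  then have "exp z \<noteq> exp (- z)" "exp z \<noteq> - exp (- z)" by (metis norm_minus_cancel)+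
  then show "sinh z \<noteq> 0" "cosh z \<noteq> 0"
    by (auto simp: sinh_field_def cosh_field_def add_eq_0_iff2)
qed

text \<open>The solution recessive at \<open>+\<infinity>\<close> is \<open>e\<^sup>-\<^sup>w\<^sup>\<xi>\<close> times this function of \<open>t = e\<^sup>-\<^sup>2\<^sup>\<xi>\<close>.\<close>

definition recessive_phi :: "complex \<Rightarrow> complex \<Rightarrow> complex \<Rightarrow> complex \<Rightarrow> complex" where
  "recessive_phi \<nu> \<alpha> \<beta> t = Gamma (2 * \<nu> + \<alpha> + \<beta> + 2) *
     (exp (- (2 * \<nu> + \<alpha> + 3/2) * Ln (1 - t)) * exp ((1/2 - \<beta>) * Ln (1 + t)) *
      hyp2F1_reg (\<nu> + 1) (\<nu> + \<alpha> + 1) (2 * \<nu> + \<alpha> + \<beta> + 2) (1 - ((1 + t) / (1 - t))\<^sup>2))"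

lemma Re_moebius_pos:
  assumes "norm t < 1"
  shows "Re ((1 + t) / (1 - t)) > 0" "Re (1 - t) > 0" "Re (1 + t) > 0" "1 - t \<noteq> 0"
proof -
  have t: "Re t < 1" "- 1 < Re t"
    using assms abs_Re_le_cmod[of t] by auto
  then show *: "Re (1 - t) > 0" "Re (1 + t) > 0" by auto
  then show "1 - t \<noteq> 0" by (metis less_irrefl zero_complex.simps(1))
  have "(norm t)\<^sup>2 < 1" using assms by (simp add: power_less_one_iff abs_square_less_1)
  then have "Re t ^ 2 + Im t ^ 2 < 1" by (simp add: cmod_power2)
  then have "Re ((1 + t) * cnj (1 - t)) > 0" by (simp add: algebra_simps power2_eq_square)
  moreover have "Re ((1 + t) / (1 - t)) = Re ((1 + t) * cnj (1 - t)) / (norm (1 - t))\<^sup>2"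
    by (subst complex_div_cnj) (simp add: Re_divide_of_real)
  ultimately show "Re ((1 + t) / (1 - t)) > 0"
    using \<open>1 - t \<noteq> 0\<close> by (simp only: zero_less_divide_iff zero_less_power2 norm_eq_zero) simp
qed

lemma not_nonpos_Re: "Re z > 0 \<Longrightarrow> z \<notin> \<real>\<^sub>\<le>\<^sub>0"
  by (auto simp: complex_nonpos_Reals_iff)

text \<open>The disc includes t = 0, the image of infinity. Holomorphy there is how recessive
  behaviour is expressed, without any asymptotic statement; \<open>recessive_unique\<close> relies
  on it.\<close>

lemma recessive_phi_holomorphic: "recessive_phi \<nu> \<alpha> \<beta> holomorphic_on ball 0 1"
proof -
  have "(hyp2F1_reg (\<nu> + 1) (\<nu> + \<alpha> + 1) (2 * \<nu> + \<alpha> + \<beta> + 2) \<circ> (\<lambda>t. 1 - ((1 + t) / (1 - t))\<^sup>2)) holomorphic_on ball 0 1"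
  proof (rule holomorphic_on_compose_gen[OF _ hyp2F1_reg_holomorphic])
    show "(\<lambda>t. 1 - ((1 + t) / (1 - t))\<^sup>2) holomorphic_on ball 0 1"
      using Re_moebius_pos(4) by (auto intro!: holomorphic_intros)
    show "(\<lambda>t. 1 - ((1 + t) / (1 - t))\<^sup>2) ` ball 0 1 \<subseteq> hyp_cut_plane"
      using one_minus_square_in_cut_plane[OF Re_moebius_pos(1)] by auto
  qed
  then show ?thesis
    unfolding recessive_phi_def[abs_def] o_def
    using not_nonpos_Re[OF Re_moebius_pos(2)] not_nonpos_Re[OF Re_moebius_pos(3)]
    by (auto intro!: holomorphic_intros)
qed

lemma recessive_phi_0:
  "2 * \<nu> + \<alpha> + \<beta> + 2 \<notin> \<int>\<^sub>\<le>\<^sub>0 \<Longrightarrow> recessive_phi \<nu> \<alpha> \<beta> 0 = 1"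
  by (simp add: recessive_phi_def hyp2F1_reg_0 rGamma_inverse_Gamma Gamma_eq_zero_iff)

lemma moebius_exp:
  assumes "Re z > 0"
  shows "norm (exp (- 2 * z)) < 1"
    and "(1 + exp (- 2 * z)) / (1 - exp (- 2 * z)) = cosh z / sinh z"
    and "2 * exp (- 2 * z) / (1 - exp (- 2 * z)) = cosh z / sinh z - 1"
    and "2 * exp (- 2 * z) / (1 + exp (- 2 * z)) = 1 - sinh z / cosh z"
proof -
  show n: "norm (exp (- 2 * z)) < 1" using assms by simp
  have nz: "1 - exp (- 2 * z) \<noteq> 0" "1 + exp (- 2 * z) \<noteq> 0"
  proof -
    have "exp (- 2 * z) \<noteq> 1" "exp (- 2 * z) \<noteq> - 1"
      by (metis n norm_one less_irrefl, metis n norm_minus_cancel norm_one less_irrefl)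
    then show "1 - exp (- 2 * z) \<noteq> 0" "1 + exp (- 2 * z) \<noteq> 0"
      by (metis right_minus_eq, metis add.commute eq_neg_iff_add_eq_0)
  qed
  define e where "e = exp z"
  have e: "e \<noteq> 0" "exp (- z) = 1 / e" "exp (- 2 * z) = 1 / e\<^sup>2"
    by (simp_all add: e_def exp_minus field_simps flip: exp_double)
  have nz': "e\<^sup>2 - 1 \<noteq> 0" "e\<^sup>2 + 1 \<noteq> 0"
    using nz e(1) unfolding e(3) by (auto simp: field_simps)
  have sc: "sinh z = (e\<^sup>2 - 1) / (2 * e)" "cosh z = (e\<^sup>2 + 1) / (2 * e)"
    using e(1) by (simp_all add: sinh_field_def cosh_field_def e(2) e_def[symmetric] field_simps power2_eq_square)
  have q: "1 - 1 / e\<^sup>2 = (e\<^sup>2 - 1) / e\<^sup>2" "1 + 1 / e\<^sup>2 = (e\<^sup>2 + 1) / e\<^sup>2"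
    using e(1) by (simp_all add: field_simps)
  show "(1 + exp (- 2 * z)) / (1 - exp (- 2 * z)) = cosh z / sinh z"
    unfolding e(3) sc q using nz' e(1) by simp
  show "2 * exp (- 2 * z) / (1 - exp (- 2 * z)) = cosh z / sinh z - 1"
    unfolding e(3) sc q using nz' e(1) by (simp add: divide_simps; simp add: algebra_simps)
  show "2 * exp (- 2 * z) / (1 + exp (- 2 * z)) = 1 - sinh z / cosh z"
    unfolding e(3) sc q using nz' e(1) by (simp add: divide_simps; simp add: algebra_simps)
qed

text \<open>\<open>liouville_transform\<close> with the hypergeometric argument of Q at cosh (2 z).
  The powers are written with logarithms of 1 - t and 1 + t, t = e^(-2 z), because these are
  principal on the whole right half-plane, where sinh z itself may cross the cut of
  \<open>Ln\<close>. The exponents satisfy A + B = -w, so the factor e^(-w z) splits off.\<close>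

lemma recessive_right_half:
  "schroedinger_on (2 * \<nu> + \<alpha> + \<beta> + 1) \<alpha> \<beta> right_half
     (\<lambda>z. exp (- (2 * \<nu> + \<alpha> + \<beta> + 1) * z) * recessive_phi \<nu> \<alpha> \<beta> (exp (- 2 * z)))"
proof -
  define w where "w = 2 * \<nu> + \<alpha> + \<beta> + 1"
  define A where "A = - (2 * \<nu> + \<alpha> + 3/2)"
  define B where "B = 1/2 - \<beta>"
  define G where "G = (\<lambda>z. Gamma (2 * \<nu> + \<alpha> + \<beta> + 2) * (exp (- w * z) *
     (exp (A * Ln (1 - exp (- 2 * z))) * exp (B * Ln (1 + exp (- 2 * z))))))"
  define X where "X = (\<lambda>z::complex. - (1 / sinh z ^ 2))"
  have Xeq: "X z = 1 - (cosh z / sinh z)\<^sup>2" if "Re z > 0" for z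
    using sinh_cosh_nz[of z] that cosh_sq_complex[of z] by (simp add: X_def field_simps)
  have "schroedinger_on w \<alpha> \<beta> right_half (\<lambda>z. G z * hyp2F1_reg (\<nu> + 1) (\<nu> + \<alpha> + 1) (2 * \<nu> + \<alpha> + \<beta> + 2) (X z))"
  proof (rule liouville_transform[where A = A and B = B and k = "\<lambda>z. 1 / sinh z ^ 2" and
        Xd = "\<lambda>z. 2 * (cosh z / sinh z) * (1 / sinh z ^ 2)" and
        Xdd = "\<lambda>z. - 2 * (1 / sinh z ^ 2)\<^sup>2 - 4 * (cosh z / sinh z)\<^sup>2 * (1 / sinh z ^ 2)"])
    fix z assume "z \<in> right_half"
    then have z: "Re z > 0" by (simp add: right_half)
    note nz = sinh_cosh_nz[of z]
    define T where "T = cosh z / sinh z"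
    define U where "U = sinh z / cosh z"
    define i where "i = 1 / sinh z ^ 2"
    have T2: "T\<^sup>2 = 1 + i" "T * U = 1"
      using nz z cosh_sq_complex[of z] by (auto simp: T_def U_def i_def field_simps)
    show "sinh z \<noteq> 0" "cosh z \<noteq> 0" using nz z by auto
    have "Re T > 0"
      unfolding T_def moebius_exp(2)[OF z, symmetric] by (rule Re_moebius_pos(1)[OF moebius_exp(1)[OF z]])
    then show "X z \<in> hyp_cut_plane"
      unfolding Xeq[OF z] T_def by (rule one_minus_square_in_cut_plane)
    have di: "((\<lambda>z. 1 / sinh z ^ 2) has_field_derivative - 2 * T * i) (at z)"
      using nz z by (auto intro!: derivative_eq_intros simp: T_def i_def field_simps power2_eq_square)
    show "(X has_field_derivative 2 * (cosh z / sinh z) * (1 / sinh z ^ 2)) (at z)"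
      unfolding X_def T_def[symmetric] i_def[symmetric] using DERIV_minus[OF di] by simp
    have dT: "((\<lambda>z. cosh z / sinh z) has_field_derivative - i) (at z)"
      unfolding i_def using nz z by (intro DERIV_coth) auto
    show "((\<lambda>z. 2 * (cosh z / sinh z) * (1 / sinh z ^ 2)) has_field_derivative
       - 2 * (1 / sinh z ^ 2)\<^sup>2 - 4 * (cosh z / sinh z)\<^sup>2 * (1 / sinh z ^ 2)) (at z)"
      using DERIV_mult[OF DERIV_cmult[OF dT, of 2] di]
      unfolding T_def[symmetric] i_def[symmetric]
      by (simp add: power2_eq_square algebra_simps)
    have "1 - exp (- 2 * z) \<notin> \<real>\<^sub>\<le>\<^sub>0" "1 + exp (- 2 * z) \<notin> \<real>\<^sub>\<le>\<^sub>0"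
      using Re_moebius_pos(2,3)[OF moebius_exp(1)[OF z]] by (auto intro!: not_nonpos_Re simp del: minus_complex.simps plus_complex.simps)
    then have "(G has_field_derivative (- w + A * (2 * exp (- 2 * z) / (1 - exp (- 2 * z))) - B * (2 * exp (- 2 * z) / (1 + exp (- 2 * z)))) * G z) (at z)"
      unfolding G_def by (auto intro!: derivative_eq_intros simp: divide_inverse algebra_simps)
    also have "- w + A * (2 * exp (- 2 * z) / (1 - exp (- 2 * z))) - B * (2 * exp (- 2 * z) / (1 + exp (- 2 * z))) = A * T + B * U"
      unfolding moebius_exp(3,4)[OF z] T_def[symmetric] U_def[symmetric] by (simp add: w_def A_def B_def field_simps)
    finally show "(G has_field_derivative (A * (cosh z / sinh z) + B * (sinh z / cosh z)) * G z) (at z)"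
      by (simp add: T_def U_def)
    have X: "X z = - i" by (simp add: X_def i_def)
    show "(2 * (cosh z / sinh z) * (1 / sinh z ^ 2))\<^sup>2 = - 4 * (1 / sinh z ^ 2) * (X z * (1 - X z))"
      unfolding T_def[symmetric] i_def[symmetric] X power_mult_distrib T2 by (simp add: power2_eq_square algebra_simps)
    have "2 * (A * T + B * U) * (2 * T * i) = 4 * A * i * T\<^sup>2 + 4 * B * i * (T * U)"
      by (simp add: power2_eq_square algebra_simps)
    then show "2 * (A * (cosh z / sinh z) + B * (sinh z / cosh z)) * (2 * (cosh z / sinh z) * (1 / sinh z ^ 2)) +
         (- 2 * (1 / sinh z ^ 2)\<^sup>2 - 4 * (cosh z / sinh z)\<^sup>2 * (1 / sinh z ^ 2)) +
         4 * (1 / sinh z ^ 2) * (2 * \<nu> + \<alpha> + \<beta> + 2 - (\<nu> + 1 + (\<nu> + \<alpha> + 1) + 1) * X z) = 0"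
      unfolding T_def[symmetric] U_def[symmetric] i_def[symmetric] X T2
      by (simp add: A_def B_def power2_eq_square algebra_simps)
    have "A\<^sup>2 - A - 4 * (\<nu> + 1) * (\<nu> + \<alpha> + 1) = \<alpha>\<^sup>2 - 1/4" "B\<^sup>2 - B = \<beta>\<^sup>2 - 1/4" "A + B = - w"
      by (simp_all add: A_def B_def w_def power2_eq_square field_simps)
    then show "(A + B)\<^sup>2 + (A\<^sup>2 - A) / sinh z ^ 2 - (B\<^sup>2 - B) / cosh z ^ 2 -
         4 * (\<nu> + 1) * (\<nu> + \<alpha> + 1) * (1 / sinh z ^ 2) = w\<^sup>2 + pot \<alpha> \<beta> z"
      unfolding pot_def by (simp add: diff_divide_distrib[symmetric])
  qed (rule right_half)
  then have "schroedinger_on w \<alpha> \<beta> right_half (\<lambda>z. G z * hyp2F1_reg (\<nu> + 1) (\<nu> + \<alpha> + 1) (2 * \<nu> + \<alpha> + \<beta> + 2) (X z))" .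
  moreover have "G z * hyp2F1_reg (\<nu> + 1) (\<nu> + \<alpha> + 1) (2 * \<nu> + \<alpha> + \<beta> + 2) (X z) =
      exp (- w * z) * recessive_phi \<nu> \<alpha> \<beta> (exp (- 2 * z))" if "z \<in> right_half" for z
  proof -
    have z: "Re z > 0" using that by (simp add: right_half)
    have alg: "(g * (e * x)) * h = e * (g * (x * h))" for g e x h :: complex
      by (simp add: mult_ac)
    show ?thesis
      unfolding recessive_phi_def moebius_exp(2)[OF z] Xeq[OF z] G_def A_def B_def by (rule alg)
  qed
  ultimately show ?thesis
    unfolding w_def by (rule schroedinger_on_cong[OF _ right_half(1)])
qed

text \<open>The branch \<open>l\<close> of log sinh is left open: the function is needed once with
  the principal branch on the half strip and once with a branch that continues through the imaginary
  segment to the left half-plane.\<close>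

lemma jacobi_schroedinger:
  assumes S: "open S" "\<And>z. z \<in> S \<Longrightarrow> sinh z \<noteq> 0" "\<And>z. z \<in> S \<Longrightarrow> Re (cosh z) > 0"
    and l: "\<And>z. z \<in> S \<Longrightarrow> (l has_field_derivative cosh z / sinh z) (at z)"
  shows "schroedinger_on (2 * \<nu> + \<alpha> + \<beta> + 1) \<alpha> \<beta> S
     (\<lambda>z. exp ((\<alpha> + 1/2) * l z) * exp ((\<beta> + 1/2) * Ln (cosh z)) *
       hyp2F1_reg (- \<nu>) (\<nu> + \<alpha> + \<beta> + 1) (\<alpha> + 1) (- (sinh z ^ 2)))"
proof (rule liouville_transform[where A = "\<alpha> + 1/2" and B = "\<beta> + 1/2" and k = "\<lambda>z. 1" and
        Xd = "\<lambda>z. - 2 * sinh z * cosh z" and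
        Xdd = "\<lambda>z. - 2 * (cosh z ^ 2 + sinh z ^ 2)"])
  fix z assume z: "z \<in> S"
  show nz: "sinh z \<noteq> 0" "cosh z \<noteq> 0" using S(2,3)[OF z] by auto
  have "- (sinh z ^ 2) = 1 - (cosh z)\<^sup>2" by (simp add: cosh_sq_complex)
  then show "- (sinh z ^ 2) \<in> hyp_cut_plane"
    using one_minus_square_in_cut_plane[OF S(3)[OF z]] by simp
  show "((\<lambda>z. - (sinh z ^ 2)) has_field_derivative - 2 * sinh z * cosh z) (at z)"
    by (auto intro!: derivative_eq_intros)
  show "((\<lambda>z. - 2 * sinh z * cosh z) has_field_derivative - 2 * (cosh z ^ 2 + sinh z ^ 2)) (at z)"
    by (auto intro!: derivative_eq_intros simp: power2_eq_square algebra_simps)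
  have dc: "((\<lambda>z. Ln (cosh z)) has_field_derivative sinh z / cosh z) (at z)"
    using not_nonpos_Re[OF S(3)[OF z]] nz by (auto intro!: derivative_eq_intros simp: field_simps)
  show "((\<lambda>z. exp ((\<alpha> + 1/2) * l z) * exp ((\<beta> + 1/2) * Ln (cosh z))) has_field_derivative
     ((\<alpha> + 1/2) * (cosh z / sinh z) + (\<beta> + 1/2) * (sinh z / cosh z)) *
     (exp ((\<alpha> + 1/2) * l z) * exp ((\<beta> + 1/2) * Ln (cosh z)))) (at z)"
  proof (rule DERIV_cong[OF DERIV_mult[OF DERIV_chain2[OF DERIV_exp DERIV_cmult[OF l[OF z], of "\<alpha> + 1/2"]]
        DERIV_chain2[OF DERIV_exp DERIV_cmult[OF dc, of "\<beta> + 1/2"]]]])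
    have "e1 * (A * T) * e2 + e2 * (B * U) * e1 = (A * T + B * U) * (e1 * e2)" for A B T U e1 e2 :: complex
      by (simp add: algebra_simps)
    then show "exp ((\<alpha> + 1/2) * l z) * ((\<alpha> + 1/2) * (cosh z / sinh z)) * exp ((\<beta> + 1/2) * Ln (cosh z)) +
      exp ((\<beta> + 1/2) * Ln (cosh z)) * ((\<beta> + 1/2) * (sinh z / cosh z)) * exp ((\<alpha> + 1/2) * l z) =
      ((\<alpha> + 1/2) * (cosh z / sinh z) + (\<beta> + 1/2) * (sinh z / cosh z)) *
      (exp ((\<alpha> + 1/2) * l z) * exp ((\<beta> + 1/2) * Ln (cosh z)))" .
  qed
  show "(- 2 * sinh z * cosh z)\<^sup>2 = - 4 * 1 * (- (sinh z ^ 2) * (1 - - (sinh z ^ 2)))"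
    using cosh_sq_complex[of z] by (simp add: power_mult_distrib)
  have "2 * ((\<alpha> + 1/2) * (cosh z / sinh z) + (\<beta> + 1/2) * (sinh z / cosh z)) * (- 2 * sinh z * cosh z) =
      - 4 * (\<alpha> + 1/2) * cosh z ^ 2 - 4 * (\<beta> + 1/2) * sinh z ^ 2"
  proof -
    have "cosh z / sinh z * (sinh z * cosh z) = cosh z ^ 2" "sinh z / cosh z * (sinh z * cosh z) = sinh z ^ 2"
      using nz by (simp_all add: power2_eq_square)
    moreover have "2 * ((\<alpha> + 1/2) * p + (\<beta> + 1/2) * q) * (- 2 * sinh z * cosh z) =
       - 4 * (\<alpha> + 1/2) * (p * (sinh z * cosh z)) - 4 * (\<beta> + 1/2) * (q * (sinh z * cosh z))" for p q
      by (simp add: algebra_simps)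
    ultimately show ?thesis by (simp only:)
  qed
  then show "2 * ((\<alpha> + 1/2) * (cosh z / sinh z) + (\<beta> + 1/2) * (sinh z / cosh z)) * (- 2 * sinh z * cosh z) +
     - 2 * (cosh z ^ 2 + sinh z ^ 2) + 4 * 1 * (\<alpha> + 1 - (- \<nu> + (\<nu> + \<alpha> + \<beta> + 1) + 1) * - (sinh z ^ 2)) = 0"
    by (simp only:) (simp add: cosh_sq_complex algebra_simps)
  have e: "(\<alpha> + 1/2 + (\<beta> + 1/2))\<^sup>2 - 4 * (- \<nu>) * (\<nu> + \<alpha> + \<beta> + 1) = (2 * \<nu> + \<alpha> + \<beta> + 1)\<^sup>2"
    "(\<alpha> + 1/2)\<^sup>2 - (\<alpha> + 1/2) = \<alpha>\<^sup>2 - 1/4" "(\<beta> + 1/2)\<^sup>2 - (\<beta> + 1/2) = \<beta>\<^sup>2 - 1/4"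
    by (simp_all add: power2_eq_square field_simps)
  show "(\<alpha> + 1/2 + (\<beta> + 1/2))\<^sup>2 + ((\<alpha> + 1/2)\<^sup>2 - (\<alpha> + 1/2)) / sinh z ^ 2 -
     ((\<beta> + 1/2)\<^sup>2 - (\<beta> + 1/2)) / cosh z ^ 2 - 4 * (- \<nu>) * (\<nu> + \<alpha> + \<beta> + 1) * 1 =
     (2 * \<nu> + \<alpha> + \<beta> + 1)\<^sup>2 + pot \<alpha> \<beta> z"
  proof -
    have alg: "P + p - q - Q * 1 = P - Q + (p - q)" for P p q Q :: complex by simp
    show ?thesis unfolding pot_def e(2,3) e(1)[symmetric] by (rule alg)
  qed
qed (use S in auto)

text \<open>The singularities of the potential are the multiples of i pi/2. Of the imaginary axis
  only the open segment from 0 to \<sigma> i pi/2 is kept, as a gate between the half-planes;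
  \<sigma> = 1 and \<sigma> = -1 choose the upper and the lower gate. The set is starlike about the
  midpoint of its gate, so solutions of the equation extend to all of it.\<close>

definition omega :: "real \<Rightarrow> complex set" where
  "omega \<sigma> = {z. Re z \<noteq> 0 \<or> 0 < \<sigma> * Im z \<and> \<sigma> * Im z < pi / 2}"

lemma right_half_subset_omega: "right_half \<subseteq> omega \<sigma>"
  by (auto simp: omega_def right_half)

lemma open_omega: "open (omega \<sigma>)"
  unfolding omega_def
  by (intro open_Collect_disj open_Collect_conj open_Collect_neq open_Collect_less continuous_intros)

lemma omega_starlike:
  assumes "\<bar>\<sigma>\<bar> = 1" "z \<in> omega \<sigma>"
  shows "Complex 0 (\<sigma> * pi / 4) \<in> omega \<sigma>" "closed_segment (Complex 0 (\<sigma> * pi / 4)) z \<subseteq> omega \<sigma>"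
proof -
  have s2: "\<sigma> * \<sigma> = 1" using assms(1) by (metis abs_mult_self_eq mult_1)
  show a: "Complex 0 (\<sigma> * pi / 4) \<in> omega \<sigma>"
    using s2 by (simp add: omega_def mult.assoc[symmetric])
  show "closed_segment (Complex 0 (\<sigma> * pi / 4)) z \<subseteq> omega \<sigma>"
  proof
    fix y assume "y \<in> closed_segment (Complex 0 (\<sigma> * pi / 4)) z"
    then obtain u where u: "0 \<le> u" "u \<le> 1" "y = (1 - u) *\<^sub>R Complex 0 (\<sigma> * pi / 4) + u *\<^sub>R z"
      by (auto simp: closed_segment_def)
    show "y \<in> omega \<sigma>"
    proof (cases "u = 0 \<or> Re z \<noteq> 0")
      case True
      then show ?thesis using u a by (auto simp: omega_def)
    next
      case False
      then have z: "0 < \<sigma> * Im z" "\<sigma> * Im z < pi / 2" "u > 0"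
        using assms(2) u(1) by (auto simp: omega_def)
      have "\<sigma> * Im y = (1 - u) * (\<sigma> * \<sigma> * pi / 4) + u * (\<sigma> * Im z)"
        by (simp add: u(3) field_simps)
      then have y: "\<sigma> * Im y = (1 - u) * (pi / 4) + u * (\<sigma> * Im z)" by (simp add: s2)
      have "0 < u * (\<sigma> * Im z)" "u * (\<sigma> * Im z) < u * (pi / 2)" "0 \<le> (1 - u) * (pi / 4)" "(1 - u) * (pi / 4) \<le> (1 - u) * (pi / 2)"
        using z u by (auto intro!: mult_pos_pos mult_strict_left_mono mult_left_mono)
      moreover have "(1 - u) * (pi / 2) + u * (pi / 2) = pi / 2" by (simp add: field_simps)
      ultimately have "0 < \<sigma> * Im y" "\<sigma> * Im y < pi / 2"
        unfolding y by linarith+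
      then show ?thesis by (simp add: omega_def)
    qed
  qed
qed

lemma omega_nz:
  assumes "\<bar>\<sigma>\<bar> = 1" "z \<in> omega \<sigma>"
  shows "sinh z \<noteq> 0" "cosh z \<noteq> 0"
proof -
  have "sinh z \<noteq> 0 \<and> cosh z \<noteq> 0"
  proof (cases "Re z = 0")
    case True
    have "\<sigma> = 1 \<or> \<sigma> = - 1" using assms(1) by auto
    then have *: "0 < \<bar>Im z\<bar>" "\<bar>Im z\<bar> < pi / 2"
      using True assms(2) by (auto simp: omega_def)
    then have "sin \<bar>Im z\<bar> > 0" "cos (Im z) > 0" by (auto intro!: sin_gt_zero cos_gt_zero_pi)
    then have "sin (Im z) \<noteq> 0" "cos (Im z) \<noteq> 0" by (auto simp: abs_if split: if_splits)
    then show ?thesis using True Re_Im_sinh_cosh[of z] by (auto simp: complex_eq_iff)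
  qed (use sinh_cosh_nz in auto)
  then show "sinh z \<noteq> 0" "cosh z \<noteq> 0" by auto
qed

lemma recessive_exists:
  assumes "\<bar>\<sigma>\<bar> = 1"
  shows "\<exists>W. schroedinger_on (2 * \<nu> + \<alpha> + \<beta> + 1) \<alpha> \<beta> (omega \<sigma>) W \<and>
    (\<forall>z. Re z > 0 \<longrightarrow> W z = exp (- (2 * \<nu> + \<alpha> + \<beta> + 1) * z) * recessive_phi \<nu> \<alpha> \<beta> (exp (- 2 * z)))"
proof -
  define w where "w = 2 * \<nu> + \<alpha> + \<beta> + 1"
  let ?u = "\<lambda>z. exp (- w * z) * recessive_phi \<nu> \<alpha> \<beta> (exp (- 2 * z))"
  have u: "schroedinger_on w \<alpha> \<beta> right_half ?u"
    unfolding w_def by (rule recessive_right_half)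
  have "1 \<in> omega \<sigma>" by (simp add: omega_def)
  have "\<exists>v. v holomorphic_on omega \<sigma> \<and> (\<forall>z\<in>omega \<sigma>. deriv (deriv v) z = (w\<^sup>2 + pot \<alpha> \<beta> z) * v z) \<and>
      (\<forall>z\<in>right_half. v z = ?u z)"
  proof (rule linear_ode_extend[OF open_omega omega_starlike[OF assms]])
    show "(\<lambda>z. w\<^sup>2 + pot \<alpha> \<beta> z) holomorphic_on omega \<sigma>"
      unfolding pot_def using omega_nz[OF assms] by (auto intro!: holomorphic_intros simp: sinh_field_def cosh_field_def)
  qed (use u right_half right_half_subset_omega \<open>1 \<in> omega \<sigma>\<close> in \<open>auto simp: schroedinger_on_def\<close>)
  then obtain v where "v holomorphic_on omega \<sigma>" "\<forall>z\<in>omega \<sigma>. deriv (deriv v) z = (w\<^sup>2 + pot \<alpha> \<beta> z) * v z"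
      "\<forall>z\<in>right_half. v z = ?u z"
    by (elim exE conjE)
  then show ?thesis
    unfolding w_def[symmetric] schroedinger_on_def by (intro exI[of _ v]) (simp add: right_half)
qed

text \<open>The choice is harmless: holomorphy on the connected set \<open>omega \<sigma>\<close>
  and the values on the right half-plane determine the function on \<open>omega \<sigma>\<close>. On
  the right half-plane the two signs agree.\<close>

definition recessive :: "real \<Rightarrow> complex \<Rightarrow> complex \<Rightarrow> complex \<Rightarrow> complex \<Rightarrow> complex" where
  "recessive \<sigma> \<nu> \<alpha> \<beta> = (SOME W. schroedinger_on (2 * \<nu> + \<alpha> + \<beta> + 1) \<alpha> \<beta> (omega \<sigma>) W \<and>
    (\<forall>z. Re z > 0 \<longrightarrow> W z = exp (- (2 * \<nu> + \<alpha> + \<beta> + 1) * z) * recessive_phi \<nu> \<alpha> \<beta> (exp (- 2 * z))))"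

lemma recessive:
  assumes "\<bar>\<sigma>\<bar> = 1"
  shows "schroedinger_on (2 * \<nu> + \<alpha> + \<beta> + 1) \<alpha> \<beta> (omega \<sigma>) (recessive \<sigma> \<nu> \<alpha> \<beta>)"
    "Re z > 0 \<Longrightarrow> recessive \<sigma> \<nu> \<alpha> \<beta> z = exp (- (2 * \<nu> + \<alpha> + \<beta> + 1) * z) * recessive_phi \<nu> \<alpha> \<beta> (exp (- 2 * z))"
  using someI_ex[OF recessive_exists[OF assms, of \<nu> \<alpha> \<beta>]] unfolding recessive_def[symmetric] by auto



section \<open>The coefficient recurrence\<close>

lemma a_coeff_Suc:
  "a_coeff l \<mu> * ((of_nat l + 1/2)\<^sup>2 - \<mu>\<^sup>2) = - 2 * of_nat (Suc l) * a_coeff (Suc l) \<mu>"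
proof -
  define P where "P = pochhammer (1/2 + \<mu>) l * pochhammer (1/2 - \<mu>) l"
  have P: "pochhammer (1/2 + \<mu>) (Suc l) * pochhammer (1/2 - \<mu>) (Suc l) = P * ((of_nat l + 1/2)\<^sup>2 - \<mu>\<^sup>2)"
    by (simp add: P_def pochhammer_Suc power2_eq_square algebra_simps)
  have n: "of_nat (Suc l) \<noteq> (0::complex)" "fact l \<noteq> (0::complex)" "(- 2 :: complex) ^ l \<noteq> 0"
    by (simp_all del: of_nat_Suc)
  show ?thesis
    unfolding a_coeff_def P P_def[symmetric] using n
    by (simp add: fact_Suc divide_simps del: of_nat_Suc)
qed

text \<open>In p and q the potential and all derivatives become polynomial, with p q = p + q as the
  relation between them. This turns the coefficient recurrence into plain algebra.\<close>

lemma exp_over_sinh_cosh: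
  fixes z :: complex
  assumes "sinh z \<noteq> 0" "cosh z \<noteq> 0"
  defines "p \<equiv> exp z / sinh z" and "q \<equiv> exp z / cosh z"
  shows "p = 1 + cosh z / sinh z" "q = 1 + sinh z / cosh z" "p * q = p + q"
    "p * (p - 2) = 1 / sinh z ^ 2" "q * (q - 2) = - (1 / cosh z ^ 2)"
    "pot \<alpha> \<beta> z = (\<alpha>\<^sup>2 - 1/4) * (p * (p - 2)) + (\<beta>\<^sup>2 - 1/4) * (q * (q - 2))"
proof -
  have e: "exp z = cosh z + sinh z"
    by (rule cosh_plus_sinh[symmetric])
  show p: "p = 1 + cosh z / sinh z" and q: "q = 1 + sinh z / cosh z"
    using assms(1,2) by (simp_all add: p_def q_def e field_simps)
  show "p * q = p + q"
    unfolding p_def q_def e using assms(1,2) by (simp add: divide_simps; simp add: algebra_simps)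
  show p2: "p * (p - 2) = 1 / sinh z ^ 2"
    unfolding p using assms(1) cosh_sq_complex[of z] by (simp add: divide_simps; simp add: algebra_simps power2_eq_square)
  show q2: "q * (q - 2) = - (1 / cosh z ^ 2)"
  proof -
    have "q * (q - 2) = (sinh z / cosh z)\<^sup>2 - 1"
      unfolding q by (simp add: power2_eq_square algebra_simps)
    also have "\<dots> = (sinh z ^ 2 - cosh z ^ 2) / cosh z ^ 2"
      using assms(2) by (simp add: power_divide diff_divide_distrib)
    also have "sinh z ^ 2 - cosh z ^ 2 = - 1" by (simp add: cosh_sq_complex)
    finally show ?thesis by simp
  qed
  show "pot \<alpha> \<beta> z = (\<alpha>\<^sup>2 - 1/4) * (p * (p - 2)) + (\<beta>\<^sup>2 - 1/4) * (q * (q - 2))"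
    unfolding p2 q2 pot_def by simp
qed

lemma DERIV_exp_over_sinh_cosh:
  fixes z :: complex
  assumes "sinh z \<noteq> 0" "cosh z \<noteq> 0"
  shows "((\<lambda>z. exp z / sinh z) has_field_derivative (exp z / sinh z) * (2 - exp z / sinh z)) (at z)"
    and "((\<lambda>z. exp z / cosh z) has_field_derivative (exp z / cosh z) * (2 - exp z / cosh z)) (at z)"
proof -
  have e: "exp z = cosh z + sinh z"
    by (rule cosh_plus_sinh[symmetric])
  have "((\<lambda>z. exp z / sinh z) has_field_derivative (exp z * sinh z - exp z * cosh z) / (sinh z * sinh z)) (at z)"
    using assms by (auto intro!: derivative_eq_intros)
  also have "(exp z * sinh z - exp z * cosh z) / (sinh z * sinh z) = (exp z / sinh z) * (2 - exp z / sinh z)"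
    unfolding e using assms by (simp add: divide_simps; simp add: algebra_simps)
  finally show "((\<lambda>z. exp z / sinh z) has_field_derivative (exp z / sinh z) * (2 - exp z / sinh z)) (at z)" .
  have "((\<lambda>z. exp z / cosh z) has_field_derivative (exp z * cosh z - exp z * sinh z) / (cosh z * cosh z)) (at z)"
    using assms by (auto intro!: derivative_eq_intros)
  also have "(exp z * cosh z - exp z * sinh z) / (cosh z * cosh z) = (exp z / cosh z) * (2 - exp z / cosh z)"
    unfolding e using assms by (simp add: divide_simps; simp add: algebra_simps)
  finally show "((\<lambda>z. exp z / cosh z) has_field_derivative (exp z / cosh z) * (2 - exp z / cosh z)) (at z)" .
qed

text \<open>A closed form in which the factors p (2 - p) and q (2 - q), which decay in both
  directions, can be split off; this gives the bound in \<open>g_bounds\<close>.\<close>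

definition g_deriv :: "nat \<Rightarrow> complex \<Rightarrow> complex \<Rightarrow> complex \<Rightarrow> complex" where
  "g_deriv n z \<alpha> \<beta> = (\<Sum>l\<le>n. a_coeff l \<alpha> * a_coeff (n - l) \<beta> * ((exp z / sinh z) ^ l * (exp z / cosh z) ^ (n - l) *
     (of_nat l * (2 - exp z / sinh z) + of_nat (n - l) * (2 - exp z / cosh z))))"

definition g_deriv2 :: "nat \<Rightarrow> complex \<Rightarrow> complex \<Rightarrow> complex \<Rightarrow> complex" where
  "g_deriv2 n z \<alpha> \<beta> = (\<Sum>l\<le>n. a_coeff l \<alpha> * a_coeff (n - l) \<beta> * ((exp z / sinh z) ^ l * (exp z / cosh z) ^ (n - l) *
     ((of_nat l * (2 - exp z / sinh z) + of_nat (n - l) * (2 - exp z / cosh z))\<^sup>2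
       - of_nat l * (exp z / sinh z * (2 - exp z / sinh z)) - of_nat (n - l) * (exp z / cosh z * (2 - exp z / cosh z)))))"

lemma DERIV_power_product:
  fixes p q :: "complex \<Rightarrow> complex"
  assumes "(p has_field_derivative p z * (2 - p z)) (at z)" "(q has_field_derivative q z * (2 - q z)) (at z)"
  shows "((\<lambda>z. p z ^ l * q z ^ k) has_field_derivative
     p z ^ l * q z ^ k * (of_nat l * (2 - p z) + of_nat k * (2 - q z))) (at z)"
proof -
  have pw: "((\<lambda>z. f z ^ m) has_field_derivative f z ^ m * (of_nat m * (2 - f z))) (at z)"
    if "(f has_field_derivative f z * (2 - f z)) (at z)" for f :: "complex \<Rightarrow> complex" and m
    using DERIV_power[OF that, of m] by (cases m) (simp_all add: algebra_simps)
  show ?thesis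
    by (rule DERIV_cong[OF DERIV_mult[OF pw[OF assms(1)] pw[OF assms(2)]]]) (simp add: algebra_simps)
qed

lemma DERIV_g_coeff:
  assumes "sinh z \<noteq> 0" "cosh z \<noteq> 0"
  shows "((\<lambda>z. g_coeff n z \<alpha> \<beta>) has_field_derivative g_deriv n z \<alpha> \<beta>) (at z)"
    and "((\<lambda>z. g_deriv n z \<alpha> \<beta>) has_field_derivative g_deriv2 n z \<alpha> \<beta>) (at z)"
proof -
  note d = DERIV_exp_over_sinh_cosh[OF assms]
  show "((\<lambda>z. g_coeff n z \<alpha> \<beta>) has_field_derivative g_deriv n z \<alpha> \<beta>) (at z)"
    unfolding g_coeff_def g_deriv_def mult.assoc[of "_ * _" "_ ^ _"]
    by (intro DERIV_sum DERIV_cmult DERIV_power_product d)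
  show "((\<lambda>z. g_deriv n z \<alpha> \<beta>) has_field_derivative g_deriv2 n z \<alpha> \<beta>) (at z)"
    unfolding g_deriv_def g_deriv2_def
  proof (intro DERIV_sum DERIV_cmult)
    fix l
    have "((\<lambda>z. of_nat l * (2 - exp z / sinh z) + of_nat (n - l) * (2 - exp z / cosh z)) has_field_derivative
      of_nat l * (0 - exp z / sinh z * (2 - exp z / sinh z)) + of_nat (n - l) * (0 - exp z / cosh z * (2 - exp z / cosh z))) (at z)"
      by (intro DERIV_add DERIV_cmult DERIV_diff DERIV_const d)
    from DERIV_mult[OF DERIV_power_product[OF d, of l "n - l"] this]
    show "((\<lambda>z. (exp z / sinh z) ^ l * (exp z / cosh z) ^ (n - l) *
         (of_nat l * (2 - exp z / sinh z) + of_nat (n - l) * (2 - exp z / cosh z))) has_field_derivative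
        (exp z / sinh z) ^ l * (exp z / cosh z) ^ (n - l) *
         ((of_nat l * (2 - exp z / sinh z) + of_nat (n - l) * (2 - exp z / cosh z))\<^sup>2 -
          of_nat l * (exp z / sinh z * (2 - exp z / sinh z)) - of_nat (n - l) * (exp z / cosh z * (2 - exp z / cosh z)))) (at z)"
    proof (rule DERIV_cong)
      have "P * E * E + (l * (0 - p) + k * (0 - q)) * P = P * (E\<^sup>2 - l * p - k * q)" for P E l p k q :: complex
        by (simp add: power2_eq_square algebra_simps)
      then show "(exp z / sinh z) ^ l * (exp z / cosh z) ^ (n - l) *
        (of_nat l * (2 - exp z / sinh z) + of_nat (n - l) * (2 - exp z / cosh z)) *
        (of_nat l * (2 - exp z / sinh z) + of_nat (n - l) * (2 - exp z / cosh z)) +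
        (of_nat l * (0 - exp z / sinh z * (2 - exp z / sinh z)) + of_nat (n - l) * (0 - exp z / cosh z * (2 - exp z / cosh z))) *
        ((exp z / sinh z) ^ l * (exp z / cosh z) ^ (n - l)) =
        (exp z / sinh z) ^ l * (exp z / cosh z) ^ (n - l) *
         ((of_nat l * (2 - exp z / sinh z) + of_nat (n - l) * (2 - exp z / cosh z))\<^sup>2 -
          of_nat l * (exp z / sinh z * (2 - exp z / sinh z)) - of_nat (n - l) * (exp z / cosh z * (2 - exp z / cosh z)))" .
    qed
  qed
qed

text \<open>Putting u = e^(-w z) times the sum of g_n \<open>inv_fact w n\<close> into the equation
  leaves g'' - 2 w g' - V g = 0 for the sum, and \<open>inv_fact\<close> absorbs the factor w - n;
  what remains order by order is this identity. It holds because each monomial p^l q^k of g_n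
  produces one term for p^(l+1) q^k and one for p^l q^(k+1), with exactly the factors by which
  \<open>a_coeff\<close> grows.\<close>

lemma g_recurrence:
  assumes "sinh z \<noteq> 0" "cosh z \<noteq> 0"
  shows "g_deriv2 n z \<alpha> \<beta> - 2 * of_nat n * g_deriv n z \<alpha> \<beta> - pot \<alpha> \<beta> z * g_coeff n z \<alpha> \<beta> = 2 * g_deriv (Suc n) z \<alpha> \<beta>"
proof -
  define p where "p = exp z / sinh z"
  define q where "q = exp z / cosh z"
  define a where "a = (\<lambda>l. a_coeff l \<alpha>)"
  define b where "b = (\<lambda>l. a_coeff l \<beta>)"
  have pq: "p * q = p + q" and V: "pot \<alpha> \<beta> z = (\<alpha>\<^sup>2 - 1/4) * (p * (p - 2)) + (\<beta>\<^sup>2 - 1/4) * (q * (q - 2))"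
    using exp_over_sinh_cosh[OF assms] by (simp_all add: p_def q_def)
  \<comment> \<open>The mixed terms collect to 2 l k (p q - p - q) and vanish; only the pure terms p
    (p - 2) and q (q - 2) survive.\<close>
  have core: "(l * (2 - p) + k * (2 - q))\<^sup>2 - l * (p * (2 - p)) - k * (q * (2 - q)) - 2 * (l + k) * (l * (2 - p) + k * (2 - q))
      - ((\<alpha>\<^sup>2 - 1/4) * (p * (p - 2)) + (\<beta>\<^sup>2 - 1/4) * (q * (q - 2))) =
      ((l + 1/2)\<^sup>2 - \<alpha>\<^sup>2) * (p * (p - 2)) + ((k + 1/2)\<^sup>2 - \<beta>\<^sup>2) * (q * (q - 2))" for l k :: complex
  proof -
    have "(l * (2 - p) + k * (2 - q))\<^sup>2 - l * (p * (2 - p)) - k * (q * (2 - q)) - 2 * (l + k) * (l * (2 - p) + k * (2 - q))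
      - ((\<alpha>\<^sup>2 - 1/4) * (p * (p - 2)) + (\<beta>\<^sup>2 - 1/4) * (q * (q - 2))) -
      (((l + 1/2)\<^sup>2 - \<alpha>\<^sup>2) * (p * (p - 2)) + ((k + 1/2)\<^sup>2 - \<beta>\<^sup>2) * (q * (q - 2))) = 2 * l * k * (p * q - (p + q))"
      by (simp add: power2_eq_square field_simps)
    then show ?thesis by (simp add: pq)
  qed
  have A: "a l * ((of_nat l + 1/2)\<^sup>2 - \<alpha>\<^sup>2) = - 2 * of_nat (Suc l) * a (Suc l)"
    and B: "b l * ((of_nat l + 1/2)\<^sup>2 - \<beta>\<^sup>2) = - 2 * of_nat (Suc l) * b (Suc l)" for l
    by (simp_all only: a_def b_def a_coeff_Suc)
  \<comment> \<open>\<open>T1\<close> and \<open>T2\<close> are the two halves of the summands of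
    \<open>g_deriv (Suc n)\<close>, from differentiating the powers of p and of q. The monomial l of
    g_n feeds \<open>T1 (Suc l)\<close> and \<open>T2 l\<close>.\<close>
  define T1 where "T1 = (\<lambda>l. a l * b (Suc n - l) * (p ^ l * q ^ (Suc n - l)) * (of_nat l * (2 - p)))"
  define T2 where "T2 = (\<lambda>l. a l * b (Suc n - l) * (p ^ l * q ^ (Suc n - l)) * (of_nat (Suc n - l) * (2 - q)))"
  have summand: "a l * b (n - l) * (p ^ l * q ^ (n - l) *
      ((of_nat l * (2 - p) + of_nat (n - l) * (2 - q))\<^sup>2 - of_nat l * (p * (2 - p)) - of_nat (n - l) * (q * (2 - q)))) -
      2 * of_nat n * (a l * b (n - l) * (p ^ l * q ^ (n - l) * (of_nat l * (2 - p) + of_nat (n - l) * (2 - q)))) -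
      pot \<alpha> \<beta> z * (a l * b (n - l) * (p ^ l * q ^ (n - l))) = 2 * T1 (Suc l) + 2 * T2 l" if "l \<le> n" for l
  proof -
    define k where "k = n - l"
    have n: "of_nat n = of_nat l + (of_nat k :: complex)"
      using that by (simp add: k_def of_nat_diff)
    have "a l * b k * (p ^ l * q ^ k *
      ((of_nat l * (2 - p) + of_nat k * (2 - q))\<^sup>2 - of_nat l * (p * (2 - p)) - of_nat k * (q * (2 - q)))) -
      2 * of_nat n * (a l * b k * (p ^ l * q ^ k * (of_nat l * (2 - p) + of_nat k * (2 - q)))) -
      pot \<alpha> \<beta> z * (a l * b k * (p ^ l * q ^ k)) =
      a l * b k * (p ^ l * q ^ k) * ((of_nat l * (2 - p) + of_nat k * (2 - q))\<^sup>2 - of_nat l * (p * (2 - p)) - of_nat k * (q * (2 - q))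
       - 2 * (of_nat l + of_nat k) * (of_nat l * (2 - p) + of_nat k * (2 - q)) - ((\<alpha>\<^sup>2 - 1/4) * (p * (p - 2)) + (\<beta>\<^sup>2 - 1/4) * (q * (q - 2))))"
    proof -
      have "c * (P * X) - 2 * m * (c * (P * Y)) - v * (c * P) = c * P * (X - 2 * m * Y - v)" for c P X Y m v :: complex
        by (simp add: algebra_simps)
      then show ?thesis unfolding V n .
    qed
    also have "\<dots> = (a l * ((of_nat l + 1/2)\<^sup>2 - \<alpha>\<^sup>2)) * b k * (p ^ l * q ^ k) * (p * (p - 2)) +
        a l * (b k * ((of_nat k + 1/2)\<^sup>2 - \<beta>\<^sup>2)) * (p ^ l * q ^ k) * (q * (q - 2))"
      unfolding core by (simp add: distrib_left mult_ac)
    also have "\<dots> = 2 * T1 (Suc l) + 2 * T2 l"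
      unfolding A B T1_def T2_def using that
      by (simp add: k_def Suc_diff_le algebra_simps)
    finally show ?thesis unfolding k_def .
  qed
  have "g_deriv2 n z \<alpha> \<beta> - 2 * of_nat n * g_deriv n z \<alpha> \<beta> - pot \<alpha> \<beta> z * g_coeff n z \<alpha> \<beta> =
      (\<Sum>l\<le>n. a l * b (n - l) * (p ^ l * q ^ (n - l) *
      ((of_nat l * (2 - p) + of_nat (n - l) * (2 - q))\<^sup>2 - of_nat l * (p * (2 - p)) - of_nat (n - l) * (q * (2 - q)))) -
      2 * of_nat n * (a l * b (n - l) * (p ^ l * q ^ (n - l) * (of_nat l * (2 - p) + of_nat (n - l) * (2 - q)))) -
      pot \<alpha> \<beta> z * (a l * b (n - l) * (p ^ l * q ^ (n - l))))"
    unfolding g_deriv2_def g_deriv_def g_coeff_def p_def[symmetric] q_def[symmetric] a_def b_def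
    by (simp only: sum_distrib_left sum_subtractf mult.assoc)
  also have "\<dots> = (\<Sum>l\<le>n. 2 * T1 (Suc l) + 2 * T2 l)"
    by (intro sum.cong refl summand) simp
  also have "\<dots> = 2 * (\<Sum>l\<le>n. T1 (Suc l)) + 2 * (\<Sum>l\<le>n. T2 l)"
    by (simp add: sum.distrib sum_distrib_left)
  \<comment> \<open>\<open>T1 0\<close> and \<open>T2 (Suc n)\<close> vanish through their factors l
    and n + 1 - l, so both sums extend to the full range.\<close>
  also have "(\<Sum>l\<le>n. T1 (Suc l)) = (\<Sum>l\<le>Suc n. T1 l)"
    by (simp add: sum.atMost_Suc_shift T1_def del: sum.atMost_Suc)
  also have "(\<Sum>l\<le>n. T2 l) = (\<Sum>l\<le>Suc n. T2 l)"
    by (simp add: T2_def)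
  also have "2 * (\<Sum>l\<le>Suc n. T1 l) + 2 * (\<Sum>l\<le>Suc n. T2 l) = 2 * (\<Sum>l\<le>Suc n. T1 l + T2 l)"
    by (simp only: sum.distrib distrib_left)
  also have "(\<Sum>l\<le>Suc n. T1 l + T2 l) = g_deriv (Suc n) z \<alpha> \<beta>"
    unfolding g_deriv_def p_def[symmetric] q_def[symmetric] T1_def T2_def a_def b_def
    by (intro sum.cong refl) (simp only: distrib_left mult.assoc)
  finally show ?thesis .
qed

text \<open>With w = 2 \<nu> + \<alpha> + \<beta> + 1 this is the Gamma quotient of the n-th term of
  the expansions.\<close>

definition inv_fact :: "complex \<Rightarrow> nat \<Rightarrow> complex" where
  "inv_fact w n = Gamma (w - of_nat n) / Gamma (w + 1)"

lemma inv_fact_0: "w \<notin> \<int>\<^sub>\<le>\<^sub>0 \<Longrightarrow> w * inv_fact w 0 = 1"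
  by (auto simp: inv_fact_def Gamma_plus1 Gamma_eq_zero_iff)

lemma inv_fact_Suc:
  assumes "w - of_nat (Suc n) \<notin> \<int>\<^sub>\<le>\<^sub>0"
  shows "(w - of_nat (Suc n)) * inv_fact w (Suc n) = inv_fact w n"
  using Gamma_plus1[OF assms] by (simp add: inv_fact_def)

definition partial_series :: "nat \<Rightarrow> complex \<Rightarrow> complex \<Rightarrow> complex \<Rightarrow> complex \<Rightarrow> complex" where
  "partial_series N w \<alpha> \<beta> z = (\<Sum>n<N. g_coeff n z \<alpha> \<beta> * inv_fact w n)"

lemma DERIV_partial_series:
  assumes "sinh z \<noteq> 0" "cosh z \<noteq> 0"
  shows "(partial_series N w \<alpha> \<beta> has_field_derivative (\<Sum>n<N. g_deriv n z \<alpha> \<beta> * inv_fact w n)) (at z)"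
    and "((\<lambda>z. \<Sum>n<N. g_deriv n z \<alpha> \<beta> * inv_fact w n) has_field_derivative (\<Sum>n<N. g_deriv2 n z \<alpha> \<beta> * inv_fact w n)) (at z)"
  unfolding partial_series_def[abs_def] by (intro DERIV_sum DERIV_cmult_right DERIV_g_coeff assms)+

text \<open>The sum telescopes: by \<open>inv_fact_Suc\<close> the term 2 (w - n) g_n'
  \<open>inv_fact w n\<close> cancels what order n - 1 leaves over, so only the contribution of the
  last order remains.\<close>

lemma partial_series_ode:
  assumes z: "sinh z \<noteq> 0" "cosh z \<noteq> 0" and w: "\<And>n. n \<le> N \<Longrightarrow> w - of_nat n \<notin> \<int>\<^sub>\<le>\<^sub>0"
  shows "(\<Sum>n<Suc N. g_deriv2 n z \<alpha> \<beta> * inv_fact w n) - 2 * w * (\<Sum>n<Suc N. g_deriv n z \<alpha> \<beta> * inv_fact w n)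
     - pot \<alpha> \<beta> z * partial_series (Suc N) w \<alpha> \<beta> z = 2 * inv_fact w N * g_deriv (Suc N) z \<alpha> \<beta>"
  using w
proof (induction N)
  case 0
  have "g_deriv 0 z \<alpha> \<beta> = 0" by (simp add: g_deriv_def)
  then have "(g_deriv2 0 z \<alpha> \<beta> - pot \<alpha> \<beta> z * g_coeff 0 z \<alpha> \<beta>) * inv_fact w 0 = 2 * g_deriv (Suc 0) z \<alpha> \<beta> * inv_fact w 0"
    using g_recurrence[OF z, of 0 \<alpha> \<beta>] by simp
  then show ?case
    using \<open>g_deriv 0 z \<alpha> \<beta> = 0\<close> by (simp add: partial_series_def algebra_simps)
next
  case (Suc N)
  define i where "i = inv_fact w (Suc N)"
  have IH: "(\<Sum>n<Suc N. g_deriv2 n z \<alpha> \<beta> * inv_fact w n) - 2 * w * (\<Sum>n<Suc N. g_deriv n z \<alpha> \<beta> * inv_fact w n)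
     - pot \<alpha> \<beta> z * partial_series (Suc N) w \<alpha> \<beta> z = 2 * inv_fact w N * g_deriv (Suc N) z \<alpha> \<beta>"
    by (rule Suc.IH, rule Suc.prems) simp
  have r: "g_deriv2 (Suc N) z \<alpha> \<beta> = 2 * g_deriv (Suc (Suc N)) z \<alpha> \<beta> + 2 * of_nat (Suc N) * g_deriv (Suc N) z \<alpha> \<beta> + pot \<alpha> \<beta> z * g_coeff (Suc N) z \<alpha> \<beta>"
    using g_recurrence[OF z, of "Suc N" \<alpha> \<beta>] by (simp add: algebra_simps)
  have i: "inv_fact w N = (w - of_nat (Suc N)) * i"
    unfolding i_def using inv_fact_Suc[OF Suc.prems[of "Suc N"]] by simp
  have "(\<Sum>n<Suc (Suc N). g_deriv2 n z \<alpha> \<beta> * inv_fact w n) - 2 * w * (\<Sum>n<Suc (Suc N). g_deriv n z \<alpha> \<beta> * inv_fact w n)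
     - pot \<alpha> \<beta> z * partial_series (Suc (Suc N)) w \<alpha> \<beta> z =
     ((\<Sum>n<Suc N. g_deriv2 n z \<alpha> \<beta> * inv_fact w n) - 2 * w * (\<Sum>n<Suc N. g_deriv n z \<alpha> \<beta> * inv_fact w n)
     - pot \<alpha> \<beta> z * partial_series (Suc N) w \<alpha> \<beta> z) +
     (g_deriv2 (Suc N) z \<alpha> \<beta> - 2 * w * g_deriv (Suc N) z \<alpha> \<beta> - pot \<alpha> \<beta> z * g_coeff (Suc N) z \<alpha> \<beta>) * i"
  proof -
    have "(A + a * i) - 2 * w * (B + b * i) - v * (C + c * i) = (A - 2 * w * B - v * C) + (a - 2 * w * b - v * c) * i"
      for A B C a b c v :: complex
      by (simp add: algebra_simps)
    then show ?thesis
      unfolding partial_series_def sum.lessThan_Suc[of _ "Suc N"] i_def .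
  qed
  also have "\<dots> = 2 * i * g_deriv (Suc (Suc N)) z \<alpha> \<beta>"
    unfolding IH r i by (simp add: algebra_simps)
  finally show ?case unfolding i_def .
qed

section \<open>A Volterra estimate on the real line\<close>

text \<open>The weight of all estimates on lines. It is the derivative of tanh, so its total mass is
  2, and its logarithmic derivative is at most 2 in absolute value, so its decay survives averaging
  against exponentials of rate above 2.\<close>

definition bump :: "real \<Rightarrow> real" where "bump x = 1 / (cosh x)\<^sup>2"

lemma bump_eq: "bump x = 1 - (tanh x)\<^sup>2"
proof -
  have "bump x = ((cosh x)\<^sup>2 - (sinh x)\<^sup>2) / (cosh x)\<^sup>2"
    by (simp add: bump_def cosh_square_eq)
  also have "\<dots> = 1 - (tanh x)\<^sup>2"
    using cosh_real_pos[of x] by (simp add: tanh_def power_divide diff_divide_distrib)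
  finally show ?thesis .
qed

lemma bump_pos: "bump x > 0"
  using cosh_real_pos[of x] by (simp add: bump_def)

lemma bump_le_1: "bump x \<le> 1"
  by (simp add: bump_eq)

lemma tanh_has_bump: "(tanh has_real_derivative bump x) (at x)"
  unfolding bump_eq using cosh_real_pos[of x] by (auto intro!: derivative_eq_intros)

lemma abs_tanh_le_1: "\<bar>tanh (x::real)\<bar> \<le> 1"
  using bump_pos[of x] by (simp add: bump_eq abs_square_less_1 less_imp_le)

text \<open>A bounded E' has no component growing like e^(2 \<kappa> x), so it equals the integral
  of -e^(2 \<kappa> (x - s)) h(s) over s > x. Such an average of h keeps the decay of
  \<open>bump\<close> and gains 1 / Re \<kappa>.\<close>

lemma volterra_step:
  fixes E' h :: "real \<Rightarrow> complex"
  assumes "\<And>x. x \<ge> a \<Longrightarrow> (E' has_vector_derivative (2 * \<kappa> * E' x + h x)) (at x)"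
    and "\<And>x. x \<ge> a \<Longrightarrow> norm (h x) \<le> H * bump x"
    and "\<And>x. x \<ge> a \<Longrightarrow> norm (E' x) \<le> B"
    and "Re \<kappa> \<ge> 2" "x \<ge> a"
  shows "norm (E' x) \<le> H / Re \<kappa> * bump x"
proof -
  define r where "r = Re \<kappa>"
  have r: "r \<ge> 2" using assms(4) by (simp add: r_def)
  have "0 \<le> H * bump a" using assms(2)[of a] norm_ge_zero[of "h a"] by linarith
  then have H: "H \<ge> 0" using bump_pos[of a] by (simp add: zero_le_mult_iff)
  have B: "B \<ge> 0" using assms(3)[of a] norm_ge_zero[of "E' a"] by linarith
  define F where "F = (\<lambda>s. exp (- 2 * \<kappa> * of_real s) * E' s)"
  define K where "K = H / (2 * r - 2)"
  have dexp: "((\<lambda>s. - exp (- 2 * r * s)) has_real_derivative 2 * r * exp (- 2 * r * s)) (at s)" for s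
    by (auto intro!: derivative_eq_intros)
  have dtanh: "((\<lambda>s. 1 - (tanh s)\<^sup>2) has_real_derivative - (2 * tanh s * bump s)) (at s)" for s
    using cosh_real_pos[of s] by (auto intro!: derivative_eq_intros simp: bump_eq)
  \<comment> \<open>A majorant for e^(-2 \<kappa> s) E'(s): its derivative contains 2 r + 2 tanh s
    \<ge> 2 r - 2, which pays for the denominator 2 r - 2. This replaces an improper integral by a
    comparison of derivatives.\<close>
  define \<phi> where "\<phi> = (\<lambda>s. - exp (- 2 * r * s) * ((1 - (tanh s)\<^sup>2) * (H / (2 * r - 2))))"
  have nF: "norm (F s) = exp (- 2 * r * s) * norm (E' s)" for s
    by (simp add: F_def norm_mult r_def)
  have dF: "(F has_vector_derivative exp (- 2 * \<kappa> * of_real s) * h s) (at s)" if "s \<ge> a" for s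
  proof -
    have v: "(complex_of_real has_vector_derivative 1) (at s)"
      using bounded_linear.has_vector_derivative[OF bounded_linear_of_real[where 'a = complex] has_vector_derivative_id, of "at s"]
      by simp
    have e: "((\<lambda>z. exp (- 2 * \<kappa> * z)) has_field_derivative - 2 * \<kappa> * exp (- 2 * \<kappa> * of_real s)) (at (of_real s))"
      by (auto intro!: derivative_eq_intros)
    have "((\<lambda>s. exp (- 2 * \<kappa> * of_real s)) has_vector_derivative - 2 * \<kappa> * exp (- 2 * \<kappa> * of_real s)) (at s)"
      using field_vector_diff_chain_at[OF v e] by (simp add: o_def)
    from has_vector_derivative_mult[OF this assms(1)[OF that]]
    show ?thesis unfolding F_def by (simp add: algebra_simps)
  qed
  have d\<phi>: "(\<phi> has_vector_derivative exp (- 2 * r * s) * (2 * r + 2 * tanh s) * (bump s * (H / (2 * r - 2)))) (at s)" for s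
    unfolding \<phi>_def has_real_derivative_iff_has_vector_derivative[symmetric] K_def[symmetric]
  proof (rule DERIV_cong[OF DERIV_mult[OF dexp DERIV_cmult_right[OF dtanh]]])
    show "2 * r * exp (- 2 * r * s) * ((1 - (tanh s)\<^sup>2) * K) + - (2 * tanh s * bump s) * K * - exp (- 2 * r * s) =
        exp (- 2 * r * s) * (2 * r + 2 * tanh s) * (bump s * K)"
      unfolding bump_eq[symmetric] by (simp add: algebra_simps)
  qed
  have le: "norm (F X - F x) \<le> \<phi> X - \<phi> x" if "X > x" for X
  proof (rule differentiable_bound_general[OF that])
    have ax: "s \<ge> a" if "x \<le> s" for s using that assms(5) by simp
    show "continuous_on {x..X} F"
      by (rule continuous_on_vector_derivative, rule has_vector_derivative_at_within, rule dF, rule ax) simp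
    show "continuous_on {x..X} \<phi>"
      by (rule continuous_on_vector_derivative, rule has_vector_derivative_at_within, rule d\<phi>)
    show "(F has_vector_derivative exp (- 2 * \<kappa> * of_real s) * h s) (at s)" if "x < s" "s < X" for s
      using dF[of s] ax[of s] that by simp
    show "(\<phi> has_vector_derivative exp (- 2 * r * s) * (2 * r + 2 * tanh s) * (bump s * (H / (2 * r - 2)))) (at s)" for s
      by (rule d\<phi>)
    show "norm (exp (- 2 * \<kappa> * of_real s) * h s) \<le> exp (- 2 * r * s) * (2 * r + 2 * tanh s) * (bump s * (H / (2 * r - 2)))"
      if "x < s" "s < X" for s
    proof -
      have "norm (exp (- 2 * \<kappa> * of_real s) * h s) = exp (- 2 * r * s) * norm (h s)"
        by (simp add: norm_mult r_def)
      also have "\<dots> \<le> exp (- 2 * r * s) * (H * bump s)"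
        using assms(2)[of s] ax[of s] that by (intro mult_left_mono) auto
      also have "\<dots> = exp (- 2 * r * s) * (2 * r - 2) * (bump s * (H / (2 * r - 2)))"
        using r by simp
      also have "\<dots> \<le> exp (- 2 * r * s) * (2 * r + 2 * tanh s) * (bump s * (H / (2 * r - 2)))"
        using abs_tanh_le_1[of s] r H bump_pos[of s]
        by (intro mult_right_mono mult_left_mono) auto
      finally show ?thesis .
    qed
  qed
  have "norm (F x) \<le> - \<phi> x + exp (- 2 * r * X) * B" if "X > x" for X
  proof -
    have "\<phi> X \<le> 0"
      unfolding \<phi>_def using r H bump_pos[of X] by (simp add: bump_eq mult_nonneg_nonneg)
    moreover have "norm (F X) \<le> exp (- 2 * r * X) * B"
      unfolding nF using assms(3)[of X] that assms(5) by (intro mult_left_mono) auto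
    moreover have "norm (F x) \<le> norm (F X) + norm (F X - F x)"
      by (metis add.commute norm_minus_commute norm_triangle_sub)
    ultimately show ?thesis using le[OF that] by linarith
  qed
  then have ev: "eventually (\<lambda>X. norm (F x) \<le> - \<phi> x + exp (- 2 * r * X) * B) at_top"
    using eventually_gt_at_top[of x] by (rule eventually_mono[rotated])
  have "((\<lambda>X. - \<phi> x + exp (- 2 * r * X) * B) \<longlongrightarrow> - \<phi> x + 0 * B) at_top"
  proof (intro tendsto_intros)
    have "filterlim (\<lambda>X. - 2 * r * X) at_bot at_top"
      using r by (intro filterlim_tendsto_neg_mult_at_bot[OF tendsto_const _ filterlim_ident]) auto
    then show "((\<lambda>X. exp (- 2 * r * X)) \<longlongrightarrow> 0) at_top"
      by (rule filterlim_compose[OF exp_at_bot])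
  qed
  from tendsto_lowerbound[OF this ev] have "norm (F x) \<le> - \<phi> x" by simp
  also have "- \<phi> x = exp (- 2 * r * x) * (bump x * (H / (2 * r - 2)))"
    by (simp add: \<phi>_def bump_eq)
  finally have "norm (E' x) \<le> bump x * (H / (2 * r - 2))"
    unfolding nF by (simp only: mult_le_cancel_left_pos exp_gt_zero)
  \<comment> \<open>Here r \<ge> 2 gives r \<le> 2 r - 2.\<close>
  also have "\<dots> \<le> bump x * (H / r)"
    using r H bump_pos[of x] by (intro mult_left_mono divide_left_mono) auto
  finally show ?thesis by (simp add: r_def mult.commute)
qed

lemma bump_integral_bound:
  fixes E E' :: "real \<Rightarrow> complex"
  assumes "\<And>s. x \<le> s \<Longrightarrow> s \<le> y \<Longrightarrow> (E has_vector_derivative E' s) (at s)"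
    and "\<And>s. x \<le> s \<Longrightarrow> s \<le> y \<Longrightarrow> norm (E' s) \<le> B * bump s" "x \<le> y"
  shows "norm (E y - E x) \<le> B * (tanh y - tanh x)"
proof (cases "x = y")
  case False
  have "norm (E y - E x) \<le> B * tanh y - B * tanh x"
  proof (rule differentiable_bound_general)
    have dt: "((\<lambda>s. B * tanh s) has_vector_derivative B * bump s) (at s)" for s
      unfolding has_real_derivative_iff_has_vector_derivative[symmetric]
      by (rule DERIV_cmult[OF tanh_has_bump])
    show "((\<lambda>s. B * tanh s) has_vector_derivative B * bump s) (at s)" for s by (rule dt)
    show "continuous_on {x..y} E"
      by (rule continuous_on_vector_derivative, rule has_vector_derivative_at_within, rule assms(1)) auto
    show "continuous_on {x..y} (\<lambda>s. B * tanh s)"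
      by (rule continuous_on_vector_derivative, rule has_vector_derivative_at_within, rule dt)
    show "(E has_vector_derivative E' s) (at s)" "norm (E' s) \<le> B * bump s" if "x < s" "s < y" for s
      using assms that by auto
  qed (use assms False in auto)
  then show ?thesis by (simp add: algebra_simps)
qed simp

lemma bump_integral_bound':
  fixes E E' :: "real \<Rightarrow> complex"
  assumes "\<And>s. x \<le> s \<Longrightarrow> s \<le> y \<Longrightarrow> (E has_vector_derivative E' s) (at s)"
    and "\<And>s. x \<le> s \<Longrightarrow> s \<le> y \<Longrightarrow> norm (E' s) \<le> B * bump s" "x \<le> y"
  shows "norm (E y - E x) \<le> 2 * B"
proof -
  have "0 \<le> B * bump x" using assms(2)[of x] assms(3) norm_ge_zero[of "E' x"] by linarith
  then have "B \<ge> 0" using bump_pos[of x] by (simp add: zero_le_mult_iff)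
  then have "B * (tanh y - tanh x) \<le> B * 2"
    using abs_tanh_le_1[of x] abs_tanh_le_1[of y] by (intro mult_left_mono) linarith+
  then show ?thesis using bump_integral_bound[OF assms] by linarith
qed

text \<open>Starting from any finite bound \<open>B\<close>, the step above improves it to \<open>c + B / 2\<close>, so iteration
  brings it down to \<open>2 * c\<close>.\<close>

lemma volterra_contraction:
  fixes E E' h :: "real \<Rightarrow> complex"
  assumes up: "\<And>x y. x \<in> I \<Longrightarrow> x \<le> y \<Longrightarrow> y \<in> I"
    and dE': "\<And>x. x \<in> I \<Longrightarrow> (E' has_vector_derivative (2 * \<kappa> * E' x + h x)) (at x)"
    and h: "\<And>x. x \<in> I \<Longrightarrow> norm (h x) \<le> (Cf * norm (E x) + Cr) * bump x"
    and ap: "\<And>x. x \<in> I \<Longrightarrow> norm (E' x) \<le> B0 * bump x"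
    and fin: "\<And>B x. (\<And>y. y \<in> I \<Longrightarrow> norm (E' y) \<le> B * bump y) \<Longrightarrow> x \<in> I \<Longrightarrow> norm (E x) \<le> m + 2 * B"
    and C: "0 \<le> Cf" "0 \<le> Cr" "Re \<kappa> \<ge> 2" "Re \<kappa> \<ge> 4 * Cf"
    and x: "x \<in> I"
  shows "norm (E' x) \<le> 2 * (Cf * m + Cr) / Re \<kappa> * bump x"
proof -
  define r where "r = Re \<kappa>"
  define c where "c = (Cf * m + Cr) / r"
  have r: "r \<ge> 2" "r \<ge> 4 * Cf" using C by (auto simp: r_def)
  have improve: "norm (E' y) \<le> (c + B / 2) * bump y"
    if P: "\<And>y. y \<in> I \<Longrightarrow> norm (E' y) \<le> B * bump y" and y: "y \<in> I" for B y
  proof -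
    have "0 \<le> B * bump x" using P[OF x] norm_ge_zero[of "E' x"] by linarith
    then have B: "B \<ge> 0" using bump_pos[of x] by (simp add: zero_le_mult_iff)
    have "norm (E' y) \<le> (Cf * (m + 2 * B) + Cr) / r * bump y"
      unfolding r_def
    proof (rule volterra_step[where a = y and B = B and h = h])
      fix s assume "y \<le> s"
      then have s: "s \<in> I" using up y by blast
      show "(E' has_vector_derivative 2 * \<kappa> * E' s + h s) (at s)" by (rule dE'[OF s])
      have "Cf * norm (E s) \<le> Cf * (m + 2 * B)"
        using fin[OF P s] C by (intro mult_left_mono) auto
      then have "(Cf * norm (E s) + Cr) * bump s \<le> (Cf * (m + 2 * B) + Cr) * bump s"
        using bump_pos[of s] by (intro mult_right_mono) auto
      then show "norm (h s) \<le> (Cf * (m + 2 * B) + Cr) * bump s" using h[OF s] by linarith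
      have "B * bump s \<le> B * 1" using B bump_le_1[of s] by (intro mult_left_mono) auto
      then show "norm (E' s) \<le> B" using P[OF s] by linarith
    qed (use C in auto)
    also have "\<dots> \<le> (c + B / 2) * bump y"
    proof (intro mult_right_mono)
      \<comment> \<open>The part of the new bound that contains B is 2 Cf B / r, which r \<ge> 4 Cf
        keeps below B / 2.\<close>
      have "4 * Cf * B \<le> r * B" using r B by (intro mult_right_mono) auto
      then have "(Cf * (m + 2 * B) + Cr) / r \<le> (Cf * m + Cr + r * (B / 2)) / r"
        using r by (intro divide_right_mono) (auto simp: algebra_simps)
      also have "\<dots> = c + B / 2"
        using r by (simp add: c_def add_divide_distrib)
      finally show "(Cf * (m + 2 * B) + Cr) / r \<le> c + B / 2" .
    qed (use bump_pos[of y] in simp)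
    finally show ?thesis .
  qed
  have step: "norm (E' y) \<le> (2 * c + (B0 - 2 * c) / 2 ^ n) * bump y" if "y \<in> I" for n y
    using that
  proof (induction n arbitrary: y)
    case 0
    then show ?case using ap by simp
  next
    case (Suc n)
    have e: "c + (2 * c + (B0 - 2 * c) / 2 ^ n) / 2 = 2 * c + (B0 - 2 * c) / 2 ^ Suc n"
      by (simp add: field_simps)
    show ?case using improve[OF Suc.IH Suc.prems] by (simp only: e)
  qed
  have "(\<lambda>n. (2 * c + (B0 - 2 * c) / 2 ^ n) * bump x) \<longlonglongrightarrow> (2 * c + 0) * bump x"
    by (intro tendsto_intros LIMSEQ_divide_realpow_zero) auto
  then have "norm (E' x) \<le> (2 * c + 0) * bump x"
    by (rule LIMSEQ_le_const) (use step[OF x] in auto)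
  then show ?thesis by (simp add: c_def r_def)
qed



text \<open>The limits at +infinity make E and E' bounded by some constants, which start the
  contraction. These constants disappear as the iteration converges, and only the limit L of E is
  left.\<close>

lemma volterra_ray:
  fixes E E' h :: "real \<Rightarrow> complex"
  assumes dE: "\<And>x. x \<ge> a \<Longrightarrow> (E has_vector_derivative E' x) (at x)"
    and dE': "\<And>x. x \<ge> a \<Longrightarrow> (E' has_vector_derivative (2 * \<kappa> * E' x + h x)) (at x)"
    and h: "\<And>x. x \<ge> a \<Longrightarrow> norm (h x) \<le> (Cf * norm (E x) + Cr) * bump x"
    and lim: "(E \<longlongrightarrow> L) at_top" "(E' \<longlongrightarrow> 0) at_top"
    and C: "0 \<le> Cf" "0 \<le> Cr" "Re \<kappa> \<ge> 2" "Re \<kappa> \<ge> 4 * Cf" and x: "x \<ge> a"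
  shows "norm (E' x) \<le> 2 * (Cf * norm L + Cr) / Re \<kappa> * bump x"
proof -
  have bdd: "\<exists>M. \<forall>x\<ge>a. norm (F x) \<le> M"
    if "(F \<longlongrightarrow> l) at_top" "\<And>x. x \<ge> a \<Longrightarrow> (F has_vector_derivative F' x) (at x)"
    for F F' :: "real \<Rightarrow> complex" and l
  proof -
    have "((\<lambda>x. norm (F x)) \<longlongrightarrow> norm l) at_top"
      using that(1) by (rule tendsto_norm)
    then have "\<forall>\<^sub>F x in at_top. norm (F x) < norm l + 1"
      by (rule order_tendstoD) simp
    then obtain X where X: "\<And>x. x \<ge> X \<Longrightarrow> norm (F x) < norm l + 1"
      unfolding eventually_at_top_linorder by blast
    have "continuous_on {a..max a X} F"
      by (rule continuous_on_vector_derivative, rule has_vector_derivative_at_within, rule that(2)) auto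
    then have "bounded (F ` {a..max a X})"
      by (intro compact_imp_bounded compact_continuous_image) auto
    then obtain M where M: "\<And>x. x \<in> {a..max a X} \<Longrightarrow> norm (F x) \<le> M"
      unfolding bounded_iff by blast
    show ?thesis
    proof (intro exI allI impI)
      fix x assume "x \<ge> a"
      then show "norm (F x) \<le> max M (norm l + 1)"
        using X[of x] M[of x] by (cases "x \<ge> X") (auto simp: le_max_iff_disj)
    qed
  qed
  obtain M where M: "\<And>x. x \<ge> a \<Longrightarrow> norm (E x) \<le> M" using bdd[OF lim(1) dE] by blast
  obtain M' where M': "\<And>x. x \<ge> a \<Longrightarrow> norm (E' x) \<le> M'" using bdd[OF lim(2) dE'] by blast
  have h': "norm (h x) \<le> (Cf * M + Cr) * bump x" if "x \<ge> a" for x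
  proof -
    have "Cf * norm (E x) \<le> Cf * M" using C M[OF that] by (intro mult_left_mono) auto
    then have "(Cf * norm (E x) + Cr) * bump x \<le> (Cf * M + Cr) * bump x"
      using bump_pos[of x] by (intro mult_right_mono) auto
    then show ?thesis using h[OF that] by linarith
  qed
  have ap: "norm (E' x) \<le> (Cf * M + Cr) / Re \<kappa> * bump x" if "x \<ge> a" for x
    by (rule volterra_step[OF dE' h' M' C(3) that]) auto
  show ?thesis
  proof (rule volterra_contraction[where I = "{a..}" and E = E and h = h])
    fix B x assume B: "\<And>y. y \<in> {a..} \<Longrightarrow> norm (E' y) \<le> B * bump y" and "x \<in> {a..}"
    then have x: "x \<ge> a" by simp
    have "\<forall>\<^sub>F y in at_top. norm (E y - E x) \<le> 2 * B"
      using eventually_ge_at_top[of x]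
    proof eventually_elim
      case (elim y)
      show ?case by (rule bump_integral_bound'[OF dE]) (use elim x B in auto)
    qed
    then have "norm (L - E x) \<le> 2 * B"
      by (intro tendsto_upperbound[OF tendsto_norm[OF tendsto_diff[OF lim(1) tendsto_const]]]) auto
    then show "norm (E x) \<le> norm L + 2 * B"
      by (smt (verit) norm_minus_commute norm_triangle_sub)
  next
    show "norm (E' x) \<le> (Cf * M + Cr) / Re \<kappa> * bump x" if "x \<in> {a..}" for x
      using ap that by simp
  qed (use dE' h C x in auto)
qed

lemma volterra_line_bound:
  fixes E E' h :: "real \<Rightarrow> complex"
  assumes dE: "\<And>x. (E has_vector_derivative E' x) (at x)"
    and dE': "\<And>x. (E' has_vector_derivative (2 * \<kappa> * E' x + h x)) (at x)"
    and h: "\<And>x. norm (h x) \<le> (Cf * norm (E x) + Cr) * bump x"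
    and lim: "(E \<longlongrightarrow> L) at_top" "(E' \<longlongrightarrow> 0) at_top"
    and C: "0 \<le> Cf" "0 \<le> Cr" "Re \<kappa> \<ge> 2" "Re \<kappa> \<ge> 4 * Cf"
  shows "norm (E' x) \<le> 2 * (Cf * norm L + Cr) / Re \<kappa> * bump x"
  by (rule volterra_ray[where a = x, OF dE dE' h lim C]) auto

text \<open>E varies by at most B times the variation of tanh, which converges at -infinity.\<close>

lemma bump_limit_at_bot:
  fixes E E' :: "real \<Rightarrow> complex"
  assumes dE: "\<And>x. (E has_vector_derivative E' x) (at x)" and B: "\<And>x. norm (E' x) \<le> B * bump x"
  obtains L where "(E \<longlongrightarrow> L) at_bot" "\<And>x. norm (E x - L) \<le> 2 * B"
proof -
  have d: "norm (E y - E x) \<le> B * (tanh y - tanh x)" if "x \<le> y" for x y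
    using bump_integral_bound[of x y E E' B] dE B that by blast
  have tb: "((\<lambda>x. tanh (x::real)) \<longlongrightarrow> - 1) at_bot" by (rule tanh_real_at_bot)
  have nb: "filterlim (\<lambda>n. - real n) at_bot sequentially"
    by (simp add: filterlim_uminus_at_bot filterlim_real_sequentially)
  have B0: "B \<ge> 0"
  proof -
    have "0 \<le> B * bump 0" using B[of 0] norm_ge_zero[of "E' 0"] by linarith
    then show ?thesis using bump_pos[of 0] by (simp add: zero_le_mult_iff)
  qed
  have "Cauchy (\<lambda>n. tanh (- real n))"
    using filterlim_compose[OF tb nb] by (rule LIMSEQ_imp_Cauchy)
  have "Cauchy (\<lambda>n. E (- real n))"
  proof (rule CauchyI)
    fix e :: real assume e: "e > 0"
    then have "e / (B + 1) > 0" using B0 by simp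
    then obtain M where M: "\<And>m n. m \<ge> M \<Longrightarrow> n \<ge> M \<Longrightarrow> norm (tanh (- real m) - tanh (- real n)) < e / (B + 1)"
      using CauchyD[OF \<open>Cauchy (\<lambda>n. tanh (- real n))\<close>] by blast
    have key: "norm (E (- real m) - E (- real n)) < e" if "m \<ge> M" "n \<ge> M" "m \<le> n" for m n
    proof -
      have "norm (E (- real m) - E (- real n)) \<le> B * (tanh (- real m) - tanh (- real n))"
        using that(3) by (intro d) auto
      also have "\<dots> \<le> B * \<bar>tanh (- real m) - tanh (- real n)\<bar>"
        using B0 by (intro mult_left_mono) auto
      also have "\<dots> \<le> (B + 1) * \<bar>tanh (- real m) - tanh (- real n)\<bar>"
        by (intro mult_right_mono) auto
      also have "\<dots> < (B + 1) * (e / (B + 1))"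
        using M[OF that(1,2)] B0 by (intro mult_strict_left_mono) auto
      finally show ?thesis using B0 by simp
    qed
    show "\<exists>M. \<forall>m\<ge>M. \<forall>n\<ge>M. norm (E (- real m) - E (- real n)) < e"
    proof (intro exI allI impI)
      fix m n assume "m \<ge> M" "n \<ge> M"
      then show "norm (E (- real m) - E (- real n)) < e"
        using key[of m n] key[of n m] by (cases "m \<le> n") (auto simp: norm_minus_commute)
    qed
  qed
  then obtain L where L: "(\<lambda>n. E (- real n)) \<longlonglongrightarrow> L"
    using Cauchy_convergent_iff convergent_def by blast
  have near: "norm (E x - L) \<le> B * (tanh x - (- 1))" for x
  proof (rule tendsto_le[OF _ _ tendsto_norm[OF tendsto_diff[OF tendsto_const L]]])
    show "(\<lambda>n. B * (tanh x - tanh (- real n))) \<longlonglongrightarrow> B * (tanh x - (- 1))"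
      by (intro tendsto_intros filterlim_compose[OF tb nb])
    have "\<forall>\<^sub>F n in sequentially. - real n \<le> x"
      using nb unfolding filterlim_at_bot by blast
    then show "\<forall>\<^sub>F n in sequentially. norm (E x - E (- real n)) \<le> B * (tanh x - tanh (- real n))"
      by eventually_elim (rule d)
  qed auto
  have "((\<lambda>x. B * (tanh x - (- 1))) \<longlongrightarrow> B * (- 1 - (- 1))) at_bot"
    by (intro tendsto_intros tb)
  then have "((\<lambda>x. E x - L) \<longlongrightarrow> 0) at_bot"
    by (intro Lim_null_comparison[of "\<lambda>x. E x - L" "\<lambda>x. B * (tanh x - (- 1))"] always_eventually allI near) simp
  then have "(E \<longlongrightarrow> L) at_bot"
    by (simp add: LIM_zero_iff)
  moreover have "norm (E x - L) \<le> 2 * B" for x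
  proof -
    have "B * (tanh x - (- 1)) \<le> B * 2"
      using B0 abs_tanh_le_1[of x] by (intro mult_left_mono) auto
    then show ?thesis using near[of x] by linarith
  qed
  ultimately show ?thesis using that by blast
qed

text \<open>The same contraction anchored at the other end. When L' = 0 only the forcing constant
  \<open>Cr\<close> is left, so the remainder is as small as the residual of the series divided by
  Re \<kappa>. The bound obtained from +infinity serves as a starting value.\<close>

lemma volterra_line_from_bot:
  fixes E E' h :: "real \<Rightarrow> complex"
  assumes dE: "\<And>x. (E has_vector_derivative E' x) (at x)"
    and dE': "\<And>x. (E' has_vector_derivative (2 * \<kappa> * E' x + h x)) (at x)"
    and h: "\<And>x. norm (h x) \<le> (Cf * norm (E x) + Cr) * bump x"
    and lim: "(E \<longlongrightarrow> L) at_top" "(E' \<longlongrightarrow> 0) at_top" "(E \<longlongrightarrow> L') at_bot"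
    and C: "0 \<le> Cf" "0 \<le> Cr" "Re \<kappa> \<ge> 2" "Re \<kappa> \<ge> 4 * Cf"
  shows "norm (E x - L') \<le> 4 * (Cf * norm L' + Cr) / Re \<kappa>"
    and "norm (E' x) \<le> 2 * (Cf * norm L' + Cr) / Re \<kappa> * bump x"
proof -
  have near: "norm (E x - L') \<le> 2 * B" if B: "\<And>y. norm (E' y) \<le> B * bump y" for B x
  proof -
    have "\<forall>\<^sub>F y in at_bot. norm (E x - E y) \<le> 2 * B"
      using eventually_le_at_bot[of x]
    proof eventually_elim
      case (elim y)
      show ?case by (rule bump_integral_bound'[OF dE]) (use elim B in auto)
    qed
    then show ?thesis
      by (intro tendsto_upperbound[OF tendsto_norm[OF tendsto_diff[OF tendsto_const lim(3)]]]) auto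
  qed
  have b: "norm (E' x) \<le> 2 * (Cf * norm L' + Cr) / Re \<kappa> * bump x" for x
  proof (rule volterra_contraction[where I = UNIV and E = E and h = h])
    fix B x assume "\<And>y. y \<in> UNIV \<Longrightarrow> norm (E' y) \<le> B * bump y"
    then have "norm (E x - L') \<le> 2 * B" by (intro near) auto
    then show "norm (E x) \<le> norm L' + 2 * B"
      using norm_triangle_sub[of "E x" L'] by linarith
  next
    show "norm (E' x) \<le> 2 * (Cf * norm L + Cr) / Re \<kappa> * bump x" for x
      by (rule volterra_line_bound[OF dE dE' h lim(1,2) C])
  qed (use dE' h C in auto)
  show "norm (E x - L') \<le> 4 * (Cf * norm L' + Cr) / Re \<kappa>"
    using near[OF b, of x] by simp
  show "norm (E' x) \<le> 2 * (Cf * norm L' + Cr) / Re \<kappa> * bump x"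
    by (rule b)
qed

section \<open>Uniform bounds away from the singularities\<close>

lemma norm_sinh_cosh_sq:
  "norm (sinh z) ^ 2 = sinh (Re z) ^ 2 + sin (Im z) ^ 2"
  "norm (cosh z) ^ 2 = sinh (Re z) ^ 2 + cos (Im z) ^ 2"
proof -
  have c: "(cosh (Re z))\<^sup>2 = 1 + (sinh (Re z))\<^sup>2" "(cos (Im z))\<^sup>2 = 1 - (sin (Im z))\<^sup>2"
    by (simp_all add: cosh_square_eq cos_squared_eq)
  show "norm (sinh z) ^ 2 = sinh (Re z) ^ 2 + sin (Im z) ^ 2"
    "norm (cosh z) ^ 2 = sinh (Re z) ^ 2 + cos (Im z) ^ 2"
    unfolding cmod_power2 Re_Im_sinh_cosh power_mult_distrib c by (simp_all add: algebra_simps)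
qed

text \<open>c bounds |s| from below near a singularity and |sinh x| does so far out; together they
  dominate a multiple of cosh x, which compares 1/s^2 with \<open>bump\<close> uniformly.\<close>

lemma inverse_sq_bound:
  assumes "0 < c" "c \<le> 1" "c \<le> norm s" "norm s ^ 2 \<ge> sinh x ^ 2"
  shows "norm (1 / s ^ 2 :: complex) \<le> 2 / c\<^sup>2 * bump x" "norm (1 / s ^ 2) \<le> 1 / c\<^sup>2"
proof -
  have s: "norm s ^ 2 > 0" using assms by auto
  have c2: "c\<^sup>2 \<le> norm s ^ 2" "c\<^sup>2 \<le> 1" "c\<^sup>2 > 0"
    using assms by (auto intro!: power_mono simp: power_le_one)
  have "c\<^sup>2 * (cosh x)\<^sup>2 = c\<^sup>2 + c\<^sup>2 * sinh x ^ 2"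
    by (simp add: cosh_square_eq algebra_simps)
  also have "\<dots> \<le> norm s ^ 2 + 1 * norm s ^ 2"
    using c2 assms by (intro add_mono mult_mono) auto
  finally have "c\<^sup>2 * (cosh x)\<^sup>2 \<le> 2 * norm s ^ 2" by simp
  then show "norm (1 / s ^ 2) \<le> 2 / c\<^sup>2 * bump x"
    using s c2 cosh_real_pos[of x] by (simp add: norm_divide norm_power bump_def field_simps)
  show "norm (1 / s ^ 2) \<le> 1 / c\<^sup>2"
    using s c2 by (simp add: norm_divide norm_power frac_le)
qed

definition away :: "real \<Rightarrow> complex \<Rightarrow> bool" where
  "away c z \<longleftrightarrow> c \<le> norm (sinh z) \<and> c \<le> norm (cosh z)"

lemma away_bounds:
  assumes "0 < c" "c \<le> 1" "away c z"
  shows "sinh z \<noteq> 0" "cosh z \<noteq> 0"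
    "norm (1 / sinh z ^ 2) \<le> 2 / c\<^sup>2 * bump (Re z)" "norm (1 / cosh z ^ 2) \<le> 2 / c\<^sup>2 * bump (Re z)"
    "norm (exp z / sinh z) \<le> 2 + 1 / c" "norm (exp z / cosh z) \<le> 2 + 1 / c"
proof -
  show nz: "sinh z \<noteq> 0" "cosh z \<noteq> 0" using assms by (auto simp: away_def)
  note b = inverse_sq_bound[OF assms(1,2), of "sinh z" "Re z"] inverse_sq_bound[OF assms(1,2), of "cosh z" "Re z"]
  have a: "c \<le> norm (sinh z)" "c \<le> norm (cosh z)" "sinh (Re z) ^ 2 \<le> norm (sinh z) ^ 2" "sinh (Re z) ^ 2 \<le> norm (cosh z) ^ 2"
    using assms(3) unfolding away_def norm_sinh_cosh_sq by auto
  show "norm (1 / sinh z ^ 2) \<le> 2 / c\<^sup>2 * bump (Re z)" "norm (1 / cosh z ^ 2) \<le> 2 / c\<^sup>2 * bump (Re z)"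
    using b a by auto
  \<comment> \<open>Applied to coth z and tanh z, whose squares differ from 1 by 1/sinh^2 and
    -1/cosh^2.\<close>
  have q: "norm y \<le> 1 + 1 / c" if "norm (y\<^sup>2 - 1) \<le> 1 / c\<^sup>2" for y :: complex
  proof -
    have "norm y ^ 2 \<le> norm (y\<^sup>2 - 1) + 1"
      using norm_triangle_ineq[of "y\<^sup>2 - 1" 1] by (simp add: norm_power)
    also have "\<dots> \<le> 1 / c\<^sup>2 + 2 / c + 1"
      using that divide_pos_pos[of 2 c] assms(1) by linarith
    also have "1 / c\<^sup>2 + 2 / c + 1 = (1 + 1 / c)\<^sup>2"
      by (simp add: power2_sum power_divide)
    finally have "norm y ^ 2 \<le> (1 + 1 / c)\<^sup>2" .
    then show ?thesis by (rule power2_le_imp_le) (use assms(1) in simp)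
  qed
  have "(cosh z / sinh z)\<^sup>2 - 1 = 1 / sinh z ^ 2"
  proof -
    have "(cosh z / sinh z)\<^sup>2 - 1 = (cosh z ^ 2 - sinh z ^ 2) / sinh z ^ 2"
      using nz by (simp add: power_divide diff_divide_distrib)
    also have "cosh z ^ 2 - sinh z ^ 2 = 1" by (simp add: cosh_sq_complex)
    finally show ?thesis .
  qed
  moreover have "norm ((sinh z / cosh z)\<^sup>2 - 1) = norm (1 / cosh z ^ 2)"
  proof -
    have "(sinh z / cosh z)\<^sup>2 - 1 = (sinh z ^ 2 - cosh z ^ 2) / cosh z ^ 2"
      using nz by (simp add: power_divide diff_divide_distrib)
    also have "sinh z ^ 2 - cosh z ^ 2 = - 1" by (simp add: cosh_sq_complex)
    finally show ?thesis by (simp add: norm_divide)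
  qed
  ultimately have "norm (cosh z / sinh z) \<le> 1 + 1 / c" "norm (sinh z / cosh z) \<le> 1 + 1 / c"
    using b a by (auto intro!: q)
  then show "norm (exp z / sinh z) \<le> 2 + 1 / c" "norm (exp z / cosh z) \<le> 2 + 1 / c"
    unfolding exp_over_sinh_cosh(1,2)[OF nz]
    using norm_triangle_ineq[of 1 "cosh z / sinh z"] norm_triangle_ineq[of 1 "sinh z / cosh z"] by auto
qed

lemma pot_bound:
  assumes "0 < c" "c \<le> 1" "away c z" "norm \<alpha> \<le> A" "norm \<beta> \<le> A"
  shows "norm (pot \<alpha> \<beta> z) \<le> 4 * (A\<^sup>2 + 1) / c\<^sup>2 * bump (Re z)"
proof -
  have q: "norm (x\<^sup>2 - 1/4) \<le> A\<^sup>2 + 1" if "norm x \<le> A" for x :: complex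
  proof -
    have "norm (x\<^sup>2 - 1/4) \<le> norm (x\<^sup>2) + norm (1/4 :: complex)" by (rule norm_triangle_ineq4)
    also have "\<dots> \<le> A\<^sup>2 + 1" using that by (auto simp: norm_power norm_divide intro!: add_mono power_mono)
    finally show ?thesis .
  qed
  have "norm (pot \<alpha> \<beta> z) \<le> norm ((\<alpha>\<^sup>2 - 1/4) * (1 / sinh z ^ 2)) + norm ((\<beta>\<^sup>2 - 1/4) * (1 / cosh z ^ 2))"
    unfolding pot_def by (simp add: norm_triangle_ineq4)
  also have "\<dots> \<le> (A\<^sup>2 + 1) * (2 / c\<^sup>2 * bump (Re z)) + (A\<^sup>2 + 1) * (2 / c\<^sup>2 * bump (Re z))"
    unfolding norm_mult using q[OF assms(4)] q[OF assms(5)] away_bounds(3,4)[OF assms(1-3)]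
    by (intro add_mono mult_mono) auto
  also have "\<dots> = 4 * (A\<^sup>2 + 1) / c\<^sup>2 * bump (Re z)" by (simp add: field_simps)
  finally show ?thesis .
qed

lemma a_coeff_bound: "\<exists>K\<ge>0. \<forall>\<mu>. norm \<mu> \<le> A \<longrightarrow> norm (a_coeff l \<mu>) \<le> K"
proof (induction l)
  case 0
  then show ?case by (intro exI[of _ 1]) (simp add: a_coeff_def)
next
  case (Suc l)
  then obtain K where K: "K \<ge> 0" "\<And>\<mu>. norm \<mu> \<le> A \<Longrightarrow> norm (a_coeff l \<mu>) \<le> K" by blast
  define D where "D = (real l + 1/2)\<^sup>2 + A\<^sup>2"
  show ?case
  proof (intro exI[of _ "K * D"] conjI allI impI)
    show "K * D \<ge> 0" using K by (simp add: D_def)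
    fix \<mu> :: complex assume \<mu>: "norm \<mu> \<le> A"
    have "norm ((of_nat l + 1/2)\<^sup>2 - \<mu>\<^sup>2) \<le> norm ((of_nat l + 1/2 :: complex)\<^sup>2) + norm (\<mu>\<^sup>2)"
      by (rule norm_triangle_ineq4)
    also have "(of_nat l + 1/2 :: complex) = of_real (real l + 1/2)" by simp
    also have "norm (of_real (real l + 1/2) ^ 2 :: complex) + norm (\<mu>\<^sup>2) \<le> D"
      unfolding D_def norm_power norm_of_real using \<mu> by (intro add_mono power_mono) auto
    finally have "norm (a_coeff l \<mu> * ((of_nat l + 1/2)\<^sup>2 - \<mu>\<^sup>2)) \<le> K * D"
      unfolding norm_mult using K \<mu> by (intro mult_mono) auto
    then have le: "2 * real (Suc l) * norm (a_coeff (Suc l) \<mu>) \<le> K * D"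
      unfolding a_coeff_Suc norm_mult norm_minus_cancel norm_of_nat by simp
    have "norm (a_coeff (Suc l) \<mu>) \<le> 2 * real (Suc l) * norm (a_coeff (Suc l) \<mu>)"
      using mult_right_mono[of 1 "2 * real (Suc l)" "norm (a_coeff (Suc l) \<mu>)"] by simp
    then show "norm (a_coeff (Suc l) \<mu>) \<le> K * D" using le by linarith
  qed
qed

lemma a_coeff_bound_upto: "\<exists>K\<ge>0. \<forall>l\<le>n. \<forall>\<mu>. norm \<mu> \<le> A \<longrightarrow> norm (a_coeff l \<mu>) \<le> K"
proof (induction n)
  case 0
  then show ?case using a_coeff_bound[of A 0] by auto
next
  case (Suc n)
  then obtain K where K: "K \<ge> 0" "\<And>l \<mu>. l \<le> n \<Longrightarrow> norm \<mu> \<le> A \<Longrightarrow> norm (a_coeff l \<mu>) \<le> K" by blast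
  obtain K' where K': "K' \<ge> 0" "\<And>\<mu>. norm \<mu> \<le> A \<Longrightarrow> norm (a_coeff (Suc n) \<mu>) \<le> K'"
    using a_coeff_bound[of A "Suc n"] by blast
  show ?case
  proof (intro exI[of _ "max K K'"] conjI allI impI)
    fix l \<mu> assume "l \<le> Suc n" "norm (\<mu>::complex) \<le> A"
    then show "norm (a_coeff l \<mu>) \<le> max K K'"
      using K(2)[of l \<mu>] K'(2)[of \<mu>] by (cases "l = Suc n") (auto simp: le_max_iff_disj)
  qed (use K in auto)
qed

text \<open>The decay of g_n' comes from pairing one factor p with 2 - p, or q with 2 - q: these
  products are -1/sinh^2 and 1/cosh^2. For l = 0 no factor p is at hand, but then the coefficient l
  vanishes.\<close>

lemma g_bounds:
  assumes c: "0 < c" "c \<le> 1"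
  shows "\<exists>K\<ge>0. \<forall>z \<alpha> \<beta>. away c z \<and> norm \<alpha> \<le> A \<and> norm \<beta> \<le> A \<longrightarrow>
    norm (g_coeff n z \<alpha> \<beta>) \<le> K \<and> norm (g_deriv n z \<alpha> \<beta>) \<le> K * bump (Re z)"
proof -
  obtain K where K: "K \<ge> 0" "\<And>l \<mu>. l \<le> n \<Longrightarrow> norm \<mu> \<le> A \<Longrightarrow> norm (a_coeff l \<mu>) \<le> K"
    using a_coeff_bound_upto[of n A] by blast
  define M where "M = 2 + 1 / c"
  have M: "M \<ge> 1" using c by (simp add: M_def)
  define D where "D = (\<Sum>l\<le>n. K * K * (M ^ n * (real n * (2 / c\<^sup>2) + real n * (2 / c\<^sup>2))))"
  define D0 where "D0 = (\<Sum>l\<le>n. K * K * M ^ n)"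
  show ?thesis
  proof (intro exI[of _ "D + D0"] conjI allI impI)
    show "D + D0 \<ge> 0" using K M c by (auto simp: D_def D0_def intro!: add_nonneg_nonneg mult_nonneg_nonneg)
    fix z \<alpha> \<beta> :: complex assume as: "away c z \<and> norm \<alpha> \<le> A \<and> norm \<beta> \<le> A"
    define p where "p = exp z / sinh z"
    define q where "q = exp z / cosh z"
    have nz: "sinh z \<noteq> 0" "cosh z \<noteq> 0" using away_bounds[OF c] as by auto
    have pq: "norm p \<le> M" "norm q \<le> M" using away_bounds(5,6)[OF c] as by (auto simp: p_def q_def M_def)
    define k where "k = 2 / c\<^sup>2 * bump (Re z)"
    have k: "k \<ge> 0" using bump_pos[of "Re z"] by (simp add: k_def)
    have pq2: "norm (p * (2 - p)) \<le> k" "norm (q * (2 - q)) \<le> k"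
    proof -
      have "p * (2 - p) = - (p * (p - 2))" "q * (2 - q) = - (q * (q - 2))" by (simp_all add: algebra_simps)
      then have "p * (2 - p) = - (1 / sinh z ^ 2)" "q * (2 - q) = 1 / cosh z ^ 2"
        using exp_over_sinh_cosh(4,5)[OF nz] by (auto simp: p_def q_def)
      then show "norm (p * (2 - p)) \<le> k" "norm (q * (2 - q)) \<le> k"
        using away_bounds(3,4)[OF c, of z] as by (auto simp: k_def)
    qed
    have pw: "norm p ^ i * norm q ^ j \<le> M ^ n" if "i + j \<le> n" for i j
    proof -
      have "norm p ^ i * norm q ^ j \<le> M ^ i * M ^ j" using pq M by (intro mult_mono power_mono) auto
      also have "\<dots> = M ^ (i + j)" by (simp add: power_add)
      also have "\<dots> \<le> M ^ n" using that M by (intro power_increasing) auto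
      finally show ?thesis .
    qed
    have "norm (g_coeff n z \<alpha> \<beta>) \<le> D0"
      unfolding g_coeff_def D0_def p_def[symmetric] q_def[symmetric]
    proof (intro sum_norm_le)
      fix l assume "l \<in> {..n}"
      then have l: "l \<le> n" by simp
      have "norm (a_coeff l \<alpha>) * norm (a_coeff (n - l) \<beta>) * (norm p ^ l * norm q ^ (n - l)) \<le> K * K * M ^ n"
        using K l as pw[of l "n - l"] by (intro mult_mono) auto
      then show "norm (a_coeff l \<alpha> * a_coeff (n - l) \<beta> * p ^ l * q ^ (n - l)) \<le> K * K * M ^ n"
        by (simp add: norm_mult norm_power mult_ac)
    qed
    moreover have "norm (g_deriv n z \<alpha> \<beta>) \<le> D * bump (Re z)"
    proof -
      have t: "norm (x ^ i * y ^ j * (of_nat i * (2 - x))) \<le> M ^ n * (real n * k)"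
        if "i + j \<le> n" "norm x \<le> M" "norm y \<le> M" "norm (x * (2 - x)) \<le> k" for x y :: complex and i j
      proof (cases i)
        case (Suc i')
        have "norm (x ^ i * y ^ j * (of_nat i * (2 - x))) = (norm x ^ i' * norm y ^ j) * (real i * norm (x * (2 - x)))"
          unfolding Suc by (simp add: norm_mult norm_power mult_ac del: of_nat_Suc)
        also have "\<dots> \<le> M ^ n * (real n * k)"
        proof (intro mult_mono)
          have "norm x ^ i' * norm y ^ j \<le> M ^ i' * M ^ j" using that M by (intro mult_mono power_mono) auto
          also have "\<dots> = M ^ (i' + j)" by (simp add: power_add)
          also have "\<dots> \<le> M ^ n" using that(1) Suc M by (intro power_increasing) auto
          finally show "norm x ^ i' * norm y ^ j \<le> M ^ n" .
        qed (use that k M in auto)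
        finally show ?thesis .
      qed (use k M in simp)
      have "norm (g_deriv n z \<alpha> \<beta>) \<le> (\<Sum>l\<le>n. K * K * (M ^ n * (real n * k) + M ^ n * (real n * k)))"
        unfolding g_deriv_def p_def[symmetric] q_def[symmetric]
      proof (intro sum_norm_le)
        fix l assume "l \<in> {..n}"
        then have l: "l \<le> n" by simp
        have "norm (p ^ l * q ^ (n - l) * (of_nat l * (2 - p) + of_nat (n - l) * (2 - q))) \<le>
            norm (p ^ l * q ^ (n - l) * (of_nat l * (2 - p))) + norm (q ^ (n - l) * p ^ l * (of_nat (n - l) * (2 - q)))"
          by (metis (no_types, lifting) distrib_left mult.commute norm_triangle_ineq)
        also have "\<dots> \<le> M ^ n * (real n * k) + M ^ n * (real n * k)"
          using l pq pq2 by (intro add_mono t) auto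
        finally show "norm (a_coeff l \<alpha> * a_coeff (n - l) \<beta> * (p ^ l * q ^ (n - l) * (of_nat l * (2 - p) + of_nat (n - l) * (2 - q))))
           \<le> K * K * (M ^ n * (real n * k) + M ^ n * (real n * k))"
          unfolding norm_mult[of "a_coeff l \<alpha> * a_coeff (n - l) \<beta>"] norm_mult[of "a_coeff l \<alpha>"]
          using K l as by (intro mult_mono) auto
      qed
      also have "\<dots> = D * bump (Re z)"
        unfolding D_def sum_distrib_right k_def by (intro sum.cong refl) (simp add: algebra_simps)
      finally show ?thesis .
    qed
    moreover have "D \<ge> 0" "D0 \<ge> 0" using K M c by (auto simp: D_def D0_def intro!: add_nonneg_nonneg mult_nonneg_nonneg)
    moreover have "D * bump (Re z) \<le> (D + D0) * bump (Re z)"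
      using bump_pos[of "Re z"] \<open>D0 \<ge> 0\<close> by (intro mult_right_mono) auto
    ultimately show "norm (g_coeff n z \<alpha> \<beta>) \<le> D + D0" "norm (g_deriv n z \<alpha> \<beta>) \<le> (D + D0) * bump (Re z)"
      by linarith+
  qed
qed



section \<open>Ladder operators\<close>

text \<open>Raises the degree \<nu> by one, that is w by 2: the differential form of the contiguous
  relations of Jacobi functions, carried over to the Schroedinger normal form.\<close>

definition ladder :: "complex \<Rightarrow> complex \<Rightarrow> (complex \<Rightarrow> complex) \<Rightarrow> complex \<Rightarrow> complex" where
  "ladder w r u z = sinh (2 * z) * deriv u z + (w * cosh (2 * z) + r) * u z"

text \<open>Since w enters only through its square, the lowering operator for w + 2 is the raising
  operator for -(w + 2).\<close>

lemma schroedinger_on_minus: "schroedinger_on (- w) \<alpha> \<beta> S u = schroedinger_on w \<alpha> \<beta> S u"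
  by (simp add: schroedinger_on_def)

lemma DERIV_pot:
  fixes z :: complex
  assumes "sinh z \<noteq> 0" "cosh z \<noteq> 0"
  shows "(pot \<alpha> \<beta> has_field_derivative
    (\<alpha>\<^sup>2 - 1/4) * (- 2 * cosh z / sinh z ^ 3) - (\<beta>\<^sup>2 - 1/4) * (- 2 * sinh z / cosh z ^ 3)) (at z)"
proof -
  have 1: "((\<lambda>z. 1 / sinh z ^ 2) has_field_derivative - 2 * cosh z / sinh z ^ 3) (at z)"
    using assms by (auto intro!: derivative_eq_intros simp: field_simps power2_eq_square power3_eq_cube)
  have 2: "((\<lambda>z. 1 / cosh z ^ 2) has_field_derivative - 2 * sinh z / cosh z ^ 3) (at z)"
    using assms by (auto intro!: derivative_eq_intros simp: field_simps power2_eq_square power3_eq_cube)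
  have "pot \<alpha> \<beta> = (\<lambda>z. (\<alpha>\<^sup>2 - 1/4) * (1 / sinh z ^ 2) - (\<beta>\<^sup>2 - 1/4) * (1 / cosh z ^ 2))"
    by (simp add: pot_def fun_eq_iff)
  then show ?thesis
    using DERIV_diff[OF DERIV_cmult[OF 1] DERIV_cmult[OF 2]] by simp
qed

text \<open>The second identity says that sinh^2 (2 z) times the potential is affine in cosh (2 z).
  The first is its derivative divided by sinh (2 z).\<close>

lemma pot_ladder_identity:
  fixes z :: complex
  assumes "sinh z \<noteq> 0" "cosh z \<noteq> 0"
  shows "sinh (2 * z) * ((\<alpha>\<^sup>2 - 1/4) * (- 2 * cosh z / sinh z ^ 3) - (\<beta>\<^sup>2 - 1/4) * (- 2 * sinh z / cosh z ^ 3))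
      + 4 * cosh (2 * z) * pot \<alpha> \<beta> z = 4 * (\<alpha>\<^sup>2 - \<beta>\<^sup>2)"
    and "sinh (2 * z) ^ 2 * pot \<alpha> \<beta> z = 2 * (\<alpha>\<^sup>2 - \<beta>\<^sup>2) * cosh (2 * z) + 2 * (\<alpha>\<^sup>2 + \<beta>\<^sup>2 - 1/2)"
proof -
  define s where "s = sinh z"
  define c where "c = cosh z"
  have sc: "s \<noteq> 0" "c \<noteq> 0" "c\<^sup>2 = 1 + s\<^sup>2"
    using assms cosh_sq_complex[of z] by (auto simp: s_def c_def)
  have dbl: "sinh (2 * z) = 2 * s * c" "cosh (2 * z) = c\<^sup>2 + s\<^sup>2"
    by (simp_all add: s_def c_def sinh_double cosh_double)
  define A where "A = \<alpha>\<^sup>2 - 1/4"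
  define B where "B = \<beta>\<^sup>2 - 1/4"
  have p: "pot \<alpha> \<beta> z = A / s\<^sup>2 - B / c\<^sup>2" by (simp add: pot_def A_def B_def s_def c_def)
  have i1: "2 * s * c * (- 2 * c / s ^ 3) = - 4 * (c\<^sup>2 / s\<^sup>2)" "2 * s * c * (- 2 * s / c ^ 3) = - 4 * (s\<^sup>2 / c\<^sup>2)"
    using sc(1,2) by (simp_all add: field_simps power2_eq_square power3_eq_cube)
  have i2: "(c\<^sup>2 + s\<^sup>2) / s\<^sup>2 = c\<^sup>2 / s\<^sup>2 + 1" "(c\<^sup>2 + s\<^sup>2) / c\<^sup>2 = 1 + s\<^sup>2 / c\<^sup>2"
    using sc(1,2) by (simp_all add: add_divide_distrib)
  have "sinh (2 * z) * (A * (- 2 * c / s ^ 3) - B * (- 2 * s / c ^ 3)) + 4 * cosh (2 * z) * pot \<alpha> \<beta> z =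
     A * (2 * s * c * (- 2 * c / s ^ 3)) - B * (2 * s * c * (- 2 * s / c ^ 3)) + 4 * A * ((c\<^sup>2 + s\<^sup>2) / s\<^sup>2) - 4 * B * ((c\<^sup>2 + s\<^sup>2) / c\<^sup>2)"
  proof -
    have "T * (A * X - B * Y) + 4 * C * (A / x - B / y) = A * (T * X) - B * (T * Y) + 4 * A * (C / x) - 4 * B * (C / y)"
      for T X Y C x y :: complex by (simp add: divide_inverse algebra_simps)
    then show ?thesis unfolding dbl p .
  qed
  also have "\<dots> = 4 * (A - B)"
    unfolding i1 i2 by (simp add: algebra_simps)
  finally show "sinh (2 * z) * ((\<alpha>\<^sup>2 - 1/4) * (- 2 * cosh z / sinh z ^ 3) - (\<beta>\<^sup>2 - 1/4) * (- 2 * sinh z / cosh z ^ 3))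
      + 4 * cosh (2 * z) * pot \<alpha> \<beta> z = 4 * (\<alpha>\<^sup>2 - \<beta>\<^sup>2)"
    by (simp add: A_def B_def s_def c_def)
  have "sinh (2 * z) ^ 2 * pot \<alpha> \<beta> z = 4 * A * c\<^sup>2 - 4 * B * s\<^sup>2"
    unfolding dbl p using sc(1,2) by (simp add: power_mult_distrib right_diff_distrib)
  also have "\<dots> = 2 * (\<alpha>\<^sup>2 - \<beta>\<^sup>2) * cosh (2 * z) + 2 * (\<alpha>\<^sup>2 + \<beta>\<^sup>2 - 1/2)"
    unfolding dbl sc(3) A_def B_def by (simp add: field_simps)
  finally show "sinh (2 * z) ^ 2 * pot \<alpha> \<beta> z = 2 * (\<alpha>\<^sup>2 - \<beta>\<^sup>2) * cosh (2 * z) + 2 * (\<alpha>\<^sup>2 + \<beta>\<^sup>2 - 1/2)" .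
qed

text \<open>The condition on r removes the term in u that would otherwise spoil the new equation.
  Lowering again returns a multiple of u, the usual factorisation of the second-order
  operator.\<close>

lemma ladder_raises:
  assumes u: "schroedinger_on w \<alpha> \<beta> S u" and S: "open S" "\<And>z. z \<in> S \<Longrightarrow> sinh z \<noteq> 0 \<and> cosh z \<noteq> 0"
    and r: "r * (w + 1) = \<alpha>\<^sup>2 - \<beta>\<^sup>2"
  shows "schroedinger_on (w + 2) \<alpha> \<beta> S (ladder w r u)"
    and "z \<in> S \<Longrightarrow> ladder (- (w + 2)) (- r) (ladder w r u) z = (2 * (\<alpha>\<^sup>2 + \<beta>\<^sup>2) - (w + 1)\<^sup>2 - r\<^sup>2) * u z"
proof -
  define v where "v = (\<lambda>z. ((w + 2) * cosh (2 * z) + r) * deriv u z + sinh (2 * z) * (w\<^sup>2 + 2 * w + pot \<alpha> \<beta> z) * u z)"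
  have ds: "((\<lambda>z. sinh (2 * z)) has_field_derivative 2 * cosh (2 * z)) (at z)"
    and dc: "((\<lambda>z. cosh (2 * z)) has_field_derivative 2 * sinh (2 * z)) (at z)" for z :: complex
    by (auto intro!: derivative_eq_intros)
  have d1: "(ladder w r u has_field_derivative v z) (at z)" if z: "z \<in> S" for z
  proof -
    note d = schroedinger_onD[OF u S(1) z]
    have "((\<lambda>z. sinh (2 * z) * deriv u z + (w * cosh (2 * z) + r) * u z) has_field_derivative
       (2 * cosh (2 * z)) * deriv u z + ((w\<^sup>2 + pot \<alpha> \<beta> z) * u z) * sinh (2 * z) +
       ((w * (2 * sinh (2 * z)) + 0) * u z + deriv u z * (w * cosh (2 * z) + r))) (at z)"
      by (intro DERIV_add DERIV_mult DERIV_cmult DERIV_const ds dc d)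
    then show ?thesis
      unfolding ladder_def[abs_def] v_def by (rule DERIV_cong) (simp add: algebra_simps)
  qed
  have d2: "(v has_field_derivative ((w + 2)\<^sup>2 + pot \<alpha> \<beta> z) * ladder w r u z) (at z)" if z: "z \<in> S" for z
  proof -
    note d = schroedinger_onD[OF u S(1) z]
    have nz: "sinh z \<noteq> 0" "cosh z \<noteq> 0" using S(2)[OF z] by auto
    define P where "P = (\<alpha>\<^sup>2 - 1/4) * (- 2 * cosh z / sinh z ^ 3) - (\<beta>\<^sup>2 - 1/4) * (- 2 * sinh z / cosh z ^ 3)"
    have dp: "(pot \<alpha> \<beta> has_field_derivative P) (at z)" unfolding P_def by (rule DERIV_pot[OF nz])
    have id: "sinh (2 * z) * P + 4 * cosh (2 * z) * pot \<alpha> \<beta> z = 4 * (r * (w + 1))"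
      unfolding P_def r by (rule pot_ladder_identity(1)[OF nz])
    have "(v has_field_derivative
       ((w + 2) * (2 * sinh (2 * z)) + 0) * deriv u z + ((w\<^sup>2 + pot \<alpha> \<beta> z) * u z) * ((w + 2) * cosh (2 * z) + r) +
       (((2 * cosh (2 * z)) * (w\<^sup>2 + 2 * w + pot \<alpha> \<beta> z) + (0 + P) * sinh (2 * z)) * u z + deriv u z * (sinh (2 * z) * (w\<^sup>2 + 2 * w + pot \<alpha> \<beta> z)))) (at z)"
      unfolding v_def by (intro DERIV_add DERIV_mult DERIV_cmult DERIV_const ds dc d dp)
    then show ?thesis
    proof (rule DERIV_cong)
      have "((w + 2) * (2 * s) + 0) * u1 + ((w\<^sup>2 + f) * u0) * ((w + 2) * c + r) +
         (((2 * c) * (w\<^sup>2 + 2 * w + f) + (0 + P) * s) * u0 + u1 * (s * (w\<^sup>2 + 2 * w + f))) =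
         ((w + 2)\<^sup>2 + f) * (s * u1 + (w * c + r) * u0) + (s * P + 4 * c * f - 4 * (r * (w + 1))) * u0"
        for s c f u0 u1 :: complex
        by (simp add: power2_eq_square algebra_simps)
      from this[of "sinh (2 * z)" "deriv u z" "pot \<alpha> \<beta> z" "u z" "cosh (2 * z)"]
      show "((w + 2) * (2 * sinh (2 * z)) + 0) * deriv u z + ((w\<^sup>2 + pot \<alpha> \<beta> z) * u z) * ((w + 2) * cosh (2 * z) + r) +
       (((2 * cosh (2 * z)) * (w\<^sup>2 + 2 * w + pot \<alpha> \<beta> z) + (0 + P) * sinh (2 * z)) * u z + deriv u z * (sinh (2 * z) * (w\<^sup>2 + 2 * w + pot \<alpha> \<beta> z))) =
        ((w + 2)\<^sup>2 + pot \<alpha> \<beta> z) * ladder w r u z"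
        unfolding id ladder_def by simp
    qed
  qed
  show "schroedinger_on (w + 2) \<alpha> \<beta> S (ladder w r u)"
    by (rule schroedinger_onI(1)[OF S(1) d1 d2])
  assume z: "z \<in> S"
  have nz: "sinh z \<noteq> 0" "cosh z \<noteq> 0" using S(2)[OF z] by auto
  have dv: "deriv (ladder w r u) z = v z" using d1[OF z] by (rule DERIV_imp_deriv)
  have id: "sinh (2 * z) ^ 2 * pot \<alpha> \<beta> z = 2 * (r * (w + 1)) * cosh (2 * z) + 2 * (\<alpha>\<^sup>2 + \<beta>\<^sup>2 - 1/2)"
    unfolding r by (rule pot_ladder_identity(2)[OF nz])
  have c2: "cosh (2 * z) ^ 2 = 1 + sinh (2 * z) ^ 2" by (rule cosh_sq_complex)
  have "s * (((w + 2) * c + r) * u1 + s * (w\<^sup>2 + 2 * w + f) * u0) + (- (w + 2) * c + - r) * (s * u1 + (w * c + r) * u0) =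
     ((w\<^sup>2 + 2 * w) * (s\<^sup>2 - c\<^sup>2) + s\<^sup>2 * f - 2 * (r * (w + 1)) * c - r\<^sup>2) * u0" for s c f u0 u1 :: complex
    by (simp add: power2_eq_square algebra_simps)
  then have "ladder (- (w + 2)) (- r) (ladder w r u) z =
     ((w\<^sup>2 + 2 * w) * (sinh (2 * z) ^ 2 - cosh (2 * z) ^ 2) + sinh (2 * z) ^ 2 * pot \<alpha> \<beta> z - 2 * (r * (w + 1)) * cosh (2 * z) - r\<^sup>2) * u z"
    unfolding ladder_def[of "- (w + 2)"] dv v_def ladder_def[of w] .
  also have "\<dots> = (2 * (\<alpha>\<^sup>2 + \<beta>\<^sup>2) - (w + 1)\<^sup>2 - r\<^sup>2) * u z"
    unfolding id c2 by (simp add: power2_eq_square algebra_simps)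
  finally show "ladder (- (w + 2)) (- r) (ladder w r u) z = (2 * (\<alpha>\<^sup>2 + \<beta>\<^sup>2) - (w + 1)\<^sup>2 - r\<^sup>2) * u z" .
qed

section \<open>Lines\<close>

text \<open>The line through i b with direction 1 + i m is parametrised by the real part, so that
  the weight \<open>bump\<close> depends on x alone whatever the slope.\<close>

definition line :: "real \<Rightarrow> real \<Rightarrow> real \<Rightarrow> complex" where
  "line b m x = \<i> * of_real b + of_real x * Complex 1 m"

lemma line_simps [simp]: "Re (line b m x) = x" "Im (line b m x) = b + m * x"
  by (simp_all add: line_def)

lemma line_chain:
  assumes "(f has_field_derivative f') (at (line b m x))"
  shows "((\<lambda>x. f (line b m x)) has_vector_derivative Complex 1 m * f') (at x)"
proof -
  have "(line b m has_vector_derivative Complex 1 m) (at x)"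
    unfolding line_def[abs_def] by (auto intro!: derivative_eq_intros)
  from field_vector_diff_chain_at[OF this assms] show ?thesis by (simp add: o_def)
qed

lemma exp_line_at_top:
  assumes "Re (w * Complex 1 m) < 0"
  shows "((\<lambda>x. exp (w * line b m x)) \<longlongrightarrow> 0) at_top"
proof (rule Lim_null_comparison)
  define k where "k = Re (w * Complex 1 m)"
  have "norm (exp (w * line b m x)) = exp (Re (w * (\<i> * of_real b))) * exp (k * x)" for x
    by (simp add: k_def line_def algebra_simps flip: exp_add)
  then show "\<forall>\<^sub>F x in at_top. norm (exp (w * line b m x)) \<le> exp (Re (w * (\<i> * of_real b))) * exp (k * x)"
    by simp
  have "filterlim (\<lambda>x. k * x) at_bot at_top"
    using assms by (intro filterlim_tendsto_neg_mult_at_bot[OF tendsto_const _ filterlim_ident]) (simp add: k_def)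
  then have "((\<lambda>x. exp (Re (w * (\<i> * of_real b))) * exp (k * x)) \<longlongrightarrow> exp (Re (w * (\<i> * of_real b))) * 0) at_top"
    by (intro tendsto_intros filterlim_compose[OF exp_at_bot])
  then show "((\<lambda>x. exp (Re (w * (\<i> * of_real b))) * exp (k * x)) \<longlongrightarrow> 0) at_top" by simp
qed

lemma exp_line_at_bot:
  assumes "Re (w * Complex 1 m) > 0"
  shows "((\<lambda>x. exp (w * line b m x)) \<longlongrightarrow> 0) at_bot"
proof -
  have "((\<lambda>x. exp (- w * line (- b) m x)) \<longlongrightarrow> 0) at_top"
    by (rule exp_line_at_top) (use assms in simp)
  moreover have "- w * line (- b) m x = w * line b m (- x)" for x
    by (simp add: line_def algebra_simps)
  ultimately show ?thesis
    by (simp add: at_bot_mirror filterlim_filtermap)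
qed

lemma deriv_exp_times:
  assumes X: "X holomorphic_on ball 0 1" and f: "\<And>z. Re z > 0 \<Longrightarrow> f z = exp (- w * z) * X (exp (- 2 * z))" and z: "Re z > 0"
  shows "deriv f z = exp (- w * z) * (- w * X (exp (- 2 * z)) - 2 * exp (- 2 * z) * deriv X (exp (- 2 * z)))"
proof -
  have "(X has_field_derivative deriv X (exp (- 2 * z))) (at (exp (- 2 * z)))"
    using z by (intro holomorphic_derivI[OF X]) auto
  moreover have "((\<lambda>z. exp (- 2 * z)) has_field_derivative - 2 * exp (- 2 * z)) (at z)"
    by (auto intro!: derivative_eq_intros)
  ultimately have dX: "((\<lambda>z. X (exp (- 2 * z))) has_field_derivative deriv X (exp (- 2 * z)) * (- 2 * exp (- 2 * z))) (at z)"
    by (rule DERIV_chain2[where g = "\<lambda>z. exp (- 2 * z)"])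
  have dw: "((\<lambda>z. exp (- w * z)) has_field_derivative exp (- w * z) * (- w)) (at z)"
    by (auto intro!: derivative_eq_intros)
  have "((\<lambda>z. exp (- w * z) * X (exp (- 2 * z))) has_field_derivative
     exp (- w * z) * (- w * X (exp (- 2 * z)) - 2 * exp (- 2 * z) * deriv X (exp (- 2 * z)))) (at z)"
    by (rule DERIV_cong[OF DERIV_mult[OF dw dX]]) (simp add: algebra_simps)
  then have "(f has_field_derivative
     exp (- w * z) * (- w * X (exp (- 2 * z)) - 2 * exp (- 2 * z) * deriv X (exp (- 2 * z)))) (at z)"
    by (rule has_field_derivative_transform_within_open[of _ _ _ right_half]) (use right_half z f in auto)
  then show ?thesis by (rule DERIV_imp_deriv)
qed

text \<open>The Wronskian with the recessive solution is constant, but equals -2 e^(-2 (w + 1) z)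
  times a function holomorphic in t = e^(-2 z) at 0. Along a line on which Re ((w + 1) z) grows it
  tends to 0, so it vanishes, and the quotient of the two functions of t is constant.\<close>

lemma recessive_unique:
  assumes v: "schroedinger_on (2 * \<nu> + \<alpha> + \<beta> + 1) \<alpha> \<beta> right_half v"
    and \<Psi>: "\<Psi> holomorphic_on ball 0 1"
      "\<And>z. Re z > 0 \<Longrightarrow> v z = exp (- (2 * \<nu> + \<alpha> + \<beta> + 1) * z) * \<Psi> (exp (- 2 * z))"
    and w: "Re ((2 * \<nu> + \<alpha> + \<beta> + 1) * Complex 1 m) > 0" "2 * \<nu> + \<alpha> + \<beta> + 2 \<notin> \<int>\<^sub>\<le>\<^sub>0"
    and z: "Re z > 0" and \<sigma>: "\<bar>\<sigma>\<bar> = 1"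
  shows "v z = \<Psi> 0 * recessive \<sigma> \<nu> \<alpha> \<beta> z"
proof -
  define w where "w = 2 * \<nu> + \<alpha> + \<beta> + 1"
  define \<Phi> where "\<Phi> = recessive_phi \<nu> \<alpha> \<beta>"
  have \<Phi>: "\<Phi> holomorphic_on ball 0 1" "\<Phi> 0 = 1"
    unfolding \<Phi>_def using recessive_phi_holomorphic recessive_phi_0[OF w(2)] by auto
  define u where "u = (\<lambda>z. exp (- w * z) * \<Phi> (exp (- 2 * z)))"
  have u: "schroedinger_on w \<alpha> \<beta> right_half u"
    unfolding u_def \<Phi>_def w_def by (rule recessive_right_half)
  obtain C where C: "\<And>z. z \<in> right_half \<Longrightarrow> u z * deriv v z - deriv u z * v z = C"
    using schroedinger_on_wronskian[OF u v[folded w_def] right_half(1,2)] by blast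
  define chi where "chi = (\<lambda>t. \<Phi> t * deriv \<Psi> t - deriv \<Phi> t * \<Psi> t)"
  have wr: "C = - 2 * exp (- 2 * (w + 1) * z) * chi (exp (- 2 * z))" if "Re z > 0" for z
  proof -
    have "C = u z * deriv v z - deriv u z * v z" using C[of z] that by (simp add: right_half)
    also have "\<dots> = - 2 * (exp (- w * z) * exp (- w * z) * exp (- 2 * z)) * chi (exp (- 2 * z))"
    proof -
      have dv: "deriv v z = exp (- w * z) * (- w * \<Psi> (exp (- 2 * z)) - 2 * exp (- 2 * z) * deriv \<Psi> (exp (- 2 * z)))"
        by (rule deriv_exp_times[OF \<Psi>(1) _ that]) (simp add: \<Psi>(2) w_def)
      have du: "deriv u z = exp (- w * z) * (- w * \<Phi> (exp (- 2 * z)) - 2 * exp (- 2 * z) * deriv \<Phi> (exp (- 2 * z)))"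
        by (rule deriv_exp_times[OF \<Phi>(1) _ that]) (simp add: u_def)
      have vz: "v z = exp (- w * z) * \<Psi> (exp (- 2 * z))"
        using \<Psi>(2)[OF that] by (simp add: w_def)
      have "e * p * (e * (- w * q - 2 * t * q')) - e * (- w * p - 2 * t * p') * (e * q) = - 2 * (e * e * t) * (p * q' - p' * q)"
        for e p q p' q' t :: complex
        by (simp add: algebra_simps)
      then show ?thesis unfolding dv du vz unfolding u_def chi_def .
    qed
    also have "exp (- w * z) * exp (- w * z) * exp (- 2 * z) = exp (- 2 * (w + 1) * z)"
      by (simp add: algebra_simps flip: exp_add)
    finally show ?thesis .
  qed
  have chi: "chi holomorphic_on ball 0 1"
    unfolding chi_def using \<Phi> \<Psi> by (intro holomorphic_intros) auto
  have "C = 0"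
  proof -
    have "((\<lambda>x. exp (- 2 * line 0 m x)) \<longlongrightarrow> 0) at_top"
      by (rule exp_line_at_top) simp
    moreover have "isCont chi 0"
      by (rule field_differentiable_imp_continuous_at[OF holomorphic_on_imp_differentiable_at[OF chi]]) auto
    ultimately have "((\<lambda>x. chi (exp (- 2 * line 0 m x))) \<longlongrightarrow> chi 0) at_top"
      by (rule isCont_tendsto_compose[rotated])
    moreover have "((\<lambda>x. exp (- 2 * (w + 1) * line 0 m x)) \<longlongrightarrow> 0) at_top"
    proof (rule exp_line_at_top)
      have "Re (- 2 * (w + 1) * Complex 1 m) = - 2 * Re (w * Complex 1 m) - 2"
        by (simp add: algebra_simps)
      then show "Re (- 2 * (w + 1) * Complex 1 m) < 0" using w(1) unfolding w_def[symmetric] by linarith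
    qed
    ultimately have "((\<lambda>x. - 2 * exp (- 2 * (w + 1) * line 0 m x) * chi (exp (- 2 * line 0 m x))) \<longlongrightarrow> - 2 * 0 * chi 0) at_top"
      by (intro tendsto_intros)
    moreover have "\<forall>\<^sub>F x in at_top. - 2 * exp (- 2 * (w + 1) * line 0 m x) * chi (exp (- 2 * line 0 m x)) = C"
      using eventually_gt_at_top[of 0] by eventually_elim (rule wr[symmetric], simp)
    ultimately have "((\<lambda>x::real. C) \<longlongrightarrow> - 2 * 0 * chi 0) at_top"
      by (rule Lim_transform_eventually)
    then show "C = 0" by (simp add: tendsto_const_iff)
  qed
  have chi0: "chi t = 0" if t: "t \<in> ball 0 1" "t \<noteq> 0" for t
  proof -
    define z where "z = - Ln t / 2"
    have "exp (- 2 * z) = t" using t by (simp add: z_def)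
    moreover have "Re z > 0" using t by (simp add: z_def)
    ultimately show ?thesis using wr[of z] \<open>C = 0\<close> by simp
  qed
  have "\<forall>\<^sub>F t in nhds 0. \<Phi> t \<noteq> 0 \<and> t \<in> ball 0 1"
  proof (rule eventually_conj)
    have "isCont \<Phi> 0"
      by (rule field_differentiable_imp_continuous_at[OF holomorphic_on_imp_differentiable_at[OF \<Phi>(1)]]) auto
    then show "\<forall>\<^sub>F t in nhds 0. \<Phi> t \<noteq> 0"
      using \<Phi>(2) by (intro tendsto_imp_eventually_ne[where c = 1]) (auto simp: isCont_def tendsto_nhds_iff)
    show "\<forall>\<^sub>F t in nhds (0::complex). t \<in> ball 0 1" by (intro eventually_nhds_in_open) auto
  qed
  then obtain e where e: "e > 0" "\<And>t. dist t 0 < e \<Longrightarrow> \<Phi> t \<noteq> 0 \<and> t \<in> ball 0 1"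
    unfolding eventually_nhds_metric by blast
  have q0: "((\<lambda>t. \<Psi> t / \<Phi> t) has_field_derivative 0) (at t)" if "t \<in> ball 0 e - {0}" for t
  proof -
    have t: "\<Phi> t \<noteq> 0" "t \<in> ball 0 1" "t \<noteq> 0" using e(2)[of t] that by (auto simp: dist_commute)
    have d: "(\<Phi> has_field_derivative deriv \<Phi> t) (at t)" "(\<Psi> has_field_derivative deriv \<Psi> t) (at t)"
      using holomorphic_derivI[OF \<Phi>(1) _ t(2)] holomorphic_derivI[OF \<Psi>(1) _ t(2)] by auto
    show ?thesis
      by (rule DERIV_cong[OF DERIV_divide[OF d(2,1) t(1)]]) (use chi0[OF t(2,3)] in \<open>simp add: chi_def algebra_simps\<close>)
  qed
  have cont: "continuous_on (ball 0 e) (\<lambda>t. \<Psi> t / \<Phi> t)"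
  proof (intro continuous_on_divide)
    have "ball 0 e \<subseteq> ball (0::complex) 1" using e(2) by (auto simp: dist_commute)
    then show "continuous_on (ball 0 e) \<Psi>" "continuous_on (ball 0 e) \<Phi>"
      using \<Phi> \<Psi> by (meson continuous_on_subset holomorphic_on_imp_continuous_on)+
  qed (use e(2) in \<open>auto simp: dist_commute\<close>)
  have "(\<lambda>t. \<Psi> t / \<Phi> t) constant_on ball 0 e"
    by (rule DERIV_zero_connected_constant_on[of _ "{0}"]) (use cont q0 in auto)
  then have near: "\<Psi> t = \<Psi> 0 * \<Phi> t" if "t \<in> ball 0 e" for t
    using that e \<Phi>(2) unfolding constant_on_def by (metis centre_in_ball dist_commute div_by_1 mem_ball nonzero_divide_eq_eq)
  have all: "\<Psi> t - \<Psi> 0 * \<Phi> t = 0" if "t \<in> ball 0 1" for t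
  proof (rule analytic_continuation_open[of "ball 0 e \<inter> ball 0 1" "ball 0 1" "\<lambda>t. \<Psi> t - \<Psi> 0 * \<Phi> t" "\<lambda>_. 0"])
    have "0 \<in> ball 0 e \<inter> ball (0::complex) 1" using e(1) by simp
    then show "ball 0 e \<inter> ball (0::complex) 1 \<noteq> {}" by blast
    show "(\<lambda>t. \<Psi> t - \<Psi> 0 * \<Phi> t) holomorphic_on ball 0 1"
      using \<Phi> \<Psi> by (intro holomorphic_intros) auto
    show "\<Psi> s - \<Psi> 0 * \<Phi> s = 0" if "s \<in> ball 0 e \<inter> ball 0 1" for s
      by (metis IntD1 near right_minus_eq that)
  qed (use that in auto)
  have "exp (- 2 * z) \<in> ball 0 1" using z by simp
  from all[OF this] have "\<Psi> (exp (- 2 * z)) = \<Psi> 0 * \<Phi> (exp (- 2 * z))" by (rule eq_iff_diff_eq_0[THEN iffD2])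
  then show ?thesis
    using \<Psi>(2)[OF z] recessive(2)[OF \<sigma> z] unfolding \<Phi>_def by simp
qed



section \<open>The connection coefficient\<close>

definition remainder :: "nat \<Rightarrow> complex \<Rightarrow> complex \<Rightarrow> complex \<Rightarrow> (complex \<Rightarrow> complex) \<Rightarrow> complex \<Rightarrow> complex" where
  "remainder N w \<alpha> \<beta> u z = exp (w * z) * u z - partial_series N w \<alpha> \<beta> z"

definition remainder' :: "nat \<Rightarrow> complex \<Rightarrow> complex \<Rightarrow> complex \<Rightarrow> (complex \<Rightarrow> complex) \<Rightarrow> complex \<Rightarrow> complex" where
  "remainder' N w \<alpha> \<beta> u z =
     exp (w * z) * (w * u z + deriv u z) - (\<Sum>n<N. g_deriv n z \<alpha> \<beta> * inv_fact w n)"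

text \<open>What the truncated series leaves over in the equation, by
  \<open>partial_series_ode\<close>. For N = 0 the series is empty and leaves nothing; for N \<ge> 1
  its last term has index N - 1, hence the shift.\<close>

definition residual :: "nat \<Rightarrow> complex \<Rightarrow> complex \<Rightarrow> complex \<Rightarrow> complex \<Rightarrow> complex" where
  "residual N w \<alpha> \<beta> z = (if N = 0 then 0 else 2 * inv_fact w (N - 1) * g_deriv N z \<alpha> \<beta>)"

lemma DERIV_remainder:
  assumes u: "schroedinger_on w \<alpha> \<beta> S u" "open S" "z \<in> S" and nz: "sinh z \<noteq> 0" "cosh z \<noteq> 0"
    and w: "\<And>n. n < N \<Longrightarrow> w - of_nat n \<notin> \<int>\<^sub>\<le>\<^sub>0"
  shows "(remainder N w \<alpha> \<beta> u has_field_derivative remainder' N w \<alpha> \<beta> u z) (at z)"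
    and "(remainder' N w \<alpha> \<beta> u has_field_derivative
       2 * w * remainder' N w \<alpha> \<beta> u z + pot \<alpha> \<beta> z * remainder N w \<alpha> \<beta> u z - residual N w \<alpha> \<beta> z) (at z)"
proof -
  note d = schroedinger_onD[OF u]
  have e: "((\<lambda>z. exp (w * z)) has_field_derivative w * exp (w * z)) (at z)"
    by (auto intro!: derivative_eq_intros)
  have 1: "((\<lambda>z. exp (w * z) * u z) has_field_derivative exp (w * z) * (w * u z + deriv u z)) (at z)"
    by (rule DERIV_cong[OF DERIV_mult[OF e d(1)]]) (simp add: algebra_simps)
  have 2: "((\<lambda>z. exp (w * z) * (w * u z + deriv u z)) has_field_derivative
      2 * w * (exp (w * z) * (w * u z + deriv u z)) + pot \<alpha> \<beta> z * (exp (w * z) * u z)) (at z)"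
    by (rule DERIV_cong[OF DERIV_mult[OF e DERIV_add[OF DERIV_cmult[OF d(1)] d(2)]]])
      (simp add: algebra_simps power2_eq_square)
  show "(remainder N w \<alpha> \<beta> u has_field_derivative remainder' N w \<alpha> \<beta> u z) (at z)"
    unfolding remainder_def[abs_def] remainder'_def by (intro DERIV_diff 1 DERIV_partial_series nz)
  have 3: "(remainder' N w \<alpha> \<beta> u has_field_derivative
      2 * w * (exp (w * z) * (w * u z + deriv u z)) + pot \<alpha> \<beta> z * (exp (w * z) * u z)
      - (\<Sum>n<N. g_deriv2 n z \<alpha> \<beta> * inv_fact w n)) (at z)"
    unfolding remainder'_def[abs_def] by (intro DERIV_diff 2 DERIV_partial_series nz)
  have S: "(\<Sum>n<N. g_deriv2 n z \<alpha> \<beta> * inv_fact w n) =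
      2 * w * (\<Sum>n<N. g_deriv n z \<alpha> \<beta> * inv_fact w n) + pot \<alpha> \<beta> z * partial_series N w \<alpha> \<beta> z + residual N w \<alpha> \<beta> z"
  proof (cases N)
    case 0
    then show ?thesis by (simp add: partial_series_def residual_def)
  next
    case (Suc M)
    have "(\<Sum>n<Suc M. g_deriv2 n z \<alpha> \<beta> * inv_fact w n) - 2 * w * (\<Sum>n<Suc M. g_deriv n z \<alpha> \<beta> * inv_fact w n)
      - pot \<alpha> \<beta> z * partial_series (Suc M) w \<alpha> \<beta> z = 2 * inv_fact w M * g_deriv (Suc M) z \<alpha> \<beta>"
      by (rule partial_series_ode[OF nz]) (use w Suc in auto)
    then show ?thesis unfolding Suc residual_def by (simp add: algebra_simps del: sum.lessThan_Suc)
  qed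
  show "(remainder' N w \<alpha> \<beta> u has_field_derivative
       2 * w * remainder' N w \<alpha> \<beta> u z + pot \<alpha> \<beta> z * remainder N w \<alpha> \<beta> u z - residual N w \<alpha> \<beta> z) (at z)"
    by (rule DERIV_cong[OF 3], unfold S remainder_def remainder'_def) (simp add: algebra_simps)
qed

text \<open>Re (n (1 + i m)) = n for real n, whatever the slope m.\<close>

lemma not_nonpos_Int_slope:
  assumes "Re (z * Complex 1 m) > 0"
  shows "z \<notin> \<int>\<^sub>\<le>\<^sub>0"
  using assms by (auto elim!: nonpos_Ints_cases)

lemma norm_slope: "norm (Complex 1 m) \<le> 1 + \<bar>m\<bar>"
  using norm_triangle_ineq[of 1 "\<i> * of_real m"] by (simp add: norm_mult Complex_eq)

text \<open>A constant times \<open>1 + M\<close> absorbs the bounded parameters; the remaining part makes the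
  Volterra iteration contract.\<close>

definition volterra_const :: "real \<Rightarrow> real \<Rightarrow> real \<Rightarrow> real" where
  "volterra_const A M c = (1 + M)\<^sup>2 * (4 * (A\<^sup>2 + 1) / c\<^sup>2)"

definition threshold :: "nat \<Rightarrow> real \<Rightarrow> real \<Rightarrow> real \<Rightarrow> real" where
  "threshold N A M c = 4 * volterra_const A M c + real N + 4 + (4 * A + 4) * (1 + M)"

text \<open>Up to bounded parameters e^(w z) grows at the rate 2 Re (\<nu> (1 + i m)) along lines of
  slope m. Demanding that this quantity be large, instead of Re \<nu>, admits \<nu> beyond the right
  half-plane once m is chosen to suit.\<close>

locale large_parameter =
  fixes N :: nat and A M c m :: real and \<nu> \<alpha> \<beta> :: complex
  assumes c: "0 < c" "c \<le> 1" and AM: "norm \<alpha> \<le> A" "norm \<beta> \<le> A" "\<bar>m\<bar> \<le> M"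
    and large: "Re (\<nu> * Complex 1 m) \<ge> threshold N A M c"
begin

abbreviation "w \<equiv> 2 * \<nu> + \<alpha> + \<beta> + 1"
abbreviation "Y \<equiv> Re (\<nu> * Complex 1 m)"

lemma A0: "A \<ge> 0" "M \<ge> 0"
  using AM norm_ge_zero[of \<alpha>] by linarith+

lemma vc0: "volterra_const A M c \<ge> 0"
  using c A0 by (simp add: volterra_const_def)

lemma Re_shift: "\<bar>Re (a * Complex 1 m)\<bar> \<le> norm a * (1 + M)"
proof -
  have "norm a * norm (Complex 1 m) \<le> norm a * (1 + M)"
    using norm_slope[of m] AM(3) by (intro mult_left_mono) auto
  then show ?thesis using abs_Re_le_cmod[of "a * Complex 1 m"] by (simp add: norm_mult)
qed

lemma Y_large: "Y \<ge> 4" "Y \<ge> 4 * volterra_const A M c" "Y \<ge> real N" "Y \<ge> (4 * A + 4) * (1 + M)"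
proof -
  have "0 \<le> (4 * A + 4) * (1 + M)" using A0 by simp
  then show "Y \<ge> 4" "Y \<ge> 4 * volterra_const A M c" "Y \<ge> real N" "Y \<ge> (4 * A + 4) * (1 + M)"
    using large vc0 unfolding threshold_def by linarith+
qed

text \<open>The factor 2 of \<nu> in \<open>w\<close> leaves one spare copy of \<open>Y\<close>,
  which absorbs \<alpha> + \<beta> + 1 and the shift by N.\<close>

lemma Re_w: "Re (w * Complex 1 m) \<ge> Y + real N" "Re (w * Complex 1 m) \<ge> Y"
proof -
  have "norm (\<alpha> + \<beta> + 1) \<le> 2 * A + 1"
    using norm_triangle_ineq[of "\<alpha> + \<beta>" 1] norm_triangle_ineq[of \<alpha> \<beta>] AM by simp
  then have "norm (\<alpha> + \<beta> + 1) * (1 + M) \<le> (2 * A + 1) * (1 + M)"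
    using A0 by (intro mult_right_mono) auto
  then have "\<bar>Re ((\<alpha> + \<beta> + 1) * Complex 1 m)\<bar> \<le> (2 * A + 1) * (1 + M)"
    using Re_shift[of "\<alpha> + \<beta> + 1"] by linarith
  moreover have "w * Complex 1 m = 2 * (\<nu> * Complex 1 m) + (\<alpha> + \<beta> + 1) * Complex 1 m"
    by (simp add: algebra_simps)
  then have "Re (w * Complex 1 m) = 2 * Y + Re ((\<alpha> + \<beta> + 1) * Complex 1 m)" by simp
  moreover have "(2 * A + 1) * (1 + M) \<le> (4 * A + 4) * (1 + M)"
    using A0 by (intro mult_right_mono) auto
  ultimately show "Re (w * Complex 1 m) \<ge> Y + real N" "Re (w * Complex 1 m) \<ge> Y"
    using large vc0 unfolding threshold_def by linarith+
qed

lemma shift_not_nonpos: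
  assumes "norm a \<le> 2 * A + 2"
  shows "\<nu> + a \<notin> \<int>\<^sub>\<le>\<^sub>0"
proof (rule not_nonpos_Int_slope)
  have "norm a * (1 + M) \<le> (2 * A + 2) * (1 + M)"
    using assms A0 by (intro mult_right_mono) auto
  moreover have "(2 * A + 2) * (1 + M) < (4 * A + 4) * (1 + M)"
    using A0 by (intro mult_strict_right_mono) auto
  ultimately have "\<bar>Re (a * Complex 1 m)\<bar> < Y" using Re_shift[of a] Y_large(4) by linarith
  moreover have "Re ((\<nu> + a) * Complex 1 m) = Y + Re (a * Complex 1 m)"
    by (simp only: distrib_right plus_complex.sel)
  ultimately show "Re ((\<nu> + a) * Complex 1 m) > 0" by linarith
qed

lemma shifts:
  "\<nu> + 1 \<notin> \<int>\<^sub>\<le>\<^sub>0" "\<nu> + \<alpha> + \<beta> + 1 \<notin> \<int>\<^sub>\<le>\<^sub>0" "\<nu> + \<alpha> + 1 \<notin> \<int>\<^sub>\<le>\<^sub>0" "\<nu> + \<beta> + 1 \<notin> \<int>\<^sub>\<le>\<^sub>0"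
  "\<nu> + ((\<alpha> + \<beta>) / 2 + 1) \<notin> \<int>\<^sub>\<le>\<^sub>0" "\<nu> + ((\<alpha> + \<beta>) / 2 + 3/2) \<notin> \<int>\<^sub>\<le>\<^sub>0"
proof -
  have ab: "norm (\<alpha> + \<beta>) \<le> 2 * A" using norm_triangle_ineq[of \<alpha> \<beta>] AM by linarith
  have "norm (\<alpha> + \<beta> + 1) \<le> 2 * A + 2" "norm (\<alpha> + 1) \<le> 2 * A + 2" "norm (\<beta> + 1) \<le> 2 * A + 2" "norm (1::complex) \<le> 2 * A + 2"
    using norm_triangle_ineq[of "\<alpha> + \<beta>" 1] norm_triangle_ineq[of \<alpha> 1] norm_triangle_ineq[of \<beta> 1] ab AM A0 by simp_all
  then show "\<nu> + 1 \<notin> \<int>\<^sub>\<le>\<^sub>0" "\<nu> + \<alpha> + \<beta> + 1 \<notin> \<int>\<^sub>\<le>\<^sub>0" "\<nu> + \<alpha> + 1 \<notin> \<int>\<^sub>\<le>\<^sub>0" "\<nu> + \<beta> + 1 \<notin> \<int>\<^sub>\<le>\<^sub>0"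
    using shift_not_nonpos[of 1] shift_not_nonpos[of "\<alpha> + \<beta> + 1"] shift_not_nonpos[of "\<alpha> + 1"] shift_not_nonpos[of "\<beta> + 1"]
    by (simp_all add: add.assoc)
  have "norm ((\<alpha> + \<beta>) / 2) \<le> A" using ab by (simp add: norm_divide)
  then have "norm ((\<alpha> + \<beta>) / 2 + 1) \<le> 2 * A + 2" "norm ((\<alpha> + \<beta>) / 2 + 3/2) \<le> 2 * A + 2"
    using norm_triangle_ineq[of "(\<alpha> + \<beta>) / 2" 1] norm_triangle_ineq[of "(\<alpha> + \<beta>) / 2" "3/2"] A0 by (simp_all add: norm_divide)
  then show "\<nu> + ((\<alpha> + \<beta>) / 2 + 1) \<notin> \<int>\<^sub>\<le>\<^sub>0" "\<nu> + ((\<alpha> + \<beta>) / 2 + 3/2) \<notin> \<int>\<^sub>\<le>\<^sub>0"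
    using shift_not_nonpos[of "(\<alpha> + \<beta>) / 2 + 1"] shift_not_nonpos[of "(\<alpha> + \<beta>) / 2 + 3/2"] by blast+
qed

lemma w_shift_not_nonpos: "n \<le> N \<Longrightarrow> w - of_nat n \<notin> \<int>\<^sub>\<le>\<^sub>0" "w + 1 \<notin> \<int>\<^sub>\<le>\<^sub>0" "w + 2 \<notin> \<int>\<^sub>\<le>\<^sub>0" "w + 2 + 1 \<notin> \<int>\<^sub>\<le>\<^sub>0"
proof -
  show "w - of_nat n \<notin> \<int>\<^sub>\<le>\<^sub>0" if "n \<le> N"
  proof (rule not_nonpos_Int_slope)
    have "Re ((w - of_nat n) * Complex 1 m) = Re (w * Complex 1 m) - real n"
      unfolding left_diff_distrib by simp
    then show "Re ((w - of_nat n) * Complex 1 m) > 0" using Re_w(1) Y_large(1) that by simp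
  qed
  have pos: "w + of_nat n \<notin> \<int>\<^sub>\<le>\<^sub>0" for n
  proof (rule not_nonpos_Int_slope)
    have "Re ((w + of_nat n) * Complex 1 m) = Re (w * Complex 1 m) + real n"
      unfolding distrib_right by simp
    then show "Re ((w + of_nat n) * Complex 1 m) > 0" using Re_w(2) Y_large(1) by simp
  qed
  from pos[of 1] pos[of 2] pos[of 3]
  show "w + 1 \<notin> \<int>\<^sub>\<le>\<^sub>0" "w + 2 \<notin> \<int>\<^sub>\<le>\<^sub>0" "w + 2 + 1 \<notin> \<int>\<^sub>\<le>\<^sub>0" by (simp_all add: add_ac)
qed

lemma inv_fact_bound: "n \<le> N \<Longrightarrow> norm (inv_fact w n) \<le> ((1 + M) / Y) ^ Suc n"
proof (induction n)
  have low: "Y / (1 + M) \<le> norm (w - of_nat n)" if "n \<le> N" for n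
  proof -
    have "Re ((w - of_nat n) * Complex 1 m) = Re (w * Complex 1 m) - real n"
      unfolding left_diff_distrib by simp
    then have "Y \<le> Re ((w - of_nat n) * Complex 1 m)" using Re_w(1) that by simp
    also have "\<dots> \<le> norm (w - of_nat n) * (1 + M)" using Re_shift[of "w - of_nat n"] by linarith
    finally show ?thesis using A0 by (simp add: divide_le_eq)
  qed
  have step: "norm x \<le> (1 + M) / Y * b" if "norm (d * x) \<le> b" "Y / (1 + M) \<le> norm d" for x d :: complex and b
  proof -
    have "Y / (1 + M) * norm x \<le> norm d * norm x" using that by (intro mult_right_mono) auto
    then have "Y / (1 + M) * norm x \<le> b" using that by (simp add: norm_mult)
    then show ?thesis using Y_large(1) A0 by (simp add: field_simps)
  qed
  case 0
  have "w * inv_fact w 0 = 1" using w_shift_not_nonpos(1)[of 0] by (intro inv_fact_0) simp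
  then have "norm (w * inv_fact w 0) \<le> 1" by simp
  from step[OF this] low[of 0] show ?case by simp
next
  case (Suc n)
  have low: "Y / (1 + M) \<le> norm (w - of_nat (Suc n))"
  proof -
    have "Re ((w - of_nat (Suc n)) * Complex 1 m) = Re (w * Complex 1 m) - real (Suc n)"
      unfolding left_diff_distrib by simp
    then have "Y \<le> Re ((w - of_nat (Suc n)) * Complex 1 m)" using Re_w(1) Suc.prems by linarith
    also have "\<dots> \<le> norm (w - of_nat (Suc n)) * (1 + M)" using Re_shift[of "w - of_nat (Suc n)"] by linarith
    finally show ?thesis using A0 by (simp add: divide_le_eq)
  qed
  have "norm ((w - of_nat (Suc n)) * inv_fact w (Suc n)) \<le> ((1 + M) / Y) ^ Suc n"
    unfolding inv_fact_Suc[OF w_shift_not_nonpos(1)[OF Suc.prems]] using Suc by simp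
  moreover have "Y / (1 + M) * norm (inv_fact w (Suc n)) \<le> norm ((w - of_nat (Suc n)) * inv_fact w (Suc n))"
    unfolding norm_mult using low by (intro mult_right_mono) auto
  ultimately have "Y / (1 + M) * norm (inv_fact w (Suc n)) \<le> ((1 + M) / Y) ^ Suc n" by linarith
  then have "norm (inv_fact w (Suc n)) \<le> (1 + M) / Y * ((1 + M) / Y) ^ Suc n"
    using Y_large(1) A0 by (simp add: pos_le_divide_eq pos_divide_le_eq mult.commute mult.left_commute del: power_Suc)
  then show ?case by simp
qed

text \<open>Two derivatives along the line bring the factor (1 + i m)^2; this is the origin of (1 +
  M)^2 in \<open>volterra_const\<close>.\<close>

lemma line_forcing:
  fixes E :: complex
  assumes "norm (residual N w \<alpha> \<beta> (line b m x)) \<le> Kr * bump x" "away c (line b m x)"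
  defines "h \<equiv> (Complex 1 m)\<^sup>2 * (pot \<alpha> \<beta> (line b m x) * E - residual N w \<alpha> \<beta> (line b m x))"
  shows "norm h \<le> (volterra_const A M c * norm E + (1 + M)\<^sup>2 * Kr) * bump x"
proof -
  have s: "norm (Complex 1 m) ^ 2 \<le> (1 + M)\<^sup>2"
    using norm_slope[of m] AM(3) by (intro power_mono) auto
  have "norm (pot \<alpha> \<beta> (line b m x) * E - residual N w \<alpha> \<beta> (line b m x)) \<le>
     norm (pot \<alpha> \<beta> (line b m x) * E) + norm (residual N w \<alpha> \<beta> (line b m x))" by (rule norm_triangle_ineq4)
  also have "\<dots> \<le> 4 * (A\<^sup>2 + 1) / c\<^sup>2 * bump x * norm E + Kr * bump x"
    unfolding norm_mult using pot_bound[OF c assms(2) AM(1,2)] assms(1)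
    by (intro add_mono mult_right_mono) auto
  finally have "norm h \<le> (1 + M)\<^sup>2 * (4 * (A\<^sup>2 + 1) / c\<^sup>2 * bump x * norm E + Kr * bump x)"
    unfolding h_def norm_mult norm_power using s by (intro mult_mono) auto
  then show ?thesis by (simp add: volterra_const_def algebra_simps)
qed

lemma line_remainder_DERIV:
  assumes "schroedinger_on w \<alpha> \<beta> S u" "open S" "line b m x \<in> S" "away c (line b m x)"
  defines "\<kappa> \<equiv> w * Complex 1 m"
  shows "((\<lambda>x. remainder N w \<alpha> \<beta> u (line b m x)) has_vector_derivative Complex 1 m * remainder' N w \<alpha> \<beta> u (line b m x)) (at x)"
    and "((\<lambda>x. Complex 1 m * remainder' N w \<alpha> \<beta> u (line b m x)) has_vector_derivative
      2 * \<kappa> * (Complex 1 m * remainder' N w \<alpha> \<beta> u (line b m x)) +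
      (Complex 1 m)\<^sup>2 * (pot \<alpha> \<beta> (line b m x) * remainder N w \<alpha> \<beta> u (line b m x) - residual N w \<alpha> \<beta> (line b m x))) (at x)"
proof -
  note d = DERIV_remainder[OF assms(1-3) away_bounds(1,2)[OF c assms(4)], of N, OF w_shift_not_nonpos(1)[OF less_imp_le]]
  show "((\<lambda>x. remainder N w \<alpha> \<beta> u (line b m x)) has_vector_derivative Complex 1 m * remainder' N w \<alpha> \<beta> u (line b m x)) (at x)"
    by (rule line_chain[OF d(1)])
  have "((\<lambda>x. Complex 1 m * remainder' N w \<alpha> \<beta> u (line b m x)) has_vector_derivative
     Complex 1 m * (Complex 1 m * (2 * w * remainder' N w \<alpha> \<beta> u (line b m x) +
       pot \<alpha> \<beta> (line b m x) * remainder N w \<alpha> \<beta> u (line b m x) - residual N w \<alpha> \<beta> (line b m x)))) (at x)"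
    using has_vector_derivative_mult_right[OF line_chain[OF d(2)], of "Complex 1 m"] by simp
  then show "((\<lambda>x. Complex 1 m * remainder' N w \<alpha> \<beta> u (line b m x)) has_vector_derivative
      2 * \<kappa> * (Complex 1 m * remainder' N w \<alpha> \<beta> u (line b m x)) +
      (Complex 1 m)\<^sup>2 * (pot \<alpha> \<beta> (line b m x) * remainder N w \<alpha> \<beta> u (line b m x) - residual N w \<alpha> \<beta> (line b m x))) (at x)"
    by (simp add: \<kappa>_def power2_eq_square algebra_simps)
qed

lemma recessive_at_top:
  assumes "\<bar>\<sigma>\<bar> = 1"
  shows "((\<lambda>x. exp (w * line b m x) * recessive \<sigma> \<nu> \<alpha> \<beta> (line b m x)) \<longlongrightarrow> 1) at_top"
    and "((\<lambda>x. exp (w * line b m x) * (w * recessive \<sigma> \<nu> \<alpha> \<beta> (line b m x) + deriv (recessive \<sigma> \<nu> \<alpha> \<beta>) (line b m x))) \<longlongrightarrow> 0) at_top"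
proof -
  define \<Phi> where "\<Phi> = recessive_phi \<nu> \<alpha> \<beta>"
  have w2: "2 * \<nu> + \<alpha> + \<beta> + 2 \<notin> \<int>\<^sub>\<le>\<^sub>0" using w_shift_not_nonpos(2) by (simp add: add.assoc)
  have \<Phi>: "\<Phi> holomorphic_on ball 0 1" "\<Phi> 0 = 1"
    unfolding \<Phi>_def using recessive_phi_holomorphic recessive_phi_0[OF w2] by auto
  have u: "recessive \<sigma> \<nu> \<alpha> \<beta> z = exp (- w * z) * \<Phi> (exp (- 2 * z))" if "Re z > 0" for z
    unfolding \<Phi>_def by (rule recessive(2)[OF assms that])
  have t: "((\<lambda>x. exp (- 2 * line b m x)) \<longlongrightarrow> 0) at_top"
    by (rule exp_line_at_top) simp
  have cont: "isCont \<Phi> 0" "isCont (deriv \<Phi>) 0"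
    using holomorphic_on_imp_differentiable_at[OF \<Phi>(1)] holomorphic_on_imp_differentiable_at[OF holomorphic_deriv[OF \<Phi>(1)]]
    by (auto intro: field_differentiable_imp_continuous_at)
  have ee: "exp (a * z) * (exp (- a * z) * y) = y" for a z y :: complex
    by (simp add: exp_minus mult.assoc[symmetric])
  have "((\<lambda>x. \<Phi> (exp (- 2 * line b m x))) \<longlongrightarrow> 1) at_top"
    using isCont_tendsto_compose[OF cont(1) t] by (simp add: \<Phi>)
  moreover have "\<forall>\<^sub>F x in at_top. \<Phi> (exp (- 2 * line b m x)) = exp (w * line b m x) * recessive \<sigma> \<nu> \<alpha> \<beta> (line b m x)"
    using eventually_gt_at_top[of 0]
  proof eventually_elim
    case (elim x)
    show ?case unfolding u[of "line b m x", unfolded line_simps, OF elim] ee ..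
  qed
  ultimately show "((\<lambda>x. exp (w * line b m x) * recessive \<sigma> \<nu> \<alpha> \<beta> (line b m x)) \<longlongrightarrow> 1) at_top"
    by (rule Lim_transform_eventually)
  have "((\<lambda>x. - 2 * exp (- 2 * line b m x) * deriv \<Phi> (exp (- 2 * line b m x))) \<longlongrightarrow> - 2 * 0 * deriv \<Phi> 0) at_top"
    by (intro tendsto_intros t isCont_tendsto_compose[OF cont(2)])
  moreover have "\<forall>\<^sub>F x in at_top. - 2 * exp (- 2 * line b m x) * deriv \<Phi> (exp (- 2 * line b m x)) =
      exp (w * line b m x) * (w * recessive \<sigma> \<nu> \<alpha> \<beta> (line b m x) + deriv (recessive \<sigma> \<nu> \<alpha> \<beta>) (line b m x))"
    using eventually_gt_at_top[of 0]
  proof eventually_elim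
    case (elim x)
    define z where "z = line b m x"
    have z: "Re z > 0" using elim by (simp add: z_def)
    have "w * recessive \<sigma> \<nu> \<alpha> \<beta> z + deriv (recessive \<sigma> \<nu> \<alpha> \<beta>) z = exp (- w * z) * (- 2 * exp (- 2 * z) * deriv \<Phi> (exp (- 2 * z)))"
    proof -
      have du: "deriv (recessive \<sigma> \<nu> \<alpha> \<beta>) z = exp (- w * z) * (- w * \<Phi> (exp (- 2 * z)) - 2 * exp (- 2 * z) * deriv \<Phi> (exp (- 2 * z)))"
        by (rule deriv_exp_times[OF \<Phi>(1) _ z]) (rule u)
      have "a * (e * p) + e * (- a * p - 2 * t * q) = e * (- 2 * t * q)" for a e p t q :: complex
        by (simp add: algebra_simps)
      then show ?thesis unfolding du u[OF z] .
    qed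
    then show ?case unfolding z_def[symmetric] by (simp only: ee)
  qed
  ultimately show "((\<lambda>x. exp (w * line b m x) * (w * recessive \<sigma> \<nu> \<alpha> \<beta> (line b m x) + deriv (recessive \<sigma> \<nu> \<alpha> \<beta>) (line b m x))) \<longlongrightarrow> 0) at_top"
    by (intro Lim_transform_eventually[where g = "\<lambda>x. exp (w * line b m x) * (w * recessive \<sigma> \<nu> \<alpha> \<beta> (line b m x) + deriv (recessive \<sigma> \<nu> \<alpha> \<beta>) (line b m x))"]) simp_all
qed

lemma bump_at_bot: "(bump \<longlongrightarrow> 0) at_bot" and bump_at_top: "(bump \<longlongrightarrow> 0) at_top"
proof -
  have "((\<lambda>x::real. 1 - (tanh x)\<^sup>2) \<longlongrightarrow> 1 - (- 1)\<^sup>2) at_bot" "((\<lambda>x::real. 1 - (tanh x)\<^sup>2) \<longlongrightarrow> 1 - 1\<^sup>2) at_top"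
    by (intro tendsto_intros tanh_real_at_bot tanh_real_at_top)+
  then show "(bump \<longlongrightarrow> 0) at_bot" "(bump \<longlongrightarrow> 0) at_top"
    unfolding bump_eq[abs_def] by simp_all
qed

text \<open>With an empty series the remainder is e^(w z) u itself. It has the limit 1 at +infinity
  and moves by O(1 / \<open>Y\<close>) along the whole line. This rough bound is enough:
  \<open>connection_value\<close> uses it only in the limit of large degree.\<close>

lemma connection_limit:
  assumes \<sigma>: "\<bar>\<sigma>\<bar> = 1" and N0: "N = 0"
    and ln: "\<And>x. line b m x \<in> omega \<sigma>" "\<And>x. away c (line b m x)"
  obtains C where
    "((\<lambda>x. exp (w * line b m x) * recessive \<sigma> \<nu> \<alpha> \<beta> (line b m x)) \<longlongrightarrow> C) at_bot"
    "((\<lambda>x. exp (w * line b m x) * (w * recessive \<sigma> \<nu> \<alpha> \<beta> (line b m x) + deriv (recessive \<sigma> \<nu> \<alpha> \<beta>) (line b m x))) \<longlongrightarrow> 0) at_bot"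
    "norm (1 - C) \<le> 4 * volterra_const A M c / Y"
proof -
  define u where "u = recessive \<sigma> \<nu> \<alpha> \<beta>"
  define E where "E = (\<lambda>x. remainder N w \<alpha> \<beta> u (line b m x))"
  define E' where "E' = (\<lambda>x. Complex 1 m * remainder' N w \<alpha> \<beta> u (line b m x))"
  have Eq: "E x = exp (w * line b m x) * u (line b m x)"
    "E' x = Complex 1 m * (exp (w * line b m x) * (w * u (line b m x) + deriv u (line b m x)))" for x
    by (simp_all add: E_def E'_def remainder_def remainder'_def partial_series_def N0)
  define h where "h = (\<lambda>x. (Complex 1 m)\<^sup>2 * (pot \<alpha> \<beta> (line b m x) * E x - residual N w \<alpha> \<beta> (line b m x)))"
  have dE: "(E has_vector_derivative E' x) (at x)"
    and dE': "(E' has_vector_derivative (2 * (w * Complex 1 m) * E' x + h x)) (at x)" for x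
    using line_remainder_DERIV[OF recessive(1)[OF \<sigma>] open_omega ln, of x] unfolding E_def E'_def h_def u_def by auto
  have h: "norm (h x) \<le> (volterra_const A M c * norm (E x) + 0) * bump x" for x
    using line_forcing[of b x 0 "E x"] ln by (simp add: residual_def N0 h_def)
  have top: "(E \<longlongrightarrow> 1) at_top" "(E' \<longlongrightarrow> 0) at_top"
    using recessive_at_top(1)[OF \<sigma>, of b] tendsto_mult[OF tendsto_const recessive_at_top(2)[OF \<sigma>, of b], of "Complex 1 m"]
    unfolding Eq[abs_def] u_def by simp_all
  have \<kappa>: "Re (w * Complex 1 m) \<ge> 2" "Re (w * Complex 1 m) \<ge> 4 * volterra_const A M c"
    using Re_w(2) Y_large by linarith+
  define B where "B = 2 * (volterra_const A M c * norm (1::complex) + 0) / Re (w * Complex 1 m)"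
  have B: "norm (E' x) \<le> B * bump x" for x
    unfolding B_def by (rule volterra_line_bound[OF dE dE' h top vc0 _ \<kappa>]) simp
  obtain C where C: "(E \<longlongrightarrow> C) at_bot" "\<And>x. norm (E x - C) \<le> 2 * B"
    using bump_limit_at_bot[OF dE B] by blast
  have "norm (1 - C) \<le> 2 * B"
    by (rule tendsto_upperbound[OF tendsto_norm[OF tendsto_diff[OF top(1) tendsto_const]]]) (use C in auto)
  also have "2 * B \<le> 4 * volterra_const A M c / Y"
    unfolding B_def using Re_w(2) Y_large(1) vc0 by (simp add: frac_le)
  finally have C1: "norm (1 - C) \<le> 4 * volterra_const A M c / Y" .
  have "(E' \<longlongrightarrow> 0) at_bot"
  proof (rule Lim_null_comparison)
    show "\<forall>\<^sub>F x in at_bot. norm (E' x) \<le> B * bump x" using B by simp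
    show "((\<lambda>x. B * bump x) \<longlongrightarrow> 0) at_bot" using tendsto_mult[OF tendsto_const bump_at_bot, of B] by simp
  qed
  then have "((\<lambda>x. inverse (Complex 1 m) * E' x) \<longlongrightarrow> inverse (Complex 1 m) * 0) at_bot"
    by (intro tendsto_intros)
  moreover have "Complex 1 m \<noteq> 0" by (simp add: complex_eq_iff)
  ultimately have "((\<lambda>x. exp (w * line b m x) * (w * u (line b m x) + deriv u (line b m x))) \<longlongrightarrow> 0) at_bot"
    unfolding Eq by (simp add: mult.assoc[symmetric])
  then show ?thesis
    using C(1) C1 that unfolding Eq[abs_def] u_def by blast
qed

end



section \<open>Recursion of the connection coefficient in the degree\<close>

lemma connected_omega: "\<bar>\<sigma>\<bar> = 1 \<Longrightarrow> connected (omega \<sigma>)"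
proof (rule starlike_imp_connected)
  assume s: "\<bar>\<sigma>\<bar> = 1"
  have "1 \<in> omega \<sigma>" by (simp add: omega_def)
  then show "starlike (omega \<sigma>)"
    unfolding starlike_def using omega_starlike[OF s] by blast
qed

text \<open>The factor between the recessive solution and the left-hand side of the expansion of Q
  (see \<open>jacobi_Q_recessive\<close>). Up to the factor w it is also the reciprocal of the
  connection coefficient, by \<open>connection_value\<close>.\<close>

definition jacobi_norm :: "complex \<Rightarrow> complex \<Rightarrow> complex \<Rightarrow> complex" where
  "jacobi_norm \<nu> \<alpha> \<beta> = 2 powr (2 * (2 * \<nu> + \<alpha> + \<beta> + 1) - 1) / of_real pi *
     (Gamma (\<nu> + 1) * Gamma (\<nu> + \<alpha> + \<beta> + 1) * Gamma (\<nu> + \<alpha> + 1) * Gamma (\<nu> + \<beta> + 1)) /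
     Gamma (2 * \<nu> + \<alpha> + \<beta> + 2) ^ 2"

lemma large_parameter_shift:
  assumes "large_parameter N A M c m \<nu> \<alpha> \<beta>"
  shows "large_parameter N A M c m (\<nu> + of_nat k) \<alpha> \<beta>"
proof -
  have "Re ((\<nu> + of_nat k) * Complex 1 m) = Re (\<nu> * Complex 1 m) + real k"
    unfolding distrib_right by simp
  then show ?thesis using assms unfolding large_parameter_def by auto
qed

text \<open>Gauss's limit formula, solved for the Gamma value at the shifted point: it grows like n!
  n^z.\<close>

lemma tendsto_Gamma_shift:
  fixes z :: complex
  assumes "z \<notin> \<int>\<^sub>\<le>\<^sub>0"
  shows "(\<lambda>n. Gamma (z + of_nat (Suc n)) / (fact n * exp (z * of_real (ln (real n))))) \<longlonglongrightarrow> 1"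
proof -
  have nz: "Gamma z \<noteq> 0" using assms by (simp add: Gamma_eq_zero_iff)
  have "Gamma_series z n = fact n * exp (z * of_real (ln (real n))) * Gamma z / Gamma (z + of_nat (Suc n))" for n
    unfolding Gamma_series_def using pochhammer_Gamma[OF assms, of "Suc n"] by simp
  then have eq: "Gamma_series z = (\<lambda>n. fact n * exp (z * of_real (ln (real n))) * Gamma z / Gamma (z + of_nat (Suc n)))"
    by (rule ext)
  have "(\<lambda>n. fact n * exp (z * of_real (ln (real n))) * Gamma z / Gamma (z + of_nat (Suc n))) \<longlonglongrightarrow> Gamma z"
    using Gamma_series_LIMSEQ[of z] unfolding eq .
  from tendsto_divide[OF tendsto_const this nz, of "Gamma z"] nz
  show ?thesis by (simp add: mult.assoc)
qed

context large_parameter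
begin

definition "rung = (\<alpha>\<^sup>2 - \<beta>\<^sup>2) / (w + 1)"

text \<open>The multiplier of the factorisation in \<open>ladder_raises\<close>. It equals -16
  (\<nu> + 1) (\<nu> + \<alpha> + \<beta> + 1) (\<nu> + \<alpha> + 1) (\<nu> + \<beta> + 1) / (w +
  1)^2, as computed in \<open>jacobi_norm_step\<close>.\<close>

definition "ladder_const = 2 * (\<alpha>\<^sup>2 + \<beta>\<^sup>2) - (w + 1)\<^sup>2 - rung\<^sup>2"

lemma nz: "w \<noteq> 0" "w + 1 \<noteq> 0" "w + 2 \<noteq> 0"
proof -
  have *: "x \<noteq> 0" if "x \<notin> \<int>\<^sub>\<le>\<^sub>0" for x :: complex using that by auto
  show "w \<noteq> 0" using *[OF w_shift_not_nonpos(1)[OF le0]] by simp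
  show "w + 1 \<noteq> 0" "w + 2 \<noteq> 0" by (rule *[OF w_shift_not_nonpos(2)], rule *[OF w_shift_not_nonpos(3)])
qed

text \<open>Lowering is applied to the solution of degree \<nu> + 1 because its leading coefficient
  survives: \<open>\<Psi> 0 = - (w + 2)\<close>. Raising the solution of degree \<nu> would cancel
  the leading term and require further Taylor coefficients. By uniqueness the lowered solution is a
  multiple of the recessive one, and raising it again gives the identity.\<close>

lemma ladder_recessive:
  assumes \<sigma>: "\<bar>\<sigma>\<bar> = 1" and z: "z \<in> omega \<sigma>"
  shows "ladder_const * recessive \<sigma> (\<nu> + 1) \<alpha> \<beta> z = - (w + 2) * ladder w rung (recessive \<sigma> \<nu> \<alpha> \<beta>) z"
proof -
  define u where "u = recessive \<sigma> \<nu> \<alpha> \<beta>"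
  define u2 where "u2 = recessive \<sigma> (\<nu> + 1) \<alpha> \<beta>"
  define v where "v = ladder (- (w + 2)) (- rung) u2"
  define \<Phi> where "\<Phi> = recessive_phi (\<nu> + 1) \<alpha> \<beta>"
  have w2: "2 * (\<nu> + 1) + \<alpha> + \<beta> + 1 = w + 2" "2 * (\<nu> + 1) + \<alpha> + \<beta> + 2 = w + 2 + 1" by simp_all
  have \<Phi>: "\<Phi> holomorphic_on ball 0 1" "\<Phi> 0 = 1"
    unfolding \<Phi>_def using recessive_phi_holomorphic recessive_phi_0[of "\<nu> + 1" \<alpha> \<beta>, unfolded w2, OF w_shift_not_nonpos(4)] by auto
  have u2: "schroedinger_on (- (w + 2)) \<alpha> \<beta> (omega \<sigma>) u2"
    using recessive(1)[OF \<sigma>, of "\<nu> + 1" \<alpha> \<beta>] unfolding w2 u2_def schroedinger_on_minus .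
  have u2_eq: "u2 z = exp (- (w + 2) * z) * \<Phi> (exp (- 2 * z))" if "Re z > 0" for z
    using recessive(2)[OF \<sigma> that, of "\<nu> + 1" \<alpha> \<beta>] unfolding w2 u2_def \<Phi>_def .
  have r: "- rung * (- (w + 2) + 1) = \<alpha>\<^sup>2 - \<beta>\<^sup>2"
  proof -
    have "- rung * (- (w + 2) + 1) = rung * (w + 1)" by (simp add: algebra_simps)
    then show ?thesis using nz(2) by (simp add: rung_def)
  qed
  have om: "open (omega \<sigma>)" "\<And>z. z \<in> omega \<sigma> \<Longrightarrow> sinh z \<noteq> 0 \<and> cosh z \<noteq> 0"
    using open_omega omega_nz[OF \<sigma>] by auto
  note L = ladder_raises[OF u2 om r, folded v_def]

  have s1: "- (w + 2) + 2 = - w" "- (- w) = w" "(- (w + 2) + 1)\<^sup>2 = (w + 1)\<^sup>2" "(- rung)\<^sup>2 = rung\<^sup>2" "- (- rung) = rung"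
    by (simp_all add: power2_eq_square algebra_simps)
  have vs: "schroedinger_on w \<alpha> \<beta> (omega \<sigma>) v"
  proof -
    have "schroedinger_on (- (w + 2) + 2) \<alpha> \<beta> (omega \<sigma>) v" by (rule L(1))
    then show ?thesis unfolding s1 schroedinger_on_minus .
  qed
  have bk: "ladder w rung v z = ladder_const * u2 z"
  proof -
    have "ladder (- (- (w + 2) + 2)) (- (- rung)) v z = (2 * (\<alpha>\<^sup>2 + \<beta>\<^sup>2) - (- (w + 2) + 1)\<^sup>2 - (- rung)\<^sup>2) * u2 z"
      by (rule L(2)) (assumption | rule z)+
    then show ?thesis unfolding s1 ladder_const_def .
  qed
  define \<Psi> where "\<Psi> = (\<lambda>t. - (w + 2) * \<Phi> t - t * (1 - t\<^sup>2) * deriv \<Phi> t - rung * t * \<Phi> t)"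
  have \<Psi>: "\<Psi> holomorphic_on ball 0 1" "\<Psi> 0 = - (w + 2)"
    unfolding \<Psi>_def using \<Phi> by (auto intro!: holomorphic_intros)
  have v_eq: "v z = exp (- w * z) * \<Psi> (exp (- 2 * z))" if z: "Re z > 0" for z
  proof -
    define T where "T = exp (- 2 * z)"
    define s where "s = sinh (2 * z)"
    define c where "c = cosh (2 * z)"
    have Te: "T * exp (2 * z) = 1" "exp (- (2 * z)) = T" by (simp_all add: T_def flip: exp_add)
    have "s = (exp (2 * z) - T) / 2" "c = (exp (2 * z) + T) / 2"
      unfolding s_def c_def sinh_field_def cosh_field_def Te(2) by simp_all
    then have "s + c = exp (2 * z)" "2 * T * s = T * exp (2 * z) - T * T"
      by (simp_all add: diff_divide_distrib add_divide_distrib right_diff_distrib)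
    then have h: "T * (s + c) = 1" "2 * T * s = 1 - T\<^sup>2"
      using Te(1) by (simp_all add: power2_eq_square)
    have "exp (- (a + 2) * z) = exp (- a * z) * exp (- 2 * z)" for a
      by (simp add: algebra_simps flip: exp_add)
    then have e: "exp (- (w + 2) * z) = exp (- w * z) * T" unfolding T_def .
    have du: "deriv u2 z = exp (- (w + 2) * z) * (- (w + 2) * \<Phi> T - 2 * T * deriv \<Phi> T)"
      unfolding T_def by (rule deriv_exp_times[OF \<Phi>(1) u2_eq z])
    have "s * (E * T * (- a * P - 2 * T * Q)) + (- a * c + - r) * (E * T * P) =
      E * (- a * (T * (s + c)) * P - T * (2 * T * s) * Q - r * T * P)" for E P Q a r
      by (simp add: algebra_simps)
    then have "v z = exp (- w * z) * (- (w + 2) * (T * (s + c)) * \<Phi> T - T * (2 * T * s) * deriv \<Phi> T - rung * T * \<Phi> T)"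
      unfolding v_def ladder_def du u2_eq[OF z] T_def[symmetric] e s_def[symmetric] c_def[symmetric] .
    then show ?thesis unfolding h \<Psi>_def T_def[symmetric] by simp
  qed
  have pos: "Re (w * Complex 1 m) > 0" using Re_w(2) Y_large(1) by linarith
  have w2': "2 * \<nu> + \<alpha> + \<beta> + 2 \<notin> \<int>\<^sub>\<le>\<^sub>0" using w_shift_not_nonpos(2) by (simp add: add.assoc)
  have v_right: "v x = - (w + 2) * u x" if "Re x > 0" for x
    using recessive_unique[OF schroedinger_on_subset[OF vs right_half_subset_omega] \<Psi>(1) v_eq pos w2' that \<sigma>]
    unfolding u_def \<Psi>(2) .
  have hv: "v holomorphic_on omega \<sigma>" and hu: "u holomorphic_on omega \<sigma>"
    using vs recessive(1)[OF \<sigma>, of \<nu> \<alpha> \<beta>] unfolding schroedinger_on_def u_def by blast+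
  have "1 \<in> right_half" by (simp add: right_half)
  then have ne: "right_half \<noteq> {}" by blast
  have eq: "v x = - (w + 2) * u x" if "x \<in> omega \<sigma>" for x
  proof (rule analytic_continuation_open[of right_half "omega \<sigma>" v "\<lambda>x. - (w + 2) * u x"])
    show "(\<lambda>x. - (w + 2) * u x) holomorphic_on omega \<sigma>"
      by (intro holomorphic_on_mult holomorphic_on_const hu)
    show "v y = - (w + 2) * u y" if "y \<in> right_half" for y
      using that unfolding right_half by (rule v_right)
  qed (rule right_half(1) open_omega ne connected_omega[OF \<sigma>] right_half_subset_omega hv that)+
  have "(u has_field_derivative deriv u z) (at z)"
    using schroedinger_onD(1)[OF recessive(1)[OF \<sigma>] open_omega z] by (simp add: u_def)
  then have "((\<lambda>x. - (w + 2) * u x) has_field_derivative - (w + 2) * deriv u z) (at z)"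
    by (rule DERIV_cmult)
  then have "(v has_field_derivative - (w + 2) * deriv u z) (at z)"
    by (rule has_field_derivative_transform_within_open[OF _ open_omega z]) (rule eq[symmetric])
  then have dv: "deriv v z = - (w + 2) * deriv u z" by (rule DERIV_imp_deriv)
  have alg: "s * (k * d) + q * (k * y) = k * (s * d + q * y)" for s k d q y :: complex
    by (simp add: algebra_simps)
  have "ladder_const * u2 z = ladder w rung v z" using bk by (rule sym)
  also have "\<dots> = - (w + 2) * ladder w rung u z"
    unfolding ladder_def eq[OF z] dv by (rule alg)
  finally show ?thesis unfolding u_def u2_def .
qed

text \<open>The ladder relation multiplied by e^((w + 2) z), in the limit Re z -> -infinity. The
  derivative contribution tends to 0 there, and since e^(2 z) (cosh (2 z) - sinh (2 z)) = 1 the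
  coefficient of C is -(w + 2) w.\<close>

lemma connection_step:
  assumes \<sigma>: "\<bar>\<sigma>\<bar> = 1" and ln: "\<And>x. line b m x \<in> omega \<sigma>"
    and C: "((\<lambda>x. exp (w * line b m x) * recessive \<sigma> \<nu> \<alpha> \<beta> (line b m x)) \<longlongrightarrow> C) at_bot"
      "((\<lambda>x. exp (w * line b m x) * (w * recessive \<sigma> \<nu> \<alpha> \<beta> (line b m x) + deriv (recessive \<sigma> \<nu> \<alpha> \<beta>) (line b m x))) \<longlongrightarrow> 0) at_bot"
    and C': "((\<lambda>x. exp ((w + 2) * line b m x) * recessive \<sigma> (\<nu> + 1) \<alpha> \<beta> (line b m x)) \<longlongrightarrow> C') at_bot"
  shows "ladder_const * C' = - (w + 2) * w * C"
proof (rule tendsto_unique[OF trivial_limit_at_bot_linorder])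
  show "((\<lambda>x. ladder_const * (exp ((w + 2) * line b m x) * recessive \<sigma> (\<nu> + 1) \<alpha> \<beta> (line b m x))) \<longlongrightarrow> ladder_const * C') at_bot"
    by (intro tendsto_intros C')
  define u where "u = recessive \<sigma> \<nu> \<alpha> \<beta>"
  define S where "S = (\<lambda>z. exp (w * z) * u z)"
  define D where "D = (\<lambda>z. exp (w * z) * (w * u z + deriv u z))"
  have key: "ladder_const * (exp ((w + 2) * z) * recessive \<sigma> (\<nu> + 1) \<alpha> \<beta> z) =
      - (w + 2) * ((exp (4 * z) - 1) / 2 * D z + w * S z + rung * exp (2 * z) * S z)" if "z \<in> omega \<sigma>" for z
  proof -
    define T where "T = exp (2 * z)"
    define s where "s = sinh (2 * z)"
    define c where "c = cosh (2 * z)"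
    have Te: "T * exp (- (2 * z)) = 1" "exp (4 * z) = T * T" by (simp_all add: T_def flip: exp_add)
    have "s = (T - exp (- (2 * z))) / 2" "c = (T + exp (- (2 * z))) / 2"
      unfolding s_def c_def sinh_field_def cosh_field_def T_def by simp_all
    then have "c - s = exp (- (2 * z))" "T * s = (T * T - T * exp (- (2 * z))) / 2"
      by (simp_all add: diff_divide_distrib add_divide_distrib right_diff_distrib)
    then have h: "T * (c - s) = 1" "T * s = (T * T - 1) / 2"
      using Te(1) by simp_all
    have e: "exp ((w + 2) * z) = exp (w * z) * T"
      by (simp add: T_def algebra_simps flip: exp_add)
    have "ladder_const * (exp ((w + 2) * z) * recessive \<sigma> (\<nu> + 1) \<alpha> \<beta> z) =
       exp (w * z) * T * (ladder_const * recessive \<sigma> (\<nu> + 1) \<alpha> \<beta> z)" unfolding e by (simp add: mult_ac)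
    also have "\<dots> = exp (w * z) * T * (- (w + 2) * (s * deriv u z + (w * c + rung) * u z))"
      unfolding ladder_recessive[OF \<sigma> that] ladder_def u_def s_def c_def ..
    also have "\<dots> = - (w + 2) * ((T * s) * D z + w * (T * (c - s)) * S z + rung * T * S z)"
    proof -
      have "E * T * (k * (s * d + (a * c + r) * y)) = k * ((T * s) * (E * (a * y + d)) + a * (T * (c - s)) * (E * y) + r * T * (E * y))"
        for E k d a r y by (simp add: algebra_simps)
      then show ?thesis unfolding D_def S_def .
    qed
    finally show ?thesis unfolding h Te(2) T_def[symmetric] by simp
  qed
  have E: "((\<lambda>x. exp (2 * line b m x)) \<longlongrightarrow> 0) at_bot" "((\<lambda>x. exp (4 * line b m x)) \<longlongrightarrow> 0) at_bot"
    by (rule exp_line_at_bot; simp)+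
  have "((\<lambda>x. - (w + 2) * ((exp (4 * line b m x) - 1) / 2 * D (line b m x) + w * S (line b m x) + rung * exp (2 * line b m x) * S (line b m x)))
     \<longlongrightarrow> - (w + 2) * ((0 - 1) / 2 * 0 + w * C + rung * 0 * C)) at_bot"
    unfolding D_def S_def u_def by (intro tendsto_intros E C) auto
  then show "((\<lambda>x. ladder_const * (exp ((w + 2) * line b m x) * recessive \<sigma> (\<nu> + 1) \<alpha> \<beta> (line b m x))) \<longlongrightarrow> - (w + 2) * w * C) at_bot"
    unfolding key[OF ln] by (simp add: mult.assoc)
qed

text \<open>Together with \<open>connection_step\<close> this makes the product of w,
  \<open>jacobi_norm\<close> and the connection coefficient invariant under \<nu> -> \<nu> +
  1.\<close>

lemma jacobi_norm_step: "jacobi_norm (\<nu> + 1) \<alpha> \<beta> * (w + 2)\<^sup>2 = - ladder_const * jacobi_norm \<nu> \<alpha> \<beta>"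
proof -
  have G: "Gamma (\<nu> + 1 + 1) = (\<nu> + 1) * Gamma (\<nu> + 1)"
    "Gamma (\<nu> + 1 + \<alpha> + \<beta> + 1) = (\<nu> + \<alpha> + \<beta> + 1) * Gamma (\<nu> + \<alpha> + \<beta> + 1)"
    "Gamma (\<nu> + 1 + \<alpha> + 1) = (\<nu> + \<alpha> + 1) * Gamma (\<nu> + \<alpha> + 1)"
    "Gamma (\<nu> + 1 + \<beta> + 1) = (\<nu> + \<beta> + 1) * Gamma (\<nu> + \<beta> + 1)"
    using Gamma_plus1[OF shifts(1)] Gamma_plus1[OF shifts(2)] Gamma_plus1[OF shifts(3)] Gamma_plus1[OF shifts(4)]
    by (simp_all add: add_ac)
  have W: "Gamma (2 * (\<nu> + 1) + \<alpha> + \<beta> + 2) = (w + 2) * ((w + 1) * Gamma (w + 1))"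
  proof -
    have "Gamma (w + 2 + 1) = (w + 2) * Gamma (w + 2)" by (rule Gamma_plus1[OF w_shift_not_nonpos(3)])
    moreover have "Gamma (w + 1 + 1) = (w + 1) * Gamma (w + 1)" by (rule Gamma_plus1[OF w_shift_not_nonpos(2)])
    moreover have "w + 1 + 1 = w + 2" "2 * (\<nu> + 1) + \<alpha> + \<beta> + 2 = w + 2 + 1" by simp_all
    ultimately show ?thesis by (simp only:)
  qed
  have w1: "2 * \<nu> + \<alpha> + \<beta> + 2 = w + 1" by simp
  have P: "(2 :: complex) powr (2 * (2 * (\<nu> + 1) + \<alpha> + \<beta> + 1) - 1) = 16 * 2 powr (2 * w - 1)"
  proof -
    have "2 * (2 * (\<nu> + 1) + \<alpha> + \<beta> + 1) - 1 = (2 * w - 1) + of_nat 4" by simp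
    moreover have "(2 :: complex) powr of_nat 4 = 2 ^ 4" by (rule powr_nat') simp
    ultimately show ?thesis by (simp only: powr_add) simp
  qed
  have K: "ladder_const * (w + 1)\<^sup>2 = - 16 * ((\<nu> + 1) * (\<nu> + \<alpha> + \<beta> + 1) * (\<nu> + \<alpha> + 1) * (\<nu> + \<beta> + 1))"
  proof -
    have "ladder_const * (w + 1)\<^sup>2 = (2 * (\<alpha>\<^sup>2 + \<beta>\<^sup>2) - (w + 1)\<^sup>2) * (w + 1)\<^sup>2 - (rung * (w + 1))\<^sup>2"
    proof -
      have "(a - x\<^sup>2 - r\<^sup>2) * x\<^sup>2 = (a - x\<^sup>2) * x\<^sup>2 - (r * x)\<^sup>2" for a x r :: complex
        by (simp add: power2_eq_square algebra_simps)
      then show ?thesis unfolding ladder_const_def .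
    qed
    also have "rung * (w + 1) = \<alpha>\<^sup>2 - \<beta>\<^sup>2" using nz(2) by (simp add: rung_def)
    also have "(2 * (\<alpha>\<^sup>2 + \<beta>\<^sup>2) - (w + 1)\<^sup>2) * (w + 1)\<^sup>2 - (\<alpha>\<^sup>2 - \<beta>\<^sup>2)\<^sup>2 =
       - ((w + 1)\<^sup>2 - (\<alpha> + \<beta>)\<^sup>2) * ((w + 1)\<^sup>2 - (\<alpha> - \<beta>)\<^sup>2)"
    proof -
      have "(2 * (\<alpha>\<^sup>2 + \<beta>\<^sup>2) - x\<^sup>2) * x\<^sup>2 - (\<alpha>\<^sup>2 - \<beta>\<^sup>2)\<^sup>2 = - (x\<^sup>2 - (\<alpha> + \<beta>)\<^sup>2) * (x\<^sup>2 - (\<alpha> - \<beta>)\<^sup>2)" for x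
        by (simp add: power2_eq_square algebra_simps)
      then show ?thesis .
    qed
    also have "(w + 1)\<^sup>2 - (\<alpha> + \<beta>)\<^sup>2 = 4 * ((\<nu> + 1) * (\<nu> + \<alpha> + \<beta> + 1))"
      by (simp add: power2_eq_square algebra_simps)
    also have "(w + 1)\<^sup>2 - (\<alpha> - \<beta>)\<^sup>2 = 4 * ((\<nu> + \<alpha> + 1) * (\<nu> + \<beta> + 1))"
      by (simp add: power2_eq_square algebra_simps)
    finally show ?thesis by simp
  qed
  have G0: "Gamma (w + 1) \<noteq> 0" using w_shift_not_nonpos(2) by (simp add: Gamma_eq_zero_iff)
  define Q where "Q = 2 powr (2 * w - 1) / of_real pi * (Gamma (\<nu> + 1) * Gamma (\<nu> + \<alpha> + \<beta> + 1) * Gamma (\<nu> + \<alpha> + 1) * Gamma (\<nu> + \<beta> + 1)) / Gamma (w + 1) ^ 2"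
  have "16 * p / q * (a * A * (b * B) * (d * D) * (e * E)) / (x * (y * G)) ^ 2 * x\<^sup>2 = 16 * (a * b * d * e) / y\<^sup>2 * (p / q * (A * B * D * E) / G\<^sup>2)"
    if "x \<noteq> 0" for p q a b d e A B D E x y G :: complex
    using that by (simp add: power_mult_distrib divide_inverse mult_ac)
  from this[OF nz(3)]
  have "jacobi_norm (\<nu> + 1) \<alpha> \<beta> * (w + 2)\<^sup>2 = 16 * ((\<nu> + 1) * (\<nu> + \<alpha> + \<beta> + 1) * (\<nu> + \<alpha> + 1) * (\<nu> + \<beta> + 1)) / (w + 1)\<^sup>2 * Q"
    unfolding jacobi_norm_def G W P Q_def .
  also have "16 * ((\<nu> + 1) * (\<nu> + \<alpha> + \<beta> + 1) * (\<nu> + \<alpha> + 1) * (\<nu> + \<beta> + 1)) = - ladder_const * (w + 1)\<^sup>2"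
    using K by simp
  also have "- ladder_const * (w + 1)\<^sup>2 / (w + 1)\<^sup>2 = - ladder_const" using nz(2) by simp
  also have "Q = jacobi_norm \<nu> \<alpha> \<beta>" unfolding Q_def jacobi_norm_def w1 ..
  finally show ?thesis .
qed

text \<open>Legendre's duplication formula trades the power of 2 and the Gamma function of doubled
  argument for a quotient of four Gamma factors over four, whose growth in the degree can be read
  off.\<close>

lemma jacobi_norm_duplication:
  "jacobi_norm \<nu> \<alpha> \<beta> = 1/2 * (Gamma (\<nu> + 1) * Gamma (\<nu> + \<alpha> + \<beta> + 1) * Gamma (\<nu> + \<alpha> + 1) * Gamma (\<nu> + \<beta> + 1)) /
     (Gamma (\<nu> + ((\<alpha> + \<beta>) / 2 + 1)) * Gamma (\<nu> + ((\<alpha> + \<beta>) / 2 + 3/2)))\<^sup>2"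
proof -
  define z where "z = \<nu> + ((\<alpha> + \<beta>) / 2 + 1)"
  have z: "z + 1/2 = \<nu> + ((\<alpha> + \<beta>) / 2 + 3/2)" "2 * z = 2 * \<nu> + \<alpha> + \<beta> + 2" by (simp_all add: z_def field_simps)
  have "Gamma z * Gamma (z + 1/2) = exp ((1 - 2 * z) * of_real (ln 2)) * of_real (sqrt pi) * Gamma (2 * z)"
    by (rule Gamma_legendre_duplication) (use shifts(5,6) in \<open>simp_all add: z z_def[symmetric]\<close>)
  then have "(Gamma z * Gamma (z + 1/2))\<^sup>2 = exp ((1 - 2 * z) * of_real (ln 2)) ^ 2 * of_real pi * Gamma (2 * z) ^ 2"
    by (simp add: power_mult_distrib flip: of_real_power)
  moreover have "2 powr (2 * (2 * \<nu> + \<alpha> + \<beta> + 1) - 1) * exp ((1 - 2 * z) * of_real (ln 2)) ^ 2 = 1 / 2"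
  proof -
    have "Ln 2 = of_real (ln 2)" by (metis Ln_of_real of_real_numeral zero_less_numeral)
    then have "2 powr (2 * (2 * \<nu> + \<alpha> + \<beta> + 1) - 1) * exp ((1 - 2 * z) * of_real (ln 2)) ^ 2 =
        exp ((2 * (2 * \<nu> + \<alpha> + \<beta> + 1) - 1) * of_real (ln 2) + 2 * ((1 - 2 * z) * of_real (ln 2)))"
      by (simp add: powr_def exp_add exp_double)
    also have "(2 * (2 * \<nu> + \<alpha> + \<beta> + 1) - 1) * of_real (ln 2) + 2 * ((1 - 2 * z) * of_real (ln 2)) = - of_real (ln 2)"
      unfolding z(2) by (simp add: algebra_simps)
    also have "exp (- of_real (ln 2) :: complex) = 1 / 2" by (simp add: exp_minus exp_of_real field_simps)
    finally show ?thesis .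
  qed
  moreover have "Gamma (2 * z) \<noteq> 0"
    using w_shift_not_nonpos(2) unfolding z(2) by (simp add: Gamma_eq_zero_iff add.assoc)
  moreover have "p / q * X / G = 1/2 * X / Y" if "Y = d * q * G" "p * d = 1/2" "G \<noteq> 0" "q \<noteq> 0" for p q d X Y G :: complex
  proof -
    have "d \<noteq> 0" using that(2) by auto
    have "p = 1 / (2 * d)" using that(2) \<open>d \<noteq> 0\<close> by (simp add: field_simps)
    then show ?thesis using that \<open>d \<noteq> 0\<close> by (simp add: field_simps)
  qed
  ultimately show ?thesis
    unfolding jacobi_norm_def z(2)[symmetric] z(1)[symmetric] z_def[symmetric] by simp
qed

end

text \<open>The parameters of the four Gamma factors in the numerator add up to one less than those
  in the denominator, so \<open>jacobi_norm\<close> behaves like 1 / (2 n), and the factor w + 2 n +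
  2 balances it.\<close>

lemma (in large_parameter) jacobi_norm_limit:
  "(\<lambda>n. (w + 2 * of_nat (Suc n)) * jacobi_norm (\<nu> + of_nat (Suc n)) \<alpha> \<beta>) \<longlonglongrightarrow> 1"
proof -
  define z where "z = \<nu> + ((\<alpha> + \<beta>) / 2 + 1)"
  define z' where "z' = \<nu> + ((\<alpha> + \<beta>) / 2 + 3/2)"
  define q where "q = (\<lambda>a n. Gamma (a + of_nat (Suc n)) / (fact n * exp (a * of_real (ln (real n)))) :: complex)"
  define e where "e = (\<lambda>(a::complex) n. exp (a * of_real (ln (real n))))"
  have G: "Gamma (a + of_nat (Suc n)) = q a n * (fact n * e a n)" for a n by (simp add: q_def e_def)
  have lim: "(q (\<nu> + 1)) \<longlonglongrightarrow> 1" "q (\<nu> + \<alpha> + \<beta> + 1) \<longlonglongrightarrow> 1" "q (\<nu> + \<alpha> + 1) \<longlonglongrightarrow> 1" "q (\<nu> + \<beta> + 1) \<longlonglongrightarrow> 1" "q z \<longlonglongrightarrow> 1" "q z' \<longlonglongrightarrow> 1"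
    unfolding q_def z_def z'_def using shifts by (intro tendsto_Gamma_shift; simp)+
  have L: "(\<lambda>n. (w + 2 + 2 * of_nat n) / (2 * of_nat n) * ((q (\<nu> + 1) n * q (\<nu> + \<alpha> + \<beta> + 1) n * q (\<nu> + \<alpha> + 1) n * q (\<nu> + \<beta> + 1) n) / (q z n * q z' n)\<^sup>2)) \<longlonglongrightarrow> 1 * ((1 * 1 * 1 * 1) / (1 * 1)\<^sup>2)"
  proof (intro tendsto_intros lim)
    have "(\<lambda>n. ((w + 2) / 2 + of_nat n) / (0 + of_nat n)) \<longlonglongrightarrow> 1" by (rule tendsto_shift_ratio)
    moreover have "((w + 2) / 2 + of_nat n) / (0 + of_nat n) = (w + 2 + 2 * of_nat n) / (2 * of_nat n)" for n
      by (cases "n = 0") (simp_all add: field_simps)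
    ultimately show "(\<lambda>n. (w + 2 + 2 * of_nat n) / (2 * of_nat n)) \<longlonglongrightarrow> 1" by (simp only:)
  qed simp
  have "\<forall>\<^sub>F n in sequentially. (w + 2 + 2 * of_nat n) / (2 * of_nat n) * ((q (\<nu> + 1) n * q (\<nu> + \<alpha> + \<beta> + 1) n * q (\<nu> + \<alpha> + 1) n * q (\<nu> + \<beta> + 1) n) / (q z n * q z' n)\<^sup>2)
     = (w + 2 * of_nat (Suc n)) * jacobi_norm (\<nu> + of_nat (Suc n)) \<alpha> \<beta>"
    using eventually_gt_at_top[of 0]
  proof eventually_elim
    case (elim n)
    interpret s: large_parameter N A M c m "\<nu> + of_nat (Suc n)" \<alpha> \<beta>
      by (rule large_parameter_shift) (rule large_parameter_axioms)
    have a: "\<nu> + of_nat (Suc n) + 1 = \<nu> + 1 + of_nat (Suc n)" "\<nu> + of_nat (Suc n) + \<alpha> + \<beta> + 1 = \<nu> + \<alpha> + \<beta> + 1 + of_nat (Suc n)"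
      "\<nu> + of_nat (Suc n) + \<alpha> + 1 = \<nu> + \<alpha> + 1 + of_nat (Suc n)" "\<nu> + of_nat (Suc n) + \<beta> + 1 = \<nu> + \<beta> + 1 + of_nat (Suc n)"
      "\<nu> + of_nat (Suc n) + ((\<alpha> + \<beta>) / 2 + 1) = z + of_nat (Suc n)" "\<nu> + of_nat (Suc n) + ((\<alpha> + \<beta>) / 2 + 3/2) = z' + of_nat (Suc n)"
      by (simp_all add: z_def z'_def)
    have "e (\<nu> + 1) n * e (\<nu> + \<alpha> + \<beta> + 1) n * e (\<nu> + \<alpha> + 1) n * e (\<nu> + \<beta> + 1) n * of_nat n = (e z n * e z' n)\<^sup>2"
    proof -
      have "of_nat n = exp (of_real (ln (real n)) :: complex)" using elim by (simp add: exp_of_real)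
      then have "e (\<nu> + 1) n * e (\<nu> + \<alpha> + \<beta> + 1) n * e (\<nu> + \<alpha> + 1) n * e (\<nu> + \<beta> + 1) n * of_nat n =
        exp ((\<nu> + 1) * of_real (ln (real n)) + (\<nu> + \<alpha> + \<beta> + 1) * of_real (ln (real n)) + (\<nu> + \<alpha> + 1) * of_real (ln (real n)) + (\<nu> + \<beta> + 1) * of_real (ln (real n)) + of_real (ln (real n)))"
        unfolding e_def exp_add by simp
      also have "(\<nu> + 1) * of_real (ln (real n)) + (\<nu> + \<alpha> + \<beta> + 1) * of_real (ln (real n)) + (\<nu> + \<alpha> + 1) * of_real (ln (real n)) + (\<nu> + \<beta> + 1) * of_real (ln (real n)) + of_real (ln (real n))
        = 2 * (z * of_real (ln (real n)) + z' * of_real (ln (real n)))"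
        by (simp add: z_def z'_def field_simps)
      also have "exp \<dots> = (e z n * e z' n)\<^sup>2" by (simp add: e_def exp_double exp_add power_mult_distrib)
      finally show ?thesis .
    qed
    then have ee: "e (\<nu> + 1) n * e (\<nu> + \<alpha> + \<beta> + 1) n * e (\<nu> + \<alpha> + 1) n * e (\<nu> + \<beta> + 1) n / (e z n * e z' n)\<^sup>2 = 1 / of_nat n"
      using elim by (simp add: field_simps e_def)
    have f: "fact n \<noteq> (0::complex)" by simp
    have "1/2 * (q1 * (F * e1) * (q2 * (F * e2)) * (q3 * (F * e3)) * (q4 * (F * e4))) / (q5 * (F * e5) * (q6 * (F * e6)))\<^sup>2 =
       1/2 * ((q1 * q2 * q3 * q4) / (q5 * q6)\<^sup>2) * (e1 * e2 * e3 * e4 / (e5 * e6)\<^sup>2)" if "F \<noteq> 0" for F q1 q2 q3 q4 q5 q6 e1 e2 e3 e4 e5 e6 :: complex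
    proof -
      have n: "q1 * (F * e1) * (q2 * (F * e2)) * (q3 * (F * e3)) * (q4 * (F * e4)) = (q1 * q2 * q3 * q4) * (e1 * e2 * e3 * e4) * F ^ 4"
        by (simp add: power4_eq_xxxx mult_ac)
      have d: "(q5 * (F * e5) * (q6 * (F * e6)))\<^sup>2 = (q5 * q6)\<^sup>2 * (e5 * e6)\<^sup>2 * F ^ 4"
        by (simp add: power4_eq_xxxx power2_eq_square mult_ac)
      show ?thesis unfolding n d using that by (simp add: mult_ac)
    qed
    note alg = this[OF f]
    have "jacobi_norm (\<nu> + of_nat (Suc n)) \<alpha> \<beta> = 1/2 * ((q (\<nu> + 1) n * q (\<nu> + \<alpha> + \<beta> + 1) n * q (\<nu> + \<alpha> + 1) n * q (\<nu> + \<beta> + 1) n) / (q z n * q z' n)\<^sup>2) * (1 / of_nat n)"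
      unfolding s.jacobi_norm_duplication a G alg ee ..
    moreover have "w + 2 * of_nat (Suc n) = w + 2 + 2 * of_nat n" by simp
    moreover have "x / (2 * y) * Q = x * (1/2 * Q * (1 / y))" for x y Q :: complex by simp
    ultimately show ?case by (simp only:)
  qed
  from Lim_transform_eventually[OF L this] show ?thesis by simp
qed

text \<open>By the two step lemmas the product of w + 2 n, \<open>jacobi_norm\<close> and C is the
  same for all degrees \<nu> + n. It tends to 1 as n grows, since C does by
  \<open>connection_limit\<close> and the rest by \<open>jacobi_norm_limit\<close>. The value 1 / w
  is the leading term \<open>inv_fact w 0\<close> of the series.\<close>

lemma (in large_parameter) connection_value:
  assumes N0: "N = 0" and \<sigma>: "\<bar>\<sigma>\<bar> = 1" and ln: "\<And>x. line b m x \<in> omega \<sigma>" "\<And>x. away c (line b m x)"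
  shows "((\<lambda>x. jacobi_norm \<nu> \<alpha> \<beta> * (exp (w * line b m x) * recessive \<sigma> \<nu> \<alpha> \<beta> (line b m x))) \<longlongrightarrow> 1 / w) at_bot"
proof -
  define S where "S = (\<lambda>n x. exp ((2 * (\<nu> + of_nat n) + \<alpha> + \<beta> + 1) * line b m x) * recessive \<sigma> (\<nu> + of_nat n) \<alpha> \<beta> (line b m x))"
  define D where "D = (\<lambda>n x. exp ((2 * (\<nu> + of_nat n) + \<alpha> + \<beta> + 1) * line b m x) *
     ((2 * (\<nu> + of_nat n) + \<alpha> + \<beta> + 1) * recessive \<sigma> (\<nu> + of_nat n) \<alpha> \<beta> (line b m x) + deriv (recessive \<sigma> (\<nu> + of_nat n) \<alpha> \<beta>) (line b m x)))"
  have lp: "large_parameter N A M c m (\<nu> + of_nat n) \<alpha> \<beta>" for n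
    by (rule large_parameter_shift) (rule large_parameter_axioms)
  have "\<exists>C. (S n \<longlongrightarrow> C) at_bot \<and> (D n \<longlongrightarrow> 0) at_bot \<and> norm (1 - C) \<le> 4 * volterra_const A M c / Re ((\<nu> + of_nat n) * Complex 1 m)" for n
    unfolding S_def D_def by (rule large_parameter.connection_limit[OF lp \<sigma> N0 ln]) blast+
  then obtain C where C: "\<And>n. (S n \<longlongrightarrow> C n) at_bot" "\<And>n. (D n \<longlongrightarrow> 0) at_bot"
      "\<And>n. norm (1 - C n) \<le> 4 * volterra_const A M c / Re ((\<nu> + of_nat n) * Complex 1 m)" by metis
  define T where "T = (\<lambda>n. (w + 2 * of_nat n) * jacobi_norm (\<nu> + of_nat n) \<alpha> \<beta> * C n)"
  have step: "T (Suc n) = T n" for n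
  proof -
    interpret s: large_parameter N A M c m "\<nu> + of_nat n" \<alpha> \<beta> by (rule lp)
    define W where "W = w + 2 * of_nat n"
    have W: "2 * (\<nu> + of_nat n) + \<alpha> + \<beta> + 1 = W" "2 * (\<nu> + of_nat (Suc n)) + \<alpha> + \<beta> + 1 = W + 2" "w + 2 * of_nat (Suc n) = W + 2"
      by (simp_all add: W_def)
    have n1: "\<nu> + of_nat (Suc n) = \<nu> + of_nat n + 1" by simp
    have 1: "s.ladder_const * C (Suc n) = - (W + 2) * W * C n"
      by (rule s.connection_step[OF \<sigma> ln(1), where C = "C n" and C' = "C (Suc n)", unfolded W,
          OF C(1)[of n, unfolded S_def, unfolded W] C(2)[of n, unfolded D_def, unfolded W]
            C(1)[of "Suc n", unfolded S_def, unfolded W, unfolded n1]])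
    have 2: "jacobi_norm (\<nu> + of_nat (Suc n)) \<alpha> \<beta> * (W + 2)\<^sup>2 = - s.ladder_const * jacobi_norm (\<nu> + of_nat n) \<alpha> \<beta>"
      using s.jacobi_norm_step unfolding W n1 .
    have "(W + 2) * T (Suc n) = (jacobi_norm (\<nu> + of_nat (Suc n)) \<alpha> \<beta> * (W + 2)\<^sup>2) * C (Suc n)"
      unfolding T_def W by (simp add: power2_eq_square mult_ac)
    also have "\<dots> = - jacobi_norm (\<nu> + of_nat n) \<alpha> \<beta> * (s.ladder_const * C (Suc n))"
      unfolding 2 by (simp add: mult_ac)
    also have "\<dots> = (W + 2) * T n"
    proof -
      have "T n = W * jacobi_norm (\<nu> + of_nat n) \<alpha> \<beta> * C n" by (simp add: T_def W_def)
      then show ?thesis unfolding 1 by (simp add: algebra_simps)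
    qed
    finally show ?thesis using s.nz(3) unfolding W by simp
  qed
  have "T (Suc n) = T 0" for n by (induction n) (simp_all add: step)
  moreover have "(\<lambda>n. T (Suc n)) \<longlonglongrightarrow> 1 * 1"
    unfolding T_def
  proof (intro tendsto_mult jacobi_norm_limit)
    have Yn: "Re ((\<nu> + of_nat n) * Complex 1 m) = Y + real n" for n unfolding distrib_right by simp
    have "(\<lambda>n. 4 * volterra_const A M c * inverse (Y + real n)) \<longlonglongrightarrow> 4 * volterra_const A M c * 0"
      by (intro tendsto_intros tendsto_inverse_0_at_top filterlim_tendsto_add_at_top[OF tendsto_const] filterlim_real_sequentially)
    then have n0: "(\<lambda>n. 4 * volterra_const A M c * inverse (Y + real n)) \<longlonglongrightarrow> 0"
      by (simp only: mult_zero_right)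
    have "norm (1 - C n) \<le> 4 * volterra_const A M c * inverse (Y + real n)" for n
      using C(3)[of n] unfolding Yn divide_inverse .
    then have "\<forall>\<^sub>F n in sequentially. norm (1 - C n) \<le> 4 * volterra_const A M c * inverse (Y + real n)"
      by (intro always_eventually allI)
    then have "(\<lambda>n. 1 - C n) \<longlonglongrightarrow> 0" using n0 by (rule Lim_null_comparison)
    from tendsto_diff[OF tendsto_const this, of 1] have "C \<longlonglongrightarrow> 1" by simp
    then show "(\<lambda>n. C (Suc n)) \<longlonglongrightarrow> 1" by (rule LIMSEQ_Suc)
  qed
  ultimately have "(\<lambda>n::nat. T 0) \<longlonglongrightarrow> 1" by simp
  then have "T 0 = 1" by (simp add: LIMSEQ_const_iff)
  then have "jacobi_norm \<nu> \<alpha> \<beta> * C 0 = 1 / w"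
    using nz(1) by (simp add: T_def field_simps)
  then show ?thesis
    using tendsto_mult[OF tendsto_const C(1)[of 0], of "jacobi_norm \<nu> \<alpha> \<beta>"] unfolding S_def by simp
qed



section \<open>Uniform expansions on lines and rays\<close>

lemma exp_over_sinh_cosh_eq:
  fixes z :: complex
  shows "exp z / sinh z = 2 / (1 - exp (- 2 * z))" "exp z / cosh z = 2 / (1 + exp (- 2 * z))"
    "exp z / sinh z = 2 * exp (2 * z) / (exp (2 * z) - 1)" "exp z / cosh z = 2 * exp (2 * z) / (exp (2 * z) + 1)"
proof -
  define e where "e = exp z"
  have e: "e \<noteq> 0" "exp (- z) = 1 / e" "exp (- 2 * z) = 1 / (e * e)" "exp (2 * z) = e * e"
    by (simp_all add: e_def exp_minus divide_inverse exp_double power2_eq_square)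
  have s: "sinh z = (e * e - 1) / (2 * e)" "cosh z = (e * e + 1) / (2 * e)"
    unfolding sinh_field_def cosh_field_def e(2) e_def[symmetric] using e(1) by (simp_all add: field_simps)
  have q: "1 - 1 / (e * e) = (e * e - 1) / (e * e)" "1 + 1 / (e * e) = (e * e + 1) / (e * e)"
    using e(1) by (simp_all add: field_simps)
  show "exp z / sinh z = 2 / (1 - exp (- 2 * z))" "exp z / cosh z = 2 / (1 + exp (- 2 * z))"
    "exp z / sinh z = 2 * exp (2 * z) / (exp (2 * z) - 1)" "exp z / cosh z = 2 * exp (2 * z) / (exp (2 * z) + 1)"
    unfolding e(3,4) s q e_def[symmetric] using e(1) by simp_all
qed

lemma exp_over_sinh_cosh_limits:
  "((\<lambda>x. exp (line b m x) / sinh (line b m x)) \<longlongrightarrow> 2) at_top"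
  "((\<lambda>x. exp (line b m x) / cosh (line b m x)) \<longlongrightarrow> 2) at_top"
  "((\<lambda>x. exp (line b m x) / sinh (line b m x)) \<longlongrightarrow> 0) at_bot"
  "((\<lambda>x. exp (line b m x) / cosh (line b m x)) \<longlongrightarrow> 0) at_bot"
proof -
  have t: "((\<lambda>x. exp (- 2 * line b m x)) \<longlongrightarrow> 0) at_top" by (rule exp_line_at_top) simp
  have e: "((\<lambda>x. exp (2 * line b m x)) \<longlongrightarrow> 0) at_bot" by (rule exp_line_at_bot) simp
  have "((\<lambda>x. 2 / (1 - exp (- 2 * line b m x))) \<longlongrightarrow> 2 / (1 - 0)) at_top" by (intro tendsto_intros t) simp
  then show "((\<lambda>x. exp (line b m x) / sinh (line b m x)) \<longlongrightarrow> 2) at_top"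
    unfolding exp_over_sinh_cosh_eq(1) by simp
  have "((\<lambda>x. 2 / (1 + exp (- 2 * line b m x))) \<longlongrightarrow> 2 / (1 + 0)) at_top" by (intro tendsto_intros t) simp
  then show "((\<lambda>x. exp (line b m x) / cosh (line b m x)) \<longlongrightarrow> 2) at_top"
    unfolding exp_over_sinh_cosh_eq(2) by simp
  have "((\<lambda>x. 2 * exp (2 * line b m x) / (exp (2 * line b m x) - 1)) \<longlongrightarrow> 2 * 0 / (0 - 1)) at_bot" by (intro tendsto_intros e) simp
  then show "((\<lambda>x. exp (line b m x) / sinh (line b m x)) \<longlongrightarrow> 0) at_bot"
    unfolding exp_over_sinh_cosh_eq(3) by simp
  have "((\<lambda>x. 2 * exp (2 * line b m x) / (exp (2 * line b m x) + 1)) \<longlongrightarrow> 2 * 0 / (0 + 1)) at_bot" by (intro tendsto_intros e) simp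
  then show "((\<lambda>x. exp (line b m x) / cosh (line b m x)) \<longlongrightarrow> 0) at_bot"
    unfolding exp_over_sinh_cosh_eq(4) by simp
qed

definition g_top :: "nat \<Rightarrow> complex \<Rightarrow> complex \<Rightarrow> complex" where
  "g_top n \<alpha> \<beta> = (\<Sum>l\<le>n. a_coeff l \<alpha> * a_coeff (n - l) \<beta> * 2 ^ l * 2 ^ (n - l))"

lemma g_coeff_limits:
  "((\<lambda>x. g_coeff n (line b m x) \<alpha> \<beta>) \<longlongrightarrow> g_top n \<alpha> \<beta>) at_top"
  "((\<lambda>x. g_coeff n (line b m x) \<alpha> \<beta>) \<longlongrightarrow> (if n = 0 then 1 else 0)) at_bot"
  "((\<lambda>x. g_deriv n (line b m x) \<alpha> \<beta>) \<longlongrightarrow> 0) at_top"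
proof -
  note l = exp_over_sinh_cosh_limits[of b m]
  show "((\<lambda>x. g_coeff n (line b m x) \<alpha> \<beta>) \<longlongrightarrow> g_top n \<alpha> \<beta>) at_top"
    unfolding g_coeff_def g_top_def by (intro tendsto_intros l)
  have "((\<lambda>x. g_coeff n (line b m x) \<alpha> \<beta>) \<longlongrightarrow> (\<Sum>j\<le>n. a_coeff j \<alpha> * a_coeff (n - j) \<beta> * 0 ^ j * 0 ^ (n - j))) at_bot"
    unfolding g_coeff_def by (intro tendsto_intros l)
  also have "(\<Sum>j\<le>n. a_coeff j \<alpha> * a_coeff (n - j) \<beta> * 0 ^ j * 0 ^ (n - j)) = (if n = 0 then 1 else 0)"
    by (cases n) (auto intro!: sum.neutral simp: a_coeff_def power_0_left)
  finally show "((\<lambda>x. g_coeff n (line b m x) \<alpha> \<beta>) \<longlongrightarrow> (if n = 0 then 1 else 0)) at_bot" .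
  have "((\<lambda>x. g_deriv n (line b m x) \<alpha> \<beta>) \<longlongrightarrow> (\<Sum>j\<le>n. a_coeff j \<alpha> * a_coeff (n - j) \<beta> * (2 ^ j * 2 ^ (n - j) *
     (of_nat j * (2 - 2) + of_nat (n - j) * (2 - 2))))) at_top"
    unfolding g_deriv_def by (intro tendsto_intros l)
  then show "((\<lambda>x. g_deriv n (line b m x) \<alpha> \<beta>) \<longlongrightarrow> 0) at_top" by simp
qed

lemma schroedinger_on_cmult:
  assumes "schroedinger_on w \<alpha> \<beta> S u" "open S"
  shows "schroedinger_on w \<alpha> \<beta> S (\<lambda>z. k * u z)" and "z \<in> S \<Longrightarrow> deriv (\<lambda>z. k * u z) z = k * deriv u z"
proof -
  have 1: "((\<lambda>z. k * u z) has_field_derivative k * deriv u z) (at z)" if "z \<in> S" for z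
    by (rule DERIV_cmult[OF schroedinger_onD(1)[OF assms that]])
  have 2: "((\<lambda>z. k * deriv u z) has_field_derivative (w\<^sup>2 + pot \<alpha> \<beta> z) * (k * u z)) (at z)" if "z \<in> S" for z
    by (rule DERIV_cong[OF DERIV_cmult[OF schroedinger_onD(2)[OF assms that]]]) simp
  show "schroedinger_on w \<alpha> \<beta> S (\<lambda>z. k * u z)" by (rule schroedinger_onI(1)[OF assms(2) 1 2])
  show "z \<in> S \<Longrightarrow> deriv (\<lambda>z. k * u z) z = k * deriv u z" by (rule DERIV_imp_deriv[OF 1])
qed

definition jacobi_recessive :: "real \<Rightarrow> complex \<Rightarrow> complex \<Rightarrow> complex \<Rightarrow> complex \<Rightarrow> complex" where
  "jacobi_recessive \<sigma> \<nu> \<alpha> \<beta> z = jacobi_norm \<nu> \<alpha> \<beta> * recessive \<sigma> \<nu> \<alpha> \<beta> z"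

lemma jacobi_recessive_schroedinger:
  "\<bar>\<sigma>\<bar> = 1 \<Longrightarrow> schroedinger_on (2 * \<nu> + \<alpha> + \<beta> + 1) \<alpha> \<beta> (omega \<sigma>) (jacobi_recessive \<sigma> \<nu> \<alpha> \<beta>)"
  unfolding jacobi_recessive_def[abs_def] by (intro schroedinger_on_cmult recessive open_omega)

context large_parameter
begin

text \<open>The limit of the remainder at +infinity. It does not depend on the height of the line or
  on its slope, so a bound found on one line serves every ray.\<close>

definition "top_limit = jacobi_norm \<nu> \<alpha> \<beta> - (\<Sum>n<N. g_top n \<alpha> \<beta> * inv_fact w n)"

lemma remainder_at_top:
  assumes \<sigma>: "\<bar>\<sigma>\<bar> = 1"
  defines "u \<equiv> jacobi_recessive \<sigma> \<nu> \<alpha> \<beta>"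
  shows "((\<lambda>x. remainder N w \<alpha> \<beta> u (line b m x)) \<longlongrightarrow> top_limit) at_top"
    and "((\<lambda>x. Complex 1 m * remainder' N w \<alpha> \<beta> u (line b m x)) \<longlongrightarrow> 0) at_top"
proof -
  have "((\<lambda>x. jacobi_norm \<nu> \<alpha> \<beta> * (exp (w * line b m x) * recessive \<sigma> \<nu> \<alpha> \<beta> (line b m x)) - (\<Sum>n<N. g_coeff n (line b m x) \<alpha> \<beta> * inv_fact w n))
     \<longlongrightarrow> jacobi_norm \<nu> \<alpha> \<beta> * 1 - (\<Sum>n<N. g_top n \<alpha> \<beta> * inv_fact w n)) at_top"
    by (intro tendsto_intros recessive_at_top[OF \<sigma>] g_coeff_limits)
  then show "((\<lambda>x. remainder N w \<alpha> \<beta> u (line b m x)) \<longlongrightarrow> top_limit) at_top"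
    unfolding remainder_def partial_series_def top_limit_def u_def jacobi_recessive_def by (simp add: mult.left_commute)
  have "((\<lambda>x. Complex 1 m * (jacobi_norm \<nu> \<alpha> \<beta> * (exp (w * line b m x) * (w * recessive \<sigma> \<nu> \<alpha> \<beta> (line b m x) + deriv (recessive \<sigma> \<nu> \<alpha> \<beta>) (line b m x)))
      - (\<Sum>n<N. g_deriv n (line b m x) \<alpha> \<beta> * inv_fact w n)))
     \<longlongrightarrow> Complex 1 m * (jacobi_norm \<nu> \<alpha> \<beta> * 0 - (\<Sum>n<N. 0 * inv_fact w n))) at_top"
    by (intro tendsto_intros recessive_at_top[OF \<sigma>] g_coeff_limits)
  moreover have "\<forall>\<^sub>F x in at_top. Complex 1 m * (jacobi_norm \<nu> \<alpha> \<beta> * (exp (w * line b m x) * (w * recessive \<sigma> \<nu> \<alpha> \<beta> (line b m x) + deriv (recessive \<sigma> \<nu> \<alpha> \<beta>) (line b m x)))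
      - (\<Sum>n<N. g_deriv n (line b m x) \<alpha> \<beta> * inv_fact w n)) = Complex 1 m * remainder' N w \<alpha> \<beta> u (line b m x)"
    using eventually_gt_at_top[of 0]
  proof eventually_elim
    case (elim x)
    have "line b m x \<in> omega \<sigma>" using elim by (simp add: omega_def)
    from schroedinger_on_cmult(2)[OF recessive(1)[OF \<sigma>] open_omega this, of "jacobi_norm \<nu> \<alpha> \<beta>" \<nu> \<alpha> \<beta>]
    have d: "deriv u (line b m x) = jacobi_norm \<nu> \<alpha> \<beta> * deriv (recessive \<sigma> \<nu> \<alpha> \<beta>) (line b m x)"
      unfolding u_def jacobi_recessive_def[abs_def] .
    have "k * (e * (a * y + y')) = e * (a * (k * y) + k * y')" for k e a y y' :: complex
      by (simp add: algebra_simps)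
    then show ?case unfolding remainder'_def d unfolding u_def jacobi_recessive_def by simp
  qed
  ultimately have "((\<lambda>x. Complex 1 m * remainder' N w \<alpha> \<beta> u (line b m x)) \<longlongrightarrow> Complex 1 m * (jacobi_norm \<nu> \<alpha> \<beta> * 0 - (\<Sum>n<N. 0 * inv_fact w n))) at_top"
    by (rule Lim_transform_eventually)
  then show "((\<lambda>x. Complex 1 m * remainder' N w \<alpha> \<beta> u (line b m x)) \<longlongrightarrow> 0) at_top" by simp
qed

lemma residual_bound:
  assumes "N \<ge> 1" and K: "\<And>z. away c z \<Longrightarrow> norm (g_deriv N z \<alpha> \<beta>) \<le> K * bump (Re z)" "K \<ge> 0" and "away c (line b m x)"
  shows "norm (residual N w \<alpha> \<beta> (line b m x)) \<le> 2 * ((1 + M) / Y) ^ N * K * bump x"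
proof -
  have "norm (inv_fact w (N - 1)) \<le> ((1 + M) / Y) ^ N"
    using inv_fact_bound[of "N - 1"] assms(1) by simp
  then have "norm (2 * inv_fact w (N - 1)) * norm (g_deriv N (line b m x) \<alpha> \<beta>) \<le> (2 * ((1 + M) / Y) ^ N) * (K * bump x)"
    using K(1)[OF assms(4)] A0 Y_large(1) by (intro mult_mono) (auto simp: norm_mult)
  then show ?thesis using assms(1) by (simp add: residual_def norm_mult mult_ac)
qed

definition "expand_bound K = 8 * (1 + M) ^ (N + 2) * K / Y ^ (N + 1)"

lemma expand_bound_eq: "4 * ((1 + M)\<^sup>2 * (2 * ((1 + M) / Y) ^ N * K)) / Y = expand_bound K"
  using Y_large(1) by (simp add: expand_bound_def power_divide power_add power2_eq_square field_simps)

lemma \<kappa>_large: "Re (w * Complex 1 m) \<ge> 2" "Re (w * Complex 1 m) \<ge> 4 * volterra_const A M c"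
  using Re_w(2) Y_large by linarith+

text \<open>The remainder tends to 0 at -infinity, because 1 / w from
  \<open>connection_value\<close> is matched by the term n = 0 while all later terms vanish there;
  the term n = 0 must be present, hence N \<ge> 1. Anchoring at that end leaves only the residual of
  the series in the bound.\<close>

lemma expand_line:
  assumes N1: "N \<ge> 1" and K: "\<And>z. away c z \<Longrightarrow> norm (g_deriv N z \<alpha> \<beta>) \<le> K * bump (Re z)" "K \<ge> 0"
    and \<sigma>: "\<bar>\<sigma>\<bar> = 1" and ln: "\<And>x. line b m x \<in> omega \<sigma>" "\<And>x. away c (line b m x)"
  shows "norm (remainder N w \<alpha> \<beta> (jacobi_recessive \<sigma> \<nu> \<alpha> \<beta>) (line b m x)) \<le> expand_bound K"
    and "norm top_limit \<le> expand_bound K"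
proof -
  define u where "u = jacobi_recessive \<sigma> \<nu> \<alpha> \<beta>"
  define E where "E = (\<lambda>x. remainder N w \<alpha> \<beta> u (line b m x))"
  define E' where "E' = (\<lambda>x. Complex 1 m * remainder' N w \<alpha> \<beta> u (line b m x))"
  define h where "h = (\<lambda>x. (Complex 1 m)\<^sup>2 * (pot \<alpha> \<beta> (line b m x) * E x - residual N w \<alpha> \<beta> (line b m x)))"
  define R where "R = (1 + M)\<^sup>2 * (2 * ((1 + M) / Y) ^ N * K)"
  have R0: "R \<ge> 0" using K(2) A0 Y_large(1) by (simp add: R_def)
  have dE: "(E has_vector_derivative E' x) (at x)"
    and dE': "(E' has_vector_derivative (2 * (w * Complex 1 m) * E' x + h x)) (at x)" for x
    using line_remainder_DERIV[OF jacobi_recessive_schroedinger[OF \<sigma>] open_omega ln, of x] unfolding E_def E'_def h_def u_def by auto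
  have h: "norm (h x) \<le> (volterra_const A M c * norm (E x) + R) * bump x" for x
    unfolding h_def R_def by (rule line_forcing[OF residual_bound[OF N1 K ln(2)] ln(2)])
  have top: "(E \<longlongrightarrow> top_limit) at_top" "(E' \<longlongrightarrow> 0) at_top"
    unfolding E_def E'_def u_def by (rule remainder_at_top[OF \<sigma>])+
  have bot: "(E \<longlongrightarrow> 0) at_bot"
  proof -
    have "large_parameter 0 A M c m \<nu> \<alpha> \<beta>"
      using large_parameter_axioms unfolding large_parameter_def threshold_def by auto
    then have "((\<lambda>x. jacobi_norm \<nu> \<alpha> \<beta> * (exp (w * line b m x) * recessive \<sigma> \<nu> \<alpha> \<beta> (line b m x))) \<longlongrightarrow> 1 / w) at_bot"
      by (rule large_parameter.connection_value[OF _ refl \<sigma> ln])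
    then have "((\<lambda>x. jacobi_norm \<nu> \<alpha> \<beta> * (exp (w * line b m x) * recessive \<sigma> \<nu> \<alpha> \<beta> (line b m x)) - (\<Sum>n<N. g_coeff n (line b m x) \<alpha> \<beta> * inv_fact w n))
      \<longlongrightarrow> 1 / w - (\<Sum>n<N. (if n = 0 then 1 else 0) * inv_fact w n)) at_bot"
      by (intro tendsto_intros g_coeff_limits)
    moreover have "(\<Sum>n<N. (if n = 0 then 1 else 0) * inv_fact w n) = inv_fact w 0"
      using N1 by (subst sum.remove[of _ 0]) (auto intro!: sum.neutral)
    moreover have "inv_fact w 0 = 1 / w"
      using inv_fact_0[of w] w_shift_not_nonpos(1)[of 0] nz(1) by (simp add: field_simps)
    ultimately show ?thesis
      unfolding E_def remainder_def partial_series_def u_def jacobi_recessive_def by (simp add: mult.left_commute)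
  qed
  have b: "norm (E x) \<le> expand_bound K" for x
  proof -
    have "norm (E x - 0) \<le> 4 * (volterra_const A M c * norm (0::complex) + R) / Re (w * Complex 1 m)"
      by (rule volterra_line_from_bot(1)[OF dE dE' h top bot vc0 R0 \<kappa>_large])
    also have "\<dots> \<le> 4 * R / Y" using R0 Re_w(2) Y_large(1) by (simp add: frac_le)
    also have "\<dots> = expand_bound K" unfolding R_def by (rule expand_bound_eq)
    finally show ?thesis by simp
  qed
  then show "norm (remainder N w \<alpha> \<beta> (jacobi_recessive \<sigma> \<nu> \<alpha> \<beta>) (line b m x)) \<le> expand_bound K"
    by (simp add: E_def u_def)
  show "norm top_limit \<le> expand_bound K"
    by (rule tendsto_upperbound[OF tendsto_norm[OF top(1)]]) (use b in auto)
qed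

text \<open>For points whose complete line may come too close to a singularity: only the part to the
  right of the point is used, and the bound for the value at +infinity is taken from another
  line.\<close>

lemma expand_ray:
  assumes N1: "N \<ge> 1" and K: "\<And>z. away c z \<Longrightarrow> norm (g_deriv N z \<alpha> \<beta>) \<le> K * bump (Re z)" "K \<ge> 0"
    and \<sigma>: "\<bar>\<sigma>\<bar> = 1" and L: "norm top_limit \<le> expand_bound K"
    and a: "a > 0" "\<And>x. x \<ge> a \<Longrightarrow> away c (line b m x)"
  shows "norm (remainder N w \<alpha> \<beta> (jacobi_recessive \<sigma> \<nu> \<alpha> \<beta>) (line b m a)) \<le> 3 * expand_bound K"
proof -
  define u where "u = jacobi_recessive \<sigma> \<nu> \<alpha> \<beta>"
  define E where "E = (\<lambda>x. remainder N w \<alpha> \<beta> u (line b m x))"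
  define E' where "E' = (\<lambda>x. Complex 1 m * remainder' N w \<alpha> \<beta> u (line b m x))"
  define h where "h = (\<lambda>x. (Complex 1 m)\<^sup>2 * (pot \<alpha> \<beta> (line b m x) * E x - residual N w \<alpha> \<beta> (line b m x)))"
  define R where "R = (1 + M)\<^sup>2 * (2 * ((1 + M) / Y) ^ N * K)"
  have R0: "R \<ge> 0" using K(2) A0 Y_large(1) by (simp add: R_def)
  have om: "line b m x \<in> omega \<sigma>" if "x \<ge> a" for x using that a(1) by (simp add: omega_def)
  have dE: "(E has_vector_derivative E' x) (at x)"
    and dE': "(E' has_vector_derivative (2 * (w * Complex 1 m) * E' x + h x)) (at x)" if "x \<ge> a" for x
    using line_remainder_DERIV[OF jacobi_recessive_schroedinger[OF \<sigma>] open_omega om a(2), of x] that unfolding E_def E'_def h_def u_def by auto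
  have h: "norm (h x) \<le> (volterra_const A M c * norm (E x) + R) * bump x" if "x \<ge> a" for x
    unfolding h_def R_def by (rule line_forcing[OF residual_bound[OF N1 K a(2)[OF that]] a(2)[OF that]])
  have top: "(E \<longlongrightarrow> top_limit) at_top" "(E' \<longlongrightarrow> 0) at_top"
    unfolding E_def E'_def u_def by (rule remainder_at_top[OF \<sigma>])+
  define B where "B = 2 * (volterra_const A M c * norm top_limit + R) / Re (w * Complex 1 m)"
  have B: "norm (E' x) \<le> B * bump x" if "x \<ge> a" for x
    unfolding B_def by (rule volterra_ray[OF dE dE' h top vc0 R0 \<kappa>_large that])
  have "norm (top_limit - E a) \<le> 2 * B"
  proof (rule tendsto_upperbound[OF tendsto_norm[OF tendsto_diff[OF top(1) tendsto_const]]])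
    show "\<forall>\<^sub>F x in at_top. norm (E x - E a) \<le> 2 * B"
      using eventually_ge_at_top[of a] by eventually_elim (rule bump_integral_bound'[OF dE B]; simp)
  qed simp
  moreover have "2 * B \<le> norm top_limit + expand_bound K"
  proof -
    have "2 * B = 4 * volterra_const A M c * norm top_limit / Re (w * Complex 1 m) + 4 * R / Re (w * Complex 1 m)"
      by (simp add: B_def add_divide_distrib algebra_simps)
    moreover have "4 * volterra_const A M c * norm top_limit / Re (w * Complex 1 m) \<le> norm top_limit"
    proof -
      have "4 * volterra_const A M c * norm top_limit \<le> Re (w * Complex 1 m) * norm top_limit"
        using \<kappa>_large(2) by (intro mult_right_mono) auto
      then show ?thesis using \<kappa>_large(1) by (simp add: divide_le_eq mult.commute)
    qed
    moreover have "4 * R / Re (w * Complex 1 m) \<le> 4 * R / Y" using R0 Re_w(2) Y_large(1) by (simp add: frac_le)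
    moreover have "4 * R / Y = expand_bound K" unfolding R_def by (rule expand_bound_eq)
    ultimately show ?thesis by linarith
  qed
  moreover have "norm (E a) \<le> norm top_limit + norm (top_limit - E a)"
    by (metis norm_minus_commute norm_triangle_sub)
  \<comment> \<open>The three units are \<open>norm top_limit\<close> itself, its share in the
    integral of E', which \<open>\<kappa>_large\<close> keeps below \<open>norm top_limit\<close>,
    and the share of the residual.\<close>
  ultimately have "norm (E a) \<le> 3 * expand_bound K" using L by linarith
  then show ?thesis by (simp add: E_def u_def)
qed

end



section \<open>Gauss's summation and Pfaff's transformation\<close>

text \<open>\<open>rGamma\<close> has no poles, so c is arbitrary: the limit is shown for some c + m
  outside the non-positive integers and carried down one unit at a time.\<close>

lemma rGamma_shift_limit:
  fixes c :: complex
  shows "(\<lambda>n. rGamma (c + of_nat (Suc n)) * (fact n * exp (c * of_real (ln (real n))))) \<longlonglongrightarrow> 1"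
proof -
  have base: "(\<lambda>n. rGamma (c + of_nat (Suc n)) * (fact n * exp (c * of_real (ln (real n))))) \<longlonglongrightarrow> 1"
    if "c \<notin> \<int>\<^sub>\<le>\<^sub>0" for c :: complex
    using tendsto_inverse[OF tendsto_Gamma_shift[OF that]] by (simp add: rGamma_inverse_Gamma divide_inverse mult_ac)
  have step: "(\<lambda>n. rGamma (c + of_nat (Suc n)) * (fact n * exp (c * of_real (ln (real n))))) \<longlonglongrightarrow> 1"
    if P: "(\<lambda>n. rGamma (c + 1 + of_nat (Suc n)) * (fact n * exp ((c + 1) * of_real (ln (real n))))) \<longlonglongrightarrow> 1" for c :: complex
  proof -
    have "(\<lambda>n. (c + 1 + of_nat n) / (0 + of_nat n) * (rGamma (c + 1 + of_nat (Suc n)) * (fact n * exp ((c + 1) * of_real (ln (real n)))))) \<longlonglongrightarrow> 1 * 1"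
      by (intro tendsto_mult tendsto_shift_ratio P)
    moreover have "\<forall>\<^sub>F n in sequentially. (c + 1 + of_nat n) / (0 + of_nat n) * (rGamma (c + 1 + of_nat (Suc n)) * (fact n * exp ((c + 1) * of_real (ln (real n))))) =
       rGamma (c + of_nat (Suc n)) * (fact n * exp (c * of_real (ln (real n))))"
      using eventually_gt_at_top[of 0]
    proof eventually_elim
      case (elim n)
      have e: "exp ((c + 1) * of_real (ln (real n))) = exp (c * of_real (ln (real n))) * of_nat n"
        using elim by (simp add: distrib_right exp_add exp_of_real)
      have r: "rGamma (c + of_nat (Suc n)) = (c + 1 + of_nat n) * rGamma (c + 1 + of_nat (Suc n))"
        using rGamma_plus1[of "c + of_nat (Suc n)"] by (simp add: add_ac)
      have "x / (0 + y) * (R * (f * (E * y))) = x * R * (f * E)" if "y \<noteq> 0" for x y R f E :: complex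
        using that by simp
      then show ?case unfolding e r using elim by simp
    qed
    ultimately show ?thesis using Lim_transform_eventually by fastforce
  qed
  obtain m :: nat where m: "real m > norm c" using reals_Archimedean2 by blast
  have "c + of_nat m \<notin> \<int>\<^sub>\<le>\<^sub>0"
  proof
    assume "c + of_nat m \<in> \<int>\<^sub>\<le>\<^sub>0"
    then obtain j where "c + of_nat m = of_int j" "j \<le> 0" by (auto elim: nonpos_Ints_cases)
    then have "Re c + real m = of_int j" by (metis Re_complex_of_real complex_Re_of_int complex_Re_of_nat plus_complex.sel(1))
    then show False using abs_Re_le_cmod[of c] m \<open>j \<le> 0\<close> by linarith
  qed
  then have "(\<lambda>n. rGamma (c + of_nat m + of_nat (Suc n)) * (fact n * exp ((c + of_nat m) * of_real (ln (real n))))) \<longlonglongrightarrow> 1"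
    by (rule base)
  then show ?thesis
  proof (induction m)
    case (Suc m)
    have "c + of_nat (Suc m) = c + of_nat m + 1" by simp
    with Suc.prems have "(\<lambda>n. rGamma (c + of_nat m + 1 + of_nat (Suc n)) * (fact n * exp ((c + of_nat m + 1) * of_real (ln (real n))))) \<longlonglongrightarrow> 1"
      by (simp only:)
    from Suc.IH[OF step[OF this]] show ?case .
  qed simp
qed

text \<open>At the point 1 the terms decay like \<open>n\<^sup>-\<^sup>1\<^sup>-\<^sup>(\<^sup>c\<^sup>-\<^sup>a\<^sup>-\<^sup>b\<^sup>)\<close>.\<close>

lemma hyp_coeff_decay:
  assumes d: "Re (c - a - b) \<ge> 1"
  shows "(\<lambda>n. of_nat n * hyp_coeff a b c n) \<longlonglongrightarrow> 0" "summable (\<lambda>n. norm (hyp_coeff a b c n))"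
proof -
  \<comment> \<open>Up to a power of n the coefficient is a product of three convergent sequences,
    hence bounded.\<close>
  define P where "P = (\<lambda>n. rGamma_series a n * rGamma_series b n * (rGamma (c + of_nat (Suc n)) * (fact n * exp (c * of_real (ln (real n))))))"
  have "P \<longlonglongrightarrow> rGamma a * rGamma b * 1"
    unfolding P_def by (intro tendsto_mult rGamma_series_LIMSEQ rGamma_shift_limit)
  then have "Bseq P" by (rule convergentI[THEN convergent_imp_Bseq])
  then obtain K where K: "K > 0" "\<And>n. norm (P n) \<le> K" unfolding Bseq_def by blast
  have eq: "of_nat (Suc n) * hyp_coeff a b c (Suc n) = P n * exp (- (c - a - b) * of_real (ln (real n)))" for n
  proof -
    define ea where "ea = exp (a * of_real (ln (real n)))"
    define eb where "eb = exp (b * of_real (ln (real n)))"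
    define ec where "ec = exp (c * of_real (ln (real n)))"
    have e: "exp (- (c - a - b) * of_real (ln (real n))) = ea * eb / ec"
      by (simp add: ea_def eb_def ec_def algebra_simps exp_diff flip: exp_add)
    have nz: "ea \<noteq> 0" "eb \<noteq> 0" "ec \<noteq> 0" by (simp_all add: ea_def eb_def ec_def)
    have "of_nat (Suc n) \<noteq> (0::complex)" by (rule of_nat_neq_0)
    then have "of_nat (Suc n) * hyp_coeff a b c (Suc n) = pochhammer a (Suc n) * pochhammer b (Suc n) * rGamma (c + of_nat (Suc n)) / fact n"
      unfolding hyp_coeff_def by (simp add: fact_Suc del: of_nat_Suc)
    also have "\<dots> = P n * (ea * eb / ec)"
      unfolding P_def rGamma_series_def ea_def[symmetric] eb_def[symmetric] ec_def[symmetric]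
      using nz by (simp add: field_simps)
    finally show ?thesis unfolding e .
  qed
  have bnd: "norm (of_nat (Suc n) * hyp_coeff a b c (Suc n)) \<le> K / real n" if "n > 0" for n
  proof -
    have "norm (exp (- (c - a - b) * of_real (ln (real n)))) = exp (- Re (c - a - b) * ln (real n))" by simp
    also have "\<dots> \<le> exp (- 1 * ln (real n))"
      using d that by (intro exp_le_cancel_iff[THEN iffD2] mult_right_mono) auto
    also have "\<dots> = 1 / real n" using that by (simp add: exp_minus divide_inverse)
    finally have "norm (P n) * norm (exp (- (c - a - b) * of_real (ln (real n)))) \<le> K * (1 / real n)"
      using K by (intro mult_mono) auto
    then show ?thesis unfolding eq norm_mult by simp
  qed
  have "(\<lambda>n. of_nat (Suc n) * hyp_coeff a b c (Suc n)) \<longlonglongrightarrow> 0"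
  proof (rule Lim_null_comparison)
    show "\<forall>\<^sub>F n in sequentially. norm (of_nat (Suc n) * hyp_coeff a b c (Suc n)) \<le> K / real n"
      using eventually_gt_at_top[of 0] by eventually_elim (rule bnd)
    show "(\<lambda>n. K / real n) \<longlonglongrightarrow> 0" by (rule lim_const_over_n)
  qed
  then show "(\<lambda>n. of_nat n * hyp_coeff a b c n) \<longlonglongrightarrow> 0"
    by (rule LIMSEQ_imp_Suc[of "\<lambda>n. of_nat n * hyp_coeff a b c n"])
  have "summable (\<lambda>n. norm (hyp_coeff a b c (Suc n)))"
  proof (rule summable_comparison_test_ev)
    show "\<forall>\<^sub>F n in sequentially. norm (norm (hyp_coeff a b c (Suc n))) \<le> K * (1 / real n ^ 2)"
      using eventually_gt_at_top[of 0]
    proof eventually_elim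
      case (elim n)
      have "real n * norm (hyp_coeff a b c (Suc n)) \<le> real (Suc n) * norm (hyp_coeff a b c (Suc n))"
        by (intro mult_right_mono) auto
      also have "\<dots> \<le> K / real n" using bnd[OF elim] by (simp add: norm_mult del: of_nat_Suc)
      finally show ?case using elim by (simp add: field_simps power2_eq_square)
    qed
    show "summable (\<lambda>n. K * (1 / real n ^ 2))"
      by (intro summable_mult) (use inverse_power_summable[of 2, where 'a = real] in \<open>simp add: divide_inverse\<close>)
  qed
  then show "summable (\<lambda>n. norm (hyp_coeff a b c n))" by (subst (asm) summable_Suc_iff)
qed

text \<open>The difference of the two sides is, term by term, a difference of consecutive values of
  n times \<open>hyp_coeff a b c n\<close>, which tend to 0; the series telescopes.\<close>

lemma gauss_step:
  assumes d: "Re (c - a - b) \<ge> 1"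
  shows "(c - a - b) * (\<Sum>n. hyp_coeff a b c n) = (c - a) * (c - b) * (\<Sum>n. hyp_coeff a b (c + 1) n)"
proof -
  have d1: "Re (c + 1 - a - b) \<ge> 1" using d by simp
  have s: "summable (hyp_coeff a b c)" "summable (hyp_coeff a b (c + 1))"
    by (rule summable_norm_cancel[OF hyp_coeff_decay(2)[OF d]], rule summable_norm_cancel[OF hyp_coeff_decay(2)[OF d1]])
  have tele: "(\<lambda>n. of_nat (Suc n) * hyp_coeff a b c (Suc n) - of_nat n * hyp_coeff a b c n) sums (0 - of_nat 0 * hyp_coeff a b c 0)"
    by (rule telescope_sums[OF hyp_coeff_decay(1)[OF d]])
  have "(c - a - b) * hyp_coeff a b c n - (c - a) * (c - b) * hyp_coeff a b (c + 1) n =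
      - (of_nat (Suc n) * hyp_coeff a b c (Suc n) - of_nat n * hyp_coeff a b c n)" for n
  proof -
    define t where "t = hyp_coeff a b (c + 1) n"
    have "rGamma (c + of_nat n) = (c + of_nat n) * rGamma (c + 1 + of_nat n)"
      using rGamma_plus1[of "c + of_nat n"] by (simp add: add_ac)
    then have t0: "hyp_coeff a b c n = (c + of_nat n) * t" by (simp add: t_def hyp_coeff_def)
    have "of_nat (Suc n) * hyp_coeff a b c (Suc n) = (a + of_nat n) * (b + of_nat n) * t"
    proof -
      have "c + of_nat (Suc n) = c + 1 + of_nat n" by simp
      then have "hyp_coeff a b c (Suc n) = pochhammer a (Suc n) * pochhammer b (Suc n) * rGamma (c + 1 + of_nat n) / fact (Suc n)"
        unfolding hyp_coeff_def by (simp only:)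
      then show ?thesis
        using of_nat_neq_0[of n, where 'a = complex] unfolding t_def hyp_coeff_def
        by (simp add: pochhammer_Suc fact_Suc del: of_nat_Suc)
    qed
    then show ?thesis unfolding t0 t_def[symmetric] by (simp add: algebra_simps)
  qed
  then have "(\<lambda>n. (c - a - b) * hyp_coeff a b c n - (c - a) * (c - b) * hyp_coeff a b (c + 1) n) sums - (0 - of_nat 0 * hyp_coeff a b c 0)"
    using sums_minus[OF tele] by (simp only:)
  moreover have "(\<lambda>n. (c - a - b) * hyp_coeff a b c n - (c - a) * (c - b) * hyp_coeff a b (c + 1) n) sums
      ((c - a - b) * (\<Sum>n. hyp_coeff a b c n) - (c - a) * (c - b) * (\<Sum>n. hyp_coeff a b (c + 1) n))"
    by (intro sums_diff sums_mult summable_sums s)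
  ultimately show ?thesis using sums_unique2 by fastforce
qed

lemma pochhammer_ge0: "0 \<le> x \<Longrightarrow> 0 \<le> pochhammer (x::real) n"
  by (induction n) (auto simp: pochhammer_Suc)

lemma norm_pochhammer_le: "norm (pochhammer (a::complex) n) \<le> pochhammer (norm a) n"
proof (induction n)
  case (Suc n)
  have "norm (a + of_nat n) \<le> norm a + real n"
    using norm_triangle_ineq[of a "of_nat n"] by simp
  then show ?case
    unfolding pochhammer_Suc norm_mult using Suc by (intro mult_mono) (auto intro!: pochhammer_ge0)
qed simp

lemma pochhammer_le_norm:
  assumes "0 \<le> x" "x \<le> Re c"
  shows "pochhammer x n \<le> norm (pochhammer (c::complex) n)"
proof (induction n)
  case (Suc n)
  have "x + real n \<le> norm (c + of_nat n)"
    using complex_Re_le_cmod[of "c + of_nat n"] assms by simp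
  then show ?case
    unfolding pochhammer_Suc norm_mult using Suc assms by (intro mult_mono) auto
qed simp

lemma Gamma_times_rGamma_shift:
  fixes z :: complex
  assumes "z \<notin> \<int>\<^sub>\<le>\<^sub>0"
  shows "Gamma z * rGamma (z + of_nat n) = inverse (pochhammer z n)"
  by (simp add: pochhammer_Gamma[OF assms] rGamma_inverse_Gamma divide_inverse mult.commute)

lemma nonpos_Ints_Re_le: "z \<in> \<int>\<^sub>\<le>\<^sub>0 \<Longrightarrow> Re z \<le> 0"
  by (elim nonpos_Ints_cases) (simp only: complex_Re_of_int of_int_le_0_iff)

text \<open>For large c only the term n = 0 contributes: after normalisation by Gamma every other
  term carries a factor O(1 / Re c), times a summable majorant.\<close>

lemma gauss_limit:
  fixes a b c :: complex
  shows "(\<lambda>k. (\<Sum>n. hyp_coeff a b (c + of_nat k) n) * Gamma (c + of_nat k)) \<longlonglongrightarrow> 1"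
proof -
  \<comment> \<open>X - |a| - |b| = 1 is what \<open>hyp_coeff_decay\<close> asks for, so the
    majorant \<open>p\<close> is summable.\<close>
  define X where "X = norm a + norm b + 1"
  define p where "p = (\<lambda>n. pochhammer (norm a) n * pochhammer (norm b) n / (pochhammer X n * fact n))"
  have X: "X > 0" by (simp add: X_def add_nonneg_pos)
  have Xn: "of_real X \<notin> (\<int>\<^sub>\<le>\<^sub>0 :: complex set)"
    using X by (auto elim!: nonpos_Ints_cases simp: complex_eq_iff)
  have p0: "p n \<ge> 0" for n using X by (simp add: p_def pochhammer_ge0)
  have "summable (\<lambda>n. norm (hyp_coeff (of_real (norm a)) (of_real (norm b)) (of_real X) n))"
    by (rule hyp_coeff_decay(2)) (simp add: X_def)
  then have "summable (\<lambda>n. norm (Gamma (of_real X :: complex)) * norm (hyp_coeff (of_real (norm a)) (of_real (norm b)) (of_real X) n))"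
    by (rule summable_mult)
  moreover have "norm (Gamma (of_real X :: complex)) * norm (hyp_coeff (of_real (norm a)) (of_real (norm b)) (of_real X) n) = p n" for n
  proof -
    have "Gamma (of_real X) * rGamma (of_real X + of_nat n) = inverse (pochhammer (of_real X :: complex) n)"
      by (rule Gamma_times_rGamma_shift[OF Xn])
    then have "Gamma (of_real X) * hyp_coeff (of_real (norm a)) (of_real (norm b)) (of_real X) n = of_real (p n)"
      unfolding hyp_coeff_def p_def by (simp add: pochhammer_of_real divide_inverse mult_ac)
    then show ?thesis using p0 by (metis norm_mult norm_of_real abs_of_nonneg)
  qed
  ultimately have sp: "summable p" by simp
  define P where "P = (\<Sum>n. p n)"
  have key: "norm ((\<Sum>n. hyp_coeff a b (c + of_nat k) n) * Gamma (c + of_nat k) - 1) \<le> X * P / (Re c + real k)"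
    if k: "Re c + real k \<ge> X" for k
  proof -
    define e where "e = c + of_nat k"
    have Re: "Re e \<ge> X" "Re e > 0" using k X by (auto simp: e_def)
    have en: "e \<notin> \<int>\<^sub>\<le>\<^sub>0" using Re by (auto elim!: nonpos_Ints_cases)
    define q where "q = (\<lambda>n. pochhammer a n * pochhammer b n / (pochhammer e n * fact n))"
    have hq: "hyp_coeff a b e n * Gamma e = q n" for n
    proof -
      have "Gamma e * rGamma (e + of_nat n) = inverse (pochhammer e n)"
        by (rule Gamma_times_rGamma_shift[OF en])
      then show ?thesis unfolding hyp_coeff_def q_def by (simp add: divide_inverse mult_ac)
    qed
    have qb: "norm (q (Suc n)) \<le> X / Re e * p (Suc n)" for n
    proof -
      have "X * pochhammer (X + 1) n = pochhammer X (Suc n)" by (simp add: pochhammer_rec)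
      have "pochhammer (X + 1) n \<le> norm (pochhammer (e + 1) n)"
        using Re X by (intro pochhammer_le_norm) auto
      moreover have "norm (pochhammer e (Suc n)) = norm e * norm (pochhammer (e + 1) n)"
        by (simp add: pochhammer_rec norm_mult)
      moreover have "Re e \<le> norm e" by (rule complex_Re_le_cmod)
      ultimately have low: "Re e * pochhammer (X + 1) n \<le> norm (pochhammer e (Suc n))"
        using Re X by (auto intro!: mult_mono pochhammer_ge0)
      have pp: "pochhammer (X + 1) n > 0" using X by (intro pochhammer_pos) auto
      have "norm (q (Suc n)) = norm (pochhammer a (Suc n)) * norm (pochhammer b (Suc n)) / (norm (pochhammer e (Suc n)) * fact (Suc n))"
        unfolding q_def by (simp add: norm_mult norm_divide del: fact_Suc)
      also have "\<dots> \<le> pochhammer (norm a) (Suc n) * pochhammer (norm b) (Suc n) / (Re e * pochhammer (X + 1) n * fact (Suc n))"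
        using low pp Re by (intro frac_le mult_mono norm_pochhammer_le mult_pos_pos mult_right_mono) (auto intro!: pochhammer_ge0 mult_nonneg_nonneg)
      also have "\<dots> = X / Re e * p (Suc n)"
        unfolding p_def \<open>X * pochhammer (X + 1) n = pochhammer X (Suc n)\<close>[symmetric] using X by simp
      finally show ?thesis .
    qed
    have sp': "summable (\<lambda>n. p (Suc n))" using sp by (subst summable_Suc_iff)
    have sq': "summable (\<lambda>n. q (Suc n))"
      by (rule summable_norm_cancel, rule summable_comparison_test'[OF summable_mult[OF sp', of "X / Re e"], of 0]) (use qb in simp)
    then have sq: "summable q" by (subst (asm) summable_Suc_iff)
    have q0: "q 0 = 1" by (simp add: q_def)
    have G0: "Gamma e \<noteq> 0" using en by (simp add: Gamma_eq_zero_iff)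
    have "hyp_coeff a b e = (\<lambda>n. q n / Gamma e)"
      using hq G0 by (simp add: fun_eq_iff field_simps)
    then have "(\<Sum>n. hyp_coeff a b e n) * Gamma e = (\<Sum>n. q n)"
      using suminf_divide[OF sq, of "Gamma e"] G0 by simp
    also have "\<dots> - 1 = (\<Sum>n. q (Suc n))"
      using suminf_split_head[OF sq] q0 by simp
    finally have "norm ((\<Sum>n. hyp_coeff a b e n) * Gamma e - 1) = norm (\<Sum>n. q (Suc n))" by simp
    also have "\<dots> \<le> (\<Sum>n. X / Re e * p (Suc n))"
      by (rule norm_suminf_le[OF qb summable_mult[OF sp']])
    also have "\<dots> = X / Re e * (\<Sum>n. p (Suc n))" by (rule suminf_mult[OF sp'])
    also have "\<dots> \<le> X / Re e * P"
      using suminf_split_head[OF sp] p0[of 0] Re X unfolding P_def by (intro mult_left_mono) auto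
    finally show ?thesis by (simp add: e_def)
  qed
  have "(\<lambda>k. X * P / (Re c + real k)) \<longlonglongrightarrow> 0"
    by (intro tendsto_divide_0[OF tendsto_const] filterlim_at_top_imp_at_infinity filterlim_tendsto_add_at_top[OF tendsto_const] filterlim_real_sequentially)
  moreover have "\<forall>\<^sub>F k in sequentially. norm ((\<Sum>n. hyp_coeff a b (c + of_nat k) n) * Gamma (c + of_nat k) - 1) \<le> X * P / (Re c + real k)"
  proof -
    have "filterlim (\<lambda>k. Re c + real k) at_top sequentially"
      by (intro filterlim_tendsto_add_at_top[OF tendsto_const] filterlim_real_sequentially)
    then have "\<forall>\<^sub>F k in sequentially. X \<le> Re c + real k" unfolding filterlim_at_top by blast
    then show ?thesis by eventually_elim (rule key)
  qed
  ultimately have "(\<lambda>k. (\<Sum>n. hyp_coeff a b (c + of_nat k) n) * Gamma (c + of_nat k) - 1) \<longlonglongrightarrow> 0"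
    by (rule Lim_null_comparison[rotated])
  then show ?thesis by (simp add: LIM_zero_iff)
qed

text \<open>By \<open>gauss_step\<close> the quotient of the two sides does not change under c -> c
  + 1, and it tends to 1.\<close>

lemma gauss_sum:
  fixes a b c :: complex
  assumes d: "Re (c - a - b) \<ge> 1" and n: "c - a \<notin> \<int>\<^sub>\<le>\<^sub>0" "c - b \<notin> \<int>\<^sub>\<le>\<^sub>0"
  shows "(\<Sum>n. hyp_coeff a b c n) = Gamma (c - a - b) / (Gamma (c - a) * Gamma (c - b))"
proof -
  have nk: "c - a + of_nat k \<notin> \<int>\<^sub>\<le>\<^sub>0" "c - b + of_nat k \<notin> \<int>\<^sub>\<le>\<^sub>0" "c - a - b + of_nat k \<notin> \<int>\<^sub>\<le>\<^sub>0" for k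
  proof -
    have "x + of_nat k \<notin> \<int>\<^sub>\<le>\<^sub>0" if "x \<notin> \<int>\<^sub>\<le>\<^sub>0" for x :: complex
    proof
      assume "x + of_nat k \<in> \<int>\<^sub>\<le>\<^sub>0"
      then obtain j where "x + of_nat k = of_int j" "j \<le> 0" by (auto elim: nonpos_Ints_cases)
      then have "x = of_int (j - int k)" by (simp add: eq_diff_eq)
      then show False using that \<open>j \<le> 0\<close> by (metis diff_le_0_iff_le nonpos_Ints_of_int of_nat_0_le_iff order_trans)
    qed
    moreover have "c - a - b \<notin> \<int>\<^sub>\<le>\<^sub>0"
    proof
      assume "c - a - b \<in> \<int>\<^sub>\<le>\<^sub>0"
      then obtain j where j: "c - a - b = of_int j" "j \<le> 0" by (auto elim: nonpos_Ints_cases)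
      have "Re (c - a - b) = of_int j" by (simp only: j(1) complex_Re_of_int)
      moreover have "real_of_int j \<le> 0" using j(2) by simp
      ultimately show False using d by linarith
    qed
    ultimately show "c - a + of_nat k \<notin> \<int>\<^sub>\<le>\<^sub>0" "c - b + of_nat k \<notin> \<int>\<^sub>\<le>\<^sub>0" "c - a - b + of_nat k \<notin> \<int>\<^sub>\<le>\<^sub>0"
      using n by auto
  qed
  define R where "R = (\<lambda>k. (\<Sum>n. hyp_coeff a b (c + of_nat k) n) * Gamma (c - a + of_nat k) * Gamma (c - b + of_nat k) / Gamma (c - a - b + of_nat k))"
  have step: "R (Suc k) = R k" for k
  proof -
    define e where "e = c + of_nat k"
    have e: "c - a + of_nat k = e - a" "c - b + of_nat k = e - b" "c - a - b + of_nat k = e - a - b"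
      "c + of_nat (Suc k) = e + 1" "c - a + of_nat (Suc k) = e - a + 1" "c - b + of_nat (Suc k) = e - b + 1" "c - a - b + of_nat (Suc k) = e - a - b + 1"
      by (simp_all add: e_def)
    note nz = nk[of k, unfolded e]
    have ne: "e - a \<noteq> 0" "e - b \<noteq> 0" "e - a - b \<noteq> 0" using nz by (auto intro!: notI) 
    have "Re (e - a - b) \<ge> 1" using d by (simp add: e_def)
    note gs = gauss_step[OF this]
    have "S' * (x * A) * (y * B) / (z * D) = S * A * B / D" if "z * S = x * y * S'" "z \<noteq> 0" for S S' x y z A B D :: complex
    proof -
      have "S' * (x * A) * (y * B) / (z * D) = (x * y * S') * A * B / (z * D)" by (simp add: mult_ac)
      also have "\<dots> = S * A * B / D" unfolding that(1)[symmetric] using that(2) by simp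
      finally show ?thesis .
    qed
    from this[OF gs ne(3)] show ?thesis
      unfolding R_def e Gamma_plus1[OF nz(1)] Gamma_plus1[OF nz(2)] Gamma_plus1[OF nz(3)] e_def[symmetric] .
  qed
  have "R (Suc k) = R 0" for k by (induction k) (simp_all add: step)
  moreover have "(\<lambda>k. R (Suc k)) \<longlonglongrightarrow> 1"
  proof -
    define q where "q = (\<lambda>(x::complex) k. Gamma (x + of_nat (Suc k)) / (fact k * exp (x * of_real (ln (real k)))))"
    define r where "r = (\<lambda>(x::complex) k. rGamma (x + of_nat (Suc k)) * (fact k * exp (x * of_real (ln (real k)))))"
    have "(\<lambda>k. ((\<Sum>n. hyp_coeff a b (c + of_nat (Suc k)) n) * Gamma (c + of_nat (Suc k))) * (q (c - a) k * q (c - b) k * (r c k * r (c - a - b) k))) \<longlonglongrightarrow> 1 * (1 * 1 * (1 * 1))"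
      unfolding q_def r_def using nk[of 0]
      by (intro tendsto_mult tendsto_Gamma_shift rGamma_shift_limit LIMSEQ_Suc[OF gauss_limit]) simp_all
    moreover have "\<forall>\<^sub>F k in sequentially. ((\<Sum>n. hyp_coeff a b (c + of_nat (Suc k)) n) * Gamma (c + of_nat (Suc k))) * (q (c - a) k * q (c - b) k * (r c k * r (c - a - b) k)) = R (Suc k)"
    proof -
      obtain k0 :: nat where k0: "real k0 > - Re c" using reals_Archimedean2 by blast
      show ?thesis
        using eventually_ge_at_top[of k0]
      proof eventually_elim
        case (elim k)
        have "c + of_nat (Suc k) \<notin> \<int>\<^sub>\<le>\<^sub>0"
        proof
          assume "c + of_nat (Suc k) \<in> \<int>\<^sub>\<le>\<^sub>0"
          then have "Re (c + of_nat (Suc k)) \<le> 0" by (rule nonpos_Ints_Re_le)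
          then show False using k0 elim by simp
        qed
        then have g: "Gamma (c + of_nat (Suc k)) * rGamma (c + of_nat (Suc k)) = 1"
          by (simp add: rGamma_inverse_Gamma Gamma_eq_zero_iff del: of_nat_Suc)
        define E where "E = (\<lambda>x::complex. exp (x * of_real (ln (real k))))"
        \<comment> \<open>The powers of k cancel because (c - a) + (c - b) = c + (c - a -
          b).\<close>
        have E: "E (c - a) * E (c - b) = E c * E (c - a - b)" "E x \<noteq> 0" for x
          by (simp_all add: E_def algebra_simps flip: exp_add)
        have f: "fact k \<noteq> (0::complex)" by simp
        have alg: "S * G * (A / (F * e1) * (B / (F * e2)) * ((r1 * (F * e3)) * (r2 * (F * e4)))) = S * (G * r1) * A * B * r2"
          if "e1 * e2 = e3 * e4" "F \<noteq> 0" "e1 \<noteq> 0" "e2 \<noteq> 0" for S G A B F e1 e2 e3 e4 r1 r2 :: complex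
        proof -
          have eq: "S * G * (A / (F * e1) * (B / (F * e2)) * ((r1 * (F * e3)) * (r2 * (F * e4)))) = S * (G * r1) * A * B * r2 * ((e3 * e4) / (e1 * e2))"
            using that(2) by simp
          have one: "(e3 * e4) / (e1 * e2) = 1" using that by (metis divide_self mult_eq_0_iff)
          show ?thesis by (simp only: eq one mult_1_right)
        qed
        have Ex: "exp (x * of_real (ln (real k))) = E x" for x by (simp add: E_def)
        show ?case
          unfolding R_def q_def r_def Ex alg[OF E(1) f E(2) E(2)] g
          by (simp add: rGamma_inverse_Gamma divide_inverse)
      qed
    qed
    ultimately show ?thesis using Lim_transform_eventually by fastforce
  qed
  ultimately have "R 0 = 1" by (simp add: LIMSEQ_const_iff)
  then show ?thesis
    using nk[of 0] unfolding R_def by (simp add: Gamma_eq_zero_iff field_simps)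
qed

text \<open>The Chu-Vandermonde sum in regularised form, valid for every c. Pascal's rule splits the
  sum for k + 1 into those for (c, d) and (c + 1, d + 1), so c and d vary in the induction.\<close>

lemma vandermonde_rGamma:
  fixes c d :: complex
  shows "(\<Sum>n\<le>k. (- 1) ^ n * of_nat (k choose n) * pochhammer d n * rGamma (c + of_nat n)) = pochhammer (c - d) k * rGamma (c + of_nat k)"
proof (induction k arbitrary: c d)
  case (Suc k)
  define T where "T = (\<lambda>k c d. \<Sum>n\<le>k. (- 1) ^ n * of_nat (k choose n) * pochhammer d n * rGamma (c + of_nat n) :: complex)"
  have "T (Suc k) c d = rGamma c + (\<Sum>n\<le>k. (- 1) ^ Suc n * of_nat (Suc k choose Suc n) * pochhammer d (Suc n) * rGamma (c + of_nat (Suc n)))"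
    unfolding T_def by (subst sum.atMost_Suc_shift) simp
  also have "\<dots> = rGamma c + (\<Sum>n\<le>k. (- 1) ^ Suc n * of_nat (k choose Suc n) * pochhammer d (Suc n) * rGamma (c + of_nat (Suc n))) -
      d * (\<Sum>n\<le>k. (- 1) ^ n * of_nat (k choose n) * pochhammer (d + 1) n * rGamma (c + 1 + of_nat n))"
    by (simp add: sum_distrib_left sum.distrib[symmetric] sum_subtractf[symmetric] pochhammer_rec algebra_simps)
  also have "rGamma c + (\<Sum>n\<le>k. (- 1) ^ Suc n * of_nat (k choose Suc n) * pochhammer d (Suc n) * rGamma (c + of_nat (Suc n))) = T k c d"
  proof -
    have "(\<Sum>n\<le>Suc k. (- 1) ^ n * of_nat (k choose n) * pochhammer d n * rGamma (c + of_nat n)) =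
       rGamma c + (\<Sum>n\<le>k. (- 1) ^ Suc n * of_nat (k choose Suc n) * pochhammer d (Suc n) * rGamma (c + of_nat (Suc n)))"
      by (subst sum.atMost_Suc_shift) simp
    then show ?thesis by (simp add: T_def binomial_eq_0)
  qed
  also have "d * (\<Sum>n\<le>k. (- 1) ^ n * of_nat (k choose n) * pochhammer (d + 1) n * rGamma (c + 1 + of_nat n)) = d * T k (c + 1) (d + 1)"
    by (simp add: T_def)
  also have "T k c d - d * T k (c + 1) (d + 1) = pochhammer (c - d) k * rGamma (c + of_nat k) - d * (pochhammer (c - d) k * rGamma (c + 1 + of_nat k))"
    unfolding T_def Suc.IH by simp
  also have "rGamma (c + of_nat k) = (c + of_nat k) * rGamma (c + 1 + of_nat k)"
    using rGamma_plus1[of "c + of_nat k"] by (simp add: add_ac)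
  also have "pochhammer (c - d) k * ((c + of_nat k) * rGamma (c + 1 + of_nat k)) - d * (pochhammer (c - d) k * rGamma (c + 1 + of_nat k)) =
      pochhammer (c - d) (Suc k) * rGamma (c + 1 + of_nat k)"
    by (simp add: pochhammer_Suc algebra_simps)
  finally show ?case by (simp add: T_def add_ac)
qed simp



section \<open>Pfaff's transformation by rearranging a double series\<close>

lemma pochhammer_binomial_term:
  fixes s x :: "'a :: field_char_0"
  shows "((- s) gchoose j) * (- x) ^ j = pochhammer s j / fact j * x ^ j"
proof -
  have "((- s) gchoose j) * (- x) ^ j = ((- 1) ^ j * pochhammer s j / fact j) * ((- 1) ^ j * x ^ j)"
    unfolding gbinomial_pochhammer power_minus[of x] minus_minus ..
  also have "\<dots> = ((- 1) ^ j * (- 1) ^ j) * (pochhammer s j / fact j * x ^ j)" by simp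
  also have "((- 1) ^ j * (- 1) ^ j :: 'a) = 1" by (simp add: power_add[symmetric] mult_2[symmetric])
  finally show ?thesis by simp
qed

lemma pochhammer_binomial_series:
  assumes "norm (x::complex) < 1"
  shows "(\<lambda>j. pochhammer s j / fact j * x ^ j) sums (1 - x) powr (- s)"
  using gen_binomial_complex[of "- x" "- s"] assms unfolding pochhammer_binomial_term by simp

lemma pochhammer_binomial_series_real:
  assumes "0 \<le> r" "r < 1"
  shows "(\<lambda>j. pochhammer s j / fact j * r ^ j) sums (1 - r) powr (- s :: real)"
  using gen_binomial_real[of "- r" "- s"] assms unfolding pochhammer_binomial_term by simp

text \<open>Expanding the powers of 1 - x with exponents -a - n on the right-hand side gives a
  double series: its rows sum to the right-hand side, its diagonals to the left-hand side by the
  Chu-Vandermonde sum. For |x| < 1/3 the majorant converges, since |x| / (1 - |x|) < 1/2.\<close>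

lemma pfaff:
  assumes x: "norm x < 1/3"
  shows "hyp_series a b c x = (1 - x) powr (- a) * hyp_series a (c - b) c (x / (x - 1))"
proof -
  define r where "r = norm x"
  have r: "0 \<le> r" "r < 1/3" using x by (auto simp: r_def)
  define t where "t = hyp_coeff a (c - b) c"
  define y where "y = x / (x - 1)"
  have x1: "1 - x \<noteq> 0" "x - 1 \<noteq> 0" using x by auto
  have y: "norm y < 1"
  proof -
    have "norm (x - 1) \<ge> 1 - r" using norm_triangle_ineq2[of 1 x] by (simp add: r_def norm_minus_commute)
    then show ?thesis using r x1 by (simp add: y_def norm_divide r_def[symmetric] divide_less_eq)
  qed
  define f where "f = (\<lambda>(n, j). t n * (- 1) ^ n * x ^ n * (pochhammer (a + of_nat n) j / fact j * x ^ j))"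
  define F where "F = (\<lambda>(n, j). norm (t n) * r ^ n * (pochhammer (norm a + real n) j / fact j * r ^ j))"
  have F0: "F p \<ge> 0" for p
    unfolding F_def case_prod_beta using r by (intro mult_nonneg_nonneg divide_nonneg_nonneg pochhammer_ge0) auto
  have fF: "norm (f p) \<le> F p" for p
  proof -
    obtain n j where p: "p = (n, j)" by (cases p)
    have "norm (pochhammer (a + of_nat n) j) \<le> pochhammer (norm (a + of_nat n)) j" by (rule norm_pochhammer_le)
    also have "\<dots> \<le> pochhammer (norm a + real n) j"
    proof (induction j)
      case (Suc j)
      have "norm (a + of_nat n) \<le> norm a + real n" using norm_triangle_ineq[of a "of_nat n"] by simp
      then show ?case unfolding pochhammer_Suc using Suc by (intro mult_mono pochhammer_ge0) auto
    qed simp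
    finally have "norm (pochhammer (a + of_nat n) j) / fact j * r ^ j \<le> pochhammer (norm a + real n) j / fact j * r ^ j"
      using r by (intro mult_right_mono divide_right_mono) auto
    from mult_left_mono[OF this, of "norm (t n) * r ^ n"]
    have "norm (t n) * r ^ n * (norm (pochhammer (a + of_nat n) j) / fact j * r ^ j) \<le> F p"
      unfolding F_def p case_prod_conv using r(1) by simp
    then show ?thesis unfolding f_def p by (simp add: norm_mult norm_divide norm_power r_def)
  qed
  have "F summable_on (UNIV \<times> UNIV)"
  proof (rule summable_on_SigmaI)
    fix n :: nat
    have s: "(\<lambda>j. F (n, j)) sums (norm (t n) * r ^ n * (1 - r) powr (- (norm a + real n)))"
      unfolding F_def case_prod_conv by (intro sums_mult pochhammer_binomial_series_real r(1)) (use r(2) in simp)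
    have "summable (\<lambda>j. norm (F (n, j)))" using s F0 by (simp add: sums_iff)
    then show "((\<lambda>j. F (n, j)) has_sum (norm (t n) * r ^ n * (1 - r) powr (- (norm a + real n)))) UNIV"
      using s by (rule norm_summable_imp_has_sum)
  next
    have e: "norm (t n) * r ^ n * (1 - r) powr (- (norm a + real n)) = (1 - r) powr (- norm a) * norm (t n * of_real (r / (1 - r)) ^ n)" for n
    proof -
      have "- (norm a + real n) = - norm a - real n" by simp
      then have "(1 - r) powr (- (norm a + real n)) = (1 - r) powr (- norm a) / (1 - r) ^ n"
        using r by (simp only: powr_diff powr_realpow)
      then show ?thesis using r by (simp add: norm_mult norm_power power_divide abs_of_nonneg del: of_real_divide)
    qed
    have "norm (of_real (r / (1 - r)) :: complex) < 1" using r by (simp add: divide_less_eq del: of_real_divide)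
    then have "summable (\<lambda>n. norm (t n * of_real (r / (1 - r)) ^ n))" unfolding t_def by (rule summable_hyp)
    then have "summable (\<lambda>n. norm ((1 - r) powr (- norm a) * norm (t n * of_real (r / (1 - r)) ^ n)))"
      using summable_mult[of "\<lambda>n. norm (t n * of_real (r / (1 - r)) ^ n)" "(1 - r) powr (- norm a)"] by (simp add: abs_mult)
    then have "(\<lambda>n. (1 - r) powr (- norm a) * norm (t n * of_real (r / (1 - r)) ^ n)) summable_on UNIV"
      by (rule norm_summable_imp_summable_on)
    then show "(\<lambda>n. norm (t n) * r ^ n * (1 - r) powr (- (norm a + real n))) summable_on UNIV"
      unfolding e .
  qed (use F0 in auto)
  then have "(\<lambda>p. norm (f p)) summable_on (UNIV \<times> UNIV)"
    by (rule Infinite_Sum.abs_summable_on_comparison_test') (use fF in auto)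
  then have fs: "f summable_on (UNIV \<times> UNIV)" by (rule abs_summable_summable)
  have inner: "((\<lambda>j. f (n, j)) has_sum (1 - x) powr (- a) * (t n * y ^ n)) UNIV" for n
  proof -
    have s: "(\<lambda>j. f (n, j)) sums (t n * (- 1) ^ n * x ^ n * (1 - x) powr (- (a + of_nat n)))"
      unfolding f_def case_prod_conv by (intro sums_mult pochhammer_binomial_series) (use x in simp)
    have alg: "u * v * w * (p / q) = p * (u * (v * w / q))" for u v w p q :: complex by simp
    have "- (a + of_nat n) = - a - of_nat n" by simp
    then have "(1 - x) powr (- (a + of_nat n)) = (1 - x) powr (- a) / (1 - x) ^ n"
      using x1 by (simp only: powr_diff powr_nat' ) (simp add: powr_nat)
    moreover have "(- 1) ^ n * x ^ n / (1 - x) ^ n = y ^ n"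
    proof -
      have "y = (- 1) * x / (1 - x)" unfolding y_def using x1 by (simp add: field_simps)
      then show ?thesis by (simp only: power_divide power_mult_distrib)
    qed
    ultimately have "t n * (- 1) ^ n * x ^ n * (1 - x) powr (- (a + of_nat n)) = (1 - x) powr (- a) * (t n * y ^ n)"
      using alg[of "t n" "(- 1) ^ n" "x ^ n" "(1 - x) powr (- a)" "(1 - x) ^ n"] by (simp only:)
    note s = s[unfolded this]
    have "summable (\<lambda>j. norm (f (n, j)))"
    proof (rule summable_comparison_test')
      have "(\<lambda>j. F (n, j)) sums (norm (t n) * r ^ n * (1 - r) powr (- (norm a + real n)))"
        unfolding F_def case_prod_conv by (intro sums_mult pochhammer_binomial_series_real r(1)) (use r(2) in simp)
      then show "summable (\<lambda>j. F (n, j))" by (rule sums_summable)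
    qed (use fF in auto)
    then show ?thesis using s by (rule norm_summable_imp_has_sum)
  qed
  have outer: "((\<lambda>n. (1 - x) powr (- a) * (t n * y ^ n)) has_sum (1 - x) powr (- a) * hyp_series a (c - b) c y) UNIV"
  proof (rule norm_summable_imp_has_sum)
    show "(\<lambda>n. (1 - x) powr (- a) * (t n * y ^ n)) sums ((1 - x) powr (- a) * hyp_series a (c - b) c y)"
      unfolding t_def by (intro sums_mult hyp_series_sums y)
    show "summable (\<lambda>n. norm ((1 - x) powr (- a) * (t n * y ^ n)))"
      unfolding norm_mult[of "(1 - x) powr (- a)"] t_def by (intro summable_mult summable_hyp y)
  qed
  have tot: "(f has_sum (1 - x) powr (- a) * hyp_series a (c - b) c y) (UNIV \<times> UNIV)"
    by (rule has_sum_SigmaI[OF _ outer fs]) (use inner in auto)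
  have bij: "bij_betw (\<lambda>(k, n). (n, k - n)) (SIGMA k:UNIV. {..k}) (UNIV \<times> UNIV :: (nat \<times> nat) set)"
    by (rule bij_betwI[where g = "\<lambda>(n, j). (n + j, n)"]) auto
  have diag: "((\<lambda>(k, n). f (n, k - n)) has_sum (1 - x) powr (- a) * hyp_series a (c - b) c y) (SIGMA k:UNIV. {..k})"
    using has_sum_reindex_bij_betw[OF bij, of f] tot by (simp add: case_prod_unfold)
  have row: "(\<Sum>n\<le>k. f (n, k - n)) = hyp_coeff a b c k * x ^ k" for k
  proof -
    have "f (n, k - n) = pochhammer a k / fact k * x ^ k * ((- 1) ^ n * of_nat (k choose n) * pochhammer (c - b) n * rGamma (c + of_nat n))"
      if "n \<le> k" for n
    proof -
      have p: "pochhammer a k = pochhammer a n * pochhammer (a + of_nat n) (k - n)" by (rule pochhammer_product[OF that])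
      have xk: "x ^ k = x ^ n * x ^ (k - n)" using that by (simp flip: power_add)
      have b: "of_nat (k choose n) = (fact k / (fact n * fact (k - n)) :: complex)" by (rule binomial_fact[OF that])
      show ?thesis unfolding f_def t_def hyp_coeff_def p xk b by (simp add: field_simps)
    qed
    then have "(\<Sum>n\<le>k. f (n, k - n)) = pochhammer a k / fact k * x ^ k * (\<Sum>n\<le>k. (- 1) ^ n * of_nat (k choose n) * pochhammer (c - b) n * rGamma (c + of_nat n))"
      unfolding sum_distrib_left by (intro sum.cong) auto
    also have "\<dots> = pochhammer a k / fact k * x ^ k * (pochhammer b k * rGamma (c + of_nat k))"
      unfolding vandermonde_rGamma by simp
    finally show ?thesis by (simp add: hyp_coeff_def mult_ac)
  qed
  have "((\<lambda>k. hyp_coeff a b c k * x ^ k) has_sum (1 - x) powr (- a) * hyp_series a (c - b) c y) UNIV"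
  proof (rule has_sum_SigmaD[OF diag])
    fix k :: nat
    show "((\<lambda>n. case (k, n) of (k, n) \<Rightarrow> f (n, k - n)) has_sum hyp_coeff a b c k * x ^ k) {..k}"
      unfolding row[symmetric] by (simp add: has_sum_finite)
  qed
  then have "(\<lambda>k. hyp_coeff a b c k * x ^ k) sums ((1 - x) powr (- a) * hyp_series a (c - b) c y)"
    by (rule has_sum_imp_sums)
  moreover have "norm x < 1" using x by simp
  ultimately show ?thesis using sums_unique2[OF hyp_series_sums] unfolding y_def by blast
qed

section \<open>The connection formula for the function of the first kind\<close>

lemma half_strip_props:
  assumes "z \<in> half_strip"
  shows "Re (sinh z) > 0" "Re (cosh z) > 0" "sinh z \<noteq> 0" "cosh z \<noteq> 0"
proof -
  have z: "Re z > 0" "\<bar>Im z\<bar> < pi / 2" using assms by (auto simp: half_strip_def)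
  have "cos (Im z) > 0" using z by (intro cos_gt_zero_pi) auto
  then show "Re (sinh z) > 0" "Re (cosh z) > 0"
    unfolding Re_Im_sinh_cosh using z by (simp_all add: cosh_real_pos)
  then show "sinh z \<noteq> 0" "cosh z \<noteq> 0" by auto
qed

lemma half_strip_open: "open half_strip" and half_strip_connected: "connected half_strip"
proof -
  have eq: "half_strip = {z. Re z > 0} \<inter> {z. Im z < pi / 2} \<inter> {z. Im z > - pi / 2}"
    by (auto simp: half_strip_def)
  show "open half_strip" unfolding eq
    by (intro open_Int open_halfspace_Re_gt open_halfspace_Im_lt open_halfspace_Im_gt)
  show "connected half_strip" unfolding eq
    by (intro convex_connected convex_Int convex_halfspace_Re_gt convex_halfspace_Im_lt convex_halfspace_Im_gt)
qed

lemma Ln_eqI: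
  assumes "exp y = z" "\<bar>Im y\<bar> < pi"
  shows "Ln z = y"
  using assms Ln_exp[of y] by auto

lemma abs_Im_Ln_less:
  assumes "Re z > 0"
  shows "\<bar>Im (Ln z)\<bar> < pi / 2"
proof -
  have "z \<noteq> 0" using assms by auto
  from Re_Ln_pos_lt[OF this] assms show ?thesis by simp
qed

definition jacobi_kernel :: "(complex \<Rightarrow> complex) \<Rightarrow> complex \<Rightarrow> complex \<Rightarrow> complex \<Rightarrow> complex \<Rightarrow> complex" where
  "jacobi_kernel l \<nu> \<alpha> \<beta> z = exp ((\<alpha> + 1/2) * l z) * exp ((\<beta> + 1/2) * Ln (cosh z)) *
       hyp2F1_reg (- \<nu>) (\<nu> + \<alpha> + \<beta> + 1) (\<alpha> + 1) (- (sinh z ^ 2))"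

text \<open>Pfaff's transformation moves the argument to tanh^2 z, which stays in the unit disc for
  |Im z| < pi/4 and tends to 1 as Re z grows, where Gauss's sum is available. The formula is proved
  where sinh^2 z is small and then continued analytically.\<close>

lemma jacobi_kernel_pfaff:
  assumes z: "Re z > 0" "\<bar>Im z\<bar> < pi / 4"
  shows "hyp2F1_reg (- \<nu>) (\<nu> + \<alpha> + \<beta> + 1) (\<alpha> + 1) (- (sinh z ^ 2)) =
    exp (2 * \<nu> * Ln (cosh z)) * hyp_series (- \<nu>) (- \<nu> - \<beta>) (\<alpha> + 1) ((sinh z / cosh z)\<^sup>2)"
    and "norm ((sinh z / cosh z)\<^sup>2) < 1"
proof -
  define S where "S = {z. 0 < Re z} \<inter> {z. Im z < pi / 4} \<inter> {z. Im z > - pi / 4}"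
  have S: "open S" "connected S" unfolding S_def
    by (intro open_Int open_halfspace_Re_gt open_halfspace_Im_lt open_halfspace_Im_gt)
      (intro convex_connected convex_Int convex_halfspace_Re_gt convex_halfspace_Im_lt convex_halfspace_Im_gt)
  have hs: "S \<subseteq> half_strip" using pi_gt_zero by (auto simp: S_def half_strip_def)
  have zS: "z \<in> S" using z by (auto simp: S_def)
  have th: "norm ((sinh z / cosh z)\<^sup>2) < 1" if "z \<in> S" for z
  proof -
    have c: "cosh z \<noteq> 0" using half_strip_props hs that by blast
    \<comment> \<open>|tanh z| < 1 amounts to sin^2 < cos^2 at Im z, that is cos (2 Im z) >
      0.\<close>
    have "cos (2 * Im z) > 0" using that by (intro cos_gt_zero_pi) (auto simp: S_def)
    then have "sin (Im z) ^ 2 < cos (Im z) ^ 2" by (simp add: cos_double)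
    then have "norm (sinh z) ^ 2 < norm (cosh z) ^ 2" unfolding norm_sinh_cosh_sq by simp
    then show ?thesis using c by (simp add: norm_power norm_divide power_divide divide_less_eq)
  qed
  then show "norm ((sinh z / cosh z)\<^sup>2) < 1" using zS .
  define L where "L = (\<lambda>z. hyp2F1_reg (- \<nu>) (\<nu> + \<alpha> + \<beta> + 1) (\<alpha> + 1) (- (sinh z ^ 2)))"
  define R where "R = (\<lambda>z. exp (2 * \<nu> * Ln (cosh z)) * hyp_series (- \<nu>) (- \<nu> - \<beta>) (\<alpha> + 1) ((sinh z / cosh z)\<^sup>2))"
  have sh: "(\<lambda>z::complex. sinh z) holomorphic_on A" "(\<lambda>z::complex. cosh z) holomorphic_on A" for A
    unfolding sinh_field_def cosh_field_def by (auto intro!: holomorphic_intros)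
  have "L holomorphic_on S"
  proof -
    have "(hyp2F1_reg (- \<nu>) (\<nu> + \<alpha> + \<beta> + 1) (\<alpha> + 1) \<circ> (\<lambda>z. - (sinh z ^ 2))) holomorphic_on S"
    proof (rule holomorphic_on_compose_gen[OF _ hyp2F1_reg_holomorphic])
      show "(\<lambda>z::complex. - (sinh z ^ 2)) holomorphic_on S" by (intro holomorphic_intros sh)
      have "- (sinh z ^ 2) \<in> hyp_cut_plane" if "z \<in> S" for z
        using one_minus_square_in_cut_plane[OF half_strip_props(2)] that hs by (simp add: cosh_sq_complex subset_iff)
      then show "(\<lambda>z. - (sinh z ^ 2)) ` S \<subseteq> hyp_cut_plane" by blast
    qed
    then show ?thesis by (simp add: L_def o_def)
  qed
  moreover have "R holomorphic_on S"
  proof -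
    have c: "cosh z \<noteq> 0" "cosh z \<notin> \<real>\<^sub>\<le>\<^sub>0" if "z \<in> S" for z
      using half_strip_props(4) not_nonpos_Re[OF half_strip_props(2)] hs that by auto
    have "(hyp_series (- \<nu>) (- \<nu> - \<beta>) (\<alpha> + 1) \<circ> (\<lambda>z. (sinh z / cosh z)\<^sup>2)) holomorphic_on S"
    proof (rule holomorphic_on_compose_gen[OF _ hyp_series_holomorphic])
      show "(\<lambda>z::complex. (sinh z / cosh z)\<^sup>2) holomorphic_on S"
        by (intro holomorphic_on_power holomorphic_on_divide sh c)
      show "(\<lambda>z::complex. (sinh z / cosh z)\<^sup>2) ` S \<subseteq> ball 0 1" using th by auto
    qed
    moreover have "(\<lambda>z. exp (2 * \<nu> * Ln (cosh z))) holomorphic_on S"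
      by (intro holomorphic_on_exp' holomorphic_on_mult holomorphic_on_const holomorphic_on_Ln' sh) (use c in auto)
    ultimately show ?thesis by (auto simp: R_def o_def intro: holomorphic_on_mult)
  qed
  moreover have "L z = R z" if "z \<in> S" "norm (sinh z ^ 2) < 1/3" for z
  proof -
    have c: "cosh z \<noteq> 0" "Re (cosh z) > 0" using half_strip_props hs that by blast+
    define x where "x = - (sinh z ^ 2)"
    have x: "norm x < 1/3" "norm x < 1" using that by (auto simp: x_def)
    have x1: "1 - x = cosh z ^ 2" by (simp add: x_def cosh_sq_complex)
    have "x - 1 = - (cosh z ^ 2)" unfolding x1[symmetric] by simp
    then have "x / (x - 1) = (sinh z / cosh z)\<^sup>2" by (simp add: x_def power_divide)
    moreover note x1
    moreover have "\<alpha> + 1 - (\<nu> + \<alpha> + \<beta> + 1) = - \<nu> - \<beta>" by simp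
    moreover have "(cosh z ^ 2) powr (- (- \<nu>)) = exp (2 * \<nu> * Ln (cosh z))"
    proof -
      have "Ln (cosh z ^ 2) = 2 * Ln (cosh z)"
        by (rule Ln_eqI) (use c abs_Im_Ln_less[OF c(2)] in \<open>simp_all add: exp_double\<close>)
      then show ?thesis using c(1) by (simp add: powr_def mult_ac)
    qed
    ultimately show ?thesis
      using pfaff[OF x(1), of "- \<nu>" "\<nu> + \<alpha> + \<beta> + 1" "\<alpha> + 1"] hyp2F1_reg_series[OF x(2)]
      unfolding L_def R_def x_def[symmetric] by simp
  qed
  moreover have "open (S \<inter> {z. norm (sinh z ^ 2) < 1/3})"
  proof -
    have "open {z::complex. norm (sinh z ^ 2) < 1/3}"
      by (intro open_Collect_less continuous_intros holomorphic_on_imp_continuous_on sh)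
    then show ?thesis using S(1) by blast
  qed
  moreover have "S \<inter> {z. norm (sinh z ^ 2) < 1/3} \<noteq> {}"
  proof -
    have "((\<lambda>x. norm (sinh (of_real x :: complex) ^ 2)) \<longlongrightarrow> norm (sinh (of_real 0 :: complex) ^ 2)) (at_right 0)"
      unfolding sinh_field_def by (intro tendsto_intros) auto
    then have "\<forall>\<^sub>F x in at_right 0. norm (sinh (of_real x :: complex) ^ 2) < 1/3"
      by (rule order_tendstoD) simp
    then have "\<forall>\<^sub>F x in at_right 0. norm (sinh (of_real x :: complex) ^ 2) < 1/3 \<and> x > 0"
      by (rule eventually_conj) (rule eventually_at_right_less)
    then obtain x :: real where "norm (sinh (of_real x :: complex) ^ 2) < 1/3" "x > 0"
      using eventually_happens'[OF trivial_limit_at_right_real] by blast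
    then have "of_real x \<in> S \<inter> {z. norm (sinh z ^ 2) < 1/3}" by (simp add: S_def)
    then show ?thesis by blast
  qed
  ultimately have "L z = R z"
    by (intro analytic_continuation_open[of "S \<inter> {z. norm (sinh z ^ 2) < 1/3}" S L R z]) (use S zS in auto)
  then show "hyp2F1_reg (- \<nu>) (\<nu> + \<alpha> + \<beta> + 1) (\<alpha> + 1) (- (sinh z ^ 2)) =
    exp (2 * \<nu> * Ln (cosh z)) * hyp_series (- \<nu>) (- \<nu> - \<beta>) (\<alpha> + 1) ((sinh z / cosh z)\<^sup>2)"
    by (simp add: L_def R_def)
qed

text \<open>The left-hand side of the first expansion, up to the powers of \<open>sinh\<close> and \<open>cosh\<close>.\<close>

definition first_kind :: "complex \<Rightarrow> complex \<Rightarrow> complex \<Rightarrow> complex \<Rightarrow> complex" where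
  "first_kind \<nu> \<alpha> \<beta> z = 2 powr (2 * \<nu> + \<alpha> + \<beta> + 1) * Beta (\<nu> + 1) (\<nu> + \<alpha> + \<beta> + 1) *
     (Gamma (\<nu> + \<alpha> + 1) / Gamma (\<nu> + 1)) * jacobi_kernel (\<lambda>z. Ln (sinh z)) \<nu> \<alpha> \<beta> z"



text \<open>On the half strip the imaginary parts on the right add up to less than pi in absolute
  value, so no multiple of 2 pi i appears.\<close>

lemma Ln_one_minus_exp:
  assumes "z \<in> half_strip"
  shows "Ln (1 - exp (- 2 * z)) = of_real (ln 2) - z + Ln (sinh z)"
    and "Ln (1 + exp (- 2 * z)) = of_real (ln 2) - z + Ln (cosh z)"
proof -
  have i: "\<bar>Im z\<bar> < pi / 2" using assms by (simp add: half_strip_def)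
  have l2: "exp (complex_of_real (ln 2)) = 2" by (subst exp_of_real) simp
  have e2: "exp (- 2 * z) = exp (- z) * exp (- z)" by (simp flip: exp_add)
  have e1: "exp (- z) * exp z = 1" by (simp flip: exp_add)
  have s: "exp (of_real (ln 2) - z + Ln x) = 2 * exp (- z) * x" if "x \<noteq> 0" for x
  proof -
    have "of_real (ln 2) - z + Ln x = of_real (ln 2) + (- z) + Ln x" by simp
    then show ?thesis using that by (simp only: exp_add l2 exp_Ln[OF that])
  qed
  have alg: "2 * a * ((b - a) / 2) = 1 - a * a" "2 * a * ((b + a) / 2) = 1 + a * a" if "a * b = 1" for a b :: complex
  proof -
    have "2 * a * ((b - a) / 2) = a * (b - a)" "2 * a * ((b + a) / 2) = a * (b + a)" by simp_all
    then have "2 * a * ((b - a) / 2) = a * b - a * a" "2 * a * ((b + a) / 2) = a * b + a * a" by (simp_all only: right_diff_distrib distrib_left)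
    then show "2 * a * ((b - a) / 2) = 1 - a * a" "2 * a * ((b + a) / 2) = 1 + a * a" using that by simp_all
  qed
  have k: "\<bar>Im (of_real (ln 2) - z + Ln x)\<bar> < pi" if "Re x > 0" for x
  proof -
    have "Im (of_real (ln 2) - z + Ln x) = Im (Ln x) - Im z" by simp
    then show ?thesis using i abs_Im_Ln_less[OF that] by linarith
  qed
  note p = half_strip_props[OF assms]
  have "2 * exp (- z) * sinh z = 1 - exp (- 2 * z)" "2 * exp (- z) * cosh z = 1 + exp (- 2 * z)"
    unfolding e2 sinh_field_def cosh_field_def by (rule alg[OF e1])+
  note E = s[OF p(3), unfolded this(1)] s[OF p(4), unfolded this(2)]
  show "Ln (1 - exp (- 2 * z)) = of_real (ln 2) - z + Ln (sinh z)"
    by (rule Ln_eqI[OF E(1) k[OF p(1)]])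
  show "Ln (1 + exp (- 2 * z)) = of_real (ln 2) - z + Ln (cosh z)"
    by (rule Ln_eqI[OF E(2) k[OF p(2)]])
qed

text \<open>After Pfaff's transformation the series converges absolutely on the closed disc, hence
  is continuous up to the point 1, and its value there is Gauss's sum. The powers of sinh and cosh
  contribute the power of 2.\<close>

lemma jacobi_kernel_limit:
  assumes w: "Re (2 * \<nu> + \<alpha> + \<beta> + 1) \<ge> 1" and np: "\<nu> + \<alpha> + 1 \<notin> \<int>\<^sub>\<le>\<^sub>0" "\<nu> + \<alpha> + \<beta> + 1 \<notin> \<int>\<^sub>\<le>\<^sub>0"
    and b: "\<bar>b\<bar> < pi / 4"
  shows "((\<lambda>x. exp (- (2 * \<nu> + \<alpha> + \<beta> + 1) * line b 0 x) * jacobi_kernel (\<lambda>z. Ln (sinh z)) \<nu> \<alpha> \<beta> (line b 0 x)) \<longlongrightarrow>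
    2 powr (- (2 * \<nu> + \<alpha> + \<beta> + 1)) * (Gamma (2 * \<nu> + \<alpha> + \<beta> + 1) / (Gamma (\<nu> + \<alpha> + 1) * Gamma (\<nu> + \<alpha> + \<beta> + 1)))) at_top"
proof -
  define a0 where "a0 = - \<nu>"
  define b0 where "b0 = - \<nu> - \<beta>"
  define c0 where "c0 = \<alpha> + 1"
  define H where "H = hyp_series a0 b0 c0"
  have e: "c0 - a0 - b0 = 2 * \<nu> + \<alpha> + \<beta> + 1" "c0 - a0 = \<nu> + \<alpha> + 1" "c0 - b0 = \<nu> + \<alpha> + \<beta> + 1"
    by (simp_all add: a0_def b0_def c0_def)
  have H1: "H 1 = Gamma (2 * \<nu> + \<alpha> + \<beta> + 1) / (Gamma (\<nu> + \<alpha> + 1) * Gamma (\<nu> + \<alpha> + \<beta> + 1))"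
    using gauss_sum[of c0 a0 b0, unfolded e(1), unfolded e(2,3), OF w np] by (simp add: H_def hyp_series_def)
  have cont: "continuous_on (cball 0 1) H"
  proof (rule uniform_limit_theorem)
    show "uniform_limit (cball 0 1) (\<lambda>n x. \<Sum>i<n. hyp_coeff a0 b0 c0 i * x ^ i) H sequentially"
      unfolding H_def hyp_series_def
    proof (rule Weierstrass_m_test)
      show "summable (\<lambda>n. norm (hyp_coeff a0 b0 c0 n))" by (rule hyp_coeff_decay(2)) (unfold e(1), rule w)
      fix n and x :: complex assume "x \<in> cball 0 1"
      then have "norm x ^ n \<le> 1" by (simp add: power_le_one)
      then show "norm (hyp_coeff a0 b0 c0 n * x ^ n) \<le> norm (hyp_coeff a0 b0 c0 n)"
        using mult_left_mono[of "norm x ^ n" 1 "norm (hyp_coeff a0 b0 c0 n)"] by (simp add: norm_mult norm_power)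
    qed
  qed (auto intro!: always_eventually continuous_intros)
  define l where "l = complex_of_real (ln 2)"
  define s where "s = (\<lambda>z::complex. 1 - exp (- 2 * z))"
  define p where "p = (\<lambda>z::complex. 1 + exp (- 2 * z))"
  have t: "((\<lambda>x. exp (- 2 * line b 0 x)) \<longlongrightarrow> 0) at_top" by (rule exp_line_at_top) simp
  have sp: "((\<lambda>x. s (line b 0 x)) \<longlongrightarrow> 1) at_top" "((\<lambda>x. p (line b 0 x)) \<longlongrightarrow> 1) at_top"
    unfolding s_def p_def using tendsto_diff[OF tendsto_const t, of 1] tendsto_add[OF tendsto_const t, of 1] by simp_all
  have key: "exp (- (2 * \<nu> + \<alpha> + \<beta> + 1) * z) * jacobi_kernel (\<lambda>z. Ln (sinh z)) \<nu> \<alpha> \<beta> z =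
      exp ((\<alpha> + 1/2) * (Ln (s z) - l)) * exp ((\<beta> + 1/2 + 2 * \<nu>) * (Ln (p z) - l)) * H ((s z / p z)\<^sup>2)"
    and bd: "norm ((s z / p z)\<^sup>2) < 1" if z: "Re z > 0" "\<bar>Im z\<bar> < pi / 4" for z
  proof -
    have hs: "z \<in> half_strip" using z by (simp add: half_strip_def)
    have L: "Ln (sinh z) = z + (Ln (s z) - l)" "Ln (cosh z) = z + (Ln (p z) - l)"
      unfolding s_def p_def Ln_one_minus_exp[OF hs] l_def by simp_all
    have "s z / p z = sinh z / cosh z"
      using moebius_exp(2)[OF z(1)] unfolding s_def p_def by (metis inverse_divide)
    note th = this
    show "norm ((s z / p z)\<^sup>2) < 1" unfolding th using jacobi_kernel_pfaff(2)[OF z] .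
    have alg: "exp x * (exp X * exp Y * (exp Z * h)) = exp U * exp V * h" if "x + X + Y + Z = U + V" for x X Y Z U V h :: complex
    proof -
      have "exp x * (exp X * exp Y * (exp Z * h)) = exp (x + X + Y + Z) * h" by (simp add: exp_add)
      then show ?thesis unfolding that by (simp add: exp_add)
    qed
    show "exp (- (2 * \<nu> + \<alpha> + \<beta> + 1) * z) * jacobi_kernel (\<lambda>z. Ln (sinh z)) \<nu> \<alpha> \<beta> z =
      exp ((\<alpha> + 1/2) * (Ln (s z) - l)) * exp ((\<beta> + 1/2 + 2 * \<nu>) * (Ln (p z) - l)) * H ((s z / p z)\<^sup>2)"
      unfolding jacobi_kernel_def jacobi_kernel_pfaff(1)[OF z] th H_def a0_def b0_def c0_def
      unfolding L
    proof (rule alg)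
      show "- (2 * \<nu> + \<alpha> + \<beta> + 1) * z + (\<alpha> + 1/2) * (z + (Ln (s z) - l)) + (\<beta> + 1/2) * (z + (Ln (p z) - l)) +
         2 * \<nu> * (z + (Ln (p z) - l)) = (\<alpha> + 1/2) * (Ln (s z) - l) + (\<beta> + 1/2 + 2 * \<nu>) * (Ln (p z) - l)"
        by (simp add: field_simps)
    qed
  qed
  have ev: "\<forall>\<^sub>F x in at_top. (s (line b 0 x) / p (line b 0 x))\<^sup>2 \<in> cball 0 1"
    using eventually_gt_at_top[of 0] by eventually_elim (use bd b in \<open>auto intro: less_imp_le\<close>)
  have "((\<lambda>x. (s (line b 0 x) / p (line b 0 x))\<^sup>2) \<longlongrightarrow> (1 / 1)\<^sup>2) at_top" by (intro tendsto_intros sp) simp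
  then have "((\<lambda>x. (s (line b 0 x) / p (line b 0 x))\<^sup>2) \<longlongrightarrow> 1) at_top" by simp
  from continuous_on_tendsto_compose[OF cont this _ ev]
  have "((\<lambda>x. H ((s (line b 0 x) / p (line b 0 x))\<^sup>2)) \<longlongrightarrow> H 1) at_top" by simp
  then have "((\<lambda>x. exp ((\<alpha> + 1/2) * (Ln (s (line b 0 x)) - l)) * exp ((\<beta> + 1/2 + 2 * \<nu>) * (Ln (p (line b 0 x)) - l)) * H ((s (line b 0 x) / p (line b 0 x))\<^sup>2))
     \<longlongrightarrow> exp ((\<alpha> + 1/2) * (Ln 1 - l)) * exp ((\<beta> + 1/2 + 2 * \<nu>) * (Ln 1 - l)) * H 1) at_top"
    by (intro tendsto_intros sp) auto
  moreover have "\<forall>\<^sub>F x in at_top. exp ((\<alpha> + 1/2) * (Ln (s (line b 0 x)) - l)) * exp ((\<beta> + 1/2 + 2 * \<nu>) * (Ln (p (line b 0 x)) - l)) * H ((s (line b 0 x) / p (line b 0 x))\<^sup>2) =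
      exp (- (2 * \<nu> + \<alpha> + \<beta> + 1) * line b 0 x) * jacobi_kernel (\<lambda>z. Ln (sinh z)) \<nu> \<alpha> \<beta> (line b 0 x)"
    using eventually_gt_at_top[of 0] by eventually_elim (rule key[symmetric], use b in auto)
  ultimately have "((\<lambda>x. exp (- (2 * \<nu> + \<alpha> + \<beta> + 1) * line b 0 x) * jacobi_kernel (\<lambda>z. Ln (sinh z)) \<nu> \<alpha> \<beta> (line b 0 x)) \<longlongrightarrow>
     exp ((\<alpha> + 1/2) * (Ln 1 - l)) * exp ((\<beta> + 1/2 + 2 * \<nu>) * (Ln 1 - l)) * H 1) at_top"
    by (rule Lim_transform_eventually)
  moreover have "exp ((\<alpha> + 1/2) * (Ln 1 - l)) * exp ((\<beta> + 1/2 + 2 * \<nu>) * (Ln 1 - l)) = 2 powr (- (2 * \<nu> + \<alpha> + \<beta> + 1))"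
  proof -
    have "Ln 2 = l" using Ln_of_real[of 2] by (simp add: l_def)
    then have "2 powr (- (2 * \<nu> + \<alpha> + \<beta> + 1)) = exp (- (2 * \<nu> + \<alpha> + \<beta> + 1) * l)" by (simp add: powr_def)
    moreover have "- (2 * \<nu> + \<alpha> + \<beta> + 1) * l = (\<alpha> + 1/2) * (Ln 1 - l) + (\<beta> + 1/2 + 2 * \<nu>) * (Ln 1 - l)"
      by (simp add: field_simps)
    ultimately show ?thesis by (simp only: exp_add)
  qed
  ultimately show ?thesis unfolding H1 by simp
qed



lemma schroedinger_on_lincomb:
  assumes "schroedinger_on w \<alpha> \<beta> S u" "schroedinger_on w \<alpha> \<beta> S v" "open S"
  shows "schroedinger_on w \<alpha> \<beta> S (\<lambda>z. a * u z + b * v z)"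
    and "z \<in> S \<Longrightarrow> deriv (\<lambda>z. a * u z + b * v z) z = a * deriv u z + b * deriv v z"
proof -
  note u = schroedinger_onD[OF assms(1,3)] and v = schroedinger_onD[OF assms(2,3)]
  have 1: "((\<lambda>z. a * u z + b * v z) has_field_derivative a * deriv u z + b * deriv v z) (at z)" if "z \<in> S" for z
    by (intro DERIV_add DERIV_cmult u(1) v(1) that)
  have 2: "((\<lambda>z. a * deriv u z + b * deriv v z) has_field_derivative (w\<^sup>2 + pot \<alpha> \<beta> z) * (a * u z + b * v z)) (at z)" if "z \<in> S" for z
    by (rule DERIV_cong[OF DERIV_add[OF DERIV_cmult[OF u(2)[OF that]] DERIV_cmult[OF v(2)[OF that]]]]) (simp add: algebra_simps)
  show "schroedinger_on w \<alpha> \<beta> S (\<lambda>z. a * u z + b * v z)" by (rule schroedinger_onI(1)[OF assms(3) 1 2])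
  show "deriv (\<lambda>z. a * u z + b * v z) z = a * deriv u z + b * deriv v z" if "z \<in> S"
    using 1[OF that] by (rule DERIV_imp_deriv)
qed

lemma schroedinger_on_reflect:
  assumes "schroedinger_on w \<alpha> \<beta> S u" "open S" "open T" "\<And>z. z \<in> T \<Longrightarrow> - z \<in> S"
  shows "schroedinger_on w \<alpha> \<beta> T (\<lambda>z. u (- z))"
    and "z \<in> T \<Longrightarrow> deriv (\<lambda>z. u (- z)) z = - deriv u (- z)"
proof -
  note u = schroedinger_onD[OF assms(1,2) assms(4)]
  have m: "((\<lambda>z. - z) has_field_derivative - 1) (at z)" for z :: complex
    by (auto intro!: derivative_eq_intros)
  have 1: "((\<lambda>z. u (- z)) has_field_derivative - deriv u (- z)) (at z)" if "z \<in> T" for z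
    by (rule DERIV_cong[OF DERIV_chain2[OF u(1)[OF that] m]]) simp
  have 2: "((\<lambda>z. - deriv u (- z)) has_field_derivative (w\<^sup>2 + pot \<alpha> \<beta> z) * u (- z)) (at z)" if "z \<in> T" for z
    by (rule DERIV_cong[OF DERIV_minus[OF DERIV_chain2[OF u(2)[OF that] m]]]) (simp add: pot_def)
  show "schroedinger_on w \<alpha> \<beta> T (\<lambda>z. u (- z))" by (rule schroedinger_onI(1)[OF assms(3) 1 2])
  show "deriv (\<lambda>z. u (- z)) z = - deriv u (- z)" if "z \<in> T"
    using 1[OF that] by (rule DERIV_imp_deriv)
qed

lemma schroedinger_on_unique:
  assumes "schroedinger_on w \<alpha> \<beta> S u" "open S" "connected S" "a \<in> S"
    and nz: "\<And>z. z \<in> S \<Longrightarrow> sinh z \<noteq> 0" "\<And>z. z \<in> S \<Longrightarrow> cosh z \<noteq> 0"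
    and "u a = 0" "deriv u a = 0" "z \<in> S"
  shows "u z = 0"
proof (rule linear_ode_unique[OF assms(2-4), where u = u and z = z and p = "\<lambda>_. 0" and q = "\<lambda>z. w\<^sup>2 + pot \<alpha> \<beta> z"])
  have "pot \<alpha> \<beta> holomorphic_on S"
    using DERIV_pot[OF nz] by (meson holomorphic_onI has_field_derivative_at_within field_differentiable_def)
  then show "(\<lambda>z. w\<^sup>2 + pot \<alpha> \<beta> z) holomorphic_on S" by (intro holomorphic_on_add holomorphic_on_const)
  show "u holomorphic_on S" using assms(1) by (simp add: schroedinger_on_def)
  show "deriv (deriv u) y = 0 * deriv u y + (w\<^sup>2 + pot \<alpha> \<beta> y) * u y" if "y \<in> S" for y
    using assms(1) that by (simp add: schroedinger_on_def)
qed (use assms(7-9) in simp_all)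

text \<open>Reflection maps the kernel P of the first kind to a multiple of its own continuation
  through the gate, and continuation does not change Wronskians. So the Wronskian of u(-z) with P is
  C times that of u(z), and D(z) = u(-z) - C u(z) has Wronskian 0 with P, which makes them
  proportional. The behaviour at +infinity shows that the factor is 1: there u(z) is negligible,
  u(-z) is governed by \<open>connection_value\<close> and P by Gauss's sum.\<close>

lemma connection_formula:
  assumes lp: "large_parameter 0 A 0 (1/2) 0 \<nu> \<alpha> \<beta>" and \<sigma>: "\<bar>\<sigma>\<bar> = 1" and z: "z \<in> half_strip"
  shows "first_kind \<nu> \<alpha> \<beta> z = jacobi_recessive \<sigma> \<nu> \<alpha> \<beta> (- z) -
    of_real \<sigma> * \<i> * exp (- (of_real \<sigma> * of_real pi * \<i> * \<alpha>)) * jacobi_recessive \<sigma> \<nu> \<alpha> \<beta> z"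
proof -
  define W where "W = 2 * \<nu> + \<alpha> + \<beta> + 1"
  define u where "u = jacobi_recessive \<sigma> \<nu> \<alpha> \<beta>"
  define P where "P = jacobi_kernel (\<lambda>z. Ln (sinh z)) \<nu> \<alpha> \<beta>"
  define si where "si = of_real \<sigma> * \<i>"
  \<comment> \<open>On the horizontal strip S the number -\<sigma> i sinh z has positive real part,
    so its principal logarithm is holomorphic there; adding \<sigma> i pi/2 restores a branch of log
    sinh that agrees with \<open>Ln (sinh z)\<close> on the half strip and continues it to Re z <
    0.\<close>
  define Lp where "Lp = (\<lambda>z. Ln (- (si * sinh z)) + si * of_real (pi / 2))"
  define Q where "Q = jacobi_kernel Lp \<nu> \<alpha> \<beta>"
  define S where "S = {z. 0 < \<sigma> * Im z \<and> \<sigma> * Im z < pi / 2}"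
  have s: "\<sigma> = 1 \<or> \<sigma> = - 1" using \<sigma> by linarith
  have si: "si * si = - 1" "si \<noteq> 0" using s by (auto simp: si_def)
  have esi: "exp (si * of_real (pi / 2)) = si" "exp (- (si * of_real (pi / 2))) = - si"
    using s by (auto simp: si_def complex_eq_iff Re_exp Im_exp)
  have S: "open S" "connected S"
  proof -
    have "S = {z. Im z > 0} \<inter> {z. Im z < pi / 2} \<or> S = {z. Im z < 0} \<inter> {z. Im z > - pi / 2}"
      using s by (auto simp: S_def)
    moreover have "open ({z. Im z > a} \<inter> {z. Im z < b})" "connected ({z. Im z > a} \<inter> {z. Im z < b})" for a b
      by (intro open_Int open_halfspace_Im_gt open_halfspace_Im_lt)
        (intro convex_connected convex_Int convex_halfspace_Im_gt convex_halfspace_Im_lt)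
    ultimately show "open S" "connected S" by (metis Int_commute)+
  qed
  have hs: "half_strip \<subseteq> omega \<sigma>" "S \<subseteq> omega \<sigma>" "- z \<in> omega \<sigma>" if "z \<in> half_strip" for z
    using that by (auto simp: omega_def S_def half_strip_def)
  have hsub: "half_strip \<subseteq> omega \<sigma>" by (auto simp: omega_def half_strip_def)
  have Sp: "Re (- (si * sinh z)) > 0" "sinh z \<noteq> 0" "Re (cosh z) > 0" if "z \<in> S" for z
  proof -
    have r: "Re (- (si * sinh z)) = cosh (Re z) * (\<sigma> * sin (Im z))" by (simp add: si_def Re_Im_sinh_cosh)
    have "\<sigma> * sin (Im z) = sin (\<sigma> * Im z)" "cos (Im z) = cos (\<sigma> * Im z)" using s by auto
    moreover have "sin (\<sigma> * Im z) > 0" "cos (\<sigma> * Im z) > 0"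
      using that by (auto simp: S_def intro!: sin_gt_zero cos_gt_zero_pi)
    ultimately have "\<sigma> * sin (Im z) > 0" "cos (Im z) > 0" by simp_all
    then show "Re (- (si * sinh z)) > 0" "Re (cosh z) > 0"
      unfolding r Re_Im_sinh_cosh by (simp_all add: cosh_real_pos)
    then show "sinh z \<noteq> 0" by auto
  qed
  have ux: "schroedinger_on W \<alpha> \<beta> (omega \<sigma>) u" unfolding W_def u_def by (rule jacobi_recessive_schroedinger[OF \<sigma>])
  have Qs: "schroedinger_on W \<alpha> \<beta> S Q"
    unfolding Q_def jacobi_kernel_def[abs_def] W_def
  proof (rule jacobi_schroedinger[OF S(1) Sp(2,3)])
    fix z assume z: "z \<in> S"
    have "((\<lambda>z. - (si * sinh z)) has_field_derivative - (si * cosh z)) (at z)"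
      by (auto intro!: derivative_eq_intros)
    from DERIV_add[OF DERIV_chain2[OF has_field_derivative_Ln[OF not_nonpos_Re[OF Sp(1)[OF z]]] this] DERIV_const]
    show "(Lp has_field_derivative cosh z / sinh z) (at z)"
      unfolding Lp_def by (rule DERIV_cong) (use si(2) Sp(2)[OF z] in \<open>simp add: field_simps\<close>)
  qed
  have Ps: "schroedinger_on W \<alpha> \<beta> half_strip P"
    unfolding P_def jacobi_kernel_def[abs_def] W_def
  proof (rule jacobi_schroedinger[OF half_strip_open half_strip_props(3,2)])
    fix z assume z: "z \<in> half_strip"
    have "(sinh has_field_derivative cosh z) (at z)" by (auto intro!: derivative_eq_intros)
    from DERIV_chain2[OF has_field_derivative_Ln[OF not_nonpos_Re[OF half_strip_props(1)[OF z]]] this]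
    show "((\<lambda>z. Ln (sinh z)) has_field_derivative cosh z / sinh z) (at z)"
      by (rule DERIV_cong) (simp add: divide_inverse)
  qed
  have Imsi: "\<bar>Im (si * of_real (pi / 2))\<bar> = pi / 2" using s by (auto simp: si_def)
  have over: "Q z = P z" if "z \<in> S" "z \<in> half_strip" for z
  proof -
    have "Ln (sinh z) = Lp z"
    proof (rule Ln_eqI)
      have "- (si * sinh z) \<noteq> 0" using si(2) Sp(2)[OF that(1)] by simp
      then have "exp (Lp z) = - (si * sinh z) * si" unfolding Lp_def exp_add esi(1) by (subst exp_Ln) simp_all
      also have "\<dots> = - (si * si) * sinh z" by (simp only: mult_ac mult_minus_left mult_minus_right)
      finally show "exp (Lp z) = sinh z" unfolding si(1) by simp
      show "\<bar>Im (Lp z)\<bar> < pi"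
        using abs_Im_Ln_less[OF Sp(1)[OF that(1)]] Imsi unfolding Lp_def plus_complex.sel by linarith
    qed
    then show ?thesis by (simp add: Q_def P_def jacobi_kernel_def)
  qed
  \<comment> \<open>Passing from z to -z through the gate rotates sinh by the half turn e^(\<sigma>
    i pi); E compensates for its power with exponent \<alpha> + 1/2.\<close>
  define E where "E = exp (- ((\<alpha> + 1/2) * (si * of_real pi)))"
  have reflP: "P z = E * Q (- z)" if "z \<in> half_strip" for z
  proof -
    have n: "sinh z \<noteq> 0" by (rule half_strip_props(3)[OF that])
    have "Ln (si * sinh z) = Ln (sinh z) + si * of_real (pi / 2)"
    proof (rule Ln_eqI)
      show "exp (Ln (sinh z) + si * of_real (pi / 2)) = si * sinh z"
        by (simp only: exp_add esi(1) exp_Ln[OF n] mult.commute)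
      show "\<bar>Im (Ln (sinh z) + si * of_real (pi / 2))\<bar> < pi"
        using abs_Im_Ln_less[OF half_strip_props(1)[OF that]] Imsi unfolding plus_complex.sel by linarith
    qed
    then have L: "Lp (- z) = Ln (sinh z) + si * of_real pi" by (simp add: Lp_def)
    have "exp ((\<alpha> + 1/2) * Ln (sinh z)) = E * exp ((\<alpha> + 1/2) * Lp (- z))"
      unfolding L E_def exp_add[symmetric] by (simp add: algebra_simps)
    then show ?thesis by (simp add: P_def Q_def jacobi_kernel_def mult.assoc)
  qed
  define um where "um = (\<lambda>z. u (- z))"
  have umr: "schroedinger_on W \<alpha> \<beta> half_strip um" "\<And>z. z \<in> half_strip \<Longrightarrow> deriv um z = - deriv u (- z)"
    unfolding um_def using schroedinger_on_reflect[OF ux open_omega half_strip_open] hs(3) by blast+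
  note usub = schroedinger_on_subset[OF ux]
  obtain \<kappa> where \<kappa>: "\<forall>z\<in>S. u z * deriv Q z - deriv u z * Q z = \<kappa>"
    using schroedinger_on_wronskian[OF usub Qs S] by (auto simp: S_def omega_def)
  obtain \<kappa>' where \<kappa>': "\<forall>z\<in>half_strip. u z * deriv P z - deriv u z * P z = \<kappa>'"
    using schroedinger_on_wronskian[OF usub[OF hsub] Ps half_strip_open half_strip_connected] by blast
  obtain \<kappa>m where \<kappa>m: "\<forall>z\<in>half_strip. um z * deriv P z - deriv um z * P z = \<kappa>m"
    using schroedinger_on_wronskian[OF umr(1) Ps half_strip_open half_strip_connected] by blast
  \<comment> \<open>\<open>z1\<close> lies where S meets the half strip, and \<open>z2\<close> below
    lies where the reflected S does; at these points the constant Wronskians are compared.\<close>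
  define z1 where "z1 = Complex 1 (\<sigma> * pi / 4)"
  have z1: "z1 \<in> S" "z1 \<in> half_strip" using s pi_gt_zero by (auto simp: z1_def S_def half_strip_def)
  have "deriv Q z1 = deriv P z1"
  proof (rule deriv_cong_ev[OF _ refl])
    have "open (S \<inter> half_strip)" using S(1) half_strip_open by blast
    then show "\<forall>\<^sub>F x in nhds z1. Q x = P x"
      unfolding eventually_nhds using z1 over by (intro exI[of _ "S \<inter> half_strip"]) auto
  qed
  then have kk: "\<kappa>' = \<kappa>" using \<kappa> \<kappa>' z1 over[OF z1] by auto
  define z2 where "z2 = Complex 1 (- (\<sigma> * pi / 4))"
  have z2: "- z2 \<in> S" "z2 \<in> half_strip" using s pi_gt_zero by (auto simp: z2_def S_def half_strip_def)
  have WE: "\<kappa>m = - E * \<kappa>"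
  proof -
    have "open (half_strip \<inter> uminus ` S)" using S(1) half_strip_open open_negations by blast
    moreover have "z2 \<in> half_strip \<inter> uminus ` S" using z2 by (auto intro: image_eqI[of _ _ "- z2"])
    moreover have "((\<lambda>z. E * Q (- z)) has_field_derivative E * (- deriv Q (- z2))) (at z2)"
    proof -
      have m: "((\<lambda>z. - z) has_field_derivative - 1) (at z2)" by (auto intro!: derivative_eq_intros)
      show ?thesis
        by (rule DERIV_cong[OF DERIV_cmult[OF DERIV_chain2[OF schroedinger_onD(1)[OF Qs S(1) z2(1)] m]]]) simp
    qed
    ultimately have "(P has_field_derivative E * (- deriv Q (- z2))) (at z2)"
      using has_field_derivative_transform_within_open[of "\<lambda>z. E * Q (- z)" _ z2 "half_strip \<inter> uminus ` S" P] reflP by auto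
    then have dP: "deriv P z2 = E * (- deriv Q (- z2))" by (rule DERIV_imp_deriv)
    have "\<kappa>m = um z2 * deriv P z2 - deriv um z2 * P z2" using \<kappa>m z2 by auto
    also have "\<dots> = - E * (u (- z2) * deriv Q (- z2) - deriv u (- z2) * Q (- z2))"
    proof -
      have "a * (E * (- b)) - (- c) * (E * d) = - E * (a * b - c * d)" for a b c d by (simp add: algebra_simps)
      then show ?thesis unfolding dP umr(2)[OF z2(2)] reflP[OF z2(2)] unfolding um_def .
    qed
    finally show ?thesis using \<kappa> z2 by auto
  qed
  define C where "C = si * exp (- (si * of_real pi * \<alpha>))"
  have EC: "- E = C"
  proof -
    have "- ((\<alpha> + 1/2) * (si * of_real pi)) = - (si * of_real pi * \<alpha>) + - (si * of_real (pi / 2))" by (simp add: algebra_simps)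
    then have "E = exp (- (si * of_real pi * \<alpha>)) * - si" unfolding E_def by (simp only: exp_add esi(2))
    then show ?thesis by (simp add: C_def)
  qed
  define D where "D = (\<lambda>z. 1 * um z + (- C) * u z)"
  note Dl = schroedinger_on_lincomb[OF umr(1) usub[OF hsub] half_strip_open, where a = 1 and b = "- C", folded D_def]
  have WD: "D z * deriv P z - deriv D z * P z = 0" if z: "z \<in> half_strip" for z
  proof -
    have "(1 * a + (- C) * b) * p' - (1 * a' + (- C) * b') * p = (a * p' - a' * p) - C * (b * p' - b' * p)" for a b a' b' p p'
      by (simp add: algebra_simps)
    then have "D z * deriv P z - deriv D z * P z = (um z * deriv P z - deriv um z * P z) - C * (u z * deriv P z - deriv u z * P z)"
      unfolding Dl(2)[OF z] unfolding D_def .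
    also have "\<dots> = - E * \<kappa> - C * \<kappa>" using \<kappa>m \<kappa>' kk WE z by auto
    finally show ?thesis unfolding EC by simp
  qed
  interpret lp: large_parameter 0 A 0 "1/2" 0 \<nu> \<alpha> \<beta> by (rule lp)
  have ReW: "Re W \<ge> 4"
  proof -
    have "Complex 1 0 = 1" by (simp add: complex_eq_iff)
    then show ?thesis using lp.Re_w(2) lp.Y_large(1) unfolding W_def by (simp only: mult_1_right)
  qed
  have W: "W \<notin> \<int>\<^sub>\<le>\<^sub>0" "W \<noteq> 0" using ReW nonpos_Ints_Re_le[of W] by auto
  define k where "k = 2 powr W * Beta (\<nu> + 1) (\<nu> + \<alpha> + \<beta> + 1) * (Gamma (\<nu> + \<alpha> + 1) / Gamma (\<nu> + 1))"
  have F: "first_kind \<nu> \<alpha> \<beta> z = k * P z" for z by (simp add: first_kind_def k_def P_def W_def)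
  have kval: "k * (2 powr (- W) * (Gamma W / (Gamma (\<nu> + \<alpha> + 1) * Gamma (\<nu> + \<alpha> + \<beta> + 1)))) = 1 / W"
  proof -
    have G: "Gamma (\<nu> + 1) \<noteq> 0" "Gamma (\<nu> + \<alpha> + \<beta> + 1) \<noteq> 0" "Gamma (\<nu> + \<alpha> + 1) \<noteq> 0" "Gamma W \<noteq> 0"
      using lp.shifts W by (auto simp: Gamma_eq_zero_iff)
    have "\<nu> + 1 + (\<nu> + \<alpha> + \<beta> + 1) = W + 1" by (simp add: W_def)
    then have B: "Beta (\<nu> + 1) (\<nu> + \<alpha> + \<beta> + 1) = Gamma (\<nu> + 1) * Gamma (\<nu> + \<alpha> + \<beta> + 1) / (W * Gamma W)"
      unfolding Beta_def by (simp only: Gamma_plus1[OF W(1)])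
    have p: "2 powr (- W) = 1 / 2 powr W" by (simp add: powr_minus divide_inverse)
    have alg: "T * (a * b / (W * g)) * (c / a) * (1 / T * (g / (c * b))) = 1 / W" if "T \<noteq> 0" "a \<noteq> 0" "b \<noteq> 0" "c \<noteq> 0" "g \<noteq> 0" for T a b c g :: complex
      using that W(2) by (simp add: field_simps)
    show ?thesis unfolding k_def B p by (rule alg) (use G in auto)
  qed
  \<comment> \<open>At height -\<sigma> pi/6 the reflected line passes through the gate, and |b| <
    pi/4 as \<open>jacobi_kernel_limit\<close> demands.\<close>
  define b where "b = - (\<sigma> * pi / 6)"
  have b: "\<bar>b\<bar> < pi / 4" using s by (auto simp: b_def)
  define l where "l = line b 0"
  have lh: "l x \<in> half_strip" if "x > 0" for x using that b by (auto simp: l_def half_strip_def)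
  have lm: "line (\<sigma> * pi / 6) 0 (- x) = - l x" for x by (simp add: l_def line_def b_def)
  have LF: "((\<lambda>x. exp (- W * l x) * first_kind \<nu> \<alpha> \<beta> (l x)) \<longlongrightarrow> 1 / W) at_top"
  proof -
    have "Re (2 * \<nu> + \<alpha> + \<beta> + 1) \<ge> 1" using ReW unfolding W_def by linarith
    note jacobi_kernel_limit[OF this lp.shifts(3,2) b, folded W_def P_def l_def]
    from tendsto_mult[OF tendsto_const this, of k]
    have "((\<lambda>x. k * (exp (- W * l x) * P (l x))) \<longlongrightarrow> 1 / W) at_top" unfolding kval .
    then show ?thesis unfolding F by (simp only: mult.left_commute)
  qed
  have L1: "((\<lambda>x. exp (- W * l x) * um (l x)) \<longlongrightarrow> 1 / W) at_top"
  proof -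
    have "((\<lambda>x. jacobi_norm \<nu> \<alpha> \<beta> * (exp (W * line (\<sigma> * pi / 6) 0 x) * recessive \<sigma> \<nu> \<alpha> \<beta> (line (\<sigma> * pi / 6) 0 x))) \<longlongrightarrow> 1 / W) at_bot"
      unfolding W_def
    proof (rule lp.connection_value[OF refl \<sigma>])
      show "line (\<sigma> * pi / 6) 0 x \<in> omega \<sigma>" for x using s pi_gt_zero by (auto simp: omega_def)
      have sc: "sin (\<sigma> * pi / 6) ^ 2 = 1/4" "cos (\<sigma> * pi / 6) ^ 2 = 3/4"
        using s by (auto simp: sin_30 cos_30 power_divide)
      show "away (1/2) (line (\<sigma> * pi / 6) 0 x)" for x
        unfolding away_def
        by (intro conjI; rule power2_le_imp_le) (auto simp: norm_sinh_cosh_sq sc power_divide)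
    qed
    from filterlim_compose[OF this filterlim_uminus_at_bot_at_top]
    show ?thesis unfolding lm um_def u_def jacobi_recessive_def by (simp add: mult.left_commute)
  qed
  have L2: "((\<lambda>x. exp (- W * l x) * u (l x)) \<longlongrightarrow> 0) at_top"
  proof -
    have "((\<lambda>x. exp ((- 2 * W) * l x)) \<longlongrightarrow> 0) at_top"
      unfolding l_def by (rule exp_line_at_top) (use ReW in simp)
    moreover have "((\<lambda>x. exp (W * l x) * recessive \<sigma> \<nu> \<alpha> \<beta> (l x)) \<longlongrightarrow> 1) at_top"
      unfolding l_def W_def by (rule lp.recessive_at_top(1)[OF \<sigma>])
    ultimately have "((\<lambda>x. exp ((- 2 * W) * l x) * (jacobi_norm \<nu> \<alpha> \<beta> * (exp (W * l x) * recessive \<sigma> \<nu> \<alpha> \<beta> (l x)))) \<longlongrightarrow> 0 * (jacobi_norm \<nu> \<alpha> \<beta> * 1)) at_top"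
      by (intro tendsto_intros)
    moreover have "exp ((- 2 * W) * l x) * (jacobi_norm \<nu> \<alpha> \<beta> * (exp (W * l x) * recessive \<sigma> \<nu> \<alpha> \<beta> (l x))) = exp (- W * l x) * u (l x)" for x
    proof -
      have "exp a * (j * (exp c * r)) = exp (a + c) * (j * r)" for a c j r :: complex by (simp add: exp_add)
      moreover have "(- 2 * W) * l x + W * l x = - W * l x" by (simp add: algebra_simps)
      ultimately show ?thesis by (simp only: u_def jacobi_recessive_def)
    qed
    ultimately show ?thesis by simp
  qed
  have LD: "((\<lambda>x. exp (- W * l x) * D (l x)) \<longlongrightarrow> 1 / W) at_top"
  proof -
    have "((\<lambda>x. exp (- W * l x) * um (l x) - C * (exp (- W * l x) * u (l x))) \<longlongrightarrow> 1 / W - C * 0) at_top"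
      by (intro tendsto_intros L1 L2)
    then show ?thesis by (simp add: D_def algebra_simps)
  qed
  have "\<exists>x>0. D (l x) \<noteq> 0"
  proof (rule ccontr)
    assume "\<not> (\<exists>x>0. D (l x) \<noteq> 0)"
    then have h: "D (l x) = 0" if "x > 0" for x using that by blast
    have "\<forall>\<^sub>F x in at_top. exp (- W * l x) * D (l x) = 0"
      using eventually_gt_at_top[of "0::real"] by eventually_elim (simp add: h)
    from Lim_transform_eventually[OF LD this] have "((\<lambda>x::real. 0) \<longlongrightarrow> 1 / W) at_top" .
    from tendsto_unique[OF trivial_limit_at_top_linorder this tendsto_const] show False using W(2) by simp
  qed
  then obtain x0 where x0: "x0 > 0" "D (l x0) \<noteq> 0" by blast
  define z0 where "z0 = l x0"
  have z0: "z0 \<in> half_strip" "D z0 \<noteq> 0" using x0 lh by (auto simp: z0_def)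
  \<comment> \<open>Subtracting this multiple of D annihilates the value at \<open>z0\<close>, and
    also the derivative because the Wronskian is 0; uniqueness then gives proportionality.\<close>
  define \<rho> where "\<rho> = k * P z0 / D z0"
  define v where "v = (\<lambda>z. k * P z + (- \<rho>) * D z)"
  note vl = schroedinger_on_lincomb[OF Ps Dl(1) half_strip_open, where a = k and b = "- \<rho>", folded v_def]
  have v0: "v z = 0" if "z \<in> half_strip" for z
  proof (rule schroedinger_on_unique[OF vl(1) half_strip_open half_strip_connected z0(1) half_strip_props(3,4) _ _ that])
    show "v z0 = 0" using z0(2) by (simp add: v_def \<rho>_def)
    have alg: "k * p' + (- (k * p / d)) * d' = k * ((d * p' - d' * p) / d)" if "d \<noteq> 0" for p p' d d'
      using that by (simp add: field_simps)
    have "k * deriv P z0 + (- (k * P z0 / D z0)) * deriv D z0 = k * ((D z0 * deriv P z0 - deriv D z0 * P z0) / D z0)"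
      by (rule alg[OF z0(2)])
    then show "deriv v z0 = 0" unfolding vl(2)[OF z0(1)] \<rho>_def WD[OF z0(1)] by simp
  qed
  have FD: "first_kind \<nu> \<alpha> \<beta> z = \<rho> * D z" if "z \<in> half_strip" for z
    using v0[OF that] by (simp add: v_def F)
  have "((\<lambda>x. \<rho> * (exp (- W * l x) * D (l x))) \<longlongrightarrow> \<rho> * (1 / W)) at_top" by (intro tendsto_intros LD)
  moreover have "\<forall>\<^sub>F x in at_top. \<rho> * (exp (- W * l x) * D (l x)) = exp (- W * l x) * first_kind \<nu> \<alpha> \<beta> (l x)"
    using eventually_gt_at_top[of 0] by eventually_elim (simp add: FD lh)
  ultimately have "((\<lambda>x. exp (- W * l x) * first_kind \<nu> \<alpha> \<beta> (l x)) \<longlongrightarrow> \<rho> * (1 / W)) at_top"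
    by (rule Lim_transform_eventually)
  from tendsto_unique[OF trivial_limit_at_top_linorder this LF] have "\<rho> = 1" using W(2) by simp
  then show ?thesis using FD[OF z] by (simp add: D_def um_def u_def C_def si_def mult_ac)
qed



section \<open>Uniform expansions\<close>

lemma sinh_expanding:
  assumes "x \<le> (y::real)"
  shows "y - x \<le> sinh y - sinh x"
proof -
  have "sinh x - x \<le> sinh y - y"
  proof (rule DERIV_nonneg_imp_nondecreasing[OF assms])
    fix t :: real
    have "((\<lambda>t. sinh t - t) has_real_derivative cosh t - 1) (at t)" by (auto intro!: derivative_eq_intros)
    then show "\<exists>y. ((\<lambda>t. sinh t - t) has_real_derivative y) (at t) \<and> 0 \<le> y"
      using cosh_real_ge_1[of t] by (intro exI[of _ "cosh t - 1"]) auto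
  qed
  then show ?thesis by simp
qed

lemma abs_le_abs_sinh: "\<bar>x\<bar> \<le> \<bar>sinh (x::real)\<bar>"
  using sinh_expanding[of 0 x] sinh_expanding[of x 0] by (cases "x \<ge> 0") auto

lemma sin_cos_nonexpansive:
  "\<bar>sin x - sin y\<bar> \<le> \<bar>x - y\<bar>" "\<bar>cos x - cos y\<bar> \<le> \<bar>x - (y::real)\<bar>"
proof -
  have s: "\<bar>2 * sin t * r\<bar> \<le> 2 * \<bar>t\<bar>" if "\<bar>r\<bar> \<le> 1" for t r :: real
    using mult_mono[OF abs_sin_x_le_abs_x[of t] that] by (simp add: abs_mult)
  have "sin x - sin y = 2 * sin ((x - y) / 2) * cos ((x + y) / 2)" by (rule sin_diff_sin)
  then show "\<bar>sin x - sin y\<bar> \<le> \<bar>x - y\<bar>" using s[of "cos ((x + y) / 2)" "(x - y) / 2"] by simp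
  have "cos x - cos y = 2 * sin ((y - x) / 2) * sin ((x + y) / 2)" using cos_diff_cos[of x y] by simp
  then show "\<bar>cos x - cos y\<bar> \<le> \<bar>x - y\<bar>" using s[of "sin ((x + y) / 2)" "(y - x) / 2"] by simp
qed

lemma norm_sinh_cosh_bounds:
  "norm (sinh z) \<le> \<bar>sinh (Re z)\<bar> + \<bar>sin (Im z)\<bar>" "norm (cosh z) \<le> \<bar>sinh (Re z)\<bar> + \<bar>cos (Im z)\<bar>"
  "\<bar>sinh (Re z)\<bar> \<le> norm (sinh z)" "\<bar>sin (Im z)\<bar> \<le> norm (sinh z)"
  "\<bar>sinh (Re z)\<bar> \<le> norm (cosh z)" "\<bar>cos (Im z)\<bar> \<le> norm (cosh z)"
proof -
  have u: "n \<le> \<bar>a\<bar> + \<bar>b\<bar>" "\<bar>a\<bar> \<le> n" "\<bar>b\<bar> \<le> n" if "n ^ 2 = a ^ 2 + b ^ 2" "n \<ge> 0" for n a b :: real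
  proof -
    have "n ^ 2 \<le> (\<bar>a\<bar> + \<bar>b\<bar>) ^ 2" unfolding power2_sum that(1) by simp
    then show "n \<le> \<bar>a\<bar> + \<bar>b\<bar>" by (rule power2_le_imp_le) simp
    have "\<bar>a\<bar> ^ 2 \<le> n ^ 2" "\<bar>b\<bar> ^ 2 \<le> n ^ 2" unfolding that(1) by simp_all
    then show "\<bar>a\<bar> \<le> n" "\<bar>b\<bar> \<le> n" using that(2) by (auto intro: power2_le_imp_le)
  qed
  note a = u[OF norm_sinh_cosh_sq(1)[of z] norm_ge_zero] and b = u[OF norm_sinh_cosh_sq(2)[of z] norm_ge_zero]
  show "norm (sinh z) \<le> \<bar>sinh (Re z)\<bar> + \<bar>sin (Im z)\<bar>" "norm (cosh z) \<le> \<bar>sinh (Re z)\<bar> + \<bar>cos (Im z)\<bar>"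
    "\<bar>sinh (Re z)\<bar> \<le> norm (sinh z)" "\<bar>sin (Im z)\<bar> \<le> norm (sinh z)"
    "\<bar>sinh (Re z)\<bar> \<le> norm (cosh z)" "\<bar>cos (Im z)\<bar> \<le> norm (cosh z)"
    by (fact a b)+
qed

text \<open>Both |sinh z| and |cosh z| are comparable with |sinh (Re z)| plus |sin (Im z)| or |cos
  (Im z)|. Sine and cosine change by at most the change of Im z, so e is at most the new norm plus
  another (1 + M) times it, which gives 2 + M.\<close>

lemma away_transfer:
  assumes a: "away e z" and s: "\<bar>sinh (Re z)\<bar> \<le> \<bar>sinh (Re z')\<bar>"
    and d: "\<bar>Im z' - Im z\<bar> \<le> M * \<bar>sinh (Re z')\<bar>" and M: "0 \<le> M"
  shows "away (e / (2 + M)) z'"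
proof -
  have t: "e / (2 + M) \<le> n" if e: "e \<le> \<bar>sinh (Re z)\<bar> + \<bar>f\<bar>" and "\<bar>f' - f\<bar> \<le> \<bar>Im z' - Im z\<bar>" "\<bar>sinh (Re z')\<bar> \<le> n" "\<bar>f'\<bar> \<le> n" for f f' n :: real
  proof -
    have "M * \<bar>sinh (Re z')\<bar> \<le> M * n" using that M by (intro mult_left_mono) auto
    then have "e \<le> n + (n + M * n)" using that s d by linarith
    then show ?thesis using M by (simp add: divide_le_eq algebra_simps)
  qed
  have e: "e \<le> norm (sinh z)" "e \<le> norm (cosh z)" using a by (auto simp: away_def)
  show ?thesis unfolding away_def
    using t[OF order_trans[OF e(1) norm_sinh_cosh_bounds(1)] sin_cos_nonexpansive(1) norm_sinh_cosh_bounds(3,4)]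
      t[OF order_trans[OF e(2) norm_sinh_cosh_bounds(2)] sin_cos_nonexpansive(2) norm_sinh_cosh_bounds(5,6)] by blast
qed

lemma away_mono: "away e z \<Longrightarrow> c \<le> e \<Longrightarrow> away c z"
  by (auto simp: away_def)

text \<open>\<kappa> compares Re (\<nu> (1 + i m)) with |\<nu>|, so that bounds in the former become
  powers of the latter. The first clause concerns complete lines crossing the gate at height b, the
  second the points of the right half-plane, which are reached along rays.\<close>

definition expansion_bound :: "nat \<Rightarrow> real \<Rightarrow> real \<Rightarrow> real \<Rightarrow> real \<Rightarrow> real \<Rightarrow> real \<Rightarrow> bool" where
  "expansion_bound N A M c \<kappa> K R \<longleftrightarrow> R > 0 \<and> (\<forall>\<nu> \<alpha> \<beta> m \<sigma>.
     norm \<alpha> \<le> A \<and> norm \<beta> \<le> A \<and> \<bar>m\<bar> \<le> M \<and> R \<le> norm \<nu> \<and> \<kappa> * norm \<nu> \<le> Re (\<nu> * Complex 1 m) \<and> \<bar>\<sigma>\<bar> = 1 \<longrightarrow>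
     (\<forall>b x. 0 < \<sigma> * b \<and> \<sigma> * b < pi / 2 \<and> away c (Complex 0 b) \<longrightarrow>
        norm (remainder N (2 * \<nu> + \<alpha> + \<beta> + 1) \<alpha> \<beta> (jacobi_recessive \<sigma> \<nu> \<alpha> \<beta>) (line b m x)) \<le> K / norm \<nu> ^ (N + 1)) \<and>
     (\<forall>\<xi>. Re \<xi> > 0 \<and> away c \<xi> \<longrightarrow>
        norm (remainder N (2 * \<nu> + \<alpha> + \<beta> + 1) \<alpha> \<beta> (jacobi_recessive \<sigma> \<nu> \<alpha> \<beta>) \<xi>) \<le> K / norm \<nu> ^ (N + 1)))"

lemma line_away:
  assumes "away c (Complex 0 b)" "\<bar>m\<bar> \<le> M"
  shows "away (c / (2 + M)) (line b m x)"
proof (rule away_transfer[OF assms(1)])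
  have "\<bar>m\<bar> * \<bar>x\<bar> \<le> M * \<bar>sinh x\<bar>" using assms(2) abs_le_abs_sinh by (intro mult_mono) auto
  then show "\<bar>Im (line b m x) - Im (Complex 0 b)\<bar> \<le> M * \<bar>sinh (Re (line b m x))\<bar>" by (simp add: abs_mult)
qed (use assms(2) in auto)

lemma expansion_bound_pos:
  fixes A M c \<kappa> :: real
  assumes N: "N \<ge> 1" and M: "0 \<le> M" and c: "0 < c" and \<kappa>: "0 < \<kappa>"
  shows "\<exists>K R. expansion_bound N A M c \<kappa> K R"
proof -
  \<comment> \<open>The minimum with 1/2 also admits the reference line at height \<sigma> pi/4 used
    below. Dividing by 2 + M accounts for the loss along slanted lines in
    \<open>away_transfer\<close>.\<close>
  define c' where "c' = min c (1/2) / (2 + M)"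
  have "min c (1/2) / (2 + M) \<le> 1 / 1" using M by (intro frac_le) auto
  then have c': "0 < c'" "c' \<le> 1" using M c by (auto simp: c'_def)
  have c'2: "c' \<le> c / (2 + M)" "c' \<le> (1/2) / (2 + M)"
    unfolding c'_def using M by (intro divide_right_mono; linarith)+
  obtain K0 where K0: "K0 \<ge> 0" "\<And>z \<alpha> \<beta>. away c' z \<Longrightarrow> norm \<alpha> \<le> A \<Longrightarrow> norm \<beta> \<le> A \<Longrightarrow> norm (g_deriv N z \<alpha> \<beta>) \<le> K0 * bump (Re z)"
    using g_bounds[OF c'(1,2), of A N] by blast
  define K where "K = 3 * (8 * (1 + M) ^ (N + 2) * K0) / \<kappa> ^ (N + 1)"
  define R where "R = max 1 (threshold N A M c' / \<kappa>)"
  have R: "R > 0" by (simp add: R_def)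
  have main: "(\<forall>b x. 0 < \<sigma> * b \<and> \<sigma> * b < pi / 2 \<and> away c (Complex 0 b) \<longrightarrow>
        norm (remainder N (2 * \<nu> + \<alpha> + \<beta> + 1) \<alpha> \<beta> (jacobi_recessive \<sigma> \<nu> \<alpha> \<beta>) (line b m x)) \<le> K / norm \<nu> ^ (N + 1)) \<and>
     (\<forall>\<xi>. Re \<xi> > 0 \<and> away c \<xi> \<longrightarrow>
        norm (remainder N (2 * \<nu> + \<alpha> + \<beta> + 1) \<alpha> \<beta> (jacobi_recessive \<sigma> \<nu> \<alpha> \<beta>) \<xi>) \<le> K / norm \<nu> ^ (N + 1))"
    if p: "norm \<alpha> \<le> A" "norm \<beta> \<le> A" "\<bar>m\<bar> \<le> M" "R \<le> norm \<nu>" "\<kappa> * norm \<nu> \<le> Re (\<nu> * Complex 1 m)" "\<bar>\<sigma>\<bar> = 1" for \<nu> \<alpha> \<beta> m \<sigma>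
  proof -
    have "threshold N A M c' / \<kappa> \<le> norm \<nu>" "1 \<le> norm \<nu>" using p(4) by (auto simp: R_def)
    then have th: "threshold N A M c' \<le> \<kappa> * norm \<nu>" and n1: "norm \<nu> \<ge> 1" using \<kappa> by (simp_all add: divide_le_eq mult.commute)
    interpret lp: large_parameter N A M c' m \<nu> \<alpha> \<beta>
      by unfold_locales (use p c' th in auto)
    have gK: "norm (g_deriv N z \<alpha> \<beta>) \<le> K0 * bump (Re z)" if "away c' z" for z using K0(2) that p by blast
    have "0 < norm \<nu>" using n1 by linarith
    then have kn: "0 < \<kappa> * norm \<nu>" by (rule mult_pos_pos[OF \<kappa>])
    have eb: "3 * lp.expand_bound K0 \<le> K / norm \<nu> ^ (N + 1)"
    proof -
      have "(\<kappa> * norm \<nu>) ^ (N + 1) \<le> Re (\<nu> * Complex 1 m) ^ (N + 1)" using p(5) kn by (intro power_mono) auto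
      then have "3 * (8 * (1 + M) ^ (N + 2) * K0) / Re (\<nu> * Complex 1 m) ^ (N + 1) \<le> 3 * (8 * (1 + M) ^ (N + 2) * K0) / (\<kappa> * norm \<nu>) ^ (N + 1)"
        using kn K0(1) M by (intro divide_left_mono mult_pos_pos zero_less_power mult_nonneg_nonneg zero_le_power) (use p(5) \<kappa> n1 in auto)
      then show ?thesis by (simp add: lp.expand_bound_def K_def power_mult_distrib mult_ac)
    qed
    have eb0: "0 \<le> lp.expand_bound K0"
      unfolding lp.expand_bound_def using K0(1) M lp.Y_large(1)
      by (intro divide_nonneg_nonneg mult_nonneg_nonneg zero_le_power) auto
    have om: "line b m x \<in> omega \<sigma>" if "0 < \<sigma> * b" "\<sigma> * b < pi / 2" for b x
      using that by (auto simp: omega_def)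
    \<comment> \<open>The reference line through the midpoint of the gate; it bounds
      \<open>top_limit\<close>, which the rays need.\<close>
    define b0 where "b0 = \<sigma> * pi / 4"
    have s: "\<sigma> = 1 \<or> \<sigma> = - 1" using p(6) by linarith
    have b0: "0 < \<sigma> * b0" "\<sigma> * b0 < pi / 2" using s pi_gt_zero by (auto simp: b0_def)
    have ab0: "away (1/2) (Complex 0 b0)"
    proof -
      have sc: "sin b0 ^ 2 = 1/2" "cos b0 ^ 2 = 1/2"
        using s by (auto simp: b0_def sin_45 cos_45 power_divide)
      show ?thesis unfolding away_def
        by (intro conjI; rule power2_le_imp_le) (auto simp: norm_sinh_cosh_sq sc power_divide)
    qed
    have L: "norm lp.top_limit \<le> lp.expand_bound K0"
      by (rule lp.expand_line(2)[OF N gK K0(1) p(6) om[OF b0] away_mono[OF line_away[OF ab0 p(3)] c'2(2)]])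
    show ?thesis
    proof (intro conjI allI impI; elim conjE)
      fix b x assume b: "0 < \<sigma> * b" "\<sigma> * b < pi / 2" "away c (Complex 0 b)"
      have "norm (remainder N (2 * \<nu> + \<alpha> + \<beta> + 1) \<alpha> \<beta> (jacobi_recessive \<sigma> \<nu> \<alpha> \<beta>) (line b m x)) \<le> lp.expand_bound K0"
        by (rule lp.expand_line(1)[OF N gK K0(1) p(6) om[OF b(1,2)] away_mono[OF line_away[OF b(3) p(3)] c'2(1)]])
      then show "norm (remainder N (2 * \<nu> + \<alpha> + \<beta> + 1) \<alpha> \<beta> (jacobi_recessive \<sigma> \<nu> \<alpha> \<beta>) (line b m x)) \<le> K / norm \<nu> ^ (N + 1)"
        using eb eb0 by linarith
    next
      fix \<xi> :: complex assume x: "0 < Re \<xi>" "away c \<xi>"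
      define b where "b = Im \<xi> - m * Re \<xi>"
      have xi: "\<xi> = line b m (Re \<xi>)" by (simp add: complex_eq_iff b_def)
      have aw: "away c' (line b m x)" if "x \<ge> Re \<xi>" for x
      proof (rule away_mono[OF away_transfer[OF x(2), of _ M] c'2(1)])
        have "sinh x - sinh (Re \<xi>) \<ge> x - Re \<xi>" by (rule sinh_expanding[OF that])
        moreover have "sinh (Re \<xi>) \<ge> 0" using x(1) by simp
        ultimately have g: "\<bar>sinh (Re \<xi>)\<bar> \<le> \<bar>sinh x\<bar>" "\<bar>x - Re \<xi>\<bar> \<le> \<bar>sinh x\<bar>" using that by linarith+
        then show "\<bar>sinh (Re \<xi>)\<bar> \<le> \<bar>sinh (Re (line b m x))\<bar>" by simp
        have "Im (line b m x) - Im \<xi> = m * (x - Re \<xi>)" by (simp add: b_def algebra_simps)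
        then show "\<bar>Im (line b m x) - Im \<xi>\<bar> \<le> M * \<bar>sinh (Re (line b m x))\<bar>"
          using mult_mono[OF p(3) g(2)] M by (simp add: abs_mult)
      qed (rule M)
      have "norm (remainder N (2 * \<nu> + \<alpha> + \<beta> + 1) \<alpha> \<beta> (jacobi_recessive \<sigma> \<nu> \<alpha> \<beta>) (line b m (Re \<xi>))) \<le> 3 * lp.expand_bound K0"
        by (rule lp.expand_ray[OF N gK K0(1) p(6) L x(1) aw])
      then show "norm (remainder N (2 * \<nu> + \<alpha> + \<beta> + 1) \<alpha> \<beta> (jacobi_recessive \<sigma> \<nu> \<alpha> \<beta>) \<xi>) \<le> K / norm \<nu> ^ (N + 1)"
        unfolding xi[symmetric] using eb by linarith
    qed
  qed
  show ?thesis unfolding expansion_bound_def using R main by blast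
qed

text \<open>For N = 0 the remainder tends to 1 / w at -infinity, once scaled, and cannot be anchored
  there. It is obtained from N = 1 by adding the single term \<open>inv_fact w 0\<close>, which has
  the required order 1 / |\<nu>|.\<close>

lemma expansion_bound_exists:
  fixes A M c \<kappa> :: real
  assumes M: "0 \<le> M" and c: "0 < c" and \<kappa>: "0 < \<kappa>"
  shows "\<exists>K R. expansion_bound N A M c \<kappa> K R"
proof (cases "N = 0")
  case False
  then show ?thesis using expansion_bound_pos[OF _ M c \<kappa>, of N] by simp
next
  case True
  have "\<exists>K R. expansion_bound 1 A M c \<kappa> K R" by (rule expansion_bound_pos[OF _ M c \<kappa>]) simp
  then obtain K1 R1 where E: "expansion_bound 1 A M c \<kappa> K1 R1" by blast
  define K where "K = \<bar>K1\<bar> + (1 + M) / \<kappa>"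
  define R where "R = max (max R1 1) (threshold 0 A M 1 / \<kappa>)"
  have R: "R > 0" by (simp add: R_def)
  have step: "norm (remainder 0 (2 * \<nu> + \<alpha> + \<beta> + 1) \<alpha> \<beta> u z) \<le> K / norm \<nu> ^ (0 + 1)"
    if p: "norm \<alpha> \<le> A" "norm \<beta> \<le> A" "\<bar>m\<bar> \<le> M" "R \<le> norm \<nu>" "\<kappa> * norm \<nu> \<le> Re (\<nu> * Complex 1 m)"
      and r: "norm (remainder 1 (2 * \<nu> + \<alpha> + \<beta> + 1) \<alpha> \<beta> u z) \<le> K1 / norm \<nu> ^ (1 + 1)" for \<nu> \<alpha> \<beta> m u z
  proof -
    have "threshold 0 A M 1 / \<kappa> \<le> norm \<nu>" "1 \<le> norm \<nu>" using p(4) by (auto simp: R_def)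
    then have th: "threshold 0 A M 1 \<le> \<kappa> * norm \<nu>" and n1: "norm \<nu> \<ge> 1" using \<kappa> by (simp_all add: divide_le_eq mult.commute)
    interpret lp: large_parameter 0 A M 1 m \<nu> \<alpha> \<beta>
      by unfold_locales (use p th in auto)
    have "0 < norm \<nu>" using n1 by linarith
    then have kn: "0 < \<kappa> * norm \<nu>" "0 < norm \<nu>" by (simp_all add: mult_pos_pos[OF \<kappa>] del: zero_less_norm_iff)
    have "norm (inv_fact (2 * \<nu> + \<alpha> + \<beta> + 1) 0) \<le> (1 + M) / Re (\<nu> * Complex 1 m)" using lp.inv_fact_bound[of 0] by simp
    also have "\<dots> \<le> (1 + M) / (\<kappa> * norm \<nu>)" using p(5) kn M by (intro frac_le) auto
    finally have i: "norm (inv_fact (2 * \<nu> + \<alpha> + \<beta> + 1) 0) \<le> (1 + M) / \<kappa> / norm \<nu>" by simp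
    have K1b: "K1 / norm \<nu> ^ (1 + 1) \<le> \<bar>K1\<bar> / norm \<nu>"
      using n1 kn by (intro frac_le) (auto simp: power2_eq_square)
    have eq: "remainder 0 (2 * \<nu> + \<alpha> + \<beta> + 1) \<alpha> \<beta> u z = remainder 1 (2 * \<nu> + \<alpha> + \<beta> + 1) \<alpha> \<beta> u z + inv_fact (2 * \<nu> + \<alpha> + \<beta> + 1) 0"
      by (simp add: remainder_def partial_series_def g_coeff_def a_coeff_def)
    have "norm (remainder 0 (2 * \<nu> + \<alpha> + \<beta> + 1) \<alpha> \<beta> u z) \<le> \<bar>K1\<bar> / norm \<nu> + (1 + M) / \<kappa> / norm \<nu>"
      unfolding eq using K1b norm_triangle_ineq[of "remainder 1 (2 * \<nu> + \<alpha> + \<beta> + 1) \<alpha> \<beta> u z" "inv_fact (2 * \<nu> + \<alpha> + \<beta> + 1) 0"] r i by linarith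
    then show ?thesis by (simp add: K_def add_divide_distrib)
  qed
  have "expansion_bound 0 A M c \<kappa> K R"
    unfolding expansion_bound_def
  proof (intro conjI allI impI; (elim conjE)?)
    fix \<nu> \<alpha> \<beta> :: complex and m \<sigma> :: real
    assume p: "norm \<alpha> \<le> A" "norm \<beta> \<le> A" "\<bar>m\<bar> \<le> M" "R \<le> norm \<nu>" "\<kappa> * norm \<nu> \<le> Re (\<nu> * Complex 1 m)" "\<bar>\<sigma>\<bar> = 1"
    have R1: "R1 \<le> norm \<nu>" using p(4) by (simp add: R_def)
    note e = E[unfolded expansion_bound_def, THEN conjunct2, rule_format, OF conjI[OF p(1) conjI[OF p(2) conjI[OF p(3) conjI[OF R1 conjI[OF p(5,6)]]]]]]
    show "norm (remainder 0 (2 * \<nu> + \<alpha> + \<beta> + 1) \<alpha> \<beta> (jacobi_recessive \<sigma> \<nu> \<alpha> \<beta>) (line b m x)) \<le> K / norm \<nu> ^ (0 + 1)"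
      if "0 < \<sigma> * b" "\<sigma> * b < pi / 2" "away c (Complex 0 b)" for b x
      by (rule step[OF p(1-5)]) (use e that in blast)
    show "norm (remainder 0 (2 * \<nu> + \<alpha> + \<beta> + 1) \<alpha> \<beta> (jacobi_recessive \<sigma> \<nu> \<alpha> \<beta>) \<xi>) \<le> K / norm \<nu> ^ (0 + 1)"
      if "0 < Re \<xi>" "away c \<xi>" for \<xi>
      by (rule step[OF p(1-5)]) (use e that in blast)
  qed (rule R)
  then show ?thesis unfolding True by blast
qed

text \<open>Points to the right of the imaginary axis are reached along rays from +infinity, whose
  slope is free to follow the argument of \<nu>.\<close>

lemma expansion_wide_sector:
  fixes A \<epsilon> \<delta> :: real
  assumes \<epsilon>: "\<epsilon> > 0" and \<delta>: "\<delta> > 0"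
  shows "\<exists>K R. R > 0 \<and> (\<forall>\<nu> \<alpha> \<beta> \<xi> \<sigma>. norm \<alpha> \<le> A \<and> norm \<beta> \<le> A \<and> R \<le> norm \<nu> \<and> \<bar>Arg \<nu>\<bar> \<le> pi - \<delta> \<and> \<bar>\<sigma>\<bar> = 1 \<and>
     Re \<xi> > 0 \<and> away \<epsilon> \<xi> \<longrightarrow>
     norm (remainder N (2 * \<nu> + \<alpha> + \<beta> + 1) \<alpha> \<beta> (jacobi_recessive \<sigma> \<nu> \<alpha> \<beta>) \<xi>) \<le> K / norm \<nu> ^ (N + 1))"
proof -
  define d where "d = min \<delta> 1"
  have d: "0 < d" "d \<le> 1" "d \<le> \<delta>" using \<delta> by (auto simp: d_def)
  have dp: "d < pi" using d pi_gt3 by linarith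
  \<comment> \<open>In the sector |\<nu>| + Re \<nu> \<ge> k |\<nu>|, which bounds the slopes by 1 /
    k.\<close>
  define k where "k = 1 - cos d"
  have k: "k > 0" using cos_monotone_0_pi[of 0 d] d dp by (simp add: k_def)
  obtain K R where E: "expansion_bound N A (1 / k) \<epsilon> 1 K R"
    using expansion_bound_exists[of "1 / k" \<epsilon> 1 N A] k \<epsilon> by auto
  then have R: "R > 0" by (simp add: expansion_bound_def)
  have "norm (remainder N (2 * \<nu> + \<alpha> + \<beta> + 1) \<alpha> \<beta> (jacobi_recessive \<sigma> \<nu> \<alpha> \<beta>) \<xi>) \<le> K / norm \<nu> ^ (N + 1)"
    if p: "norm \<alpha> \<le> A" "norm \<beta> \<le> A" "R \<le> norm \<nu>" "\<bar>Arg \<nu>\<bar> \<le> pi - \<delta>" "\<bar>\<sigma>\<bar> = 1" "Re \<xi> > 0" "away \<epsilon> \<xi>" for \<nu> \<alpha> \<beta> \<xi> \<sigma>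
  proof -
    have n: "norm \<nu> > 0" using p(3) R by linarith
    have "cos (pi - d) \<le> cos \<bar>Arg \<nu>\<bar>" using p(4) d dp by (intro cos_monotone_0_pi_le) auto
    then have "- cos d \<le> cos (Arg \<nu>)" by simp
    then have "norm \<nu> * (- cos d) \<le> norm \<nu> * cos (Arg \<nu>)" using n by (intro mult_left_mono) auto
    moreover have "Re \<nu> = norm \<nu> * cos (Arg \<nu>)" using arg_cong[OF rcis_cmod_Arg[of \<nu>], of Re] by simp
    ultimately have q: "norm \<nu> + Re \<nu> \<ge> norm \<nu> * k" by (simp add: k_def algebra_simps)
    define T where "T = norm \<nu> + Re \<nu>"
    have nk: "norm \<nu> * k > 0" using n k by simp
    have T: "T > 0" "T \<ge> norm \<nu> * k" using q nk by (auto simp: T_def)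
    \<comment> \<open>This is -tan (Arg \<nu> / 2). With it Re (\<nu> (1 + i m)) = |\<nu>|, so the
      expansion bound applies with \<kappa> = 1.\<close>
    define m where "m = - Im \<nu> / T"
    have m: "\<bar>m\<bar> \<le> 1 / k"
    proof -
      have "\<bar>m\<bar> = \<bar>Im \<nu>\<bar> / T" using T by (simp add: m_def)
      also have "\<dots> \<le> norm \<nu> / (norm \<nu> * k)" using T nk abs_Im_le_cmod by (intro frac_le) auto
      also have "\<dots> = 1 / k" using n by simp
      finally show ?thesis .
    qed
    have "Re (\<nu> * Complex 1 m) = Re \<nu> + Im \<nu> ^ 2 / T" by (simp add: m_def power2_eq_square)
    moreover have "Re \<nu> + Im \<nu> ^ 2 / T = norm \<nu>"
    proof -
      have "Re \<nu> * T + Im \<nu> ^ 2 = norm \<nu> * Re \<nu> + (Re \<nu> ^ 2 + Im \<nu> ^ 2)" by (simp add: T_def algebra_simps power2_eq_square)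
      also have "\<dots> = norm \<nu> * T" unfolding cmod_power2[symmetric] by (simp add: T_def algebra_simps power2_eq_square)
      finally show ?thesis using T(1) by (simp add: field_simps)
    qed
    ultimately have "1 * norm \<nu> \<le> Re (\<nu> * Complex 1 m)" by simp
    then show ?thesis using E m p unfolding expansion_bound_def by blast
  qed
  then show ?thesis using R by blast
qed

lemma right_sector:
  assumes "\<bar>Arg \<nu>\<bar> \<le> pi / 2 - \<delta>" "0 < d" "d \<le> \<delta>" "d \<le> 1"
  shows "Re \<nu> \<ge> sin d * norm \<nu>"
proof -
  have "cos (pi / 2 - d) \<le> cos \<bar>Arg \<nu>\<bar>" using assms pi_gt3 by (intro cos_monotone_0_pi_le) auto
  then have "sin d \<le> cos (Arg \<nu>)" by (simp add: cos_diff)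
  then have "norm \<nu> * sin d \<le> norm \<nu> * cos (Arg \<nu>)" by (intro mult_left_mono) auto
  moreover have "Re \<nu> = norm \<nu> * cos (Arg \<nu>)" using arg_cong[OF rcis_cmod_Arg[of \<nu>], of Re] by simp
  ultimately show ?thesis by (simp add: mult.commute)
qed

text \<open>If the height of \<zeta> is well inside the gate, a horizontal line will do. Otherwise
  the height is close to an end of the gate; as \<zeta> is away from the singularity there, |Re
  \<zeta>| is bounded below, and a small tilt moves the crossing point to a fixed distance from the
  end.\<close>

lemma slope_exists:
  assumes \<epsilon>: "\<epsilon> > 0" and m0: "m0 > 0"
  shows "\<exists>c>0. \<forall>\<zeta> \<sigma>. Re \<zeta> < 0 \<and> 0 \<le> \<sigma> * Im \<zeta> \<and> \<sigma> * Im \<zeta> < pi / 2 \<and> \<bar>\<sigma>\<bar> = 1 \<and> away \<epsilon> \<zeta> \<longrightarrow>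
    (\<exists>m b. \<bar>m\<bar> \<le> m0 \<and> 0 < \<sigma> * b \<and> \<sigma> * b < pi / 2 \<and> away c (Complex 0 b) \<and> \<zeta> = line b m (Re \<zeta>))"
proof -
  \<comment> \<open>\<open>\<eta>\<close> is at most \<epsilon> / 2, so near an end of the gate the
    other half of \<epsilon> has to come from sinh (Re \<zeta>), which forces |Re \<zeta>| \<ge>
    \<open>s0\<close>. As \<open>\<eta>\<close> is also at most \<open>m0 * s0\<close>, the shift by
    \<open>\<eta>\<close> then costs a slope of at most \<open>m0\<close>.\<close>
  define s0 where "s0 = arsinh (\<epsilon> / 2)"
  have s0: "s0 > 0" using \<epsilon> by (simp add: s0_def)
  define \<eta> where "\<eta> = min (pi / 6) (min (\<epsilon> / 2) (m0 * s0))"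
  have \<eta>: "0 < \<eta>" "\<eta> \<le> pi / 6" "\<eta> \<le> \<epsilon> / 2" "\<eta> \<le> m0 * s0" using \<epsilon> m0 s0 by (auto simp: \<eta>_def)
  have c: "sin \<eta> > 0" using \<eta> pi_gt_zero by (intro sin_gt_zero) linarith+
  have "\<exists>m b. \<bar>m\<bar> \<le> m0 \<and> 0 < \<sigma> * b \<and> \<sigma> * b < pi / 2 \<and> away (sin \<eta>) (Complex 0 b) \<and> \<zeta> = line b m (Re \<zeta>)"
    if p: "Re \<zeta> < 0" "0 \<le> \<sigma> * Im \<zeta>" "\<sigma> * Im \<zeta> < pi / 2" "\<bar>\<sigma>\<bar> = 1" "away \<epsilon> \<zeta>" for \<zeta> \<sigma>
  proof -
    define x where "x = - Re \<zeta>"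
    have x: "x > 0" using p by (simp add: x_def)
    have s: "\<sigma> = 1 \<or> \<sigma> = - 1" using p(4) by linarith
    define t where "t = \<sigma> * Im \<zeta>"
    have sx: "\<bar>sinh (Re \<zeta>)\<bar> = sinh x" using x by (simp add: x_def)
    have trig: "\<bar>sin (Im \<zeta>)\<bar> = \<bar>sin t\<bar>" "\<bar>cos (Im \<zeta>)\<bar> = \<bar>cos t\<bar>" using s by (auto simp: t_def)
    have sl: "\<eta> / x \<le> m0" if "sinh x \<ge> \<epsilon> / 2"
    proof -
      have "sinh s0 \<le> sinh x" using that by (simp add: s0_def)
      then have "s0 \<le> x" by simp
      then have "m0 * s0 \<le> m0 * x" using m0 by simp
      then show ?thesis using \<eta>(4) x by (simp add: divide_le_eq)
    qed
    have sinle: "\<bar>sin y\<bar> \<le> \<eta>" if "\<bar>y\<bar> \<le> \<eta>" for y using abs_sin_x_le_abs_x[of y] that by linarith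
    obtain r where r: "\<bar>r\<bar> \<le> m0" "\<eta> \<le> t + r * x" "t + r * x \<le> pi / 2 - \<eta>"
    proof -
      consider "t < \<eta>" | "\<eta> \<le> t" "t \<le> pi / 2 - \<eta>" | "t > pi / 2 - \<eta>" by linarith
      then have "\<exists>r. \<bar>r\<bar> \<le> m0 \<and> \<eta> \<le> t + r * x \<and> t + r * x \<le> pi / 2 - \<eta>"
      proof cases
        case 1
        have "\<epsilon> \<le> sinh x + \<bar>sin t\<bar>" using p(5) norm_sinh_cosh_bounds(1)[of \<zeta>] unfolding away_def sx trig by linarith
        moreover have "\<bar>sin t\<bar> \<le> \<eta>" using 1 p(2) by (intro sinle) (simp add: t_def)
        ultimately have "\<eta> / x \<le> m0" using sl \<eta>(3) by linarith
        then show ?thesis using 1 x p(2) \<eta> by (intro exI[of _ "\<eta> / x"]) (auto simp: t_def)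
      next
        case 2
        then show ?thesis using m0 by (intro exI[of _ 0]) auto
      next
        case 3
        have "\<epsilon> \<le> sinh x + \<bar>cos t\<bar>" using p(5) norm_sinh_cosh_bounds(2)[of \<zeta>] unfolding away_def sx trig by linarith
        moreover have "cos t = sin (pi / 2 - t)" by (simp add: sin_diff)
        moreover have "\<bar>sin (pi / 2 - t)\<bar> \<le> \<eta>" using 3 p(3) by (intro sinle) (simp add: t_def)
        ultimately have "\<eta> / x \<le> m0" using sl \<eta>(3) by linarith
        then show ?thesis using 3 x p(3) \<eta> by (intro exI[of _ "- (\<eta> / x)"]) (auto simp: t_def)
      qed
      then show thesis using that by blast
    qed
    define b where "b = Im \<zeta> + \<sigma> * r * x"
    have sb: "\<sigma> * b = t + r * x" using s by (auto simp: b_def t_def)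
    have "sin \<eta> \<le> sin (\<sigma> * b)" unfolding sb using r \<eta> by (intro sin_monotone_2pi_le) auto
    moreover have "cos (pi / 2 - \<eta>) \<le> cos (\<sigma> * b)" unfolding sb using r \<eta> by (intro cos_monotone_0_pi_le) auto
    moreover have "\<bar>sin b\<bar> = \<bar>sin (\<sigma> * b)\<bar>" "\<bar>cos b\<bar> = \<bar>cos (\<sigma> * b)\<bar>" using s by auto
    ultimately have "sin \<eta> \<le> \<bar>sin b\<bar>" "sin \<eta> \<le> \<bar>cos b\<bar>" by (auto simp: cos_diff)
    then have "away (sin \<eta>) (Complex 0 b)"
      unfolding away_def using norm_sinh_cosh_bounds(4,6)[of "Complex 0 b"] by simp
    moreover have "\<zeta> = line b (\<sigma> * r) (Re \<zeta>)" by (simp add: complex_eq_iff b_def x_def)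
    moreover have "\<bar>\<sigma> * r\<bar> \<le> m0" using r p(4) by (simp add: abs_mult)
    moreover have "0 < \<sigma> * b" "\<sigma> * b < pi / 2" unfolding sb using r \<eta>(1) by linarith+
    ultimately show ?thesis by blast
  qed
  then show ?thesis using c by blast
qed

text \<open>The condition \<sigma> Im \<xi> \<le> 0 places -\<xi> on the side of the gate of
  \<open>omega \<sigma>\<close>, so that \<open>slope_exists\<close> provides a complete line
  through it.\<close>

lemma expansion_reflected:
  fixes A \<epsilon> \<delta> :: real
  assumes \<epsilon>: "\<epsilon> > 0" and \<delta>: "\<delta> > 0"
  shows "\<exists>K R. R > 0 \<and> (\<forall>\<nu> \<alpha> \<beta> \<xi> \<sigma>. norm \<alpha> \<le> A \<and> norm \<beta> \<le> A \<and> R \<le> norm \<nu> \<and> \<bar>Arg \<nu>\<bar> \<le> pi / 2 - \<delta> \<and> \<bar>\<sigma>\<bar> = 1 \<and>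
     \<xi> \<in> half_strip \<and> \<sigma> * Im \<xi> \<le> 0 \<and> away \<epsilon> \<xi> \<longrightarrow>
     norm (remainder N (2 * \<nu> + \<alpha> + \<beta> + 1) \<alpha> \<beta> (jacobi_recessive \<sigma> \<nu> \<alpha> \<beta>) (- \<xi>)) \<le> K / norm \<nu> ^ (N + 1))"
proof -
  define d where "d = min \<delta> 1"
  have d: "0 < d" "d \<le> 1" "d \<le> \<delta>" using \<delta> by (auto simp: d_def)
  \<comment> \<open>Re \<nu> \<ge> sin d |\<nu>| in the sector; a slope of at most half of sin d
    costs at most half of this.\<close>
  define m0 where "m0 = sin d / 2"
  have m0: "m0 > 0" "m0 \<le> 1"
    unfolding m0_def using d pi_gt3 sin_gt_zero[of d] sin_le_one[of d] by linarith+
  obtain c where c: "c > 0" and sl: "\<And>\<zeta> \<sigma>. Re \<zeta> < 0 \<and> 0 \<le> \<sigma> * Im \<zeta> \<and> \<sigma> * Im \<zeta> < pi / 2 \<and> \<bar>\<sigma>\<bar> = 1 \<and> away \<epsilon> \<zeta> \<Longrightarrow>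
    \<exists>m b. \<bar>m\<bar> \<le> m0 \<and> 0 < \<sigma> * b \<and> \<sigma> * b < pi / 2 \<and> away c (Complex 0 b) \<and> \<zeta> = line b m (Re \<zeta>)"
    using slope_exists[OF \<epsilon> m0(1)] by blast
  obtain K R where E: "expansion_bound N A 1 c m0 K R"
    using expansion_bound_exists[of 1 c m0 N A] m0 c by auto
  then have R: "R > 0" by (simp add: expansion_bound_def)
  have "norm (remainder N (2 * \<nu> + \<alpha> + \<beta> + 1) \<alpha> \<beta> (jacobi_recessive \<sigma> \<nu> \<alpha> \<beta>) (- \<xi>)) \<le> K / norm \<nu> ^ (N + 1)"
    if p: "norm \<alpha> \<le> A" "norm \<beta> \<le> A" "R \<le> norm \<nu>" "\<bar>Arg \<nu>\<bar> \<le> pi / 2 - \<delta>" "\<bar>\<sigma>\<bar> = 1" "\<xi> \<in> half_strip" "\<sigma> * Im \<xi> \<le> 0" "away \<epsilon> \<xi>" for \<nu> \<alpha> \<beta> \<xi> \<sigma>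
  proof -
    have s: "\<sigma> = 1 \<or> \<sigma> = - 1" using p(5) by linarith
    have a: "away \<epsilon> (- \<xi>)" using p(8) by (simp add: away_def)
    have q: "Re (- \<xi>) < 0" "0 \<le> \<sigma> * Im (- \<xi>)" "\<sigma> * Im (- \<xi>) < pi / 2"
      using p(6,7) s by (auto simp: half_strip_def)
    obtain m b where m: "\<bar>m\<bar> \<le> m0" "0 < \<sigma> * b" "\<sigma> * b < pi / 2" "away c (Complex 0 b)" "- \<xi> = line b m (Re (- \<xi>))"
      using sl[OF conjI[OF q(1) conjI[OF q(2) conjI[OF q(3) conjI[OF p(5) a]]]]] by blast
    have "\<bar>m * Im \<nu>\<bar> \<le> m0 * norm \<nu>" unfolding abs_mult using m(1) m0 abs_Im_le_cmod by (intro mult_mono) auto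
    moreover have "Re \<nu> \<ge> 2 * m0 * norm \<nu>" using right_sector[OF p(4) d(1,3,2)] by (simp add: m0_def)
    moreover have "Re (\<nu> * Complex 1 m) = Re \<nu> - m * Im \<nu>" by (simp add: mult.commute)
    ultimately have "m0 * norm \<nu> \<le> Re (\<nu> * Complex 1 m)" by linarith
    moreover have "\<bar>m\<bar> \<le> 1" using m(1) m0 by linarith
    ultimately have "norm (remainder N (2 * \<nu> + \<alpha> + \<beta> + 1) \<alpha> \<beta> (jacobi_recessive \<sigma> \<nu> \<alpha> \<beta>) (line b m (Re (- \<xi>)))) \<le> K / norm \<nu> ^ (N + 1)"
      using E m p unfolding expansion_bound_def by blast
    then show ?thesis unfolding m(5)[symmetric] .
  qed
  then show ?thesis using R by blast
qed



section \<open>The inverse factorial expansions\<close>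

lemma base_powr:
  assumes "z \<in> half_strip"
  shows "(exp z / sinh z) powr s = exp (s * (z - Ln (sinh z)))" "(exp z / cosh z) powr s = exp (s * (z - Ln (cosh z)))"
    "(exp (- z) / sinh z) powr s = exp (s * (- z - Ln (sinh z)))" "(exp (- z) / cosh z) powr s = exp (s * (- z - Ln (cosh z)))"
proof -
  have i: "\<bar>Im z\<bar> < pi / 2" using assms by (simp add: half_strip_def)
  note p = half_strip_props[OF assms]
  have k: "(exp y / x) powr s = exp (s * (y - Ln x))" if "Re x > 0" "\<bar>Im y\<bar> < pi / 2" for x y
  proof -
    have x: "x \<noteq> 0" using that by auto
    have "Ln (exp y / x) = y - Ln x"
    proof (rule Ln_eqI)
      show "exp (y - Ln x) = exp y / x" by (simp add: exp_diff exp_Ln[OF x])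
      show "\<bar>Im (y - Ln x)\<bar> < pi" using that(2) abs_Im_Ln_less[OF that(1)] unfolding minus_complex.sel by linarith
    qed
    then show ?thesis using x by (simp add: powr_def)
  qed
  show "(exp z / sinh z) powr s = exp (s * (z - Ln (sinh z)))" "(exp z / cosh z) powr s = exp (s * (z - Ln (cosh z)))"
    "(exp (- z) / sinh z) powr s = exp (s * (- z - Ln (sinh z)))" "(exp (- z) / cosh z) powr s = exp (s * (- z - Ln (cosh z)))"
    by (intro k p; use i in simp)+
qed

lemma twice_square_powr:
  assumes "Re x > 0"
  shows "(2 * x ^ 2) powr s = exp (s * (of_real (ln 2) + 2 * Ln x))"
proof -
  have x: "x \<noteq> 0" using assms by auto
  have "Ln (2 * x ^ 2) = of_real (ln 2) + 2 * Ln x"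
  proof (rule Ln_eqI)
    have "exp (complex_of_real (ln 2)) = 2" by (subst exp_of_real) simp
    then show "exp (of_real (ln 2) + 2 * Ln x) = 2 * x ^ 2" by (simp add: exp_add exp_double exp_Ln[OF x])
    show "\<bar>Im (of_real (ln 2) + 2 * Ln x)\<bar> < pi" using abs_Im_Ln_less[OF assms] by simp
  qed
  then show ?thesis using x by (simp add: powr_def)
qed

lemma two_powr: "2 powr s = exp (s * complex_of_real (ln 2))"
proof -
  have "Ln 2 = complex_of_real (ln 2)" using Ln_of_real[of 2] by simp
  then show ?thesis by (simp add: powr_def)
qed

lemma cosh_twice: "cosh (2 * z) - 1 = 2 * sinh z ^ 2" "cosh (2 * z) + 1 = 2 * cosh z ^ 2" for z :: complex
  using cosh_sq_complex[of z] by (simp_all add: cosh_double)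

text \<open>Both sides contain the same hypergeometric value; the rest is a comparison of exponents,
  with principal logarithms adding up as in \<open>Ln_one_minus_exp\<close>.\<close>

lemma jacobi_Q_recessive:
  assumes z: "z \<in> half_strip" and \<sigma>: "\<bar>\<sigma>\<bar> = 1"
  shows "2 powr (2 * \<nu> + \<alpha> + \<beta> + 1) / of_real pi * Beta (\<nu> + 1) (\<nu> + \<alpha> + \<beta> + 1) * jacobi_Q \<nu> \<alpha> \<beta> (cosh (2 * z)) =
    exp (- ((\<alpha> + 1/2) * Ln (sinh z)) - (\<beta> + 1/2) * Ln (cosh z)) * jacobi_recessive \<sigma> \<nu> \<alpha> \<beta> z"
proof -
  note p = half_strip_props[OF z]
  have Re: "Re z > 0" using z by (simp add: half_strip_def)
  define W where "W = 2 * \<nu> + \<alpha> + \<beta> + 1"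
  define l where "l = complex_of_real (ln 2)"
  define Ls where "Ls = Ln (sinh z)"
  define Lc where "Lc = Ln (cosh z)"
  define F where "F = hyp2F1_reg (\<nu> + 1) (\<nu> + \<alpha> + 1) (2 * \<nu> + \<alpha> + \<beta> + 2) (2 / (1 - cosh (2 * z)))"
  have arg: "1 - ((1 + exp (- 2 * z)) / (1 - exp (- 2 * z)))\<^sup>2 = 2 / (1 - cosh (2 * z))"
  proof -
    have "1 - cosh (2 * z) = - (2 * sinh z ^ 2)" using cosh_twice(1)[of z] by (simp add: algebra_simps)
    moreover have "1 - (cosh z / sinh z)\<^sup>2 = 2 / - (2 * sinh z ^ 2)"
      using p(3) by (simp add: power_divide cosh_sq_complex add_divide_distrib)
    ultimately show ?thesis unfolding moebius_exp(2)[OF Re] by simp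
  qed
  have bs: "\<nu> + 1 + (\<nu> + \<alpha> + \<beta> + 1) = 2 * \<nu> + \<alpha> + \<beta> + 2" by simp
  define g1 where "g1 = Gamma (\<nu> + 1) * Gamma (\<nu> + \<alpha> + \<beta> + 1)"
  define g2 where "g2 = Gamma (\<nu> + \<alpha> + 1)"
  define g3 where "g3 = Gamma (\<nu> + \<beta> + 1)"
  define g where "g = Gamma (2 * \<nu> + \<alpha> + \<beta> + 2)"
  have "2 powr W / of_real pi * Beta (\<nu> + 1) (\<nu> + \<alpha> + \<beta> + 1) * jacobi_Q \<nu> \<alpha> \<beta> (cosh (2 * z)) =
     exp (W * l) / of_real pi * (g1 / g) * (exp ((\<nu> + \<alpha> + \<beta>) * l) * g2 * g3 / (exp ((\<nu> + \<alpha> + 1) * (l + 2 * Ls)) * exp (\<beta> * (l + 2 * Lc))) * F)"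
    unfolding jacobi_Q_def cosh_twice twice_square_powr[OF p(1)] twice_square_powr[OF p(2)] two_powr Beta_def bs
      l_def Ls_def Lc_def F_def g1_def g2_def g3_def g_def ..
  also have "\<dots> = exp (W * l + (\<nu> + \<alpha> + \<beta>) * l - (\<nu> + \<alpha> + 1) * (l + 2 * Ls) - \<beta> * (l + 2 * Lc)) * (g1 * g2 * g3 / (of_real pi * g)) * F"
    by (simp add: exp_add exp_diff mult_ac)
  also have "W * l + (\<nu> + \<alpha> + \<beta>) * l - (\<nu> + \<alpha> + 1) * (l + 2 * Ls) - \<beta> * (l + 2 * Lc) =
     (- ((\<alpha> + 1/2) * Ls) - (\<beta> + 1/2) * Lc) + (2 * W - 1) * l + - W * z +
     - (2 * \<nu> + \<alpha> + 3/2) * (l - z + Ls) + (1/2 - \<beta>) * (l - z + Lc)"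
    by (simp add: W_def field_simps)
  also have "exp \<dots> * (g1 * g2 * g3 / (of_real pi * g)) * F =
     exp (- ((\<alpha> + 1/2) * Ls) - (\<beta> + 1/2) * Lc) * (exp ((2 * W - 1) * l) / of_real pi * (g1 * g2 * g3) / g ^ 2 *
     (exp (- W * z) * (g * (exp (- (2 * \<nu> + \<alpha> + 3/2) * (l - z + Ls)) * exp ((1/2 - \<beta>) * (l - z + Lc)) * F))))"
  proof -
    \<comment> \<open>\<open>Gamma\<close> has the value 0 at its poles; then \<open>g = 0\<close>
      and both sides vanish.\<close>
    have "exp (a + b + c + d + e) * (x / (y * g)) * F = exp a * (exp b / y * x / g ^ 2 * (exp c * (g * (exp d * exp e * F))))"
      for a b c d e x y :: complex
      by (cases "g = 0") (simp_all add: exp_add power2_eq_square)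
    then show ?thesis .
  qed
  also have "\<dots> = exp (- ((\<alpha> + 1/2) * Ls) - (\<beta> + 1/2) * Lc) * jacobi_recessive \<sigma> \<nu> \<alpha> \<beta> z"
    unfolding jacobi_recessive_def recessive(2)[OF \<sigma> Re] recessive_phi_def jacobi_norm_def arg Ln_one_minus_exp[OF z] two_powr
      l_def Ls_def Lc_def F_def g1_def g2_def g3_def g_def W_def ..
  finally show ?thesis by (simp only: W_def Ls_def Lc_def)
qed

lemma jacobi_P_first_kind:
  assumes z: "z \<in> half_strip"
  shows "2 powr (2 * \<nu> + \<alpha> + \<beta> + 1) * Beta (\<nu> + 1) (\<nu> + \<alpha> + \<beta> + 1) * jacobi_P \<nu> \<alpha> \<beta> (cosh (2 * z)) =
    exp (- ((\<alpha> + 1/2) * Ln (sinh z)) - (\<beta> + 1/2) * Ln (cosh z)) * first_kind \<nu> \<alpha> \<beta> z"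
proof -
  have arg: "(1 - cosh (2 * z)) / 2 = - (sinh z ^ 2)" using cosh_twice(1)[of z] by (simp add: field_simps)
  have "T * B * (G * f) = exp (- a - b) * (T * B * G * (exp a * exp b * f))" for T B G f a b :: complex
  proof -
    have "exp (- a - b) * (exp a * exp b) = 1" by (simp flip: exp_add)
    then show ?thesis by (simp add: mult_ac)
  qed
  then show ?thesis unfolding jacobi_P_def first_kind_def jacobi_kernel_def arg .
qed

lemma partial_series_eq:
  "(\<Sum>n<N. g_coeff n z \<alpha> \<beta> * Gamma (2 * \<nu> + \<alpha> + \<beta> - of_nat n + 1) / Gamma (2 * \<nu> + \<alpha> + \<beta> + 2)) =
   partial_series N (2 * \<nu> + \<alpha> + \<beta> + 1) \<alpha> \<beta> z"
proof -
  have "2 * \<nu> + \<alpha> + \<beta> - of_nat n + 1 = 2 * \<nu> + \<alpha> + \<beta> + 1 - of_nat n" for n by simp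
  moreover have "2 * \<nu> + \<alpha> + \<beta> + 1 + 1 = 2 * \<nu> + \<alpha> + \<beta> + 2" by simp
  ultimately show ?thesis unfolding partial_series_def inv_fact_def by (simp only: times_divide_eq_right)
qed

text \<open>With the logarithms of sinh z and cosh z for \<open>Ls\<close> and \<open>Lc\<close>,
  each prefactor of the expansions times the matching exponential of w z is the same factor, sinh to
  the power -\<alpha> - 1/2 times cosh to the power -\<beta> - 1/2.\<close>

lemma prefactor_identities:
  fixes \<nu> \<alpha> \<beta> z Ls Lc X :: complex
  shows "exp ((\<alpha> + 1/2) * (- z - Ls)) * exp ((\<beta> + 1/2) * (- z - Lc)) * exp (- 2 * \<nu> * z) * (exp ((2 * \<nu> + \<alpha> + \<beta> + 1) * z) * X) =
      exp (- ((\<alpha> + 1/2) * Ls) - (\<beta> + 1/2) * Lc) * X"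
    and "exp ((\<alpha> + 1/2) * (z - Ls)) * exp ((\<beta> + 1/2) * (z - Lc)) * exp (2 * \<nu> * z) * (exp ((2 * \<nu> + \<alpha> + \<beta> + 1) * (- z)) * X) =
      exp (- ((\<alpha> + 1/2) * Ls) - (\<beta> + 1/2) * Lc) * X"
proof -
  have alg: "exp a * exp b * exp c * (exp d * X) = exp e * X" if "a + b + c + d = e" for a b c d e :: complex
    by (simp add: exp_add flip: that)
  show "exp ((\<alpha> + 1/2) * (- z - Ls)) * exp ((\<beta> + 1/2) * (- z - Lc)) * exp (- 2 * \<nu> * z) * (exp ((2 * \<nu> + \<alpha> + \<beta> + 1) * z) * X) =
      exp (- ((\<alpha> + 1/2) * Ls) - (\<beta> + 1/2) * Lc) * X"
    by (rule alg) (simp add: field_simps)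
  show "exp ((\<alpha> + 1/2) * (z - Ls)) * exp ((\<beta> + 1/2) * (z - Lc)) * exp (2 * \<nu> * z) * (exp ((2 * \<nu> + \<alpha> + \<beta> + 1) * (- z)) * X) =
      exp (- ((\<alpha> + 1/2) * Ls) - (\<beta> + 1/2) * Lc) * X"
    by (rule alg) (simp add: field_simps)
qed

lemma series_plus_remainder: "partial_series N w \<alpha> \<beta> z + remainder N w \<alpha> \<beta> u z = exp (w * z) * u z"
  by (simp add: remainder_def)

text \<open>On the Stokes line \<open>\<xi> > 0\<close> the coefficient \<open>sin (\<pi> \<alpha>)\<close> is the mean of its two one-sided values, so
  averaging the connection formulas of the two half-planes leaves no exponentially small term to estimate.\<close>

lemma first_kind_stokes:
  assumes lp: "large_parameter 0 A 0 (1/2) 0 \<nu> \<alpha> \<beta>" and z: "z \<in> half_strip" "Im z = 0"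
  shows "first_kind \<nu> \<alpha> \<beta> z = (jacobi_recessive 1 \<nu> \<alpha> \<beta> (- z) + jacobi_recessive (- 1) \<nu> \<alpha> \<beta> (- z)) / 2 -
    stokes_C z \<alpha> * jacobi_recessive 1 \<nu> \<alpha> \<beta> z"
proof -
  have Re: "Re z > 0" using z by (simp add: half_strip_def)
  have r: "jacobi_recessive (- 1) \<nu> \<alpha> \<beta> z = jacobi_recessive 1 \<nu> \<alpha> \<beta> z"
    by (simp add: jacobi_recessive_def recessive(2)[OF _ Re])
  define e where "e = exp (of_real pi * \<i> * \<alpha>)"
  define e' where "e' = exp (- (of_real pi * \<i> * \<alpha>))"
  have sn: "stokes_C z \<alpha> = (\<i> * e' - \<i> * e) / 2"
  proof -
    have "sin (of_real pi * \<alpha>) = \<i> * (exp (- (\<i> * (of_real pi * \<alpha>))) - exp (\<i> * (of_real pi * \<alpha>))) / 2"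
      by (rule sin_exp_eq')
    moreover have "\<i> * (of_real pi * \<alpha>) = of_real pi * \<i> * \<alpha>" by (simp add: mult_ac)
    ultimately show ?thesis using z(2) by (simp only: stokes_C_def simp_thms if_True e_def e'_def right_diff_distrib)
  qed
  have f: "first_kind \<nu> \<alpha> \<beta> z = jacobi_recessive 1 \<nu> \<alpha> \<beta> (- z) - \<i> * e' * jacobi_recessive 1 \<nu> \<alpha> \<beta> z"
    "first_kind \<nu> \<alpha> \<beta> z = jacobi_recessive (- 1) \<nu> \<alpha> \<beta> (- z) + \<i> * e * jacobi_recessive 1 \<nu> \<alpha> \<beta> z"
    using connection_formula[OF lp _ z(1), of 1] connection_formula[OF lp _ z(1), of "- 1"]
    by (simp_all add: r e_def e'_def)
  have alg: "f = (a + b) / 2 - (\<i> * e' - \<i> * e) / 2 * c" if "f = a - \<i> * e' * c" "f = b + \<i> * e * c" for f a b c :: complex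
  proof -
    have "2 * f = (a - \<i> * e' * c) + (b + \<i> * e * c)" unfolding that(1)[symmetric] that(2)[symmetric] by simp
    moreover have "((a - x * c) + (b + y * c)) / 2 = (a + b) / 2 - (x - y) / 2 * c" for x y :: complex by (simp add: field_simps)
    ultimately show ?thesis by (metis nonzero_mult_div_cancel_left zero_neq_numeral)
  qed
  show ?thesis unfolding sn by (rule alg[OF f])
qed

lemma jacobi_Q_expansion:
  fixes \<epsilon> \<delta> A :: real
  assumes "\<epsilon> > 0" "\<delta> > 0"
  shows "\<exists>K. \<exists>R>0. \<forall>\<nu> \<xi> \<alpha> \<beta> :: complex.
        \<xi> \<in> half_strip \<and> norm (sinh \<xi>) \<ge> \<epsilon> \<and> norm (cosh \<xi>) \<ge> \<epsilon> \<and>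
        norm \<alpha> \<le> A \<and> norm \<beta> \<le> A \<and> norm \<nu> \<ge> R \<and> \<bar>Arg \<nu>\<bar> \<le> pi - \<delta> \<longrightarrow>
        (\<exists>r. norm r \<le> K / norm \<nu> ^ (N + 1) \<and>
          2 powr (2 * \<nu> + \<alpha> + \<beta> + 1) / of_real pi * Beta (\<nu> + 1) (\<nu> + \<alpha> + \<beta> + 1) *
            jacobi_Q \<nu> \<alpha> \<beta> (cosh (2 * \<xi>)) =
          (exp (- \<xi>) / sinh \<xi>) powr (\<alpha> + 1/2) * (exp (- \<xi>) / cosh \<xi>) powr (\<beta> + 1/2) *
            exp (- 2 * \<nu> * \<xi>) *
            ((\<Sum>n<N. g_coeff n \<xi> \<alpha> \<beta> *
                Gamma (2 * \<nu> + \<alpha> + \<beta> - of_nat n + 1) / Gamma (2 * \<nu> + \<alpha> + \<beta> + 2)) + r))"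
proof -
  obtain K R where R: "R > 0" and E: "\<And>\<nu> \<alpha> \<beta> \<xi> \<sigma>. norm \<alpha> \<le> A \<and> norm \<beta> \<le> A \<and> R \<le> norm \<nu> \<and> \<bar>Arg \<nu>\<bar> \<le> pi - \<delta> \<and> \<bar>\<sigma>\<bar> = 1 \<and>
     Re \<xi> > 0 \<and> away \<epsilon> \<xi> \<Longrightarrow>
     norm (remainder N (2 * \<nu> + \<alpha> + \<beta> + 1) \<alpha> \<beta> (jacobi_recessive \<sigma> \<nu> \<alpha> \<beta>) \<xi>) \<le> K / norm \<nu> ^ (N + 1)"
    using expansion_wide_sector[OF assms, of A N] by blast
  show ?thesis
  proof (intro exI[of _ K] exI[of _ R] conjI R allI impI; elim conjE)
    fix \<nu> \<xi> \<alpha> \<beta> :: complex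
    assume p: "\<xi> \<in> half_strip" "norm (sinh \<xi>) \<ge> \<epsilon>" "norm (cosh \<xi>) \<ge> \<epsilon>" "norm \<alpha> \<le> A" "norm \<beta> \<le> A" "norm \<nu> \<ge> R" "\<bar>Arg \<nu>\<bar> \<le> pi - \<delta>"
    \<comment> \<open>On the right half-plane both signs \<sigma> give the same function; the sign 1
      is taken.\<close>
    have b: "norm (remainder N (2 * \<nu> + \<alpha> + \<beta> + 1) \<alpha> \<beta> (jacobi_recessive 1 \<nu> \<alpha> \<beta>) \<xi>) \<le> K / norm \<nu> ^ (N + 1)"
      by (rule E) (use p in \<open>auto simp: away_def half_strip_def\<close>)
    have one: "\<bar>1::real\<bar> = 1" by simp
    show "\<exists>r. norm r \<le> K / norm \<nu> ^ (N + 1) \<and>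
          2 powr (2 * \<nu> + \<alpha> + \<beta> + 1) / of_real pi * Beta (\<nu> + 1) (\<nu> + \<alpha> + \<beta> + 1) *
            jacobi_Q \<nu> \<alpha> \<beta> (cosh (2 * \<xi>)) =
          (exp (- \<xi>) / sinh \<xi>) powr (\<alpha> + 1/2) * (exp (- \<xi>) / cosh \<xi>) powr (\<beta> + 1/2) *
            exp (- 2 * \<nu> * \<xi>) *
            ((\<Sum>n<N. g_coeff n \<xi> \<alpha> \<beta> *
                Gamma (2 * \<nu> + \<alpha> + \<beta> - of_nat n + 1) / Gamma (2 * \<nu> + \<alpha> + \<beta> + 2)) + r)"
      by (rule exI, rule conjI[OF b])
        (unfold partial_series_eq series_plus_remainder base_powr[OF p(1)] prefactor_identities(1), rule jacobi_Q_recessive[OF p(1) one])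
  qed
qed

lemma jacobi_P_expansion:
  fixes \<epsilon> \<delta> A :: real
  assumes \<epsilon>: "\<epsilon> > 0" and \<delta>: "\<delta> > 0"
  shows "\<exists>K. \<exists>R>0. \<forall>\<nu> \<xi> \<alpha> \<beta> :: complex.
        \<xi> \<in> half_strip \<and> norm (sinh \<xi>) \<ge> \<epsilon> \<and> norm (cosh \<xi>) \<ge> \<epsilon> \<and>
        norm \<alpha> \<le> A \<and> norm \<beta> \<le> A \<and> norm \<nu> \<ge> R \<and> \<bar>Arg \<nu>\<bar> \<le> pi / 2 - \<delta> \<longrightarrow>
        (\<exists>r s. norm r \<le> K / norm \<nu> ^ (N + 1) \<and> norm s \<le> K / norm \<nu> ^ (M + 1) \<and>
          2 powr (2 * \<nu> + \<alpha> + \<beta> + 1) * Beta (\<nu> + 1) (\<nu> + \<alpha> + \<beta> + 1) *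
            jacobi_P \<nu> \<alpha> \<beta> (cosh (2 * \<xi>)) =
          (exp \<xi> / sinh \<xi>) powr (\<alpha> + 1/2) * (exp \<xi> / cosh \<xi>) powr (\<beta> + 1/2) *
            exp (2 * \<nu> * \<xi>) *
            ((\<Sum>n<N. g_coeff n (- \<xi>) \<alpha> \<beta> *
                Gamma (2 * \<nu> + \<alpha> + \<beta> - of_nat n + 1) / Gamma (2 * \<nu> + \<alpha> + \<beta> + 2)) + r)
          - stokes_C \<xi> \<alpha> *
            (exp (- \<xi>) / sinh \<xi>) powr (\<alpha> + 1/2) * (exp (- \<xi>) / cosh \<xi>) powr (\<beta> + 1/2) *
            exp (- 2 * \<nu> * \<xi>) *
            ((\<Sum>m<M. g_coeff m \<xi> \<alpha> \<beta> *
                Gamma (2 * \<nu> + \<alpha> + \<beta> - of_nat m + 1) / Gamma (2 * \<nu> + \<alpha> + \<beta> + 2)) + s))"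
proof -
  define d where "d = min \<delta> 1"
  have d: "0 < d" "d \<le> 1" "d \<le> \<delta>" using \<delta> by (auto simp: d_def)
  have sd: "sin d > 0" using d pi_gt3 by (intro sin_gt_zero) linarith+
  obtain K1 R1 where R1: "R1 > 0" and E1: "\<And>\<nu> \<alpha> \<beta> \<xi> \<sigma>. norm \<alpha> \<le> A \<and> norm \<beta> \<le> A \<and> R1 \<le> norm \<nu> \<and> \<bar>Arg \<nu>\<bar> \<le> pi / 2 - \<delta> \<and> \<bar>\<sigma>\<bar> = 1 \<and>
     \<xi> \<in> half_strip \<and> \<sigma> * Im \<xi> \<le> 0 \<and> away \<epsilon> \<xi> \<Longrightarrow>
     norm (remainder N (2 * \<nu> + \<alpha> + \<beta> + 1) \<alpha> \<beta> (jacobi_recessive \<sigma> \<nu> \<alpha> \<beta>) (- \<xi>)) \<le> K1 / norm \<nu> ^ (N + 1)"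
    using expansion_reflected[OF assms, of A N] by blast
  obtain K2 R2 where R2: "R2 > 0" and E2: "\<And>\<nu> \<alpha> \<beta> \<xi> \<sigma>. norm \<alpha> \<le> A \<and> norm \<beta> \<le> A \<and> R2 \<le> norm \<nu> \<and> \<bar>Arg \<nu>\<bar> \<le> pi - \<delta> \<and> \<bar>\<sigma>\<bar> = 1 \<and>
     Re \<xi> > 0 \<and> away \<epsilon> \<xi> \<Longrightarrow>
     norm (remainder M (2 * \<nu> + \<alpha> + \<beta> + 1) \<alpha> \<beta> (jacobi_recessive \<sigma> \<nu> \<alpha> \<beta>) \<xi>) \<le> K2 / norm \<nu> ^ (M + 1)"
    using expansion_wide_sector[OF assms, of A M] by blast
  define K where "K = max K1 K2"
  \<comment> \<open>The last threshold, for slope 0 and an empty series, makes the connection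
    formula applicable; the sector turns it into a condition on |\<nu>|.\<close>
  define R where "R = max (max R1 R2) (threshold 0 A 0 (1/2) / sin d)"
  have R: "R > 0" using R1 by (simp add: R_def)
  show ?thesis
  proof (intro exI[of _ K] exI[of _ R] conjI R allI impI; elim conjE)
    fix \<nu> \<xi> \<alpha> \<beta> :: complex
    assume p: "\<xi> \<in> half_strip" "norm (sinh \<xi>) \<ge> \<epsilon>" "norm (cosh \<xi>) \<ge> \<epsilon>" "norm \<alpha> \<le> A" "norm \<beta> \<le> A" "norm \<nu> \<ge> R" "\<bar>Arg \<nu>\<bar> \<le> pi / 2 - \<delta>"
    have n: "R1 \<le> norm \<nu>" "R2 \<le> norm \<nu>" "threshold 0 A 0 (1/2) / sin d \<le> norm \<nu>" using p(6) by (simp_all add: R_def)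
    have aw: "away \<epsilon> \<xi>" "Re \<xi> > 0" using p by (auto simp: away_def half_strip_def)
    have "\<bar>Arg \<nu>\<bar> \<le> pi - \<delta>" using p(7) pi_gt_zero by linarith
    then have b2: "norm (remainder M (2 * \<nu> + \<alpha> + \<beta> + 1) \<alpha> \<beta> (jacobi_recessive \<sigma> \<nu> \<alpha> \<beta>) \<xi>) \<le> K2 / norm \<nu> ^ (M + 1)" if "\<bar>\<sigma>\<bar> = 1" for \<sigma>
      using E2 p n aw that by blast
    have b1: "norm (remainder N (2 * \<nu> + \<alpha> + \<beta> + 1) \<alpha> \<beta> (jacobi_recessive \<sigma> \<nu> \<alpha> \<beta>) (- \<xi>)) \<le> K1 / norm \<nu> ^ (N + 1)"
      if "\<bar>\<sigma>\<bar> = 1" "\<sigma> * Im \<xi> \<le> 0" for \<sigma>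
      using E1 p n aw that by blast
    have KK: "K1 / norm \<nu> ^ j \<le> K / norm \<nu> ^ j" "K2 / norm \<nu> ^ j \<le> K / norm \<nu> ^ j" for j
      by (auto simp: K_def intro!: divide_right_mono)
    have lp: "large_parameter 0 A 0 (1/2) 0 \<nu> \<alpha> \<beta>"
    proof unfold_locales
      have "threshold 0 A 0 (1/2) \<le> sin d * norm \<nu>" using n(3) sd by (simp add: divide_le_eq mult.commute)
      also have "\<dots> \<le> Re \<nu>" by (rule right_sector[OF p(7) d(1,3,2)])
      finally show "threshold 0 A 0 (1/2) \<le> Re (\<nu> * Complex 1 0)" by simp
    qed (use p in auto)
    \<comment> \<open>s is the remainder of the recessive solution at \<xi>. r comes from its
      reflection, as an average over the two continuations when \<xi> is real.\<close>
    obtain r s where r: "norm r \<le> K / norm \<nu> ^ (N + 1)" and s: "norm s \<le> K / norm \<nu> ^ (M + 1)"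
      and fk: "first_kind \<nu> \<alpha> \<beta> \<xi> = exp ((2 * \<nu> + \<alpha> + \<beta> + 1) * \<xi>) * (partial_series N (2 * \<nu> + \<alpha> + \<beta> + 1) \<alpha> \<beta> (- \<xi>) + r) -
        stokes_C \<xi> \<alpha> * (exp (- ((2 * \<nu> + \<alpha> + \<beta> + 1) * \<xi>)) * (partial_series M (2 * \<nu> + \<alpha> + \<beta> + 1) \<alpha> \<beta> \<xi> + s))"
    proof -
      define W where "W = 2 * \<nu> + \<alpha> + \<beta> + 1"
      define rm where "rm = (\<lambda>\<sigma>. remainder N W \<alpha> \<beta> (jacobi_recessive \<sigma> \<nu> \<alpha> \<beta>) (- \<xi>))"
      define sm where "sm = (\<lambda>\<sigma>. remainder M W \<alpha> \<beta> (jacobi_recessive \<sigma> \<nu> \<alpha> \<beta>) \<xi>)"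
      have ee: "exp (W * \<xi>) * exp (- (W * \<xi>)) = 1" "exp (- (W * \<xi>)) * exp (W * \<xi>) = 1" by (simp_all flip: exp_add)
      have ur: "exp (W * \<xi>) * (partial_series N W \<alpha> \<beta> (- \<xi>) + rm \<sigma>) = jacobi_recessive \<sigma> \<nu> \<alpha> \<beta> (- \<xi>)" for \<sigma>
        unfolding rm_def series_plus_remainder mult_minus_right mult.assoc[symmetric] ee by simp
      have us: "exp (- (W * \<xi>)) * (partial_series M W \<alpha> \<beta> \<xi> + sm \<sigma>) = jacobi_recessive \<sigma> \<nu> \<alpha> \<beta> \<xi>" for \<sigma>
        unfolding sm_def series_plus_remainder mult.assoc[symmetric] ee by simp
      have rb: "norm (rm \<sigma>) \<le> K / norm \<nu> ^ (N + 1)" if "\<bar>\<sigma>\<bar> = 1" "\<sigma> * Im \<xi> \<le> 0" for \<sigma>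
        unfolding rm_def W_def using b1[OF that] KK(1) by (rule order_trans)
      have sb: "norm (sm \<sigma>) \<le> K / norm \<nu> ^ (M + 1)" if "\<bar>\<sigma>\<bar> = 1" for \<sigma>
        unfolding sm_def W_def using b2[OF that] KK(2) by (rule order_trans)
      show thesis
      proof (cases "Im \<xi> = 0")
        case True
        show thesis
        proof (rule that)
          have "norm (rm 1 + rm (- 1)) \<le> 2 * (K / norm \<nu> ^ (N + 1))"
            using norm_triangle_ineq[of "rm 1" "rm (- 1)"] rb[of 1] rb[of "- 1"] True by simp
          moreover have "norm ((rm 1 + rm (- 1)) / 2) = norm (rm 1 + rm (- 1)) / 2" by (simp add: norm_divide)
          ultimately show "norm ((rm 1 + rm (- 1)) / 2) \<le> K / norm \<nu> ^ (N + 1)" by linarith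
          show "norm (sm 1) \<le> K / norm \<nu> ^ (M + 1)" by (rule sb) simp
          have "exp (W * \<xi>) * (partial_series N W \<alpha> \<beta> (- \<xi>) + (rm 1 + rm (- 1)) / 2) =
            (exp (W * \<xi>) * (partial_series N W \<alpha> \<beta> (- \<xi>) + rm 1) + exp (W * \<xi>) * (partial_series N W \<alpha> \<beta> (- \<xi>) + rm (- 1))) / 2"
            by (simp add: field_simps)
          then show "first_kind \<nu> \<alpha> \<beta> \<xi> = exp ((2 * \<nu> + \<alpha> + \<beta> + 1) * \<xi>) * (partial_series N (2 * \<nu> + \<alpha> + \<beta> + 1) \<alpha> \<beta> (- \<xi>) + (rm 1 + rm (- 1)) / 2) -
            stokes_C \<xi> \<alpha> * (exp (- ((2 * \<nu> + \<alpha> + \<beta> + 1) * \<xi>)) * (partial_series M (2 * \<nu> + \<alpha> + \<beta> + 1) \<alpha> \<beta> \<xi> + sm 1))"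
            unfolding W_def[symmetric] us ur using first_kind_stokes[OF lp p(1) True] by simp
        qed
      next
        case False
        \<comment> \<open>The sign opposite to that of Im \<xi>, so that -\<xi> lies on the side of
          the gate of \<open>omega \<sigma>\<close>; with it the coefficient of the connection
          formula is \<open>stokes_C\<close>.\<close>
        define \<sigma> :: real where "\<sigma> = (if Im \<xi> > 0 then - 1 else 1)"
        have sg: "\<bar>\<sigma>\<bar> = 1" "\<sigma> * Im \<xi> \<le> 0" by (auto simp: \<sigma>_def)
        have C: "of_real \<sigma> * \<i> * exp (- (of_real \<sigma> * of_real pi * \<i> * \<alpha>)) = stokes_C \<xi> \<alpha>"
          using False by (simp add: \<sigma>_def stokes_C_def)
        show thesis
        proof (rule that)
          show "norm (rm \<sigma>) \<le> K / norm \<nu> ^ (N + 1)" by (rule rb[OF sg])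
          show "norm (sm \<sigma>) \<le> K / norm \<nu> ^ (M + 1)" by (rule sb[OF sg(1)])
          show "first_kind \<nu> \<alpha> \<beta> \<xi> = exp ((2 * \<nu> + \<alpha> + \<beta> + 1) * \<xi>) * (partial_series N (2 * \<nu> + \<alpha> + \<beta> + 1) \<alpha> \<beta> (- \<xi>) + rm \<sigma>) -
            stokes_C \<xi> \<alpha> * (exp (- ((2 * \<nu> + \<alpha> + \<beta> + 1) * \<xi>)) * (partial_series M (2 * \<nu> + \<alpha> + \<beta> + 1) \<alpha> \<beta> \<xi> + sm \<sigma>))"
            unfolding W_def[symmetric] us ur using connection_formula[OF lp sg(1) p(1)] unfolding C .
        qed
      qed
    qed
    have split: "exp ((\<alpha> + 1/2) * (\<xi> - Ln (sinh \<xi>))) * exp ((\<beta> + 1/2) * (\<xi> - Ln (cosh \<xi>))) * exp (2 * \<nu> * \<xi>) * X -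
        stokes_C \<xi> \<alpha> * exp ((\<alpha> + 1/2) * (- \<xi> - Ln (sinh \<xi>))) * exp ((\<beta> + 1/2) * (- \<xi> - Ln (cosh \<xi>))) * exp (- 2 * \<nu> * \<xi>) * X' =
      exp (- ((\<alpha> + 1/2) * Ln (sinh \<xi>)) - (\<beta> + 1/2) * Ln (cosh \<xi>)) * (exp ((2 * \<nu> + \<alpha> + \<beta> + 1) * \<xi>) * X - stokes_C \<xi> \<alpha> * (exp (- ((2 * \<nu> + \<alpha> + \<beta> + 1) * \<xi>)) * X'))"
      for X X'
    proof -
      have ee: "exp ((2 * \<nu> + \<alpha> + \<beta> + 1) * (- \<xi>)) * (exp ((2 * \<nu> + \<alpha> + \<beta> + 1) * \<xi>) * X) = X"
        "exp ((2 * \<nu> + \<alpha> + \<beta> + 1) * \<xi>) * (exp (- ((2 * \<nu> + \<alpha> + \<beta> + 1) * \<xi>)) * X') = X'"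
      proof -
        have ex: "exp a * (exp b * x) = x" if "a = - b" for a b x :: complex
          unfolding that mult.assoc[symmetric] by (simp flip: exp_add)
        show "exp ((2 * \<nu> + \<alpha> + \<beta> + 1) * (- \<xi>)) * (exp ((2 * \<nu> + \<alpha> + \<beta> + 1) * \<xi>) * X) = X"
          "exp ((2 * \<nu> + \<alpha> + \<beta> + 1) * \<xi>) * (exp (- ((2 * \<nu> + \<alpha> + \<beta> + 1) * \<xi>)) * X') = X'" by (rule ex; simp)+
      qed
      note pf = prefactor_identities(2)[of \<alpha> \<xi> "Ln (sinh \<xi>)" \<beta> "Ln (cosh \<xi>)" \<nu> "exp ((2 * \<nu> + \<alpha> + \<beta> + 1) * \<xi>) * X", unfolded ee]
        prefactor_identities(1)[of \<alpha> \<xi> "Ln (sinh \<xi>)" \<beta> "Ln (cosh \<xi>)" \<nu> "exp (- ((2 * \<nu> + \<alpha> + \<beta> + 1) * \<xi>)) * X'", unfolded ee]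
      have "T - c * a * b * e * X' = G * (Y - c * Y')" if "T = G * Y" "a * b * e * X' = G * Y'" for T c a b e G Y Y'
      proof -
        have "T - c * a * b * e * X' = G * Y - c * (a * b * e * X')" unfolding that(1) by (simp add: mult.assoc)
        then show ?thesis unfolding that(2) by (simp add: algebra_simps)
      qed
      from this[OF pf] show ?thesis .
    qed
    show "\<exists>r s. norm r \<le> K / norm \<nu> ^ (N + 1) \<and> norm s \<le> K / norm \<nu> ^ (M + 1) \<and>
          2 powr (2 * \<nu> + \<alpha> + \<beta> + 1) * Beta (\<nu> + 1) (\<nu> + \<alpha> + \<beta> + 1) *
            jacobi_P \<nu> \<alpha> \<beta> (cosh (2 * \<xi>)) =
          (exp \<xi> / sinh \<xi>) powr (\<alpha> + 1/2) * (exp \<xi> / cosh \<xi>) powr (\<beta> + 1/2) *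
            exp (2 * \<nu> * \<xi>) *
            ((\<Sum>n<N. g_coeff n (- \<xi>) \<alpha> \<beta> *
                Gamma (2 * \<nu> + \<alpha> + \<beta> - of_nat n + 1) / Gamma (2 * \<nu> + \<alpha> + \<beta> + 2)) + r)
          - stokes_C \<xi> \<alpha> *
            (exp (- \<xi>) / sinh \<xi>) powr (\<alpha> + 1/2) * (exp (- \<xi>) / cosh \<xi>) powr (\<beta> + 1/2) *
            exp (- 2 * \<nu> * \<xi>) *
            ((\<Sum>m<M. g_coeff m \<xi> \<alpha> \<beta> *
                Gamma (2 * \<nu> + \<alpha> + \<beta> - of_nat m + 1) / Gamma (2 * \<nu> + \<alpha> + \<beta> + 2)) + s)"
      by (intro exI conjI, rule r, rule s)
        (unfold partial_series_eq base_powr[OF p(1)] split fk[symmetric], rule jacobi_P_first_kind[OF p(1)])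
  qed
qed

theorem theorem1p1:
  fixes \<epsilon> \<delta> A :: real
  assumes "\<epsilon> > 0" and "\<delta> > 0"
  shows
    "(\<forall>N M :: nat. \<exists>K. \<exists>R>0. \<forall>\<nu> \<xi> \<alpha> \<beta> :: complex.
        \<xi> \<in> half_strip \<and> norm (sinh \<xi>) \<ge> \<epsilon> \<and> norm (cosh \<xi>) \<ge> \<epsilon> \<and>
        norm \<alpha> \<le> A \<and> norm \<beta> \<le> A \<and> norm \<nu> \<ge> R \<and> \<bar>Arg \<nu>\<bar> \<le> pi / 2 - \<delta> \<longrightarrow>
        (\<exists>r s. norm r \<le> K / norm \<nu> ^ (N + 1) \<and> norm s \<le> K / norm \<nu> ^ (M + 1) \<and>
          2 powr (2 * \<nu> + \<alpha> + \<beta> + 1) * Beta (\<nu> + 1) (\<nu> + \<alpha> + \<beta> + 1) *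
            jacobi_P \<nu> \<alpha> \<beta> (cosh (2 * \<xi>)) =
          (exp \<xi> / sinh \<xi>) powr (\<alpha> + 1/2) * (exp \<xi> / cosh \<xi>) powr (\<beta> + 1/2) *
            exp (2 * \<nu> * \<xi>) *
            ((\<Sum>n<N. g_coeff n (- \<xi>) \<alpha> \<beta> *
                Gamma (2 * \<nu> + \<alpha> + \<beta> - of_nat n + 1) / Gamma (2 * \<nu> + \<alpha> + \<beta> + 2)) + r)
          - stokes_C \<xi> \<alpha> *
            (exp (- \<xi>) / sinh \<xi>) powr (\<alpha> + 1/2) * (exp (- \<xi>) / cosh \<xi>) powr (\<beta> + 1/2) *
            exp (- 2 * \<nu> * \<xi>) *
            ((\<Sum>m<M. g_coeff m \<xi> \<alpha> \<beta> *
                Gamma (2 * \<nu> + \<alpha> + \<beta> - of_nat m + 1) / Gamma (2 * \<nu> + \<alpha> + \<beta> + 2)) + s)))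
     \<and>
     (\<forall>N :: nat. \<exists>K. \<exists>R>0. \<forall>\<nu> \<xi> \<alpha> \<beta> :: complex.
        \<xi> \<in> half_strip \<and> norm (sinh \<xi>) \<ge> \<epsilon> \<and> norm (cosh \<xi>) \<ge> \<epsilon> \<and>
        norm \<alpha> \<le> A \<and> norm \<beta> \<le> A \<and> norm \<nu> \<ge> R \<and> \<bar>Arg \<nu>\<bar> \<le> pi - \<delta> \<longrightarrow>
        (\<exists>r. norm r \<le> K / norm \<nu> ^ (N + 1) \<and>
          2 powr (2 * \<nu> + \<alpha> + \<beta> + 1) / of_real pi * Beta (\<nu> + 1) (\<nu> + \<alpha> + \<beta> + 1) *
            jacobi_Q \<nu> \<alpha> \<beta> (cosh (2 * \<xi>)) =
          (exp (- \<xi>) / sinh \<xi>) powr (\<alpha> + 1/2) * (exp (- \<xi>) / cosh \<xi>) powr (\<beta> + 1/2) *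
            exp (- 2 * \<nu> * \<xi>) *
            ((\<Sum>n<N. g_coeff n \<xi> \<alpha> \<beta> *
                Gamma (2 * \<nu> + \<alpha> + \<beta> - of_nat n + 1) / Gamma (2 * \<nu> + \<alpha> + \<beta> + 2)) + r)))"
  by (intro conjI allI jacobi_P_expansion jacobi_Q_expansion assms)

end
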